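(* Let $n\ge 1$, let $G$ be a finitely generated group with property ${\rm F}\mathcal{B}_{\widetilde{A}_n}$, and let $\rho:G\rightarrow \mathrm{GL}_{n+1}(K)$ be a linear representation (a group homomorphism) over a field $K$. (i) If $K$ has positive characteristic, then for every $g\in G$ the eigenvalues of $\rho(g)$ (in an algebraic closure of $K$) are roots of unity. (ii) If $K$ has characteristic zero, then for every $g\in G$ the coefficients of the characteristic polynomial of $\rho(g)$ and its roots (in an algebraic closure of $K$) are integral over $\mathbb{Z}$.
   Context: The Coxeter group $W$ of type $\widetilde{A}_n$ ($n\ge 1$) is the infinite dihedral group with its two standard generating involutions if $n=1$; for $n\ge 2$ it has generators $s_0,\dots,s_n$ (indices mod $n+1$) with relations $s_i^2=1$, $(s_is_{i+1})^3=1$, and $(s_is_j)^2=1$ for $j\ne i,i\pm1$. Its Coxeter complex is the simplicial complex whose simplices are the cosets $wW_J$ ($w\in W$, $J\subsetneq I=\{s_0,\dots,s_n\}$, $W_J=\langle J\rangle$), ordered by reverse inclusion. A building of type $\widetilde{A}_n$ is a simplicial complex that is a union of subcomplexes (apartments), each isomorphic to this Coxeter complex, such that any two simplices lie in a common apartment, and for any two apartments containing simplices $A$ and $B$ there is an isomorphism between the apartments fixing $A$ and $B$ pointwise. Buildings are not assumed thick (the Coxeter complex itself is a building). Such a building has a type function (vertex coloring) with values in a set of $n+1$ types, such that the vertices of every maximal simplex (chamber) have pairwise distinct types and realize all types. A simplicial action is type preserving (color-preserving) if every group element preserves the type of every vertex. A group $G$ has property ${\rm F}\mathcal{B}_{\widetilde{A}_n}$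 if every simplicial type preserving action of $G$ on any building of type $\widetilde{A}_n$ has a fixed point (in the geometric realisation). *)

theory Defs
  imports
    "HOL-Algebra.Generated_Groups"
    "HOL-Algebra.Group_Action"
    "HOL-Algebra.Algebraic_Closure_Type"
    "Jordan_Normal_Form.Char_Poly"
begin

text \<open>
  Coxeter groups are given by their presentation. A Coxeter matrix is a function \<open>m\<close> on pairs of
  indices from \<open>I\<close>, with \<open>m i j = 0\<close> standing for infinity (the relator is then the empty word).
  Because the relators \<open>s\<^sub>i s\<^sub>i\<close> (from \<open>m i i = 1\<close>) make the generators involutions, the group is
  the quotient of the monoid of positive words by the congruence the relators generate; no formal
  inverses are needed.
\<close>

inductive coxeter_eq :: "nat set \<Rightarrow> (nat \<Rightarrow> nat \<Rightarrow> nat) \<Rightarrow> nat list \<Rightarrow> nat list \<Rightarrow> bool"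
  for I :: "nat set" and m :: "nat \<Rightarrow> nat \<Rightarrow> nat"
where
  refl: "u \<in> lists I \<Longrightarrow> coxeter_eq I m u u"
| sym: "coxeter_eq I m u v \<Longrightarrow> coxeter_eq I m v u"
| trans: "coxeter_eq I m u v \<Longrightarrow> coxeter_eq I m v w \<Longrightarrow> coxeter_eq I m u w"
| relator: "u \<in> lists I \<Longrightarrow> v \<in> lists I \<Longrightarrow> i \<in> I \<Longrightarrow> j \<in> I \<Longrightarrow>
    coxeter_eq I m (u @ concat (replicate (m i j) [i, j]) @ v) (u @ v)"

definition coxeter_class :: "nat set \<Rightarrow> (nat \<Rightarrow> nat \<Rightarrow> nat) \<Rightarrow> nat list \<Rightarrow> nat list set" where
  "coxeter_class I m u = {v. coxeter_eq I m u v}"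

definition coxeter_group :: "nat set \<Rightarrow> (nat \<Rightarrow> nat \<Rightarrow> nat) \<Rightarrow> nat list set monoid" where
  "coxeter_group I m =
     \<lparr>carrier = coxeter_class I m ` lists I,
      monoid.mult = (\<lambda>A B. \<Union>u\<in>A. \<Union>v\<in>B. coxeter_class I m (u @ v)),
      monoid.one = coxeter_class I m []\<rparr>"

definition coxeter_parabolic ::
  "nat set \<Rightarrow> (nat \<Rightarrow> nat \<Rightarrow> nat) \<Rightarrow> nat set \<Rightarrow> nat list set set" where
  "coxeter_parabolic I m J = generate (coxeter_group I m) ((\<lambda>i. coxeter_class I m [i]) ` J)"

text \<open>The set of simplices of the Coxeter complex; the face relation is reverse inclusion.\<close>

definition coxeter_complex :: "nat set \<Rightarrow> (nat \<Rightarrow> nat \<Rightarrow> nat) \<Rightarrow> nat list set set set" where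
  "coxeter_complex I m =
     {w <#\<^bsub>coxeter_group I m\<^esub> coxeter_parabolic I m J | w J.
        w \<in> carrier (coxeter_group I m) \<and> J \<subset> I}"

text \<open>
  The Coxeter matrix of type $\widetilde{A}_n$ on the index set \<open>{..n}\<close>, indices being read
  modulo \<open>n + 1\<close>. For \<open>n = 1\<close> this is the infinite dihedral group.
\<close>

definition Atilde :: "nat \<Rightarrow> nat \<Rightarrow> nat \<Rightarrow> nat" where
  "Atilde n i j =
     (if i = j then 1
      else if n = 1 then 0
      else if j = (i + 1) mod (n + 1) \<or> i = (j + 1) mod (n + 1) then 3
      else 2)"

text \<open>
  Simplicial complexes are sets of finite nonempty sets of vertices. The empty simplex is left out,
  in accordance with the restriction to proper subsets \<open>J \<subset> I\<close> in the Coxeter complex.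
\<close>

definition simplicial_complex :: "'v set set \<Rightarrow> bool" where
  "simplicial_complex \<Delta> \<longleftrightarrow>
     (\<forall>s\<in>\<Delta>. finite s \<and> s \<noteq> {} \<and> (\<forall>t. t \<subseteq> s \<and> t \<noteq> {} \<longrightarrow> t \<in> \<Delta>))"

definition vertices :: "'v set set \<Rightarrow> 'v set" where
  "vertices \<Delta> = \<Union>\<Delta>"

definition chambers :: "'v set set \<Rightarrow> 'v set set" where
  "chambers \<Delta> = {c \<in> \<Delta>. \<forall>s\<in>\<Delta>. c \<subseteq> s \<longrightarrow> s = c}"

definition simplicial_iso :: "('v \<Rightarrow> 'w) \<Rightarrow> 'v set set \<Rightarrow> 'w set set \<Rightarrow> bool" where
  "simplicial_iso f \<Delta> \<Delta>' \<longleftrightarrow>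
     bij_betw f (vertices \<Delta>) (vertices \<Delta>') \<and> (\<forall>s. s \<subseteq> vertices \<Delta> \<longrightarrow> (s \<in> \<Delta> \<longleftrightarrow> f ` s \<in> \<Delta>'))"

definition iso_coxeter_complex ::
  "nat set \<Rightarrow> (nat \<Rightarrow> nat \<Rightarrow> nat) \<Rightarrow> 'v set set \<Rightarrow> bool" where
  "iso_coxeter_complex I m \<Delta> \<longleftrightarrow>
     (\<exists>h. bij_betw h \<Delta> (coxeter_complex I m) \<and> (\<forall>s\<in>\<Delta>. \<forall>t\<in>\<Delta>. s \<subseteq> t \<longleftrightarrow> h t \<subseteq> h s))"

text \<open>
  A building is nonempty, possibly thin. The apartment system is not part of the structure.
\<close>

definition building :: "nat set \<Rightarrow> (nat \<Rightarrow> nat \<Rightarrow> nat) \<Rightarrow> 'v set set \<Rightarrow> bool" where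
  "building I m \<Delta> \<longleftrightarrow>
     simplicial_complex \<Delta> \<and> \<Delta> \<noteq> {} \<and>
     (\<exists>\<A>. \<Union>\<A> = \<Delta> \<and>
        (\<forall>A\<in>\<A>. simplicial_complex A \<and> iso_coxeter_complex I m A) \<and>
        (\<forall>s\<in>\<Delta>. \<forall>t\<in>\<Delta>. \<exists>A\<in>\<A>. s \<in> A \<and> t \<in> A) \<and>
        (\<forall>A\<in>\<A>. \<forall>B\<in>\<A>. \<forall>s\<in>A \<inter> B. \<forall>t\<in>A \<inter> B.
           \<exists>f. simplicial_iso f A B \<and> (\<forall>v\<in>s \<union> t. f v = v)))"

definition type_function :: "nat set \<Rightarrow> 'v set set \<Rightarrow> ('v \<Rightarrow> nat) \<Rightarrow> bool" where
  "type_function I \<Delta> \<tau> \<longleftrightarrow> (\<forall>c\<in>chambers \<Delta>. bij_betw \<tau> c I)"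

definition simplicial_action ::
  "('g, 'b) monoid_scheme \<Rightarrow> 'v set set \<Rightarrow> ('g \<Rightarrow> 'v \<Rightarrow> 'v) \<Rightarrow> bool" where
  "simplicial_action G \<Delta> \<phi> \<longleftrightarrow>
     group_action G (vertices \<Delta>) \<phi> \<and> (\<forall>g\<in>carrier G. \<forall>s\<in>\<Delta>. \<phi> g ` s \<in> \<Delta>)"

definition type_preserving ::
  "('g, 'b) monoid_scheme \<Rightarrow> 'v set set \<Rightarrow> ('v \<Rightarrow> nat) \<Rightarrow> ('g \<Rightarrow> 'v \<Rightarrow> 'v) \<Rightarrow> bool" where
  "type_preserving G \<Delta> \<tau> \<phi> \<longleftrightarrow> (\<forall>g\<in>carrier G. \<forall>v\<in>vertices \<Delta>. \<tau> (\<phi> g v) = \<tau> v)"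

text \<open>
  Points of the geometric realisation are given by barycentric coordinates; a simplicial map acts
  on them by affine extension.
\<close>

definition realisation :: "'v set set \<Rightarrow> ('v \<Rightarrow> real) set" where
  "realisation \<Delta> = {x. (\<forall>v. 0 \<le> x v) \<and> {v. x v \<noteq> 0} \<in> \<Delta> \<and> (\<Sum>v | x v \<noteq> 0. x v) = 1}"

definition realisation_map :: "('v \<Rightarrow> 'w) \<Rightarrow> ('v \<Rightarrow> real) \<Rightarrow> 'w \<Rightarrow> real" where
  "realisation_map f x = (\<lambda>w. \<Sum>v | x v \<noteq> 0 \<and> f v = w. x v)"

definition has_fixed_point ::
  "('g, 'b) monoid_scheme \<Rightarrow> 'v set set \<Rightarrow> ('g \<Rightarrow> 'v \<Rightarrow> 'v) \<Rightarrow> bool" where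
  "has_fixed_point G \<Delta> \<phi> \<longleftrightarrow>
     (\<exists>x\<in>realisation \<Delta>. \<forall>g\<in>carrier G. realisation_map (\<phi> g) x = x)"

text \<open>
  HOL cannot quantify over the type of vertices inside a formula. The vertex type
  \<open>'g \<times> nat\<close>, of cardinality $\max(|{}'g|, \aleph_0)$, loses no generality. Let \<open>G\<close> act on a building
  \<open>\<Delta>\<close> with vertices in an arbitrary type, and use the complete apartment system of \<open>\<Delta>\<close>, which every
  automorphism preserves. Apartments are countable, so some nonempty set of at most
  $\max(|G|, \aleph_0)$ apartments is closed under \<open>G\<close> and contains, for any two simplices of its
  union, an apartment containing both. That union is a \<open>G\<close>-invariant subbuilding of the same type
  whose vertices embed in \<open>'g \<times> nat\<close>, and a fixed point in it is a fixed point in \<open>\<Delta>\<close>.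

  A type function of a building is unique up to renaming the types, so it does not matter which
  one the action is required to preserve.
\<close>

definition property_FB :: "nat \<Rightarrow> ('g, 'b) monoid_scheme \<Rightarrow> bool" where
  "property_FB n G \<longleftrightarrow>
     (\<forall>(\<Delta> :: ('g \<times> nat) set set) \<tau> \<phi>.
        building {..n} (Atilde n) \<Delta> \<longrightarrow> type_function {..n} \<Delta> \<tau> \<longrightarrow>
        simplicial_action G \<Delta> \<phi> \<longrightarrow> type_preserving G \<Delta> \<tau> \<phi> \<longrightarrow> has_fixed_point G \<Delta> \<phi>)"

definition finitely_generated :: "('g, 'b) monoid_scheme \<Rightarrow> bool" where
  "finitely_generated G \<longleftrightarrow> (\<exists>S. finite S \<and> S \<subseteq> carrier G \<and> generate G S = carrier G)"

definition general_linear_group :: "nat \<Rightarrow> 'k :: field mat monoid" where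
  "general_linear_group d = units_of (ring_mat TYPE('k) d ())"

end

theory Submission
  imports Defs "HOL-Library.Countable_Set"
begin

text \<open>
  If a coefficient or root \<open>a\<close> of a characteristic polynomial is not integral over \<open>\<int>\<close>, then the
  finitely generated group \<open>\<rho>(G)\<close> has its matrix entries in a countable field \<open>F\<close> that contains \<open>a\<close>
  and carries a discrete valuation \<open>v\<close> with \<open>v a < 0\<close>. Such a valuation comes from a maximal subring
  avoiding \<open>a\<close> over the prime field and extends along each adjunction. The matrices over \<open>F\<close> whose
  determinant has valuation zero act, preserving types, on the building of lattices in \<open>F\<^bsup>n+1\<^esup>\<close>,
  which is countable because \<open>F\<close> is. A fixed point gives a fixed lattice, so each matrix of the group is
  conjugate to one over the valuation ring and its characteristic polynomial has coefficients there;
  a root in \<open>F\<close> then lies in the valuation ring as well. For \<open>\<chi> = v \<circ> det \<circ> \<rho>\<close>, the same argument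
  for the diagonal representation \<open>diag(\<pi>\<^bsup>\<chi>\<^esup>, \<pi>\<^bsup>-\<chi>\<^esup>, 1, \<dots>, 1)\<close> first shows that \<open>\<chi> = 0\<close>.
  In positive characteristic the powers of an algebraic integer form a finite set.

  The chambers of the standard apartment are the images of the chain \<open>{0..} \<supset> {1..} \<supset> \<dots> \<supset> {n..}\<close> of
  sets of integers under the affine permutations generated by the reflections.
\<close>

section \<open>Affine permutations and the word problem\<close>

text \<open>The Coxeter group of an apartment is given by generators and relations. Before lattices
  can be compared with \<open>coxeter_complex\<close>, its word problem must therefore be solved:
  two words are congruent exactly when they induce the same permutation of the integers. On the
  valuation side the obstacle is discreteness. A maximal subring obtained from Zorn's lemma is a
  valuation ring, but its value group could a priori be anything. It is cyclic because the field is
  algebraic over one whose values are already integers: if an equation has degree \<open>d\<close>,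
  some power \<open>x ^ k\<close> with \<open>1 \<le> k \<le> d\<close> has a value from below, and
  the factorial of \<open>d\<close> clears all denominators. Countability is forced by the vertex
  type \<open>'g \<times> nat\<close> in \<open>property_FB\<close>, into which the lattices must be
  injected; a completion of the field would be too large for this. Property FB is silent about
  actions that move types, which matrices of nonzero determinant value do. The character
  \<open>\<chi>\<close> therefore cannot be killed on the given representation and is first placed
  in a representation of determinant one.\<close>

locale affine_type_A =
  fixes n :: nat
  assumes n_pos: "n \<ge> 1"
begin

abbreviation N :: int where "N \<equiv> int n + 1"

text \<open>This is the extended affine symmetric group: the usual normalisation of the sum over a
  window is left out, so translations belong to it and have to be split off later.\<close>

definition affine_perm :: "(int \<Rightarrow> int) \<Rightarrow> bool" where
  "affine_perm w \<longleftrightarrow> bij w \<and> (\<forall>x. w (x + N) = w x + N)"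

text \<open>Indexing by all integers, rather than by residues, gives the affine reflection
  \<open>i = 0\<close> the same formula as the others.\<close>

definition refl_perm :: "int \<Rightarrow> int \<Rightarrow> int" where
  "refl_perm i x = (if N dvd x - i then x - 1 else if N dvd x - i + 1 then x + 1 else x)"

definition wperm :: "nat list \<Rightarrow> int \<Rightarrow> int" where
  "wperm u = foldr (\<lambda>i. (\<circ>) (refl_perm (int i))) u id"

lemma wperm_simps [simp]: "wperm [] = id" "wperm (i # u) = refl_perm (int i) \<circ> wperm u"
  by (simp_all add: wperm_def)

definition descent :: "(int \<Rightarrow> int) \<Rightarrow> int \<Rightarrow> bool" where
  "descent w i \<longleftrightarrow> w i < w (i - 1)"

lemma not_N_dvd: "0 < x \<Longrightarrow> x < N \<Longrightarrow> \<not> N dvd x"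
  using zdvd_not_zless by blast

lemma not_N_dvd_succ: "N dvd x \<Longrightarrow> \<not> N dvd x + 1" "N dvd x + 1 \<Longrightarrow> \<not> N dvd x"
  using n_pos not_N_dvd[of 1] dvd_add_right_iff[of N x 1] by auto

lemma refl_perm_self [simp]: "refl_perm i i = i - 1"
  by (simp add: refl_perm_def)

lemma refl_perm_pred [simp]: "refl_perm i (i - 1) = i"
  using n_pos not_N_dvd[of 1] by (simp add: refl_perm_def)

lemma refl_perm_invol: "refl_perm i (refl_perm i x) = x"
proof -
  consider "N dvd x - i" | "N dvd x - i + 1" "\<not> N dvd x - i" | "\<not> N dvd x - i" "\<not> N dvd x - i + 1"
    by blast
  then show ?thesis
  proof cases
    case 1
    then have "\<not> N dvd x - 1 - i"
      using not_N_dvd_succ(1)[of "x - 1 - i"] by auto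
    then show ?thesis using 1 by (simp add: refl_perm_def)
  next
    case 2
    then have "N dvd x + 1 - i" by (simp add: algebra_simps)
    then show ?thesis using 2 by (simp add: refl_perm_def)
  qed (simp add: refl_perm_def)
qed

lemma refl_perm_comp_invol: "refl_perm i \<circ> refl_perm i = id"
  by (auto simp: refl_perm_invol)

lemma refl_perm_cong: "N dvd i - j \<Longrightarrow> refl_perm i = refl_perm j"
proof
  fix x assume *: "N dvd i - j"
  have "N dvd x - i \<longleftrightarrow> N dvd x - j"
    using dvd_add_left_iff[OF *, of "x - i"] by simp
  moreover have "N dvd x - i + 1 \<longleftrightarrow> N dvd x - j + 1"
    using dvd_add_left_iff[OF *, of "x - i + 1"] by (simp add: algebra_simps)
  ultimately show "refl_perm i x = refl_perm j x"
    by (simp add: refl_perm_def)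
qed

lemma affine_perm_refl: "affine_perm (refl_perm i)"
proof -
  have "bij (refl_perm i)"
    by (rule o_bij[of "refl_perm i"]) (auto simp: refl_perm_comp_invol)
  moreover have "refl_perm i (x + N) = refl_perm i x + N" for x
  proof -
    have "N dvd x + N - i \<longleftrightarrow> N dvd x - i"
      using dvd_add_left_iff[of N N "x - i"] by (simp add: algebra_simps)
    moreover have "N dvd x + N - i + 1 \<longleftrightarrow> N dvd x - i + 1"
      using dvd_add_left_iff[of N N "x - i + 1"] by (simp add: algebra_simps)
    ultimately show ?thesis by (simp add: refl_perm_def)
  qed
  ultimately show ?thesis by (simp add: affine_perm_def)
qed

lemma affine_perm_comp: "affine_perm v \<Longrightarrow> affine_perm w \<Longrightarrow> affine_perm (v \<circ> w)"
  by (auto simp: affine_perm_def bij_comp)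

lemma affine_perm_shift: "affine_perm w \<Longrightarrow> w (x + a * N) = w x + a * N"
proof (induction a rule: int_induct[where k = 0])
  case (step1 i)
  have "w (x + (i + 1) * N) = w ((x + i * N) + N)" by (simp add: algebra_simps)
  also have "\<dots> = w (x + i * N) + N" using step1 by (simp only: affine_perm_def)
  finally show ?case using step1 by (simp add: algebra_simps)
next
  case (step2 i)
  have "w ((x + (i - 1) * N) + N) = w (x + (i - 1) * N) + N"
    using step2 by (simp only: affine_perm_def)
  moreover have "(x + (i - 1) * N) + N = x + i * N" by (simp add: algebra_simps)
  ultimately show ?case using step2 by (simp add: algebra_simps)
qed simp

lemma affine_perm_perm: "affine_perm (wperm u)"
proof (induction u)
  case Nil
  have "bij (id :: int \<Rightarrow> int)" by simp
  then show ?case unfolding affine_perm_def wperm_simps by simp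
next
  case (Cons i u)
  then show ?case by (simp only: wperm_simps affine_perm_comp affine_perm_refl)
qed

lemma wperm_append: "wperm (u @ v) = wperm u \<circ> wperm v"
  by (induction u) auto

lemma wperm_snoc: "wperm (u @ [i]) = wperm u \<circ> refl_perm (int i)"
  by (simp add: wperm_append)

lemma wperm_rev: "wperm (rev u) \<circ> wperm u = id" "wperm u \<circ> wperm (rev u) = id"
proof -
  show *: "wperm (rev u) \<circ> wperm u = id" for u
  proof (induction u)
    case (Cons i u)
    have "wperm (rev (i # u)) \<circ> wperm (i # u) =
        wperm (rev u) \<circ> (refl_perm (int i) \<circ> refl_perm (int i)) \<circ> wperm u"
      by (simp only: rev.simps wperm_append wperm_simps o_assoc o_id)
    then show ?case using Cons by (simp only: refl_perm_comp_invol o_id)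
  qed simp
  from *[of "rev u"] show "wperm u \<circ> wperm (rev u) = id" by simp
qed

lemma descent_cong: "affine_perm w \<Longrightarrow> N dvd i - j \<Longrightarrow> descent w i \<longleftrightarrow> descent w j"
proof -
  assume w: "affine_perm w" and "N dvd i - j"
  then obtain a where "i = j + a * N" by (metis dvdE mult.commute diff_add_cancel add.commute)
  then show ?thesis
    using affine_perm_shift[OF w, of j a] affine_perm_shift[OF w, of "j - 1" a]
    by (simp add: descent_def algebra_simps)
qed

section \<open>Inversion counts and reduced words of affine permutations\<close>

lemma sum_window:
  fixes f :: "int \<Rightarrow> int"
  assumes "\<And>x. f (x + N) = f x"
  shows "sum f {c..<c + N} = sum f {d..<d + N}"
proof -
  have step: "sum f {c + 1..<c + 1 + N} = sum f {c..<c + N}" for c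
  proof -
    have "{c..<c + N} = insert c {c + 1..<c + N}" using n_pos by auto
    moreover have "{c + 1..<c + 1 + N} = insert (c + N) {c + 1..<c + N}" using n_pos by auto
    ultimately show ?thesis using assms[of c] by simp
  qed
  have "sum f {c..<c + N} = sum f {0..<0 + N}" for c
  proof (induction c rule: int_induct[where k = 0])
    case (step1 i)
    then show ?case using step[of i] by simp
  next
    case (step2 i)
    then show ?case using step[of "i - 1"] by simp
  qed simp
  from this[of c] this[of d] show ?thesis by simp
qed

text \<open>A window that starts at \<open>k - 1\<close> contains exactly one pair exchanged by the
  reflection, which therefore acts on it as a transposition; a window starting at \<open>k\<close>
  would cut the pair.\<close>

lemma refl_perm_window:
  assumes "x \<in> {k - 1..<k - 1 + N}"
  shows "refl_perm k x = (if x = k then k - 1 else if x = k - 1 then k else x)"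
proof -
  have "N dvd x - k \<longleftrightarrow> x = k"
  proof
    assume *: "N dvd x - k"
    then show "x = k"
    proof (cases "x = k - 1")
      case True
      then show ?thesis using * not_N_dvd[of 1] n_pos by simp
    next
      case False
      then show ?thesis using * assms zdvd_not_zless[of "x - k" N] by force
    qed
  qed simp
  moreover have "N dvd x - k + 1 \<longleftrightarrow> x = k - 1"
    using assms zdvd_not_zless[of "x - k + 1" N] by force
  ultimately show ?thesis by (auto simp: refl_perm_def)
qed

lemma bij_betw_refl_perm_window: "bij_betw (refl_perm k) {k - 1..<k - 1 + N} {k - 1..<k - 1 + N}"
proof -
  have "refl_perm k ` {k - 1..<k - 1 + N} \<subseteq> {k - 1..<k - 1 + N}"
    using refl_perm_window[of _ k] n_pos by (auto split: if_splits)
  then show ?thesis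
    by (intro bij_betw_byWitness[where f' = "refl_perm k"]) (auto simp: refl_perm_invol)
qed

text \<open>
  Twice the number of inversions modulo translation by \<open>N\<close> (Shi's formula). Summing over ordered
  pairs of residues makes every window of \<open>N\<close> consecutive integers equally good, so that the
  affine reflection needs no special treatment.
\<close>

definition inv_term :: "(int \<Rightarrow> int) \<Rightarrow> int \<Rightarrow> int \<Rightarrow> int" where
  "inv_term w i j = \<bar>(w j - w i) div N - (j - i) div N\<bar>"

definition inv_count :: "(int \<Rightarrow> int) \<Rightarrow> int" where
  "inv_count w = (\<Sum>i\<in>{0..<N}. \<Sum>j\<in>{0..<N}. inv_term w i j)"

lemma div_add_N: "(a + N) div N = a div N + 1" "(a - N) div N = a div N - 1"
proof -
  show *: "(a + N) div N = a div N + 1" for a :: int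
    using div_mult_self1[of N a 1] n_pos by (simp add: algebra_simps)
  show "(a - N) div N = a div N - 1"
    using *[of "a - N"] by simp
qed

lemma double_sum_window:
  fixes f :: "int \<Rightarrow> int \<Rightarrow> int"
  assumes 1: "\<And>i j. f (i + N) j = f i j" and 2: "\<And>i j. f i (j + N) = f i j"
  shows "(\<Sum>i\<in>{c..<c + N}. \<Sum>j\<in>{c..<c + N}. f i j) = (\<Sum>i\<in>{0..<N}. \<Sum>j\<in>{0..<N}. f i j)"
proof -
  have "(\<Sum>i\<in>{c..<c + N}. \<Sum>j\<in>{c..<c + N}. f i j) = (\<Sum>i\<in>{c..<c + N}. \<Sum>j\<in>{0..<0 + N}. f i j)"
    by (intro sum.cong HOL.refl sum_window 2)
  also have "\<dots> = (\<Sum>i\<in>{0..<0 + N}. \<Sum>j\<in>{0..<0 + N}. f i j)"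
    by (rule sum_window) (simp add: 1)
  finally show ?thesis by simp
qed

lemma inv_count_window:
  assumes w: "affine_perm w"
  shows "inv_count w = (\<Sum>i\<in>{c..<c + N}. \<Sum>j\<in>{c..<c + N}. inv_term w i j)"
proof -
  have w': "w (x + N) = w x + N" for x using w by (simp add: affine_perm_def)
  have "w j - (w i + N) = w j - w i - N" "j - (i + N) = j - i - N"
    "w j + N - w i = w j - w i + N" "j + N - i = j - i + N" for i j by auto
  then have "inv_term w (i + N) j = inv_term w i j" "inv_term w i (j + N) = inv_term w i j" for i j
    by (auto simp only: inv_term_def w' div_add_N)
  then show ?thesis
    unfolding inv_count_def by (intro double_sum_window[symmetric]) auto
qed

lemma inv_count_nonneg: "inv_count w \<ge> 0"
  by (auto simp: inv_count_def inv_term_def intro!: sum_nonneg)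

text \<open>Reindexing by the reflection moves it from \<open>w\<close> to the index difference. For
  most pairs in the window it keeps the order of \<open>i\<close> and \<open>j\<close>, so the index
  quotient stays \<open>0\<close> or \<open>-1\<close>; only the two orderings of
  \<open>k - 1\<close> and \<open>k\<close> change, each contributing one less.\<close>

lemma inv_count_descent:
  assumes w: "affine_perm w" and d: "descent w k"
  shows "inv_count (w \<circ> refl_perm k) = inv_count w - 2"
proof -
  define W where "W = {k - 1..<k - 1 + N}"
  let ?s = "refl_perm k"
  define h where "h i j = \<bar>(w j - w i) div N - (?s j - ?s i) div N\<bar>" for i j
  have bij: "bij_betw ?s W W" unfolding W_def by (rule bij_betw_refl_perm_window)
  have "inv_count (w \<circ> ?s) = (\<Sum>i\<in>W. \<Sum>j\<in>W. inv_term (w \<circ> ?s) i j)"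
    unfolding W_def by (rule inv_count_window) (simp add: affine_perm_comp affine_perm_refl w)
  also have "\<dots> = (\<Sum>i\<in>W. \<Sum>j\<in>W. h (?s i) (?s j))"
    by (simp add: h_def inv_term_def refl_perm_invol)
  also have "\<dots> = (\<Sum>i\<in>W. \<Sum>j\<in>W. h (?s i) j)"
    by (intro sum.cong[OF HOL.refl] sum.reindex_bij_betw[OF bij])
  also have "\<dots> = (\<Sum>i\<in>W. \<Sum>j\<in>W. h i j)"
    by (rule sum.reindex_bij_betw[OF bij, of "\<lambda>i. \<Sum>j\<in>W. h i j"])
  also have "\<dots> = (\<Sum>i\<in>W. \<Sum>j\<in>W. inv_term w i j -
      ((if i = k - 1 then if j = k then 1 else 0 else 0) +
       (if i = k then if j = k - 1 then 1 else 0 else 0)))"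
  proof (intro sum.cong HOL.refl)
    fix i j assume ij: "i \<in> W" "j \<in> W"
    have s: "?s x = (if x = k then k - 1 else if x = k - 1 then k else x)" if "x \<in> W" for x
      using refl_perm_window that by (simp add: W_def)
    have neg1: "x div N = -1" if "x < 0" "x \<ge> -N" for x
    proof -
      have "(x + N) div N = 0" using that by (intro div_pos_pos_trivial) auto
      then show ?thesis by (simp add: div_add_N)
    qed
    have pos0: "x div N = 0" if "0 \<le> x" "x < N" for x
      using that by (rule div_pos_pos_trivial)
    have d': "w k < w (k - 1)" using d by (simp add: descent_def)
    have 1: "(w k - w (k - 1)) div N < 0" using d' n_pos by (intro div_neg_pos_less0) auto
    have 2: "(w (k - 1) - w k) div N \<ge> 0" using d' by (simp add: pos_imp_zdiv_nonneg_iff)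
    have m1: "(-1) div N = -1" using n_pos by (intro neg1) auto
    have p1: "1 div N = 0" using n_pos by (intro pos0) auto
    consider "i = k - 1" "j = k" | "i = k" "j = k - 1" | "i = j" 
      | "i < j" "\<not> (i = k - 1 \<and> j = k)" | "j < i" "\<not> (j = k - 1 \<and> i = k)"
      by linarith
    then show "h i j = inv_term w i j -
      ((if i = k - 1 then if j = k then 1 else 0 else 0) +
       (if i = k then if j = k - 1 then 1 else 0 else 0))"
    proof cases
      case 1
      then show ?thesis using \<open>(w k - w (k - 1)) div N < 0\<close> m1 p1
        by (simp add: h_def inv_term_def)
    next
      case 2
      then show ?thesis using \<open>(w (k - 1) - w k) div N \<ge> 0\<close> m1 p1
        by (simp add: h_def inv_term_def)
    next
      case 4
      then have "0 \<le> j - i" "j - i < N" "0 \<le> ?s j - ?s i" "?s j - ?s i < N"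
        using ij by (auto simp: s) (auto simp: W_def)
      then show ?thesis using 4 by (auto simp: h_def inv_term_def pos0)
    next
      case 5
      then have "j - i < 0" "j - i \<ge> -N" "?s j - ?s i < 0" "?s j - ?s i \<ge> -N"
        using ij by (auto simp: s) (auto simp: W_def)
      then show ?thesis using 5 by (auto simp: h_def inv_term_def neg1)
    qed (auto simp: h_def inv_term_def)
  qed
  also have "\<dots> = (\<Sum>i\<in>W. \<Sum>j\<in>W. inv_term w i j) - 
     ((\<Sum>i\<in>W. if i = k - 1 then (\<Sum>j\<in>W. if j = k then 1 else 0) else 0) +
      (\<Sum>i\<in>W. if i = k then (\<Sum>j\<in>W. if j = k - 1 then 1 else 0) else 0))"
    unfolding sum_subtractf sum.distrib
    by (intro arg_cong2[where f = minus] arg_cong2[where f = plus] sum.cong HOL.refl) auto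
  also have "\<dots> = (\<Sum>i\<in>W. \<Sum>j\<in>W. inv_term w i j) - 2"
  proof -
    have "finite W" "k \<in> W" "k - 1 \<in> W" using n_pos by (auto simp: W_def)
    then show ?thesis by simp
  qed
  also have "(\<Sum>i\<in>W. \<Sum>j\<in>W. inv_term w i j) = inv_count w"
    unfolding W_def by (rule inv_count_window[OF w, symmetric])
  finally show ?thesis .
qed

lemma descent_refl: "affine_perm w \<Longrightarrow> \<not> descent w k \<Longrightarrow> descent (w \<circ> refl_perm k) k"
  using bij_is_inj[of w] inj_eq[of w k "k - 1"] by (auto simp: descent_def affine_perm_def)

lemma inv_count_ascent:
  assumes w: "affine_perm w" and d: "\<not> descent w k"
  shows "inv_count (w \<circ> refl_perm k) = inv_count w + 2"
proof -
  have "inv_count ((w \<circ> refl_perm k) \<circ> refl_perm k) = inv_count (w \<circ> refl_perm k) - 2"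
    using w d by (intro inv_count_descent descent_refl affine_perm_comp affine_perm_refl)
  then show ?thesis by (simp add: comp_assoc refl_perm_comp_invol)
qed

lemma inv_count_perm_le: "inv_count (wperm u) \<le> 2 * int (length u)"
proof (induction u rule: rev_induct)
  case Nil
  show ?case by (simp add: inv_count_def inv_term_def)
next
  case (snoc i u)
  then show ?case
    using inv_count_descent[OF affine_perm_perm, of u "int i"]
      inv_count_ascent[OF affine_perm_perm, of u "int i"]
    unfolding wperm_snoc length_append by (cases "descent (wperm u) (int i)") (simp_all del: o_apply)
qed

text \<open>A descent depends only on its residue, so \<open>w\<close> increases everywhere. Strict
  growth over \<open>N\<close> unit steps already uses up the total increase \<open>N\<close>, hence
  every step is exactly one.\<close>

lemma no_descent_shift:
  assumes w: "affine_perm w" and nd: "\<And>i. i \<le> n \<Longrightarrow> \<not> descent w (int i)"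
  shows "w x = x + w 0"
proof -
  have nd': "\<not> descent w i" for i
  proof -
    have "nat (i mod N) \<le> n" using pos_mod_bound[of N i] pos_mod_sign[of N i] by linarith
    moreover have "N dvd i - int (nat (i mod N))"
      using pos_mod_sign[of N i] by (simp add: minus_mod_eq_mult_div)
    ultimately show ?thesis using nd descent_cong[OF w] by blast
  qed
  have inj: "inj w" using w by (auto simp: affine_perm_def bij_is_inj)
  have lt: "w (i - 1) + 1 \<le> w i" for i
    using nd'[of i] inj_eq[OF inj, of i "i - 1"] by (auto simp: descent_def)
  have ge: "w (i + int k) \<ge> w i + int k" for i k
  proof (induction k)
    case (Suc k)
    then show ?case using lt[of "i + int (Suc k)"] by (simp add: algebra_simps)
  qed simp
  have eq: "w (i + 1) = w i + 1" for i
  proof -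
    have "w (i + 1 + int n) = w i + N" using affine_perm_shift[OF w, of i 1] by (simp add: add.commute add.left_commute)
    then show ?thesis using ge[of "i + 1" n] lt[of "i + 1"] by simp
  qed
  show ?thesis
  proof (induction x rule: int_induct[where k = 0])
    case (step2 i)
    then show ?case using eq[of "i - 1"] by simp
  qed (use eq in simp_all)
qed

text \<open>Bubble sort: stripping a descent lowers the count by two, and a permutation without
  descents is a translation, whose count is zero.\<close>

lemma reduced_word_up_to_shift:
  assumes w: "affine_perm w"
  shows "\<exists>u\<in>lists {..n}. \<exists>c. w = (\<lambda>x. wperm u x + c) \<and> inv_count w = 2 * int (length u)"
  using w
proof (induction "nat (inv_count w)" arbitrary: w rule: less_induct)
  case less
  show ?case
  proof (cases "\<exists>i\<le>n. descent w (int i)")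
    case True
    then obtain i where i: "i \<le> n" "descent w (int i)" by blast
    have *: "inv_count (w \<circ> refl_perm (int i)) = inv_count w - 2"
      by (rule inv_count_descent[OF less.prems i(2)])
    then have "nat (inv_count (w \<circ> refl_perm (int i))) < nat (inv_count w)"
      using inv_count_nonneg[of "w \<circ> refl_perm (int i)"] by linarith
    then obtain u c where u: "u \<in> lists {..n}" "w \<circ> refl_perm (int i) = (\<lambda>x. wperm u x + c)"
      "inv_count (w \<circ> refl_perm (int i)) = 2 * int (length u)"
      using less.hyps affine_perm_comp[OF less.prems affine_perm_refl] by metis
    have "w x = wperm (u @ [i]) x + c" for x
      using fun_cong[OF u(2), of "refl_perm (int i) x"]
      by (simp add: wperm_append refl_perm_invol)
    then show ?thesis using u i * by (intro bexI[of _ "u @ [i]"]) auto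
  next
    case False
    then have "w x = x + w 0" for x using no_descent_shift[OF less.prems] by blast
    then have w: "w = (\<lambda>x. x + w 0)" by blast
    have "inv_count w = 0" 
      by (subst w) (simp add: inv_count_def inv_term_def)
    then show ?thesis using w by (intro bexI[of _ "[]"]) auto
  qed
qed

text \<open>The total displacement over a period separates the Coxeter group from the translations.\<close>

definition displacement :: "(int \<Rightarrow> int) \<Rightarrow> int" where
  "displacement w = (\<Sum>x\<in>{0..<N}. w x - x)"

lemma displacement_window:
  "affine_perm w \<Longrightarrow> displacement w = (\<Sum>x\<in>{c..<c + N}. w x - x)"
  using sum_window[of "\<lambda>x. w x - x" 0 c] by (simp add: affine_perm_def displacement_def)

lemma displacement_refl: "affine_perm w \<Longrightarrow> displacement (w \<circ> refl_perm k) = displacement w"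
  using sum.reindex_bij_betw[OF bij_betw_refl_perm_window, of w]
  by (simp add: displacement_window[of _ "k - 1"] affine_perm_comp affine_perm_refl sum_subtractf)

lemma displacement_perm: "displacement (wperm u) = 0"
proof (induction u rule: rev_induct)
  case (snoc i u)
  then show ?case by (simp only: wperm_snoc displacement_refl affine_perm_perm)
qed (simp add: displacement_def)

lemma displacement_shift: "displacement (\<lambda>x. w x + c) = displacement w + c * N"
proof -
  have "w x + c - x = (w x - x) + c" for x by simp
  then show ?thesis by (simp only: displacement_def sum.distrib) simp
qed

lemma perm_shift_eq_perm: "wperm u = (\<lambda>x. wperm v x + c) \<Longrightarrow> c = 0"
  using displacement_shift[of "wperm v" c] displacement_perm[of u] n_pos by (simp add: displacement_perm)

lemma reduced_word: "\<exists>v\<in>lists {..n}. wperm v = wperm u \<and> inv_count (wperm u) = 2 * int (length v)"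
proof -
  obtain v c where *: "v \<in> lists {..n}" "wperm u = (\<lambda>x. wperm v x + c)"
    "inv_count (wperm u) = 2 * int (length v)"
    using reduced_word_up_to_shift[OF affine_perm_perm] by blast
  with perm_shift_eq_perm[OF *(2)] show ?thesis by auto
qed

text \<open>This makes the type of a vertex well defined. A map of one ray onto another carries the
  first window of the one onto the first window of the other; the displacements over it sum to zero
  for a word, but also to \<open>N\<close> times the difference of the starting points.\<close>

lemma perm_image_ray_inj:
  assumes "wperm u ` {k..} = wperm v ` {l..}"
  shows "k = l"
proof -
  define w where "w = wperm (rev v @ u)"
  have w: "affine_perm w" by (simp add: w_def affine_perm_perm)
  have inj: "inj w" using w by (simp add: affine_perm_def bij_is_inj)
  have "wperm (rev v) (wperm v x) = x" for x
    using fun_cong[OF wperm_rev(1), of v x] by simp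
  then have 1: "w ` {k..} = {l..}"
    using arg_cong[OF assms, of "(`) (wperm (rev v))"]
    by (simp add: w_def wperm_append image_image)
  have shift: "{a + N..} = (\<lambda>x. x + N) ` {a..}" for a :: int
  proof -
    have "x = (x - N) + N \<and> x - N \<in> {a..}" if "x \<in> {a + N..}" for x using that by auto
    then have "{a + N..} \<subseteq> (\<lambda>x. x + N) ` {a..}" by blast
    then show ?thesis by auto
  qed
  have "w ` {k + N..} = (\<lambda>x. x + N) ` w ` {k..}"
    using w by (simp only: shift affine_perm_def image_image)
  then have 2: "w ` {k + N..} = {l + N..}" by (simp only: 1 shift)
  have win: "{a..<a + N} = {a..} - {a + N..}" for a :: int by auto
  have "w ` {k..<k + N} = {l..<l + N}"
    using inj by (simp only: win image_set_diff 1 2)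
  then have bij: "bij_betw w {k..<k + N} {l..<l + N}"
    using inj by (auto simp: bij_betw_def intro: inj_on_subset)
  have sum_ray: "(\<Sum>x\<in>{a..<a + N}. x) = (\<Sum>x\<in>{0..<N}. x) + a * N" for a :: int
  proof -
    have "(\<Sum>x\<in>{a..<a + N}. x) = (\<Sum>x\<in>(+) a ` {0..<N}. x)" by (simp add: add.commute)
    also have "\<dots> = (\<Sum>x\<in>{0..<N}. a + x)" by (subst sum.reindex) auto
    finally show ?thesis by (simp add: sum.distrib)
  qed
  have "0 = (\<Sum>x\<in>{k..<k + N}. w x - x)"
    using displacement_window[OF w, of k] by (simp add: w_def displacement_perm)
  also have "\<dots> = (\<Sum>x\<in>{l..<l + N}. x) - (\<Sum>x\<in>{k..<k + N}. x)"
    using sum.reindex_bij_betw[OF bij, of "\<lambda>x. x"] by (simp add: sum_subtractf)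
  finally show ?thesis unfolding sum_ray by simp
qed

section \<open>Coxeter relations and Matsumoto's theorem\<close>

declare coxeter_eq.trans [trans]

abbreviation cox_eq (infix "\<approx>" 50) where "u \<approx> v \<equiv> coxeter_eq {..n} (Atilde n) u v"

lemma cox_eq_lists: "u \<approx> v \<Longrightarrow> u \<in> lists {..n} \<and> v \<in> lists {..n}"
proof (induction rule: coxeter_eq.induct)
  case (relator u v i j)
  then have "concat (replicate k [i, j]) \<in> lists {..n}" for k
    by (induction k) auto
  then show ?case using relator by auto
qed auto

lemma cox_eq_context:
  assumes "u \<approx> v" "x \<in> lists {..n}" "y \<in> lists {..n}"
  shows "x @ u @ y \<approx> x @ v @ y"
  using assms(1)
proof (induction rule: coxeter_eq.induct)
  case (refl u)
  then show ?case using assms by (intro coxeter_eq.refl) auto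
next
  case (relator u v i j)
  then show ?case
    using assms coxeter_eq.relator[of "x @ u" "{..n}" "v @ y" i j "Atilde n"] by simp
qed (blast intro: coxeter_eq.sym coxeter_eq.trans)+

lemma cox_eq_append:
  assumes "u \<approx> u'" "v \<approx> v'"
  shows "u @ v \<approx> u' @ v'"
proof -
  have "u @ v \<approx> u' @ v" using cox_eq_context[OF assms(1), of "[]" v] cox_eq_lists[OF assms(2)] by simp
  moreover have "u' @ v \<approx> u' @ v'"
    using cox_eq_context[OF assms(2), of "u'" "[]"] cox_eq_lists[OF assms(1)] by simp
  ultimately show ?thesis by (rule coxeter_eq.trans)
qed

text \<open>The residues moved by the two reflections, \<open>i - 1\<close>, \<open>i\<close> and
  \<open>j - 1\<close>, \<open>j\<close>, are disjoint under these hypotheses.\<close>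

lemma refl_perm_commute:
  assumes "\<not> N dvd i - j" "\<not> N dvd i - j + 1" "\<not> N dvd i - j - 1"
  shows "refl_perm i \<circ> refl_perm j = refl_perm j \<circ> refl_perm i"
proof
  fix x
  have *: "N dvd a \<Longrightarrow> N dvd b \<Longrightarrow> N dvd a - b" for a b by (rule dvd_diff)
  have **: "N dvd j - i \<longleftrightarrow> N dvd i - j" "N dvd j - i + 1 \<longleftrightarrow> N dvd i - j - 1" "N dvd j - i - 1 \<longleftrightarrow> N dvd i - j + 1"
    using dvd_minus_iff[of N "j - i"] dvd_minus_iff[of N "j - i + 1"] dvd_minus_iff[of N "j - i - 1"]
    by (simp_all add: algebra_simps)
  have fixj: "refl_perm j y = y" if "N dvd y - i \<or> N dvd y - i + 1" for y
    using that assms ** *[of "y - i" "y - j"] *[of "y - i" "y - j + 1"]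
      *[of "y - i + 1" "y - j"] *[of "y - i + 1" "y - j + 1"]
    by (auto simp: refl_perm_def algebra_simps)
  have fixi: "refl_perm i y = y" if "N dvd y - j \<or> N dvd y - j + 1" for y
    using that assms ** *[of "y - i" "y - j"] *[of "y - i" "y - j + 1"]
      *[of "y - i + 1" "y - j"] *[of "y - i + 1" "y - j + 1"]
    by (auto simp: refl_perm_def algebra_simps)
  have mv: "N dvd y - k \<or> N dvd y - k + 1 \<Longrightarrow> N dvd refl_perm k y - k \<or> N dvd refl_perm k y - k + 1" for y k
    by (auto simp: refl_perm_def algebra_simps)
  consider "N dvd x - i \<or> N dvd x - i + 1" | "N dvd x - j \<or> N dvd x - j + 1"
    | "\<not> (N dvd x - i \<or> N dvd x - i + 1)" "\<not> (N dvd x - j \<or> N dvd x - j + 1)"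
    by blast
  then show "(refl_perm i \<circ> refl_perm j) x = (refl_perm j \<circ> refl_perm i) x"
  proof cases
    case 3
    then show ?thesis by (simp add: refl_perm_def)
  qed (use fixi fixj mv in \<open>metis comp_apply\<close>)+
qed

text \<open>Both sides move only the residues of \<open>i - 1\<close>, \<open>i\<close>,
  \<open>i + 1\<close>, which are distinct as \<open>n \<ge> 2\<close>; on each translate of this
  triple both exchange its ends.\<close>

lemma refl_perm_braid:
  assumes "n \<ge> 2"
  shows "refl_perm i \<circ> refl_perm (i + 1) \<circ> refl_perm i = refl_perm (i + 1) \<circ> refl_perm i \<circ> refl_perm (i + 1)"
proof
  fix x
  have *: "N dvd a \<Longrightarrow> N dvd b \<Longrightarrow> N dvd a - b" for a b by (rule dvd_diff)
  have no: "\<not> N dvd 1" "\<not> N dvd 2" using assms not_N_dvd[of 1] not_N_dvd[of 2] by auto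
  \<comment> \<open>Once the translate \<open>a * N\<close> is fixed, divisibility by
    \<open>N\<close> becomes equality, because the differences that occur have absolute value at
    most two.\<close>
  have step: "refl_perm k y = (if y = k + a * N then y - 1 else if y = k - 1 + a * N then y + 1 else y)"
    if "y \<in> {i - 1 + a * N, i + a * N, i + 1 + a * N}" "k \<in> {i, i + 1}" for k a y
  proof -
    have "N dvd c + a * N \<longleftrightarrow> N dvd c" for c by (simp add: dvd_add_left_iff)
    moreover have "\<not> N dvd -1" "\<not> N dvd -2" using no by auto
    moreover have "y - i = (y - a * N - i) + a * N" "y - i + 1 = (y - a * N - i + 1) + a * N"
      "y - (i + 1) = (y - a * N - (i + 1)) + a * N" "y - (i + 1) + 1 = (y - a * N - (i + 1) + 1) + a * N"
      by auto
    ultimately have "N dvd y - i \<longleftrightarrow> N dvd y - a * N - i" "N dvd y - i + 1 \<longleftrightarrow> N dvd y - a * N - i + 1"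
      "N dvd y - (i + 1) \<longleftrightarrow> N dvd y - a * N - (i + 1)" 
      "N dvd y - (i + 1) + 1 \<longleftrightarrow> N dvd y - a * N - (i + 1) + 1"
      by metis+
    then show ?thesis using that no \<open>\<not> N dvd -1\<close> \<open>\<not> N dvd -2\<close>
      unfolding refl_perm_def by (elim insertE emptyE) auto
  qed
  show "(refl_perm i \<circ> refl_perm (i + 1) \<circ> refl_perm i) x =
      (refl_perm (i + 1) \<circ> refl_perm i \<circ> refl_perm (i + 1)) x"
  proof (cases "N dvd x - i \<or> N dvd x - i + 1 \<or> N dvd x - i - 1")
    case True
    then obtain a where "x = i + a * N \<or> x = i - 1 + a * N \<or> x = i + 1 + a * N"
      by (elim disjE dvdE) (force simp: algebra_simps)+
    then show ?thesis
      by (elim disjE) (simp_all add: step[where a = a])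
  next
    case False
    then show ?thesis by (simp add: refl_perm_def algebra_simps)
  qed
qed

lemma Atilde_adjacent:
  assumes "n \<ge> 2" "i \<le> n" "j \<le> n" "Atilde n i j = 3"
  shows "N dvd int j - (int i + 1) \<or> N dvd int i - (int j + 1)"
proof -
  have *: "N dvd int b - (int a + 1)" if "b = (a + 1) mod (n + 1)" for a b
  proof -
    have "int b = (int a + 1) mod N" using that by (simp add: zmod_int add.commute)
    then show ?thesis by (simp add: mod_eq_dvd_iff[symmetric])
  qed
  then show ?thesis using assms by (auto simp: Atilde_def split: if_splits)
qed

lemma Atilde_not_adjacent:
  assumes "n \<ge> 2" "i \<le> n" "j \<le> n" "i \<noteq> j" "Atilde n i j \<noteq> 3"
  shows "\<not> N dvd int i - int j" "\<not> N dvd int i - int j + 1" "\<not> N dvd int i - int j - 1"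
proof -
  show "\<not> N dvd int i - int j"
    using assms zdvd_not_zless[of "int i - int j" N] zdvd_not_zless[of "int j - int i" N]
      dvd_minus_iff[of N "int i - int j"] by fastforce
  have *: "b = (a + 1) mod (n + 1)" if "N dvd int b - (int a + 1)" "b \<le> n" for a b
  proof -
    have "int b mod N = (int a + 1) mod N" using that(1) by (rule mod_eq_dvd_iff[THEN iffD2])
    moreover have "int b mod N = int b" using that(2) by (intro mod_pos_pos_trivial) auto
    ultimately have "int b = (int a + 1) mod N" by metis
    then have "int b = int ((a + 1) mod (n + 1))" by (simp add: zmod_int add.commute)
    then show ?thesis by linarith
  qed
  have ne: "j \<noteq> (i + 1) mod (n + 1)" "i \<noteq> (j + 1) mod (n + 1)"
    using assms by (auto simp: Atilde_def split: if_splits)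
  show "\<not> N dvd int i - int j + 1"
    using *[of j i] ne assms(3) dvd_minus_iff[of N "int i - int j + 1"] by (auto simp: algebra_simps)
  show "\<not> N dvd int i - int j - 1"
    using *[of i j] ne assms(2) by (auto simp: algebra_simps)
qed

text \<open>The two adjacent cases record which index follows the other cyclically, since the braid
  relation is available for \<open>refl_perm i\<close> and \<open>refl_perm (i + 1)\<close>.\<close>

lemma Atilde_cases:
  assumes "i \<le> n" "j \<le> n" "i \<noteq> j"
  obtains (infinite) "n = 1" "Atilde n i j = 0" "Atilde n j i = 0"
    | (adj) "n \<ge> 2" "N dvd int j - (int i + 1)" "Atilde n i j = 3" "Atilde n j i = 3"
    | (adj') "n \<ge> 2" "N dvd int i - (int j + 1)" "Atilde n i j = 3" "Atilde n j i = 3"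
    | (commute) "n \<ge> 2" "Atilde n i j = 2" "Atilde n j i = 2"
        "\<not> N dvd int i - int j" "\<not> N dvd int i - int j + 1" "\<not> N dvd int i - int j - 1"
proof (cases "n = 1")
  case True
  then show ?thesis using infinite assms by (simp add: Atilde_def)
next
  case False
  then have n: "n \<ge> 2" using n_pos by simp
  have sym: "Atilde n j i = Atilde n i j" by (auto simp: Atilde_def)
  have "Atilde n i j = 3 \<or> Atilde n i j = 2" using assms n by (auto simp: Atilde_def)
  then show ?thesis
    using Atilde_adjacent[OF n assms(1,2)] Atilde_not_adjacent[OF n assms] adj adj' commute n sym
    by auto
qed

lemma wperm_cox_eq: "u \<approx> v \<Longrightarrow> wperm u = wperm v"
proof (induction rule: coxeter_eq.induct)
  case (relator u v i j)
  then have ij: "i \<le> n" "j \<le> n" by auto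
  have "wperm (concat (replicate (Atilde n i j) [i, j])) = id"
  proof (cases "i = j")
    case True
    then show ?thesis by (simp add: Atilde_def refl_perm_comp_invol)
  next
    case False
    have three: "concat (replicate 3 [i, j]) = [i, j, i] @ [j, i, j]" by (simp add: numeral_3_eq_3)
    have two: "concat (replicate 2 [i, j]) = [i, j] @ [i, j]" by (simp add: numeral_2_eq_2)
    show ?thesis using ij False
    proof (cases rule: Atilde_cases)
      case adj
      have j: "refl_perm (int j) = refl_perm (int i + 1)" by (rule refl_perm_cong[OF adj(2)])
      have "wperm [i, j, i] = wperm [j, i, j]" 
        using refl_perm_braid[OF adj(1), of "int i"] by (simp only: wperm_simps o_id o_assoc j)
      then show ?thesis using wperm_rev(1)[of "[j, i, j]"] unfolding adj three wperm_append by simp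
    next
      case adj'
      have i: "refl_perm (int i) = refl_perm (int j + 1)" by (rule refl_perm_cong[OF adj'(2)])
      have "wperm [i, j, i] = wperm [j, i, j]" 
        using refl_perm_braid[OF adj'(1), of "int j"] by (simp only: wperm_simps o_id o_assoc i)
      then show ?thesis using wperm_rev(1)[of "[j, i, j]"] unfolding adj' three wperm_append by simp
    next
      case commute
      have "wperm [i, j] = wperm [j, i]"
        using refl_perm_commute[OF commute(4,5,6)] by (simp only: wperm_simps o_id)
      then show ?thesis using wperm_rev(1)[of "[i, j]"] unfolding commute two wperm_append by simp
    qed (use affine_type_A.wperm_simps(1)[OF affine_type_A_axioms] in \<open>simp only: replicate_0 concat.simps\<close>)
  qed
  then show ?case unfolding wperm_append by (simp only: id_o)
qed auto

lemma cox_eq_cancel: "y \<in> lists {..n} \<Longrightarrow> i \<le> n \<Longrightarrow> y @ [i, i] \<approx> y"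
  using coxeter_eq.relator[of y "{..n}" "[]" i i "Atilde n"] by (simp add: Atilde_def)

text \<open>Relators can only be inserted or deleted. Squares are inserted until the full relator
  \<open>i, j, i, j\<close> stands in front of \<open>j, i\<close>; the braid relation below follows
  the same pattern.\<close>

lemma cox_eq_commute:
  assumes "Atilde n i j = 2" "i \<le> n" "j \<le> n" "y \<in> lists {..n}"
  shows "y @ [i, j] \<approx> y @ [j, i]"
proof -
  have 1: "(y @ [i, j]) @ [j] @ [j] @ [] \<approx> (y @ [i, j])" 
    using cox_eq_cancel[of "y @ [i, j]" j] assms by simp
  have "y @ [i, j] \<approx> y @ [i, j] @ [i, i]"
    using cox_eq_cancel[of "y @ [i, j]" i] assms by (auto intro: coxeter_eq.sym)
  also have "y @ [i, j] @ [i, i] \<approx> y @ [i, j, i, j, j, i]"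
    using cox_eq_append[OF coxeter_eq.sym[OF cox_eq_cancel[of "y @ [i, j, i]" j]], of "[i]" "[i]"] assms
      coxeter_eq.refl[of "[i]" "{..n}" "Atilde n"] by simp
  also have "y @ [i, j, i, j, j, i] \<approx> y @ [j, i]"
    using coxeter_eq.relator[of y "{..n}" "[j, i]" i j "Atilde n"] assms by (simp add: numeral_2_eq_2)
  finally show ?thesis .
qed

lemma cox_eq_braid:
  assumes "Atilde n i j = 3" "i \<le> n" "j \<le> n" "y \<in> lists {..n}"
  shows "y @ [i, j, i] \<approx> y @ [j, i, j]"
proof -
  have "y @ [i, j, i] \<approx> y @ [i, j, i] @ [j, j]"
    using cox_eq_cancel[of "y @ [i, j, i]" j] assms by (auto intro: coxeter_eq.sym)
  also have "y @ [i, j, i] @ [j, j] \<approx> y @ [i, j, i, j, i, i, j]"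
    using cox_eq_append[OF coxeter_eq.sym[OF cox_eq_cancel[of "y @ [i, j, i, j]" i]], of "[j]" "[j]"] assms
      coxeter_eq.refl[of "[j]" "{..n}" "Atilde n"] by simp
  also have "y @ [i, j, i, j, i, i, j] \<approx> y @ [i, j, i, j, i, j, j, i, j]"
    using cox_eq_append[OF coxeter_eq.sym[OF cox_eq_cancel[of "y @ [i, j, i, j, i]" j]], of "[i, j]" "[i, j]"] assms
      coxeter_eq.refl[of "[i, j]" "{..n}" "Atilde n"] by simp
  also have "y @ [i, j, i, j, i, j, j, i, j] \<approx> y @ [j, i, j]"
    using coxeter_eq.relator[of y "{..n}" "[j, i, j]" i j "Atilde n"] assms by (simp add: numeral_3_eq_3)
  finally show ?thesis .
qed

text \<open>Two neighbouring descents mean \<open>w (i + 1) < w i < w (i - 1)\<close>. The three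
  inversions of this triple can be undone starting from either reflection, which strips the longest
  element of a dihedral group of order six in both of its reduced forms.\<close>

lemma descent_two:
  assumes n: "n \<ge> 2" and w: "affine_perm w" and d: "descent w i" "descent w (i + 1)"
  shows "descent (w \<circ> refl_perm i) (i + 1)" "descent (w \<circ> refl_perm i \<circ> refl_perm (i + 1)) i"
    "descent (w \<circ> refl_perm (i + 1)) i" "descent (w \<circ> refl_perm (i + 1) \<circ> refl_perm i) (i + 1)"
proof -
  have no: "\<not> N dvd 1" "\<not> N dvd 2" using n not_N_dvd[of 1] not_N_dvd[of 2] by auto
  moreover have "\<not> N dvd -1" "\<not> N dvd -2" using no by auto
  ultimately have fx: "refl_perm i (i + 1) = i + 1" "refl_perm (i + 1) (i - 1) = i - 1"
    by (simp_all add: refl_perm_def)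
  have s: "refl_perm (i + 1) i = i + 1" "refl_perm (i + 1) (i + 1) = i"
    using refl_perm_pred[of "i + 1"] refl_perm_self[of "i + 1"] by simp_all
  show "descent (w \<circ> refl_perm i) (i + 1)" "descent (w \<circ> refl_perm i \<circ> refl_perm (i + 1)) i"
    "descent (w \<circ> refl_perm (i + 1)) i" "descent (w \<circ> refl_perm (i + 1) \<circ> refl_perm i) (i + 1)"
    using d by (auto simp: descent_def fx s)
qed

lemma descent_commute:
  assumes "affine_perm w" "descent w j" "\<not> N dvd i - j" "\<not> N dvd i - j + 1" "\<not> N dvd i - j - 1"
  shows "descent (w \<circ> refl_perm i) j"
proof -
  have "\<not> N dvd j - i" "\<not> N dvd j - i + 1" "\<not> N dvd j - i - 1"
    using assms(3-5) dvd_minus_iff[of N "j - i"] dvd_minus_iff[of N "j - i + 1"] dvd_minus_iff[of N "j - i - 1"]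
    by (simp_all add: algebra_simps)
  then have "refl_perm i j = j" "refl_perm i (j - 1) = j - 1"
    by (simp_all add: refl_perm_def algebra_simps)
  then show ?thesis using assms(2) by (simp add: descent_def)
qed

text \<open>Here \<open>N = 2\<close>, so the two descents give
  \<open>w i < w (i - 1) < w (i - 2)\<close>, against \<open>w i = w (i - 2) + 2\<close>. In the
  infinite dihedral group all reduced words of an element end in the same letter.\<close>

lemma not_descent_both_dihedral:
  assumes "n = 1" "affine_perm w" "descent w i" "descent w j" "\<not> N dvd i - j"
  shows False
proof -
  have "N dvd i - 1 - j" using assms(1,5) by (simp; presburger)
  then have "descent w (i - 1)"
    using descent_cong[OF assms(2), of "i - 1" j] assms(4) by simp
  then have "w i < w (i - 2)" using assms(3) by (simp add: descent_def)
  then show False using affine_perm_shift[OF assms(2), of "i - 2" 1] assms(1) by simp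
qed

text \<open>By \<open>inv_count_perm_le\<close> no word for the same permutation is shorter; the
  condition is phrased through the permutation so that it can be followed along descents.\<close>

definition reduced :: "nat list \<Rightarrow> bool" where
  "reduced u \<longleftrightarrow> u \<in> lists {..n} \<and> inv_count (wperm u) = 2 * int (length u)"

lemma reduced_snoc:
  assumes "reduced (u @ [i])"
  shows "reduced u" "i \<le> n" "descent (wperm (u @ [i])) (int i)"
proof -
  have *: "inv_count (wperm u \<circ> refl_perm (int i)) = 2 * int (length u) + 2"
    using assms unfolding reduced_def wperm_snoc by simp
  have nd: "\<not> descent (wperm u) (int i)"
    using inv_count_descent[OF affine_perm_perm, of u "int i"] inv_count_perm_le[of u] * by auto
  then show "reduced u"
    using inv_count_ascent[OF affine_perm_perm, of u "int i"] * assms by (auto simp: reduced_def)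
  show "i \<le> n" using assms by (auto simp: reduced_def)
  show "descent (wperm (u @ [i])) (int i)"
    unfolding wperm_snoc by (rule descent_refl[OF affine_perm_perm nd])
qed

lemma reducedI:
  assumes "reduced y" "i \<le> n" "wperm y = w \<circ> refl_perm (int i)" "affine_perm w" "descent w (int i)"
  shows "reduced (y @ [i])" "wperm (y @ [i]) = w"
proof -
  show *: "wperm (y @ [i]) = w"
    unfolding wperm_snoc assms(3) by (simp add: comp_assoc refl_perm_comp_invol)
  have "inv_count w = 2 * int (length y) + 2"
    using inv_count_descent[OF assms(4,5)] assms(1,3) by (simp add: reduced_def)
  then show "reduced (y @ [i])" using assms(1,2) * by (simp add: reduced_def)
qed

lemma obtain_reduced:
  obtains y where "reduced y" "wperm y = wperm u"
  using reduced_word[of u] by (auto simp: reduced_def)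

text \<open>Matsumoto's argument: two reduced words with different last letters \<open>i\<close> and \<open>j\<close> are both
  compared with a reduced word ending in the longest element of the dihedral group of \<open>i\<close> and \<open>j\<close>.\<close>

lemma reduced_unique:
  assumes "reduced u" "reduced v" "wperm u = wperm v"
  shows "u \<approx> v"
  using assms
proof (induction "length u" arbitrary: u v rule: less_induct)
  case less
  have len: "length v = length u" using less.prems by (simp add: reduced_def)
  show ?case
  proof (cases "u = []")
    case True
    then show ?thesis using len by (auto intro!: coxeter_eq.refl)
  next
    case False
    then obtain u' i where u: "u = u' @ [i]" by (metis rev_exhaust)
    from False len have "v \<noteq> []" by auto
    then obtain v' j where v: "v = v' @ [j]" by (metis rev_exhaust)
    note u' = reduced_snoc[OF less.prems(1)[unfolded u]]
    note v' = reduced_snoc[OF less.prems(2)[unfolded v]]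
    define w where "w = wperm u"
    have w: "affine_perm w" "wperm (u' @ [i]) = w" "wperm (v' @ [j]) = w"
      using less.prems(3) u v by (simp_all add: w_def affine_perm_perm)
    have di: "descent w (int i)" "descent w (int j)" using u'(3) v'(3) w by simp_all
    have pu': "wperm u' = w \<circ> refl_perm (int i)"
      unfolding w(2)[symmetric] wperm_snoc by (simp add: comp_assoc refl_perm_comp_invol)
    have pv': "wperm v' = w \<circ> refl_perm (int j)"
      unfolding w(3)[symmetric] wperm_snoc by (simp add: comp_assoc refl_perm_comp_invol)
    have IHu: "u' \<approx> y" if "reduced y" "wperm y = w \<circ> refl_perm (int i)" for y
      using less.hyps[of u' y] u u'(1) that pu' by simp
    have IHv: "v' \<approx> y" if "reduced y" "wperm y = w \<circ> refl_perm (int j)" for y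
      using less.hyps[of v' y] v v'(1) that pv' len u by simp
    have one: "[k] \<approx> [k]" if "k \<le> n" for k using that by (intro coxeter_eq.refl) auto
    \<comment> \<open>By induction \<open>u\<close> and \<open>v\<close> may be exchanged for any
      reduced words of the same permutation ending in \<open>i\<close> and in \<open>j\<close>; it
      remains to find two such words that are visibly congruent.\<close>
    have fin: "u \<approx> v" if "reduced y" "wperm y = w \<circ> refl_perm (int i)"
      "reduced z" "wperm z = w \<circ> refl_perm (int j)" "y @ [i] \<approx> z @ [j]" for y z
    proof -
      have "u \<approx> y @ [i]" unfolding u using cox_eq_append[OF IHu one] that u'(2) by blast
      moreover have "z @ [j] \<approx> v" 
        unfolding v using cox_eq_append[OF IHv one] that v'(2) by (blast intro: coxeter_eq.sym)
      ultimately show ?thesis using that by (blast intro: coxeter_eq.trans)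
    qed
    show ?thesis
    proof (cases "i = j")
      case True
      then show ?thesis unfolding u v using cox_eq_append[OF IHu one] v' pv' by simp
    next
      case False
      \<comment> \<open>\<open>a\<close> and \<open>b\<close> are \<open>i\<close> and
        \<open>j\<close>, named so that \<open>b\<close> follows \<open>a\<close>
        cyclically.\<close>
      have braid: ?thesis if n: "n \<ge> 2" and ij: "N dvd int b - (int a + 1)" "Atilde n i j = 3"
        and ab: "{a, b} = {i, j}" for a b
      proof -
        have le: "a \<le> n" "b \<le> n" and nn: "a \<noteq> b" using ab u'(2) v'(2) False by (auto simp: doubleton_eq_iff)
        have d: "descent w (int a)" "descent w (int b)" using di ab by (auto simp: doubleton_eq_iff)
        have rb: "refl_perm (int b) = refl_perm (int a + 1)" by (rule refl_perm_cong[OF ij(1)])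
        have db: "descent w' (int a + 1) \<longleftrightarrow> descent w' (int b)" if "affine_perm w'" for w'
          using descent_cong[OF that ij(1)] by simp
        note aff = affine_perm_comp affine_perm_refl w(1)
        have affs: "affine_perm (w \<circ> refl_perm c)" "affine_perm (w \<circ> refl_perm c \<circ> refl_perm d)" for c d
          by (intro aff)+
        have d2: "descent (w \<circ> refl_perm (int a)) (int b)"
          "descent (w \<circ> refl_perm (int a) \<circ> refl_perm (int b)) (int a)"
          "descent (w \<circ> refl_perm (int b)) (int a)"
          "descent (w \<circ> refl_perm (int b) \<circ> refl_perm (int a)) (int b)"
          using descent_two[OF n w(1) d(1)] d(2) 
          by (simp_all add: db[symmetric] aff rb[symmetric])
        have eq: "w \<circ> refl_perm (int a) \<circ> refl_perm (int b) \<circ> refl_perm (int a) =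
            w \<circ> refl_perm (int b) \<circ> refl_perm (int a) \<circ> refl_perm (int b)"
          using refl_perm_braid[OF n, of "int a"] by (simp add: comp_assoc rb)
        \<comment> \<open>\<open>y\<close> is to be a reduced word for \<open>w\<close> with the
          whole longest element removed; the word \<open>u @ [a, b, a]\<close> only witnesses that
          this permutation comes from a word.\<close>
        have "wperm (u @ [a, b, a]) = w \<circ> refl_perm (int a) \<circ> refl_perm (int b) \<circ> refl_perm (int a)"
          unfolding wperm_append w_def by (simp add: comp_assoc)
        then obtain y where y: "reduced y"
          "wperm y = w \<circ> refl_perm (int a) \<circ> refl_perm (int b) \<circ> refl_perm (int a)"
          using obtain_reduced by metis
        note y1 = reducedI[OF y(1) le(1) y(2) affs(2) d2(2)]
        note y2 = reducedI[OF y1(1) le(2) y1(2) affs(1) d2(1)]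
        note z1 = reducedI[OF y(1) le(2) y(2)[unfolded eq] affs(2) d2(4)]
        note z2 = reducedI[OF z1(1) le(1) z1(2) affs(1) d2(3)]
        have ylist: "y \<in> lists {..n}" using y(1) by (simp add: reduced_def)
        show ?thesis
        proof (cases "i = a")
          case True
          then have "j = b" using ab nn by (auto simp: doubleton_eq_iff)
          with True show ?thesis
            using fin[of "(y @ [a]) @ [b]" "(y @ [b]) @ [a]"] y2 z2 cox_eq_braid[of i j y] ij ylist u'(2) v'(2) by simp
        next
          case False
          then have "i = b" "j = a" using ab nn by (auto simp: doubleton_eq_iff)
          then show ?thesis
            using fin[of "(y @ [b]) @ [a]" "(y @ [a]) @ [b]"] y2 z2 cox_eq_braid[of i j y] ij ylist u'(2) v'(2) by simp
        qed
      qed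
      from u'(2) v'(2) False show ?thesis
      proof (cases rule: Atilde_cases)
        case infinite
        have "\<not> N dvd int i - int j"
          using infinite u'(2) v'(2) False by (auto simp: le_Suc_eq)
        then show ?thesis using not_descent_both_dihedral[OF infinite(1) w(1) di] by blast
      next
        case adj
        then show ?thesis using braid[of j i] by blast
      next
        case adj'
        then show ?thesis using braid[of i j] by blast
      next
        case commute
        have eq: "w \<circ> refl_perm (int i) \<circ> refl_perm (int j) = w \<circ> refl_perm (int j) \<circ> refl_perm (int i)"
          using refl_perm_commute[OF commute(4-6)] by (simp add: comp_assoc)
        have c': "\<not> N dvd int j - int i" "\<not> N dvd int j - int i + 1" "\<not> N dvd int j - int i - 1"
          using commute(4-6) dvd_minus_iff[of N "int i - int j"] dvd_minus_iff[of N "int i - int j + 1"]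
            dvd_minus_iff[of N "int i - int j - 1"] by (simp_all add: algebra_simps)
        have affs: "affine_perm (w \<circ> refl_perm c)" for c
          by (intro affine_perm_comp affine_perm_refl w(1))
        have d2: "descent (w \<circ> refl_perm (int i)) (int j)" "descent (w \<circ> refl_perm (int j)) (int i)"
          using descent_commute[OF w(1) di(2) commute(4-6)] descent_commute[OF w(1) di(1) c'] by blast+
        have "wperm (u @ [i, j]) = w \<circ> refl_perm (int i) \<circ> refl_perm (int j)"
          unfolding wperm_append w_def by (simp add: comp_assoc)
        then obtain y where y: "reduced y" "wperm y = w \<circ> refl_perm (int i) \<circ> refl_perm (int j)"
          using obtain_reduced by metis
        note y1 = reducedI[OF y(1) v'(2) y(2) affs(1) d2(1)]
        note z1 = reducedI[OF y(1) u'(2) y(2)[unfolded eq] affs(1) d2(2)]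
        have ylist: "y \<in> lists {..n}" using y(1) by (simp add: reduced_def)
        show ?thesis
          using fin[OF y1 z1] cox_eq_commute[of j i y] commute ylist u'(2) v'(2) by simp
      qed
    qed
  qed
qed

text \<open>Appending a letter either keeps the word reduced or meets a descent; in the latter case
  uniqueness of reduced words rewrites \<open>v\<close> so that it ends in that letter, and the
  square cancels.\<close>

lemma cox_eq_reduced: "u \<in> lists {..n} \<Longrightarrow> \<exists>v. reduced v \<and> u \<approx> v"
proof (induction u rule: rev_induct)
  case Nil
  have "reduced []" by (simp add: reduced_def inv_count_def inv_term_def)
  then show ?case by (blast intro: coxeter_eq.refl lists.Nil)
next
  case (snoc i u)
  then obtain v where v: "reduced v" "u \<approx> v" by auto
  have i: "i \<le> n" using snoc.prems by auto
  have "[i] \<approx> [i]" using i by (intro coxeter_eq.refl) auto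
  then have ui: "u @ [i] \<approx> v @ [i]" by (rule cox_eq_append[OF v(2)])
  show ?case
  proof (cases "descent (wperm v) (int i)")
    case True
    obtain y where y: "reduced y" "wperm y = wperm v \<circ> refl_perm (int i)"
      using obtain_reduced[of "v @ [i]"] unfolding wperm_snoc by metis
    have "v \<approx> y @ [i]"
      using reducedI[OF y(1) i y(2) affine_perm_perm True] by (intro reduced_unique v(1)) simp_all
    then have "v @ [i] \<approx> (y @ [i]) @ [i]" using \<open>[i] \<approx> [i]\<close> by (rule cox_eq_append)
    also have "(y @ [i]) @ [i] \<approx> y" 
      using cox_eq_cancel[of y i] y(1) i by (simp add: reduced_def)
    finally show ?thesis using ui y(1) by (blast intro: coxeter_eq.trans)
  next
    case False
    then have "reduced (v @ [i])"
      using inv_count_ascent[OF affine_perm_perm False] v(1) i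
      unfolding reduced_def wperm_snoc by simp
    then show ?thesis using ui by blast
  qed
qed

text \<open>Faithfulness of the permutation representation: both words reduce, and reduced words for
  the same permutation are congruent.\<close>

theorem cox_eq_iff: "u \<in> lists {..n} \<Longrightarrow> v \<in> lists {..n} \<Longrightarrow> u \<approx> v \<longleftrightarrow> wperm u = wperm v"
  using cox_eq_reduced[of u] cox_eq_reduced[of v] reduced_unique wperm_cox_eq
  by (metis coxeter_eq.sym coxeter_eq.trans)

end

section \<open>The Coxeter complex\<close>

context affine_type_A begin

text \<open>The vertex of type \<open>k\<close> of the chamber \<open>u\<close>. Only
  \<open>k \<le> n\<close> occurs in the apartment; the other members of the periodic chain are
  translates by multiples of \<open>N\<close>.\<close>

definition ray :: "nat list \<Rightarrow> nat \<Rightarrow> int set" where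
  "ray u k = wperm u ` {int k..}"

definition apartment :: "int set set set" where
  "apartment = {s. s \<noteq> {} \<and> (\<exists>u\<in>lists {..n}. s \<subseteq> ray u ` {..n})}"

lemma ray_inj: "ray u k = ray v l \<Longrightarrow> k = l"
  using perm_image_ray_inj[of u "int k" v "int l"] by (simp add: ray_def)

lemma wperm_image:
  "wperm (u @ v) ` A = wperm u ` wperm v ` A" "wperm (i # u) ` A = refl_perm (int i) ` wperm u ` A"
  by (simp_all add: wperm_append image_image)

lemma ray_append: "ray (u @ v) k = wperm u ` ray v k"
  by (simp add: ray_def wperm_append image_image)

lemma simplicial_complex_apartment: "simplicial_complex apartment"
  unfolding simplicial_complex_def
proof (intro ballI conjI allI impI)
  fix s assume s: "s \<in> apartment"
  then obtain u where "s \<subseteq> ray u ` {..n}" by (auto simp: apartment_def)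
  then show "finite s" by (rule finite_subset) simp
  show "s \<noteq> {}" using s by (simp add: apartment_def)
  show "t \<in> apartment" if "t \<subseteq> s \<and> t \<noteq> {}" for t
    using s that unfolding apartment_def by blast
qed

lemma refl_perm_ray:
  assumes "\<not> N dvd k - i"
  shows "refl_perm i ` {k..} = {k..}"
proof -
  have sub: "refl_perm i ` {k..} \<subseteq> {k..}"
  proof (rule image_subsetI)
    fix y assume "y \<in> {k..}"
    then show "refl_perm i y \<in> {k..}" using assms by (cases "y = k") (auto simp: refl_perm_def)
  qed
  moreover have "{k..} \<subseteq> refl_perm i ` {k..}"
    using image_mono[OF sub, of "refl_perm i"] by (simp add: image_image refl_perm_invol)
  ultimately show ?thesis by blast
qed

lemma wperm_ray_stable:
  assumes "v \<in> lists ({..n} - T)" "k \<in> T" "k \<le> n"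
  shows "wperm v ` {int k..} = {int k..}"
  using assms(1)
proof (induction v)
  case (Cons i v)
  then have i: "i \<le> n" "i \<noteq> k" using assms(2) by auto
  have "\<not> N dvd int k - int i"
    using i assms(3) zdvd_not_zless[of "int k - int i" N] zdvd_not_zless[of "int i - int k" N]
      dvd_minus_iff[of N "int k - int i"] by fastforce
  then show ?case using Cons refl_perm_ray by (simp only: wperm_image)
qed simp

text \<open>The stabiliser of a face is the parabolic subgroup of the missing types. A descent at
  \<open>i \<in> T\<close> is impossible, since a map preserving the ray from \<open>i\<close> sends
  \<open>i\<close> into it and \<open>i - 1\<close> outside; so sorting uses only letters outside
  \<open>T\<close>.\<close>

lemma stabilizer_word:
  assumes T: "T \<subseteq> {..n}" and "\<And>k. k \<in> T \<Longrightarrow> wperm x ` {int k..} = {int k..}"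
  shows "\<exists>v\<in>lists ({..n} - T). wperm v = wperm x"
  using assms(2)
proof (induction "nat (inv_count (wperm x))" arbitrary: x rule: less_induct)
  case less
  note w = affine_perm_perm[of x]
  have inj: "inj (wperm x)" using w by (simp add: affine_perm_def bij_is_inj)
  show ?case
  proof (cases "\<exists>i\<le>n. descent (wperm x) (int i)")
    case True
    then obtain i where i: "i \<le> n" "descent (wperm x) (int i)" by blast
    have iT: "i \<notin> T"
    proof
      assume "i \<in> T"
      then have *: "wperm x ` {int i..} = {int i..}" by (rule less.prems)
      then have "wperm x (int i) \<in> {int i..}" by blast
      moreover have "wperm x (int i - 1) \<notin> wperm x ` {int i..}"
        using inj by (auto simp: inj_image_mem_iff)
      ultimately show False using i(2) * by (simp add: descent_def)
    qed
    have *: "inv_count (wperm (x @ [i])) = inv_count (wperm x) - 2"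
      unfolding wperm_snoc by (rule inv_count_descent[OF w i(2)])
    then have lt: "nat (inv_count (wperm (x @ [i]))) < nat (inv_count (wperm x))"
      using inv_count_nonneg[of "wperm (x @ [i])"] by linarith
    have "wperm (x @ [i]) ` {int k..} = {int k..}" if k: "k \<in> T" for k
    proof -
      have "wperm (x @ [i]) ` {int k..} = wperm x ` wperm [i] ` {int k..}"
        by (rule wperm_image)
      also have "wperm [i] ` {int k..} = {int k..}"
        using k T i(1) iT by (intro wperm_ray_stable[of _ T]) auto
      finally show ?thesis using less.prems[OF k] by simp
    qed
    then obtain v where v: "v \<in> lists ({..n} - T)" "wperm v = wperm (x @ [i])"
      using less.hyps[OF lt] by blast
    have "wperm (v @ [i]) = wperm x"
      unfolding wperm_snoc v(2) by (simp add: comp_assoc refl_perm_comp_invol)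
    then show ?thesis using v(1) i(1) iT by (intro bexI[of _ "v @ [i]"]) auto
  next
    case False
    \<comment> \<open>A word without descents is a translation, and zero displacement excludes a
      nontrivial one.\<close>
    then have "wperm x y = y + wperm x 0" for y using no_descent_shift[OF w] by blast
    then have *: "wperm x = (\<lambda>y. wperm [] y + wperm x 0)"
      by (intro HOL.ext) (metis id_apply wperm_simps(1))
    then have "wperm x 0 = 0" by (rule perm_shift_eq_perm)
    with * have "wperm x = wperm []" by (intro HOL.ext) (metis add_0_right)
    then show ?thesis by (intro bexI[of _ "[]"]) simp_all
  qed
qed

section \<open>Words, parabolic cosets and simplices\<close>

abbreviation cls :: "nat list \<Rightarrow> nat list set" where "cls \<equiv> coxeter_class {..n} (Atilde n)"

abbreviation cox :: "nat list set monoid" where "cox \<equiv> coxeter_group {..n} (Atilde n)"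

lemma cls_eq_iff:
  assumes "u \<in> lists {..n}" "v \<in> lists {..n}"
  shows "cls u = cls v \<longleftrightarrow> wperm u = wperm v"
proof -
  have "cls u = cls v \<longleftrightarrow> u \<approx> v"
    using assms unfolding coxeter_class_def
    by (auto intro: coxeter_eq.refl coxeter_eq.trans coxeter_eq.sym)
  then show ?thesis using cox_eq_iff assms by simp
qed

lemma cox_mult:
  assumes "u \<in> lists {..n}" "v \<in> lists {..n}"
  shows "cls u \<otimes>\<^bsub>cox\<^esub> cls v = cls (u @ v)"
proof -
  have "cls (u' @ v') = cls (u @ v)" if "u' \<in> cls u" "v' \<in> cls v" for u' v'
  proof -
    have "u \<approx> u'" "v \<approx> v'" using that by (simp_all add: coxeter_class_def)
    then have "u @ v \<approx> u' @ v'" by (rule cox_eq_append)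
    then have "wperm (u @ v) = wperm (u' @ v')" "u' @ v' \<in> lists {..n}"
      using wperm_cox_eq cox_eq_lists by blast+
    then show ?thesis using assms cls_eq_iff[of "u' @ v'" "u @ v"] by simp
  qed
  moreover have "u \<in> cls u" "v \<in> cls v"
    using assms by (auto simp: coxeter_class_def intro: coxeter_eq.refl)
  ultimately have "(\<Union>u'\<in>cls u. \<Union>v'\<in>cls v. cls (u' @ v')) = cls (u @ v)" by blast
  then show ?thesis by (simp add: coxeter_group_def)
qed

lemma cox_carrier: "carrier cox = cls ` lists {..n}"
  by (simp add: coxeter_group_def)

lemma cox_one: "\<one>\<^bsub>cox\<^esub> = cls []"
  by (simp add: coxeter_group_def)

lemma append_lists: "u \<in> lists A \<Longrightarrow> v \<in> lists A \<Longrightarrow> u @ v \<in> lists A"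
  by (simp add: append_in_lists_conv)

lemma rev_lists: "rev u \<in> lists A \<longleftrightarrow> u \<in> lists A"
  by (simp add: in_lists_conv_set)

lemma cox_inverse: "u \<in> lists {..n} \<Longrightarrow> cls (rev u) \<otimes>\<^bsub>cox\<^esub> cls u = \<one>\<^bsub>cox\<^esub>"
proof -
  assume u: "u \<in> lists {..n}"
  then have ru: "rev u \<in> lists {..n}" "rev u @ u \<in> lists {..n}" by (simp_all only: rev_lists append_lists)
  have "wperm (rev u @ u) = wperm []" unfolding wperm_append wperm_rev by simp
  then have "cls (rev u @ u) = cls []" using cls_eq_iff[OF ru(2) lists.Nil] by blast
  then show ?thesis unfolding cox_mult[OF ru(1) u] cox_one .
qed

lemma group_cox: "group cox"
proof (rule groupI)
  fix x y assume "x \<in> carrier cox" "y \<in> carrier cox"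
  then obtain u v where uv: "u \<in> lists {..n}" "v \<in> lists {..n}" "x = cls u" "y = cls v"
    unfolding cox_carrier by blast
  show "x \<otimes>\<^bsub>cox\<^esub> y \<in> carrier cox"
    unfolding uv(3,4) cox_mult[OF uv(1,2)] cox_carrier using uv(1,2) by (intro imageI append_lists)
  fix z assume "z \<in> carrier cox"
  then obtain w where w: "w \<in> lists {..n}" "z = cls w" unfolding cox_carrier by blast
  then have "u @ v \<in> lists {..n}" "v @ w \<in> lists {..n}" using uv by (simp_all only: append_lists)
  then show "x \<otimes>\<^bsub>cox\<^esub> y \<otimes>\<^bsub>cox\<^esub> z = x \<otimes>\<^bsub>cox\<^esub> (y \<otimes>\<^bsub>cox\<^esub> z)"
    using uv w by (simp only: cox_mult append_assoc)
next
  fix x assume "x \<in> carrier cox"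
  then obtain u where u: "u \<in> lists {..n}" "x = cls u" unfolding cox_carrier by blast
  have Nil: "[] \<in> lists {..n}" by simp
  show "\<one>\<^bsub>cox\<^esub> \<otimes>\<^bsub>cox\<^esub> x = x"
    unfolding u(2) cox_one cox_mult[OF Nil u(1)] by simp
  have "rev u \<in> lists {..n}" using u(1) by (simp only: rev_lists)
  then show "\<exists>y\<in>carrier cox. y \<otimes>\<^bsub>cox\<^esub> x = \<one>\<^bsub>cox\<^esub>"
    unfolding cox_carrier u(2) using cox_inverse[OF u(1)] by blast
qed (simp add: cox_carrier cox_one)

text \<open>Each generator is its own inverse, so the inverses under which \<open>generate\<close>
  closes add no new words.\<close>

lemma coxeter_parabolic_eq:
  assumes J: "J \<subseteq> {..n}"
  shows "coxeter_parabolic {..n} (Atilde n) J = cls ` lists J"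
proof -
  interpret group cox by (rule group_cox)
  have JI: "lists J \<subseteq> lists {..n}" using J by auto
  have "x \<in> cls ` lists J" if "x \<in> generate cox ((\<lambda>i. cls [i]) ` J)" for x
    using that
  proof (induction rule: generate.induct)
    case (inv h)
    then obtain i where i: "i \<in> J" "h = cls [i]" by auto
    then have "inv\<^bsub>cox\<^esub> h = h"
      using cox_inverse[of "[i]"] J by (intro inv_equality) (auto simp: cox_carrier)
    then show ?case using i by auto
  next
    case (eng h1 h2)
    then obtain u1 u2 where u12: "u1 \<in> lists J" "u2 \<in> lists J" "h1 = cls u1" "h2 = cls u2"
      by (elim imageE)
    have "cls u1 \<otimes>\<^bsub>cox\<^esub> cls u2 = cls (u1 @ u2)"
      using u12(1,2) JI by (intro cox_mult subsetD[OF JI])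
    then show ?case using append_lists[OF u12(1,2)] by (simp only: u12(3,4) imageI)
  qed (auto simp: cox_one)
  moreover have "cls u \<in> generate cox ((\<lambda>i. cls [i]) ` J)" if "u \<in> lists J" for u
    using that
  proof (induction u)
    case Nil
    then show ?case using generate.one[of cox] by (simp add: cox_one)
  next
    case (Cons i u)
    then have "cls [i] \<otimes>\<^bsub>cox\<^esub> cls u \<in> generate cox ((\<lambda>i. cls [i]) ` J)"
      by (intro generate.eng) (simp_all add: generate.incl)
    moreover have "cls [i] \<otimes>\<^bsub>cox\<^esub> cls u = cls ([i] @ u)"
      using Cons.hyps J by (intro cox_mult subsetD[OF JI]) auto
    ultimately show ?case by simp
  qed
  ultimately show ?thesis unfolding coxeter_parabolic_def by blast
qed

text \<open>The chambers that contain \<open>s\<close>, read as group elements. For the face of the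
  chamber \<open>u\<close> with types \<open>T\<close> this is the coset of \<open>u\<close> modulo
  the parabolic subgroup of the complement of \<open>T\<close>.\<close>

definition face_coset :: "int set set \<Rightarrow> nat list set set" where
  "face_coset s = cls ` {u \<in> lists {..n}. s \<subseteq> ray u ` {..n}}"

text \<open>Vertices of different types never coincide, so inclusion can be tested type by
  type.\<close>

lemma ray_face_subset:
  assumes "T \<subseteq> {..n}"
  shows "ray u ` T \<subseteq> ray v ` {..n} \<longleftrightarrow> (\<forall>k\<in>T. ray u k = ray v k)"
proof
  assume *: "ray u ` T \<subseteq> ray v ` {..n}"
  show "\<forall>k\<in>T. ray u k = ray v k"
  proof
    fix k assume "k \<in> T"
    then obtain l where "ray u k = ray v l" using * by blast
    with ray_inj[OF this] show "ray u k = ray v k" by simp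
  qed
next
  assume *: "\<forall>k\<in>T. ray u k = ray v k"
  show "ray u ` T \<subseteq> ray v ` {..n}"
  proof (rule image_subsetI)
    fix k assume "k \<in> T"
    then show "ray u k \<in> ray v ` {..n}" using * assms by blast
  qed
qed

lemma face_coset_eq:
  assumes u: "u \<in> lists {..n}" and T: "T \<subseteq> {..n}"
  shows "face_coset (ray u ` T) = cls u <#\<^bsub>cox\<^esub> coxeter_parabolic {..n} (Atilde n) ({..n} - T)"
proof -
  have J: "lists ({..n} - T) \<subseteq> lists {..n}" by auto
  have iff: "(\<exists>x. x \<in> lists {..n} \<and> ray u ` T \<subseteq> ray x ` {..n} \<and> c = cls x) \<longleftrightarrow>
      (\<exists>v\<in>lists ({..n} - T). c = cls (u @ v))" for c
  proof
    assume "\<exists>x. x \<in> lists {..n} \<and> ray u ` T \<subseteq> ray x ` {..n} \<and> c = cls x"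
    then obtain x where x: "x \<in> lists {..n}" "ray u ` T \<subseteq> ray x ` {..n}" "c = cls x"
      by (elim exE conjE)
    have ux: "ray u k = ray x k" if "k \<in> T" for k
      using iffD1[OF ray_face_subset[OF T] x(2)] that by (rule bspec)
    have "wperm (rev u @ x) ` {int k..} = {int k..}" if k: "k \<in> T" for k
    proof -
      have "ray (rev u @ x) k = ray (rev u @ u) k" by (simp only: ray_append ux[OF k])
      also have "\<dots> = {int k..}" unfolding ray_def wperm_append wperm_rev by simp
      finally show ?thesis by (simp add: ray_def)
    qed
    then obtain v where v: "v \<in> lists ({..n} - T)" "wperm v = wperm (rev u @ x)"
      using stabilizer_word[OF T] by blast
    have "wperm (u @ v) = wperm x"
      unfolding wperm_append v(2) by (simp only: o_assoc wperm_rev id_o)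
    then have "cls (u @ v) = cls x"
      using cls_eq_iff[OF append_lists[OF u subsetD[OF J v(1)]] x(1)] by simp
    then show "\<exists>v\<in>lists ({..n} - T). c = cls (u @ v)" 
      using x(3) by (intro bexI[OF _ v(1)]) simp
  next
    assume "\<exists>v\<in>lists ({..n} - T). c = cls (u @ v)"
    then obtain v where v: "v \<in> lists ({..n} - T)" "c = cls (u @ v)" by (elim bexE)
    have "ray u k = ray (u @ v) k" if "k \<in> T" for k
      using wperm_ray_stable[OF v(1) that] T that unfolding ray_def wperm_image by auto
    then have "ray u ` T \<subseteq> ray (u @ v) ` {..n}" by (intro iffD2[OF ray_face_subset[OF T]] ballI)
    then show "\<exists>x. x \<in> lists {..n} \<and> ray u ` T \<subseteq> ray x ` {..n} \<and> c = cls x"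
      using v(2) append_lists[OF u subsetD[OF J v(1)]] by (intro exI[of _ "u @ v"] conjI)
  qed
  have "face_coset (ray u ` T) = {c. \<exists>x. x \<in> lists {..n} \<and> ray u ` T \<subseteq> ray x ` {..n} \<and> c = cls x}"
    unfolding face_coset_def image_def by (intro Collect_cong) (simp only: Bex_def mem_Collect_eq conj_assoc)
  also have "\<dots> = {c. \<exists>v\<in>lists ({..n} - T). c = cls (u @ v)}"
    by (simp only: iff)
  also have "\<dots> = cls u <#\<^bsub>cox\<^esub> coxeter_parabolic {..n} (Atilde n) ({..n} - T)"
  proof -
    have "cls u \<otimes>\<^bsub>cox\<^esub> cls v = cls (u @ v)" if "v \<in> lists ({..n} - T)" for v
      using that by (intro cox_mult u subsetD[OF J])
    then have "(\<Union>v\<in>lists ({..n} - T). {cls u \<otimes>\<^bsub>cox\<^esub> cls v}) = (\<Union>v\<in>lists ({..n} - T). {cls (u @ v)})"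
      by (intro SUP_cong) simp_all
    also have "\<dots> = {c. \<exists>v\<in>lists ({..n} - T). c = cls (u @ v)}" by fast
    finally show ?thesis by (simp only: coxeter_parabolic_eq[OF Diff_subset] l_coset_def image_image UN_simps)
  qed
  finally show ?thesis .
qed

lemma apartment_cases:
  assumes "s \<in> apartment"
  obtains u T where "u \<in> lists {..n}" "T \<subseteq> {..n}" "T \<noteq> {}" "s = ray u ` T"
proof -
  from assms obtain u where u: "u \<in> lists {..n}" "s \<subseteq> ray u ` {..n}" "s \<noteq> {}"
    by (auto simp: apartment_def)
  then obtain T where "T \<subseteq> {..n}" "s = ray u ` T" by (metis subset_imageE)
  with u that show ?thesis by blast
qed

lemma ray_image_in_apartment:
  "u \<in> lists {..n} \<Longrightarrow> T \<subseteq> {..n} \<Longrightarrow> T \<noteq> {} \<Longrightarrow> ray u ` T \<in> apartment"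
  unfolding apartment_def by blast

text \<open>For the converse, a vertex of \<open>s\<close> whose type \<open>k\<close> is missing in
  \<open>t\<close> would have to lie both in the chamber \<open>u\<close> and in its neighbour
  \<open>u @ [k]\<close>, since both contain \<open>t\<close>; but these two differ in the vertex of
  type \<open>k\<close>.\<close>

lemma face_coset_subset_iff:
  assumes s: "s \<in> apartment" and t: "t \<in> apartment"
  shows "s \<subseteq> t \<longleftrightarrow> face_coset t \<subseteq> face_coset s"
proof
  show "s \<subseteq> t \<Longrightarrow> face_coset t \<subseteq> face_coset s" by (auto simp: face_coset_def)
next
  assume sub: "face_coset t \<subseteq> face_coset s"
  obtain u T where u: "u \<in> lists {..n}" "T \<subseteq> {..n}" "t = ray u ` T"
    using t by (rule apartment_cases)
  have contains: "s \<subseteq> ray v ` {..n}" if v: "v \<in> lists {..n}" "t \<subseteq> ray v ` {..n}" for v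
  proof -
    have "cls v \<in> face_coset s" using sub v by (auto simp: face_coset_def)
    then obtain v' where v': "v' \<in> lists {..n}" "s \<subseteq> ray v' ` {..n}" "cls v = cls v'"
      by (auto simp: face_coset_def)
    then have "ray v' = ray v" using v(1) by (auto simp: cls_eq_iff ray_def fun_eq_iff)
    then show ?thesis using v'(2) by simp
  qed
  show "s \<subseteq> t"
  proof
    fix x assume x: "x \<in> s"
    then obtain k where k: "k \<le> n" "x = ray u k" using contains[of u] u by auto
    show "x \<in> t"
    proof (cases "k \<in> T")
      case False
      have "ray u l = ray (u @ [k]) l" if "l \<in> T" for l
        using wperm_ray_stable[of "[k]" T l] that False k u(2)
        unfolding ray_def wperm_image by auto
      then have "t \<subseteq> ray (u @ [k]) ` {..n}"
        using u ray_face_subset by blast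
      then have "x \<in> ray (u @ [k]) ` {..n}" using contains[of "u @ [k]"] u k x by auto
      then have "ray u k = ray (u @ [k]) k" using k(2) ray_inj by blast
      then have "wperm u ` {int k..} = wperm u ` refl_perm (int k) ` {int k..}"
        by (simp add: ray_def wperm_image)
      then have "{int k..} = refl_perm (int k) ` {int k..}"
        using affine_perm_perm[of u] by (simp add: affine_perm_def bij_is_inj inj_image_eq_iff)
      then have "refl_perm (int k) (int k) \<in> {int k..}" by blast
      then show ?thesis by simp
    qed (use k u in auto)
  qed
qed

lemma iso_coxeter_complex_apartment: "iso_coxeter_complex {..n} (Atilde n) apartment"
  unfolding iso_coxeter_complex_def
proof (intro exI conjI ballI)
  show "s \<subseteq> t \<longleftrightarrow> face_coset t \<subseteq> face_coset s" if "s \<in> apartment" "t \<in> apartment" for s t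
    using that by (rule face_coset_subset_iff)
  have "inj_on face_coset apartment"
    using face_coset_subset_iff by (auto intro!: inj_onI)
  moreover have "face_coset ` apartment = coxeter_complex {..n} (Atilde n)"
  proof (intro equalityI subsetI)
    fix c assume "c \<in> face_coset ` apartment"
    then obtain s where s: "s \<in> apartment" "c = face_coset s" by blast
    obtain u T where u: "u \<in> lists {..n}" "T \<subseteq> {..n}" "T \<noteq> {}" "s = ray u ` T"
      using s(1) by (rule apartment_cases)
    have "{..n} - T \<subset> {..n}" using u by auto
    then show "c \<in> coxeter_complex {..n} (Atilde n)"
      unfolding coxeter_complex_def s(2) u(4) face_coset_eq[OF u(1,2)] cox_carrier using u(1) by blast
  next
    fix c assume "c \<in> coxeter_complex {..n} (Atilde n)"
    then obtain u J where u: "u \<in> lists {..n}" "J \<subset> {..n}"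
      "c = cls u <#\<^bsub>cox\<^esub> coxeter_parabolic {..n} (Atilde n) J"
      by (auto simp: coxeter_complex_def cox_carrier)
    have "{..n} - ({..n} - J) = J" using u(2) by blast
    then have "c = face_coset (ray u ` ({..n} - J))" using u face_coset_eq[of u "{..n} - J"] by simp
    moreover have "ray u ` ({..n} - J) \<in> apartment"
      using u by (intro ray_image_in_apartment) auto
    ultimately show "c \<in> face_coset ` apartment" by blast
  qed
  ultimately show "bij_betw face_coset apartment (coxeter_complex {..n} (Atilde n))"
    by (simp add: bij_betw_def)
qed

lemma vertices_apartment: "vertices apartment = {ray u k | u k. u \<in> lists {..n} \<and> k \<le> n}"
proof (intro equalityI subsetI)
  fix x assume "x \<in> vertices apartment"
  then obtain s where s: "s \<in> apartment" "x \<in> s" unfolding vertices_def by (elim UnionE)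
  obtain u T where u: "u \<in> lists {..n}" "T \<subseteq> {..n}" "s = ray u ` T"
    using s(1) by (rule apartment_cases)
  obtain k where "x = ray u k" "k \<in> T" using s(2) unfolding u(3) by (elim imageE)
  then show "x \<in> {ray u k | u k. u \<in> lists {..n} \<and> k \<le> n}"
    using u(1,2) by (intro CollectI exI[of _ u] exI[of _ k] conjI) auto
next
  fix x assume "x \<in> {ray u k | u k. u \<in> lists {..n} \<and> k \<le> n}"
  then obtain u k where u: "u \<in> lists {..n}" "k \<le> n" "x = ray u k" by (elim CollectE exE conjE)
  then have "ray u ` {k} \<in> apartment" by (intro ray_image_in_apartment) auto
  then show "x \<in> vertices apartment" unfolding vertices_def u(3) by (rule UnionI) simp
qed

end

section \<open>Fields with a valuation\<close>

definition ring_closed :: "'a :: comm_ring_1 set \<Rightarrow> bool" where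
  "ring_closed R \<longleftrightarrow> 1 \<in> R \<and> (\<forall>x\<in>R. \<forall>y\<in>R. x - y \<in> R \<and> x * y \<in> R)"

definition field_closed :: "'a :: field set \<Rightarrow> bool" where
  "field_closed F \<longleftrightarrow> ring_closed F \<and> (\<forall>x\<in>F. inverse x \<in> F)"

lemma ring_closed_one: "ring_closed R \<Longrightarrow> 1 \<in> R"
  and ring_closed_diff: "ring_closed R \<Longrightarrow> x \<in> R \<Longrightarrow> y \<in> R \<Longrightarrow> x - y \<in> R"
  and ring_closed_mult: "ring_closed R \<Longrightarrow> x \<in> R \<Longrightarrow> y \<in> R \<Longrightarrow> x * y \<in> R"
  by (auto simp: ring_closed_def)

lemma ring_closed_zero: "ring_closed R \<Longrightarrow> 0 \<in> R"
  using ring_closed_diff[of R 1 1] ring_closed_one by force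

lemma ring_closed_uminus: "ring_closed R \<Longrightarrow> x \<in> R \<Longrightarrow> - x \<in> R"
  using ring_closed_diff[of R 0 x] ring_closed_zero by force

lemma ring_closed_add: "ring_closed R \<Longrightarrow> x \<in> R \<Longrightarrow> y \<in> R \<Longrightarrow> x + y \<in> R"
  using ring_closed_diff[of R x "- y"] ring_closed_uminus by force

lemma ring_closed_power: "ring_closed R \<Longrightarrow> x \<in> R \<Longrightarrow> x ^ k \<in> R"
  by (induction k) (auto intro: ring_closed_one ring_closed_mult)

lemma ring_closed_sum: "ring_closed R \<Longrightarrow> (\<And>i. i \<in> A \<Longrightarrow> f i \<in> R) \<Longrightarrow> sum f A \<in> R"
  by (induction A rule: infinite_finite_induct) (auto intro: ring_closed_zero ring_closed_add)

lemma ring_closed_of_nat: "ring_closed R \<Longrightarrow> of_nat k \<in> R"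
  by (induction k) (auto intro: ring_closed_zero ring_closed_one ring_closed_add)

lemma ring_closed_of_int: "ring_closed R \<Longrightarrow> of_int k \<in> R"
  using ring_closed_of_nat ring_closed_uminus by (cases k rule: int_cases2) fastforce+

lemmas ring_closed_intros = ring_closed_zero ring_closed_one ring_closed_add ring_closed_diff
  ring_closed_uminus ring_closed_mult ring_closed_power ring_closed_sum

lemma field_closed_ring: "field_closed F \<Longrightarrow> ring_closed F"
  and field_closed_inverse: "field_closed F \<Longrightarrow> x \<in> F \<Longrightarrow> inverse x \<in> F"
  by (auto simp: field_closed_def)

lemma field_closed_divide: "field_closed F \<Longrightarrow> x \<in> F \<Longrightarrow> y \<in> F \<Longrightarrow> x / y \<in> F"
  unfolding divide_inverse by (intro ring_closed_mult field_closed_ring field_closed_inverse)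

lemma field_closed_powi: "field_closed F \<Longrightarrow> x \<in> F \<Longrightarrow> x powi k \<in> F"
  by (auto simp: power_int_def intro: ring_closed_power field_closed_ring field_closed_inverse)

lemmas field_closed_intros = ring_closed_intros[OF field_closed_ring] field_closed_inverse
  field_closed_divide field_closed_powi

definition poly_over :: "'a :: field set \<Rightarrow> 'a poly \<Rightarrow> bool" where
  "poly_over R p \<longleftrightarrow> (\<forall>i. poly.coeff p i \<in> R)"

lemma poly_over_mono: "poly_over R p \<Longrightarrow> R \<subseteq> S \<Longrightarrow> poly_over S p"
  by (auto simp: poly_over_def)

lemma poly_over_arith:
  assumes R: "ring_closed R"
  shows "poly_over R 0" "poly_over R 1" "c \<in> R \<Longrightarrow> poly_over R [:c:]" "poly_over R [:0, 1:]"
    "poly_over R p \<Longrightarrow> poly_over R q \<Longrightarrow> poly_over R (p + q)"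
    "poly_over R p \<Longrightarrow> poly_over R q \<Longrightarrow> poly_over R (p - q)"
    "poly_over R p \<Longrightarrow> poly_over R q \<Longrightarrow> poly_over R (p * q)"
    "poly_over R p \<Longrightarrow> poly_over R (- p)"
proof -
  note [intro] = ring_closed_intros(1-6)[OF R]
  show "poly_over R 0" "poly_over R 1" by (auto simp: poly_over_def)
  show "c \<in> R \<Longrightarrow> poly_over R [:c:]" "poly_over R [:0, 1:]"
    by (auto simp: poly_over_def coeff_pCons split: nat.splits)
  show "poly_over R p \<Longrightarrow> poly_over R q \<Longrightarrow> poly_over R (p + q)"
    "poly_over R p \<Longrightarrow> poly_over R q \<Longrightarrow> poly_over R (p - q)"
    "poly_over R p \<Longrightarrow> poly_over R (- p)"
    by (auto simp: poly_over_def)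
  show "poly_over R p \<Longrightarrow> poly_over R q \<Longrightarrow> poly_over R (p * q)"
    unfolding poly_over_def coeff_mult by (intro allI ring_closed_sum[OF R]) blast
qed

lemma poly_over_eval: "ring_closed R \<Longrightarrow> poly_over R p \<Longrightarrow> x \<in> R \<Longrightarrow> poly p x \<in> R"
  by (auto simp: poly_altdef poly_over_def intro!: ring_closed_intros)

lemma poly_over_sum_eval:
  assumes R: "ring_closed R" and "\<And>i. i \<le> d \<Longrightarrow> f i \<in> R"
  obtains p where "poly_over R p" "\<And>x. poly p x = (\<Sum>i\<le>d. f i * x ^ i)"
    "\<And>i. poly.coeff p i = (if i \<le> d then f i else 0)"
proof -
  let ?p = "Poly (map f [0..<Suc d])"
  have c: "poly.coeff ?p i = (if i \<le> d then f i else 0)" for i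
    by (simp add: nth_default_def less_Suc_eq_le del: upt_Suc)
  have "poly_over R ?p" using assms unfolding poly_over_def c by (auto simp: ring_closed_zero)
  moreover have "poly ?p x = (\<Sum>i\<le>d. f i * x ^ i)" for x
  proof -
    have deg: "Polynomial.degree ?p \<le> d" using c by (intro degree_le) auto
    have "poly ?p x = (\<Sum>i\<le>Polynomial.degree ?p. poly.coeff ?p i * x ^ i)" by (rule poly_altdef)
    also have "\<dots> = (\<Sum>i\<le>d. poly.coeff ?p i * x ^ i)"
      using deg by (intro sum.mono_neutral_left) (auto simp: coeff_eq_0 simp del: upt_Suc coeff_Poly_eq)
    finally show ?thesis by (simp only: c) (auto intro!: sum.cong)
  qed
  ultimately show ?thesis using that c by blast
qed

definition ring_adjoin :: "'a :: field set \<Rightarrow> 'a \<Rightarrow> 'a set" where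
  "ring_adjoin R x = {poly p x | p. poly_over R p}"

lemma ring_adjoin:
  assumes R: "ring_closed R"
  shows "ring_closed (ring_adjoin R x)" "R \<subseteq> ring_adjoin R x" "x \<in> ring_adjoin R x"
    "ring_closed S \<Longrightarrow> R \<subseteq> S \<Longrightarrow> x \<in> S \<Longrightarrow> ring_adjoin R x \<subseteq> S"
proof -
  note [intro] = poly_over_arith[OF R]
  show "ring_closed (ring_adjoin R x)"
    unfolding ring_closed_def ring_adjoin_def
  proof (intro conjI ballI)
    show "1 \<in> {poly p x | p. poly_over R p}" using poly_1[of x] by (metis (mono_tags, lifting) CollectI poly_over_arith(2)[OF R])
    fix y z assume "y \<in> {poly p x | p. poly_over R p}" "z \<in> {poly p x | p. poly_over R p}"
    then obtain p q where "poly_over R p" "poly_over R q" "y = poly p x" "z = poly q x" by blast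
    then have "poly_over R (p - q)" "poly_over R (p * q)" "y - z = poly (p - q) x" "y * z = poly (p * q) x"
      by auto
    then show "y - z \<in> {poly p x | p. poly_over R p}" "y * z \<in> {poly p x | p. poly_over R p}" by blast+
  qed
  show "R \<subseteq> ring_adjoin R x"
  proof
    fix c assume "c \<in> R"
    then have "poly_over R [:c:]" "c = poly [:c:] x" by auto
    then show "c \<in> ring_adjoin R x" unfolding ring_adjoin_def by blast
  qed
  have "poly_over R [:0, 1:]" "x = poly [:0, 1:] x" by auto
  then show "x \<in> ring_adjoin R x" unfolding ring_adjoin_def by blast
  show "ring_adjoin R x \<subseteq> S" if "ring_closed S" "R \<subseteq> S" "x \<in> S"
  proof
    fix z assume "z \<in> ring_adjoin R x"
    then obtain p where "poly_over R p" "z = poly p x" unfolding ring_adjoin_def by blast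
    then show "z \<in> S" using poly_over_eval[OF that(1) poly_over_mono[OF _ that(2)] that(3)] by blast
  qed
qed

text \<open>The denominator may be zero: division by zero gives \<open>0\<close>, which lies in the
  field anyway, so no side condition is imposed.\<close>

definition field_adjoin :: "'a :: field set \<Rightarrow> 'a \<Rightarrow> 'a set" where
  "field_adjoin F x = {y / z | y z. y \<in> ring_adjoin F x \<and> z \<in> ring_adjoin F x}"

lemma field_adjoin:
  assumes F: "ring_closed F"
  shows "field_closed (field_adjoin F x)" "F \<subseteq> field_adjoin F x" "x \<in> field_adjoin F x"
    "ring_adjoin F x \<subseteq> field_adjoin F x"
proof -
  note R = ring_adjoin(1)[OF F, of x]
  have mem: "y \<in> ring_adjoin F x \<Longrightarrow> z \<in> ring_adjoin F x \<Longrightarrow> y / z \<in> field_adjoin F x" for y z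
    by (auto simp: field_adjoin_def)
  show sub: "ring_adjoin F x \<subseteq> field_adjoin F x"
    using mem[of _ 1] ring_closed_one[OF R] by auto
  then show "F \<subseteq> field_adjoin F x" "x \<in> field_adjoin F x" using ring_adjoin(2,3)[OF F] by blast+
  show "field_closed (field_adjoin F x)"
    unfolding field_closed_def ring_closed_def
  proof (intro conjI ballI)
    show "1 \<in> field_adjoin F x" using sub ring_closed_one[OF R] by blast
    fix y z assume "y \<in> field_adjoin F x" "z \<in> field_adjoin F x"
    then obtain a b c d where *: "a \<in> ring_adjoin F x" "b \<in> ring_adjoin F x" "c \<in> ring_adjoin F x"
      "d \<in> ring_adjoin F x" "y = a / b" "z = c / d" by (auto simp: field_adjoin_def)
    have "y * z = (a * c) / (b * d)" using * by simp
    then show "y * z \<in> field_adjoin F x" using mem ring_closed_mult[OF R] * by metis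
    show "y - z \<in> field_adjoin F x"
    proof (cases "b = 0 \<or> d = 0")
      case True
      then have "y - z = a / b \<or> y - z = (- c) / d" using * by auto
      then show ?thesis using mem * ring_closed_uminus[OF R] by metis
    next
      case False
      then have "y - z = (a * d - c * b) / (b * d)" using * by (simp add: diff_frac_eq)
      then show ?thesis using mem * ring_closed_mult[OF R] ring_closed_diff[OF R] by metis
    qed
  next
    fix y assume "y \<in> field_adjoin F x"
    then obtain a b where "a \<in> ring_adjoin F x" "b \<in> ring_adjoin F x" "y = a / b" 
      by (auto simp: field_adjoin_def)
    then show "inverse y \<in> field_adjoin F x" using mem by simp
  qed
qed

lemma countable_field_adjoin:
  assumes "countable F"
  shows "countable (field_adjoin F x)"
proof -
  have "{p. poly_over F p} \<subseteq> Poly ` lists F"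
  proof
    fix p assume "p \<in> {p. poly_over F p}"
    then have "\<forall>c\<in>set (coeffs p). c \<in> F" unfolding poly_over_def coeffs_def by auto
    then have "coeffs p \<in> lists F" by (simp add: in_lists_conv_set)
    then have "Poly (coeffs p) \<in> Poly ` lists F" by (rule imageI)
    then show "p \<in> Poly ` lists F" by simp
  qed
  then have "countable {p. poly_over F p}"
    by (rule countable_subset) (intro countable_image countable_lists assms)
  then have "countable ((\<lambda>p. poly p x) ` {p. poly_over F p})" by (rule countable_image)
  then have R: "countable (ring_adjoin F x)" by (simp add: ring_adjoin_def setcompr_eq_image)
  have "field_adjoin F x \<subseteq> (\<lambda>(y, z). y / z) ` (ring_adjoin F x \<times> ring_adjoin F x)"
    unfolding field_adjoin_def by blast
  then show ?thesis by (rule countable_subset) (intro countable_image countable_SIGMA R)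
qed

text \<open>Gaussian elimination: the coordinate \<open>d\<close> is cleared with the pivot
  \<open>p\<close>, and the induction runs over the remaining coordinates. It serves both for
  algebraic relations between powers and for the columns of a matrix.\<close>

lemma dependent_family:
  fixes c :: "'j \<Rightarrow> 'i \<Rightarrow> 'a :: field"
  assumes F: "field_closed F"
  shows "finite I \<Longrightarrow> finite J \<Longrightarrow> card I < card J \<Longrightarrow> (\<And>j i. j \<in> J \<Longrightarrow> i \<in> I \<Longrightarrow> c j i \<in> F) \<Longrightarrow>
    \<exists>\<alpha>. (\<forall>j\<in>J. \<alpha> j \<in> F) \<and> (\<exists>j\<in>J. \<alpha> j \<noteq> 0) \<and> (\<forall>i\<in>I. (\<Sum>j\<in>J. \<alpha> j * c j i) = 0)"
proof (induction I arbitrary: J c rule: finite_induct)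
  case empty
  then obtain j where "j \<in> J" by fastforce
  then show ?case using field_closed_intros(2)[OF F] by (intro exI[of _ "\<lambda>_. 1"]) auto
next
  case (insert d I)
  show ?case
  proof (cases "\<exists>p\<in>J. c p d \<noteq> 0")
    case False
    obtain \<alpha> where \<alpha>: "\<forall>j\<in>J. \<alpha> j \<in> F" "\<exists>j\<in>J. \<alpha> j \<noteq> 0" "\<forall>i\<in>I. (\<Sum>j\<in>J. \<alpha> j * c j i) = 0"
      using insert.IH[of J c] insert.prems insert.hyps by auto
    have "(\<Sum>j\<in>J. \<alpha> j * c j d) = 0" using False by (intro sum.neutral) auto
    then show ?thesis using \<alpha> by auto
  next
    case True
    then obtain p where p: "p \<in> J" "c p d \<noteq> 0" by blast
    define J' where "J' = J - {p}"
    have J: "J = insert p J'" "p \<notin> J'" "finite J'" using p insert.prems by (auto simp: J'_def)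
    define c' where "c' j i = c j i - c j d / c p d * c p i" for j i
    have c: "c j i \<in> F" if "j \<in> J" "i \<in> insert d I" for j i using insert.prems that by blast
    have cd: "c j d / c p d \<in> F" if "j \<in> J" for j
      using field_closed_divide[OF F] c that p by simp
    have "c' j i \<in> F" if "j \<in> J'" "i \<in> I" for j i
      using that p c cd J(1) by (auto simp: c'_def intro!: field_closed_intros[OF F])
    moreover have "card I < card J'" using insert.prems insert.hyps J by simp
    ultimately obtain \<alpha> where \<alpha>: "\<forall>j\<in>J'. \<alpha> j \<in> F" "\<exists>j\<in>J'. \<alpha> j \<noteq> 0"
      "\<forall>i\<in>I. (\<Sum>j\<in>J'. \<alpha> j * c' j i) = 0"
      using insert.IH[of J' c'] J by auto
    define \<beta> where "\<beta> j = (if j = p then - (\<Sum>j\<in>J'. \<alpha> j * (c j d / c p d)) else \<alpha> j)" for j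
    have \<beta>p: "\<beta> p = - (\<Sum>j\<in>J'. \<alpha> j * (c j d / c p d))" by (simp add: \<beta>_def)
    have "\<alpha> j * (c j d / c p d) \<in> F" if "j \<in> J'" for j
      using \<alpha>(1) cd that J(1) field_closed_intros(6)[OF F] by blast
    then have "\<beta> p \<in> F" unfolding \<beta>p by (intro field_closed_intros(5,8)[OF F])
    then have "\<forall>j\<in>J. \<beta> j \<in> F" using \<alpha>(1) J by (auto simp: \<beta>_def)
    moreover have "\<exists>j\<in>J. \<beta> j \<noteq> 0" using \<alpha>(2) J by (auto simp: \<beta>_def)
    moreover have "(\<Sum>j\<in>J. \<beta> j * c j i) = 0" if "i \<in> insert d I" for i
    proof -
      have "(\<Sum>j\<in>J. \<beta> j * c j i) = \<beta> p * c p i + (\<Sum>j\<in>J'. \<beta> j * c j i)"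
        using J by simp
      also have "(\<Sum>j\<in>J'. \<beta> j * c j i) = (\<Sum>j\<in>J'. \<alpha> j * c j i)"
        using J(2) by (intro sum.cong) (auto simp: \<beta>_def)
      also have "\<beta> p * c p i + (\<Sum>j\<in>J'. \<alpha> j * c j i) = (\<Sum>j\<in>J'. \<alpha> j * c' j i)"
        by (simp add: \<beta>p c'_def sum_distrib_right right_diff_distrib sum_subtractf mult.assoc)
      also have "\<dots> = 0"
      proof (cases "i = d")
        case True
        then have "c' j i = 0" for j using p by (simp add: c'_def)
        then show ?thesis by simp
      qed (use \<alpha>(3) that in auto)
      finally show ?thesis .
    qed
    ultimately show ?thesis by blast
  qed
qed

text \<open>A valuation may be trivial and need not be normalised; its value at 0 is junk.\<close>

definition valuation :: "'a :: field set \<Rightarrow> ('a \<Rightarrow> int) \<Rightarrow> bool" where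
  "valuation F v \<longleftrightarrow> (\<forall>x\<in>F - {0}. \<forall>y\<in>F - {0}.
     v (x * y) = v x + v y \<and> (x + y \<noteq> 0 \<longrightarrow> min (v x) (v y) \<le> v (x + y)))"

section \<open>Krull valuation rings\<close>

definition val_ring :: "'a :: field set \<Rightarrow> 'a set \<Rightarrow> bool" where
  "val_ring E B \<longleftrightarrow> ring_closed B \<and> B \<subseteq> E \<and> (\<forall>x\<in>E. x \<noteq> 0 \<longrightarrow> x \<in> B \<or> inverse x \<in> B)"

lemma maximal_subring:
  assumes "ring_closed R" "R \<subseteq> E" "a \<notin> R"
  obtains B where "ring_closed B" "R \<subseteq> B" "B \<subseteq> E" "a \<notin> B"
    "\<And>C. ring_closed C \<Longrightarrow> B \<subseteq> C \<Longrightarrow> C \<subseteq> E \<Longrightarrow> a \<notin> C \<Longrightarrow> C = B"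
proof -
  define Rs where "Rs = {B. ring_closed B \<and> R \<subseteq> B \<and> B \<subseteq> E \<and> a \<notin> B}"
  have "\<exists>M\<in>Rs. \<forall>P\<in>Rs. M \<subseteq> P \<longrightarrow> P = M"
  proof (rule subset_Zorn_nonempty)
    show "Rs \<noteq> {}" using assms by (auto simp: Rs_def)
    fix Cs assume ne: "Cs \<noteq> {}" and chain: "subset.chain Rs Cs"
    have sub: "Cs \<subseteq> Rs" using chain by (simp add: subset_chain_def)
    have Cs: "ring_closed P \<and> R \<subseteq> P \<and> P \<subseteq> E \<and> a \<notin> P" if "P \<in> Cs" for P
      using subsetD[OF sub that] by (simp add: Rs_def)
    obtain P0 where P0: "P0 \<in> Cs" using ne by blast
    have "ring_closed (\<Union>Cs)"
      unfolding ring_closed_def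
    proof (intro conjI ballI)
      show "1 \<in> \<Union>Cs" using ring_closed_one[of P0] Cs[OF P0] P0 by blast
      fix x y assume "x \<in> \<Union>Cs" "y \<in> \<Union>Cs"
      then obtain P Q where PQ: "P \<in> Cs" "Q \<in> Cs" "x \<in> P" "y \<in> Q" by (elim UnionE)
      then have "P \<subseteq> Q \<or> Q \<subseteq> P" using chain unfolding subset_chain_def by blast
      then obtain Z where Z: "Z \<in> Cs" "x \<in> Z" "y \<in> Z" using PQ by blast
      have "ring_closed Z" using Cs[OF Z(1)] by blast
      then have "x - y \<in> Z" "x * y \<in> Z"
        using Z by (auto intro: ring_closed_diff ring_closed_mult)
      then show "x - y \<in> \<Union>Cs" "x * y \<in> \<Union>Cs" using Z(1) by (auto intro: UnionI)
    qed
    moreover have "R \<subseteq> \<Union>Cs" using Cs[OF P0] P0 by blast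
    moreover have "\<Union>Cs \<subseteq> E" "a \<notin> \<Union>Cs" using Cs by blast+
    ultimately show "\<Union>Cs \<in> Rs" unfolding Rs_def by blast
  qed
  then obtain M where M: "M \<in> Rs" and max: "\<And>P. P \<in> Rs \<Longrightarrow> M \<subseteq> P \<Longrightarrow> P = M" by blast
  show ?thesis
  proof (rule that[of M])
    show "ring_closed M" "R \<subseteq> M" "M \<subseteq> E" "a \<notin> M" using M by (simp_all add: Rs_def)
    fix C assume "ring_closed C" "M \<subseteq> C" "C \<subseteq> E" "a \<notin> C"
    then show "C = M" using max[of C] \<open>R \<subseteq> M\<close> by (simp add: Rs_def)
  qed
qed

text \<open>
  A subring that is maximal among those avoiding \<open>a\<close> but containing \<open>1 / a\<close> is a valuation ring
  (Krull's argument: \<open>1 / a\<close> lies in its Jacobson radical).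
\<close>

lemma exists_val_ring:
  assumes E: "field_closed E" and R: "ring_closed R" "R \<subseteq> E" and a: "a \<in> E" "a \<notin> R" "inverse a \<in> R"
  obtains B where "val_ring E B" "R \<subseteq> B" "a \<notin> B"
proof -
  obtain B where B: "ring_closed B" "R \<subseteq> B" "B \<subseteq> E" "a \<notin> B"
    and max: "\<And>C. ring_closed C \<Longrightarrow> B \<subseteq> C \<Longrightarrow> C \<subseteq> E \<Longrightarrow> a \<notin> C \<Longrightarrow> C = B"
    using maximal_subring[OF R a(2)] by blast
  define y where "y = inverse a"
  have y: "y \<in> B" using a B by (auto simp: y_def)
  have "a \<noteq> 0" using a(2) ring_closed_zero[OF R(1)] by auto
  then have ya: "y * a = 1" "a * y = 1" by (simp_all add: y_def)
  note B_intros = ring_closed_intros[OF B(1)]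
  \<comment> \<open>Adjoining any \<open>x\<close> outside \<open>B\<close> must bring in
    \<open>a\<close>, by maximality.\<close>
  have adj: "\<exists>n f. (\<forall>i\<le>n. f i \<in> B) \<and> a = (\<Sum>i\<le>n. f i * x ^ i)" if x: "x \<in> E" "x \<notin> B" for x
  proof -
    have "a \<in> ring_adjoin B x"
    proof (rule ccontr)
      assume "a \<notin> ring_adjoin B x"
      moreover have "ring_adjoin B x \<subseteq> E"
        using ring_adjoin(4)[OF B(1) field_closed_ring[OF E] B(3) x(1)] .
      ultimately have "ring_adjoin B x = B"
        using max[of "ring_adjoin B x"] ring_adjoin(1,2)[OF B(1)] by blast
      then show False using ring_adjoin(3)[OF B(1), of x] x by blast
    qed
    then obtain p where "poly_over B p" "a = poly p x" by (auto simp: ring_adjoin_def)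
    then show ?thesis
      by (intro exI[of _ "Polynomial.degree p"] exI[of _ "poly.coeff p"]) (auto simp: poly_over_def poly_altdef)
  qed
  \<comment> \<open>\<open>y = 1 / a\<close> lies in the Jacobson radical. If
    \<open>1 - y * c\<close> had no inverse in \<open>B\<close>, then \<open>a\<close> would be a
    polynomial in that inverse; clearing denominators puts \<open>a * ?u ^ n\<close> into
    \<open>B\<close>, and this differs from \<open>a\<close> by an element of
    \<open>B\<close>.\<close>
  have unit: "inverse (1 - y * c) \<in> B \<and> 1 - y * c \<noteq> 0" if c: "c \<in> B" for c
  proof -
    let ?u = "1 - y * c"
    have uB: "?u \<in> B" using c y by (intro B_intros)
    have u0: "?u \<noteq> 0"
    proof
      assume "?u = 0"
      then have "a * (y * c) = a" by simp
      then have "c = a" using ya by (simp add: mult.assoc[symmetric])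
      then show False using c B(4) by simp
    qed
    moreover have "inverse ?u \<in> B"
    proof (rule ccontr)
      assume "inverse ?u \<notin> B"
      moreover have "inverse ?u \<in> E" using uB B(3) field_closed_inverse[OF E] by blast
      ultimately obtain n f where f: "\<forall>i\<le>n. f i \<in> B" "a = (\<Sum>i\<le>n. f i * inverse ?u ^ i)"
        using adj by blast
      have "a * ?u ^ n = (\<Sum>i\<le>n. f i * ?u ^ (n - i))"
        unfolding f(2) sum_distrib_right
      proof (intro sum.cong HOL.refl)
        fix i assume "i \<in> {..n}"
        then have "?u ^ n = ?u ^ i * ?u ^ (n - i)" by (simp add: power_add[symmetric])
        moreover have "inverse ?u ^ i * ?u ^ i = 1" using u0 by (simp add: power_mult_distrib[symmetric])
        ultimately show "f i * inverse ?u ^ i * ?u ^ n = f i * ?u ^ (n - i)"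
          by (simp add: mult.assoc[symmetric])
      qed
      then have 1: "a * ?u ^ n \<in> B" using f(1) uB by (auto intro!: B_intros)
      have "\<exists>c'\<in>B. ?u ^ n = 1 - y * c'"
      proof (induction n)
        case 0
        then show ?case using ring_closed_zero[OF B(1)] by (intro bexI[of _ 0]) auto
      next
        case (Suc n)
        then obtain c' where "c' \<in> B" and c': "?u ^ n = 1 - y * c'" by blast
        have "?u ^ Suc n = ?u * (1 - y * c')" unfolding power_Suc c' ..
        also have "\<dots> = 1 - y * (c + c' - c * y * c')" by (simp add: algebra_simps)
        finally have "?u ^ Suc n = 1 - y * (c + c' - c * y * c')" .
        moreover have "c + c' - c * y * c' \<in> B" using c \<open>c' \<in> B\<close> y by (intro B_intros)
        ultimately show ?case by blast
      qed
      then obtain c' where c': "c' \<in> B" "?u ^ n = 1 - y * c'" by blast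
      have "a * (1 - y * c') = a - c'" using ya(2) by (simp add: right_diff_distrib mult.assoc[symmetric])
      then have "a = a * ?u ^ n + c'" unfolding c'(2) by simp
      then show False using B_intros(3)[OF 1 c'(1)] B(4) by simp
    qed
    ultimately show ?thesis by blast
  qed
  \<comment> \<open>An expression of \<open>a\<close> in \<open>x\<close> of least degree
    \<open>n\<close> can be shortened. The expression in \<open>inverse x\<close>, of degree
    \<open>m \<le> n\<close>, has a constant term \<open>g 0\<close> with \<open>1 - y * g 0\<close>
    invertible, so it can be solved for \<open>1\<close> and turns \<open>x ^ n\<close> into lower
    powers.\<close>
  have key: False
    if x: "x \<noteq> 0" and f: "\<forall>i\<le>n. f i \<in> B" "a = (\<Sum>i\<le>n. f i * x ^ i)"
      and min: "\<And>k g. k < n \<Longrightarrow> \<forall>i\<le>k. g i \<in> B \<Longrightarrow> a \<noteq> (\<Sum>i\<le>k. g i * x ^ i)"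
      and g: "\<forall>j\<le>m. g j \<in> B" "a = (\<Sum>j\<le>m. g j * inverse x ^ j)" and mn: "m \<le> n" for x n f m g
  proof -
    have n: "n > 0"
    proof (rule ccontr)
      assume "\<not> n > 0"
      then have "(\<Sum>i\<le>n. f i * x ^ i) = f 0" by simp
      then show False using f B(4) by (metis le0)
    qed
    define w where "w = inverse (1 - y * g 0)"
    have w: "w \<in> B" "w * (1 - y * g 0) = 1" using unit[of "g 0"] g(1) by (auto simp: w_def)
    have "{..m} = insert 0 {1..m}" by auto
    then have "(\<Sum>j\<le>m. g j * inverse x ^ j) = g 0 + (\<Sum>j=1..m. g j * inverse x ^ j)" by simp
    with g(2) have "a = g 0 + (\<Sum>j=1..m. g j * inverse x ^ j)" by (rule HOL.trans)
    then have "y * a = y * g 0 + y * (\<Sum>j=1..m. g j * inverse x ^ j)" by (simp only: distrib_left)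
    then have "1 - y * g 0 = y * (\<Sum>j=1..m. g j * inverse x ^ j)" unfolding ya(1) by (simp only: diff_eq_eq add.commute)
    then have one: "w * (y * (\<Sum>j=1..m. g j * inverse x ^ j)) = 1" using w(2) by (simp only:)
    have "x ^ n = (w * (y * (\<Sum>j=1..m. g j * inverse x ^ j))) * x ^ n" unfolding one by simp
    also have "\<dots> = (\<Sum>j=1..m. w * y * g j * (inverse x ^ j * x ^ n))"
      by (simp add: sum_distrib_left sum_distrib_right mult_ac)
    also have "\<dots> = (\<Sum>j=1..m. w * y * g j * x ^ (n - j))"
    proof (intro sum.cong HOL.refl)
      fix j assume "j \<in> {1..m}"
      then have "x ^ n = x ^ j * x ^ (n - j)" using mn by (simp add: power_add[symmetric])
      then have "inverse x ^ j * x ^ n = x ^ (n - j)" using x by (simp add: field_simps)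
      then show "w * y * g j * (inverse x ^ j * x ^ n) = w * y * g j * x ^ (n - j)" by simp
    qed
    also have "\<dots> = (\<Sum>i\<in>{n-m..n-1}. w * y * g (n - i) * x ^ i)"
      by (rule sum.reindex_bij_witness[of _ "\<lambda>i. n - i" "\<lambda>j. n - j"]) (use mn n in auto)
    also have "\<dots> = (\<Sum>i\<le>n-1. (if n - m \<le> i then w * y * g (n - i) else 0) * x ^ i)"
      by (rule sum.mono_neutral_cong_left) auto
    finally have xn: "x ^ n = (\<Sum>i\<le>n-1. (if n - m \<le> i then w * y * g (n - i) else 0) * x ^ i)" .
    define h where "h i = f i + f n * (if n - m \<le> i then w * y * g (n - i) else 0)" for i
    have "{..n} = insert n {..n-1}" using n by auto
    then have "(\<Sum>i\<le>n. f i * x ^ i) = f n * x ^ n + (\<Sum>i\<le>n-1. f i * x ^ i)" using n by simp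
    with f(2) have "a = f n * x ^ n + (\<Sum>i\<le>n-1. f i * x ^ i)" by (rule HOL.trans)
    also have "f n * x ^ n = (\<Sum>i\<le>n-1. f n * (if n - m \<le> i then w * y * g (n - i) else 0) * x ^ i)"
      by (simp only: xn sum_distrib_left mult.assoc)
    also have "\<dots> + (\<Sum>i\<le>n-1. f i * x ^ i) = (\<Sum>i\<le>n-1. h i * x ^ i)"
      by (simp only: h_def sum.distrib distrib_right add.commute)
    finally have "a = (\<Sum>i\<le>n-1. h i * x ^ i)" .
    moreover have "\<forall>i\<le>n-1. h i \<in> B"
      using f(1) g(1) w(1) y mn by (auto simp: h_def intro!: B_intros)
    ultimately show False using min[of "n - 1" h] n by simp
  qed
  have "x \<in> B \<or> inverse x \<in> B" if x: "x \<in> E" "x \<noteq> 0" for x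
  proof (rule ccontr)
    assume "\<not> (x \<in> B \<or> inverse x \<in> B)"
    define P where "P z n \<longleftrightarrow> (\<exists>f. (\<forall>i\<le>n. f i \<in> B) \<and> a = (\<Sum>i\<le>n. f i * z ^ i))" for z and n :: nat
    have "\<exists>n. P x n" "\<exists>n. P (inverse x) n"
      using adj[of x] adj[of "inverse x"] x field_closed_inverse[OF E] \<open>\<not> (x \<in> B \<or> inverse x \<in> B)\<close>
      by (auto simp: P_def)
    then have least: "P x (LEAST n. P x n)" "P (inverse x) (LEAST n. P (inverse x) n)"
      by (blast intro: LeastI)+
    define n m where "n = (LEAST n. P x n)" and "m = (LEAST n. P (inverse x) n)"
    have minn: "\<not> P x k" if "k < n" for k using that unfolding n_def by (rule not_less_Least)
    have minm: "\<not> P (inverse x) k" if "k < m" for k using that unfolding m_def by (rule not_less_Least)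
    obtain f where f: "\<forall>i\<le>n. f i \<in> B" "a = (\<Sum>i\<le>n. f i * x ^ i)"
      using least(1) unfolding n_def[symmetric] unfolding P_def by blast
    obtain g where g: "\<forall>i\<le>m. g i \<in> B" "a = (\<Sum>i\<le>m. g i * inverse x ^ i)"
      using least(2) unfolding m_def[symmetric] unfolding P_def by blast
    show False
    proof (cases "m \<le> n")
      case True
      show False
        by (rule key[OF x(2) f _ g True]) (use minn in \<open>unfold P_def, blast\<close>)
    next
      case False
      have f': "a = (\<Sum>i\<le>n. f i * inverse (inverse x) ^ i)" using f(2) by (simp only: inverse_inverse_eq)
      have nz: "inverse x \<noteq> 0" "n \<le> m" using False x(2) by simp_all
      show False
        by (rule key[OF nz(1) g _ f(1) f' nz(2)]) (use minm in \<open>unfold P_def, blast\<close>)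
    qed
  qed
  then have "val_ring E B" using B by (auto simp: val_ring_def)
  then show ?thesis using that B by blast
qed

lemma field_closed_field_adjoin: "field_closed F \<Longrightarrow> field_closed (field_adjoin F x)"
  by (rule field_adjoin(1)[OF field_closed_ring])

definition vunit :: "'a :: field set \<Rightarrow> 'a \<Rightarrow> bool" where
  "vunit B u \<longleftrightarrow> u \<noteq> 0 \<and> u \<in> B \<and> inverse u \<in> B"

lemma vunit_one: "ring_closed B \<Longrightarrow> vunit B 1"
  by (simp add: vunit_def ring_closed_one)

lemma vunit_mult: "ring_closed B \<Longrightarrow> vunit B x \<Longrightarrow> vunit B y \<Longrightarrow> vunit B (x * y)"
  by (simp add: vunit_def ring_closed_mult)

lemma vunit_inverse: "vunit B x \<Longrightarrow> vunit B (inverse x)"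
  by (simp add: vunit_def)

lemma vunit_divide: "ring_closed B \<Longrightarrow> vunit B x \<Longrightarrow> vunit B y \<Longrightarrow> vunit B (x / y)"
  unfolding divide_inverse by (intro vunit_mult vunit_inverse)

lemma vunit_power: "ring_closed B \<Longrightarrow> vunit B x \<Longrightarrow> vunit B (x ^ k)"
  by (induction k) (simp_all add: vunit_one vunit_mult)

lemma vunit_minus_one: "ring_closed B \<Longrightarrow> vunit B (-1)"
  using ring_closed_uminus[of B 1] ring_closed_one[of B] by (simp add: vunit_def)

text \<open>The nonunits form an ideal: one of \<open>x / y\<close> and \<open>y / x\<close> lies in
  \<open>B\<close>, so its denominator divides \<open>x + y\<close> and would be a unit together
  with it.\<close>

lemma nonunit_add:
  assumes E: "field_closed E" and B: "val_ring E B"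
    and x: "x \<in> B" "\<not> vunit B x" and y: "y \<in> B" "\<not> vunit B y"
  shows "\<not> vunit B (x + y)"
proof
  assume u: "vunit B (x + y)"
  have R: "ring_closed B" "B \<subseteq> E" using B by (auto simp: val_ring_def)
  have *: "vunit B y'" if "y' \<in> B" "y' \<noteq> 0" "x' / y' \<in> B" "vunit B (x' + y')" for x' y'
  proof -
    have "inverse y' = (1 + x' / y') * inverse (x' + y')"
      using that by (simp add: vunit_def field_simps)
    moreover have "(1 + x' / y') * inverse (x' + y') \<in> B"
      using that by (intro ring_closed_mult ring_closed_add ring_closed_one R(1)) (simp_all add: vunit_def)
    ultimately show ?thesis using that by (simp add: vunit_def)
  qed
  have nz: "x \<noteq> 0" "y \<noteq> 0" using u x y by auto
  have "x / y \<in> E" using x y R field_closed_divide[OF E] by blast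
  then have "x / y \<in> B \<or> inverse (x / y) \<in> B" using B nz by (auto simp: val_ring_def)
  then show False
  proof
    assume "x / y \<in> B"
    then show False using *[OF y(1) nz(2) _ u] y(2) by blast
  next
    assume "inverse (x / y) \<in> B"
    then show False using *[OF x(1) nz(1), of y] u x(2) by (simp add: add.commute)
  qed
qed

lemma nonunit_sum:
  assumes E: "field_closed E" and B: "val_ring E B"
  shows "(\<And>i. i \<in> A \<Longrightarrow> f i \<in> B \<and> \<not> vunit B (f i)) \<Longrightarrow> sum f A \<in> B \<and> \<not> vunit B (sum f A)"
proof (induction A rule: infinite_finite_induct)
  case (insert x A)
  have R: "ring_closed B" using B by (simp add: val_ring_def)
  have x: "f x \<in> B" "\<not> vunit B (f x)" and A: "sum f A \<in> B" "\<not> vunit B (sum f A)"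
    using insert.prems insert.IH by blast+
  then show ?case
    using insert.hyps nonunit_add[OF E B x A] ring_closed_add[OF R x(1) A(1)] by simp
next
  case (infinite A)
  then show ?case using B by (simp add: vunit_def val_ring_def ring_closed_zero)
next
  case empty
  then show ?case using B by (simp add: vunit_def val_ring_def ring_closed_zero)
qed

text \<open>Divisibility in a valuation ring is total, so among finitely many elements there is one
  of least value.\<close>

lemma val_ring_dominant:
  assumes E: "field_closed E" and B: "val_ring E B"
  shows "finite T \<Longrightarrow> T \<noteq> {} \<Longrightarrow> (\<And>i. i \<in> T \<Longrightarrow> t i \<in> E \<and> t i \<noteq> 0) \<Longrightarrow> \<exists>i\<in>T. \<forall>j\<in>T. t j / t i \<in> B"
proof (induction T rule: finite_ne_induct)
  case (singleton x)
  then show ?case using B by (simp add: val_ring_def ring_closed_one)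
next
  case (insert x T)
  have R: "ring_closed B" using B by (simp add: val_ring_def)
  obtain i where i: "i \<in> T" "\<forall>j\<in>T. t j / t i \<in> B" using insert by auto
  have nz: "t x \<noteq> 0" "t i \<noteq> 0" "t i / t x \<in> E"
    using insert.prems[of x] insert.prems[of i] i field_closed_divide[OF E] by auto
  then consider "t i / t x \<in> B" | "t x / t i \<in> B" using B by (auto simp: val_ring_def)
  then show ?case
  proof cases
    case 1
    have "t j / t x \<in> B" if "j \<in> T" for j
    proof -
      have "t j / t x = t j / t i * (t i / t x)" using nz by simp
      then show ?thesis using ring_closed_mult[OF R] i(2) that 1 by metis
    qed
    moreover have "t x / t x \<in> B" using nz R by (simp add: ring_closed_one)
    ultimately show ?thesis by blast
  next
    case 2
    then show ?thesis using i by auto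
  qed
qed

text \<open>The relation \<open>f\<close> rewrites the power of \<open>b\<close> at its degree in
  lower powers; evaluating by Horner's scheme then never leaves their span.\<close>

lemma ring_adjoin_algebraic_span:
  assumes F: "field_closed F" and f: "poly_over F f" "f \<noteq> 0" "poly f b = 0"
    and z: "z \<in> ring_adjoin F b"
  shows "\<exists>c. (\<forall>i. c i \<in> F) \<and> z = (\<Sum>i<Polynomial.degree f. c i * b ^ i)"
proof -
  let ?d = "Polynomial.degree f"
  have "?d \<noteq> 0"
  proof
    assume "?d = 0"
    then obtain a where "f = [:a:]" by (rule degree_eq_zeroE)
    then show False using f by simp
  qed
  then obtain k where d: "?d = Suc k" by (metis not0_implies_Suc)
  define e where "e i = - (poly.coeff f i / poly.coeff f ?d)" for i
  have eF: "e i \<in> F" for i using f(1) by (auto simp: e_def poly_over_def intro!: field_closed_intros[OF F])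
  have lc: "poly.coeff f ?d \<noteq> 0" using f(2) by simp
  have bd: "b ^ Suc k = (\<Sum>i<Suc k. e i * b ^ i)"
  proof -
    have "0 = (\<Sum>i<Suc k. poly.coeff f i * b ^ i) + poly.coeff f ?d * b ^ Suc k"
      using f(3) by (simp add: poly_altdef d lessThan_Suc_atMost[symmetric])
    then have "poly.coeff f ?d * b ^ Suc k = - (\<Sum>i<Suc k. poly.coeff f i * b ^ i)"
      by (simp only: eq_neg_iff_add_eq_0 add.commute)
    then have "b ^ Suc k = - (\<Sum>i<Suc k. poly.coeff f i * b ^ i) / poly.coeff f ?d"
      using lc by (metis nonzero_mult_div_cancel_left)
    also have "\<dots> = (\<Sum>i<Suc k. e i * b ^ i)"
      by (simp add: e_def sum_divide_distrib sum_negf[symmetric] del: sum.lessThan_Suc)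
    finally show ?thesis .
  qed
  have "\<exists>c. (\<forall>i. c i \<in> F) \<and> poly p b = (\<Sum>i<Suc k. c i * b ^ i)" if "poly_over F p" for p
    using that
  proof (induction p)
    case 0
    then show ?case using field_closed_intros(1)[OF F] by (intro exI[of _ "\<lambda>_. 0"]) auto
  next
    case (pCons a p)
    then have a: "a \<in> F" and "poly_over F p" unfolding poly_over_def
      by (metis coeff_pCons_0, metis coeff_pCons_Suc)
    then obtain c where c: "\<And>i. c i \<in> F" "poly p b = (\<Sum>i<Suc k. c i * b ^ i)" using pCons.IH by blast
    define c' where "c' i = (if i = 0 then a else c (i - 1)) + c k * e i" for i
    have "poly (pCons a p) b = a + (\<Sum>i<k. c i * b ^ Suc i) + c k * b ^ Suc k"
      by (simp add: c(2) algebra_simps sum_distrib_left)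
    also have "a + (\<Sum>i<k. c i * b ^ Suc i) = (\<Sum>i<Suc k. (if i = 0 then a else c (i - 1)) * b ^ i)"
      by (subst sum.lessThan_Suc_shift) simp
    also have "c k * b ^ Suc k = (\<Sum>i<Suc k. c k * e i * b ^ i)"
      by (simp only: bd sum_distrib_left mult.assoc)
    also have "(\<Sum>i<Suc k. (if i = 0 then a else c (i - 1)) * b ^ i) + (\<Sum>i<Suc k. c k * e i * b ^ i) =
        (\<Sum>i<Suc k. c' i * b ^ i)"
      by (simp only: c'_def sum.distrib distrib_right)
    finally have "poly (pCons a p) b = (\<Sum>i<Suc k. c' i * b ^ i)" .
    moreover have "c' i \<in> F" for i using a c(1) eF by (auto simp: c'_def intro!: field_closed_intros[OF F])
    ultimately show ?case by blast
  qed
  then show ?thesis using z by (auto simp: ring_adjoin_def d)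
qed

text \<open>The value group of an algebraic extension is torsion over that of the base, with
  exponents bounded by the degree. In an algebraic relation for \<open>x\<close> the dominant term
  cannot be alone, so two terms \<open>\<alpha> i * x ^ i\<close> and
  \<open>\<alpha> j * x ^ j\<close> differ by a unit.\<close>

lemma val_ring_power_unit:
  assumes F: "field_closed F" and f: "poly_over F f" "f \<noteq> 0" "poly f b = 0"
    and B: "val_ring (field_adjoin F b) B" and x: "x \<in> field_adjoin F b" "x \<noteq> 0"
  shows "\<exists>k c. 1 \<le> k \<and> k \<le> Polynomial.degree f \<and> c \<in> F \<and> c \<noteq> 0 \<and> vunit B (x ^ k / c)"
proof -
  let ?d = "Polynomial.degree f" and ?E = "field_adjoin F b"
  note E = field_closed_field_adjoin[OF F, of b]
  have R: "ring_closed B" using B by (simp add: val_ring_def)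
  note RF = field_closed_ring[OF F]
  have FE: "F \<subseteq> ?E" by (rule field_adjoin(2)[OF RF])
  obtain p q where pq: "p \<in> ring_adjoin F b" "q \<in> ring_adjoin F b" "x = p / q"
    using x(1) by (auto simp: field_adjoin_def)
  have nz: "p \<noteq> 0" "q \<noteq> 0" using pq x(2) by auto
  \<comment> \<open>Since \<open>x = p / q\<close> is only a quotient, the \<open>?d + 1\<close>
    products \<open>p ^ j * q ^ (?d - j)\<close> take the place of its powers; they lie in the span
    of \<open>?d\<close> elements.\<close>
  have "\<forall>j. \<exists>c. (\<forall>i. c i \<in> F) \<and> p ^ j * q ^ (?d - j) = (\<Sum>i<?d. c i * b ^ i)"
    using pq by (intro allI ring_adjoin_algebraic_span[OF F f] ring_closed_intros[OF ring_adjoin(1)[OF RF]])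
  then obtain c where c: "\<And>j i. c j i \<in> F" "\<And>j. p ^ j * q ^ (?d - j) = (\<Sum>i<?d. c j i * b ^ i)"
    by metis
  obtain \<alpha> where \<alpha>: "\<forall>j\<in>{..?d}. \<alpha> j \<in> F" "\<exists>j\<in>{..?d}. \<alpha> j \<noteq> 0"
    "\<forall>i\<in>{..<?d}. (\<Sum>j\<in>{..?d}. \<alpha> j * c j i) = 0"
    using dependent_family[OF F, of "{..<?d}" "{..?d}" c] c(1) by auto
  have "(\<Sum>j\<le>?d. \<alpha> j * (p ^ j * q ^ (?d - j))) = (\<Sum>j\<le>?d. \<Sum>i<?d. \<alpha> j * c j i * b ^ i)"
    by (simp add: c(2) sum_distrib_left mult.assoc)
  also have "\<dots> = (\<Sum>i<?d. (\<Sum>j\<le>?d. \<alpha> j * c j i) * b ^ i)"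
    by (subst sum.swap) (simp add: sum_distrib_right)
  also have "\<dots> = 0" using \<alpha>(3) by (intro sum.neutral) auto
  finally have 0: "(\<Sum>j\<le>?d. \<alpha> j * (p ^ j * q ^ (?d - j))) = 0" .
  have "p ^ j * q ^ (?d - j) = q ^ ?d * x ^ j" if "j \<le> ?d" for j
  proof -
    have "q ^ ?d = q ^ j * q ^ (?d - j)" using that by (simp add: power_add[symmetric])
    then show ?thesis using nz by (simp add: pq(3) power_divide)
  qed
  then have "(\<Sum>j\<le>?d. \<alpha> j * (p ^ j * q ^ (?d - j))) = q ^ ?d * (\<Sum>j\<le>?d. \<alpha> j * x ^ j)"
    by (simp add: sum_distrib_left mult_ac)
  then have rel: "(\<Sum>j\<le>?d. \<alpha> j * x ^ j) = 0" using 0 nz by simp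
  define T where "T = {j. j \<le> ?d \<and> \<alpha> j \<noteq> 0}"
  define t where "t j = \<alpha> j * x ^ j" for j
  have T: "finite T" "T \<noteq> {}" using \<alpha>(2) by (auto simp: T_def)
  have \<alpha>E: "\<alpha> j \<in> ?E" if "j \<le> ?d" for j using \<alpha>(1) FE that by auto
  have t: "t i \<in> ?E \<and> t i \<noteq> 0" if "i \<in> T" for i
    using that x \<alpha>E by (simp add: T_def t_def ring_closed_mult ring_closed_power field_closed_ring[OF E])
  have sumT: "(\<Sum>j\<in>T. t j) = 0"
  proof -
    have "(\<Sum>j\<in>T. t j) = (\<Sum>j\<le>?d. \<alpha> j * x ^ j)"
      by (intro sum.mono_neutral_cong_left) (auto simp: T_def t_def)
    then show ?thesis using rel by simp
  qed
  obtain i where i: "i \<in> T" "\<forall>j\<in>T. t j / t i \<in> B" using val_ring_dominant[OF E B T, of t] t by blast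
  \<comment> \<open>Otherwise the remaining quotients would be nonunits whose sum is the unit
    \<open>-1\<close>.\<close>
  have "\<exists>j\<in>T - {i}. vunit B (t j / t i)"
  proof (rule ccontr)
    assume "\<not> ?thesis"
    then have "\<not> vunit B (\<Sum>j\<in>T - {i}. t j / t i)"
      using nonunit_sum[OF E B, of "T - {i}" "\<lambda>j. t j / t i"] i by auto
    moreover have "(\<Sum>j\<in>T - {i}. t j / t i) = -1"
    proof -
      have "(\<Sum>j\<in>T - {i}. t j) = - t i" using sumT T i by (simp add: sum_diff1)
      then show ?thesis using t[OF i(1)] by (simp add: sum_divide_distrib[symmetric])
    qed
    ultimately show False using vunit_minus_one[OF R] by simp
  qed
  then obtain j where j: "j \<in> T" "j \<noteq> i" "vunit B (t j / t i)" by blast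
  have main: "\<exists>k c. 1 \<le> k \<and> k \<le> ?d \<and> c \<in> F \<and> c \<noteq> 0 \<and> vunit B (x ^ k / c)"
    if "i' \<in> T" "j' \<in> T" "i' < j'" "vunit B (t j' / t i')" for i' j'
  proof -
    have "x ^ j' = x ^ i' * x ^ (j' - i')" using that(3) by (simp add: power_add[symmetric])
    then have "t j' / t i' = x ^ (j' - i') / (\<alpha> i' / \<alpha> j')" using x(2) by (simp add: t_def)
    moreover have "\<alpha> i' / \<alpha> j' \<in> F" "\<alpha> i' / \<alpha> j' \<noteq> 0"
      using that \<alpha>(1) field_closed_divide[OF F] by (auto simp: T_def)
    moreover have "1 \<le> j' - i'" "j' - i' \<le> ?d" using that by (auto simp: T_def)
    ultimately show ?thesis using that(4) by metis
  qed
  show ?thesis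
  proof (cases "i < j")
    case True
    then show ?thesis using main i j by blast
  next
    case False
    have "vunit B (t i / t j)" using vunit_inverse[OF j(3)] by simp
    moreover have "j < i" using j(2) False by simp
    ultimately show ?thesis using main[OF j(1) i(1)] by blast
  qed
qed

text \<open>\<open>disc\<close> says that \<open>B\<close> induces on \<open>F\<close> a discrete
  valuation with uniformiser \<open>\<pi>\<close>. The factorial \<open>D\<close> of the degree is a
  multiple of every exponent from the preceding lemma, so \<open>x ^ D\<close> is always a unit
  times a power of \<open>\<pi>\<close>; the exponent of that power is taken as the value of
  \<open>x\<close>, which is \<open>D\<close> times the rational one.\<close>

lemma val_ring_algebraic_valuation:
  assumes F: "field_closed F" and f: "poly_over F f" "f \<noteq> 0" "poly f b = 0"
    and B: "val_ring (field_adjoin F b) B" and \<pi>: "\<pi> \<noteq> 0" "\<pi> \<in> B" "inverse \<pi> \<notin> B"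
    and disc: "\<And>c. c \<in> F \<Longrightarrow> c \<noteq> 0 \<Longrightarrow> \<exists>m. vunit B (c / \<pi> powi m)"
  shows "\<exists>v. valuation (field_adjoin F b) v \<and>
    (\<forall>x\<in>field_adjoin F b. x \<noteq> 0 \<longrightarrow> (x \<in> B \<longleftrightarrow> 0 \<le> v x))"
proof -
  let ?E = "field_adjoin F b"
  note E = field_closed_field_adjoin[OF F, of b]
  have R: "ring_closed B" "B \<subseteq> ?E" using B by (auto simp: val_ring_def)
  define D :: nat where "D = fact (Polynomial.degree f)"
  have "D > 0" by (simp add: D_def)
  have \<pi>unit: "j = 0" if "vunit B (\<pi> powi j)" for j
  proof -
    have pos: False if "vunit B (\<pi> ^ Suc k)" for k
    proof -
      have "inverse \<pi> = \<pi> ^ k * inverse (\<pi> ^ Suc k)" using \<pi>(1) by simp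
      moreover have "\<pi> ^ k * inverse (\<pi> ^ Suc k) \<in> B"
        using that \<pi>(2) by (intro ring_closed_mult ring_closed_power R(1)) (simp_all only: vunit_def)
      ultimately show False using \<pi>(3) by metis
    qed
    show ?thesis
    proof (rule ccontr)
      assume "j \<noteq> 0"
      then obtain k where k: "nat \<bar>j\<bar> = Suc k" by (cases "nat \<bar>j\<bar>") auto
      have "vunit B (\<pi> ^ nat \<bar>j\<bar>)"
      proof (cases "j \<ge> 0")
        case True
        then show ?thesis using that by (simp add: power_int_def)
      next
        case False
        then show ?thesis using vunit_inverse[OF that] by (simp add: power_int_def power_inverse)
      qed
      then show False unfolding k by (rule pos)
    qed
  qed
  have \<pi>B: "j \<ge> 0" if "\<pi> powi j \<in> B" for j
  proof (rule ccontr)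
    assume "\<not> j \<ge> 0"
    then have k: "j = - int (nat (- j))" by simp
    obtain k where k: "j = - int k" using k by blast
    have "\<pi> ^ k \<in> B" using \<pi> ring_closed_power[OF R(1)] by blast
    then have "vunit B (\<pi> powi j)" using that \<pi>(1) k(1) by (simp add: vunit_def power_int_minus)
    then show False using \<pi>unit[of j] \<open>\<not> j \<ge> 0\<close> by simp
  qed
  have ex: "\<exists>m. vunit B (x ^ D / \<pi> powi m)" if x: "x \<in> ?E" "x \<noteq> 0" for x
  proof -
    obtain k c where k: "1 \<le> k" "k \<le> Polynomial.degree f" "c \<in> F" "c \<noteq> 0" "vunit B (x ^ k / c)"
      using val_ring_power_unit[OF F f B x] by blast
    then have "k dvd D" unfolding D_def by (intro dvd_fact)
    then obtain l where l: "D = k * l" by blast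
    obtain m where m: "vunit B (c / \<pi> powi m)" using disc k by blast
    have "vunit B ((x ^ k / c) ^ l * (c / \<pi> powi m) ^ l)"
      by (intro vunit_mult vunit_power R(1) k m)
    moreover have "(x ^ k / c) ^ l * (c / \<pi> powi m) ^ l = x ^ D / \<pi> powi (m * int l)"
      using k(4) by (simp add: l power_divide power_mult power_int_mult)
    ultimately show ?thesis by metis
  qed
  have uniq: "m = m'" if "vunit B (y / \<pi> powi m)" "vunit B (y / \<pi> powi m')" for y m m'
  proof -
    have "y \<noteq> 0" using that by (auto simp: vunit_def)
    then have "y / \<pi> powi m' / (y / \<pi> powi m) = \<pi> powi (m - m')"
      using \<pi>(1) by (simp add: power_int_diff)
    then have "vunit B (\<pi> powi (m - m'))" using vunit_divide[OF R(1) that(2,1)] by simp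
    then show ?thesis using \<pi>unit by fastforce
  qed
  define v where "v x = (THE m. vunit B (x ^ D / \<pi> powi m))" for x
  have v_eq: "v x = m" if "vunit B (x ^ D / \<pi> powi m)" for x m
    unfolding v_def using that uniq[OF _ that] by (rule the_equality)
  have v: "vunit B (x ^ D / \<pi> powi v x)" if "x \<in> ?E" "x \<noteq> 0" for x
    using ex[OF that] v_eq by metis
  have mult: "v (x * y) = v x + v y" if "x \<in> ?E" "x \<noteq> 0" "y \<in> ?E" "y \<noteq> 0" for x y
  proof (rule v_eq)
    have "vunit B ((x ^ D / \<pi> powi v x) * (y ^ D / \<pi> powi v y))"
      using that by (intro vunit_mult R(1) v)
    then show "vunit B ((x * y) ^ D / \<pi> powi (v x + v y))"
      using \<pi>(1) by (simp add: power_mult_distrib power_int_add)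
  qed
  have mem: "x \<in> B \<longleftrightarrow> 0 \<le> v x" if x: "x \<in> ?E" "x \<noteq> 0" for x
  proof
    let ?u = "x ^ D / \<pi> powi v x"
    have u: "vunit B ?u" using v x by blast
    have eq: "x ^ D = \<pi> powi v x * ?u" "\<pi> powi v x = x ^ D * inverse ?u" using \<pi>(1) x(2) by auto
    {
      assume "x \<in> B"
      then have "x ^ D * inverse ?u \<in> B"
        using u by (intro ring_closed_mult ring_closed_power R(1)) (simp_all only: vunit_def)
      then show "0 \<le> v x" using \<pi>B unfolding eq(2)[symmetric] by blast
    }
    assume "0 \<le> v x"
    then have "\<pi> powi v x \<in> B" using \<pi> ring_closed_power[OF R(1)] by (simp add: power_int_def)
    then have "\<pi> powi v x * ?u \<in> B"
      using u by (intro ring_closed_mult R(1)) (simp_all only: vunit_def)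
    then have xD: "x ^ D \<in> B" using eq(1) by simp
    \<comment> \<open>\<open>B\<close> contains the roots of its elements: otherwise
      \<open>inverse x \<in> B\<close>, and \<open>x = x ^ D * inverse x ^ (D - 1)\<close> would lie
      in \<open>B\<close> after all.\<close>
    show "x \<in> B"
    proof (rule ccontr)
      assume "x \<notin> B"
      then have "inverse x \<in> B" using B x by (auto simp: val_ring_def)
      then have "x ^ D * inverse x ^ (D - 1) \<in> B" 
        by (intro ring_closed_mult[OF R(1) xD] ring_closed_power R(1))
      moreover have "x ^ D = x * x ^ (D - 1)" using \<open>D > 0\<close> by (simp add: power_eq_if)
      ultimately have "x ^ D * inverse x ^ (D - 1) = x" using x(2) by (simp add: power_inverse)
      then show False using \<open>x ^ D * inverse x ^ (D - 1) \<in> B\<close> \<open>x \<notin> B\<close> by metis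
    qed
  qed
  \<comment> \<open>After division by the element of smaller value, the ultrametric inequality says
    that \<open>B\<close> contains \<open>1 + y / x\<close>.\<close>
  have add: "v x \<le> v (x + y)" 
    if "x \<in> ?E" "x \<noteq> 0" "y \<in> ?E" "y \<noteq> 0" "x + y \<noteq> 0" "v x \<le> v y" for x y
  proof -
    have q: "v (z / x) = v z - v x" "z / x \<in> ?E" if "z \<in> ?E" "z \<noteq> 0" for z
    proof -
      show zx: "z / x \<in> ?E" using field_closed_divide[OF E that(1) \<open>x \<in> ?E\<close>] .
      have "v (z / x * x) = v (z / x) + v x"
        using zx that \<open>x \<in> ?E\<close> \<open>x \<noteq> 0\<close> by (intro mult) simp_all
      then show "v (z / x) = v z - v x" using \<open>x \<noteq> 0\<close> by simp
    qed
    have "y / x \<noteq> 0" "0 \<le> v (y / x)" using q(1)[OF \<open>y \<in> ?E\<close> \<open>y \<noteq> 0\<close>] that by simp_all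
    then have "y / x \<in> B" using iffD2[OF mem[OF q(2)[OF \<open>y \<in> ?E\<close> \<open>y \<noteq> 0\<close>]]] by blast
    then have "1 + y / x \<in> B" by (rule ring_closed_add[OF R(1) ring_closed_one[OF R(1)]])
    moreover have "1 + y / x = (x + y) / x" using \<open>x \<noteq> 0\<close> by (simp add: add_divide_distrib)
    ultimately have B': "(x + y) / x \<in> B" by metis
    have xy: "x + y \<in> ?E" by (rule field_closed_intros(3)[OF E \<open>x \<in> ?E\<close> \<open>y \<in> ?E\<close>])
    have "(x + y) / x \<noteq> 0" using \<open>x \<noteq> 0\<close> \<open>x + y \<noteq> 0\<close> by simp
    then have "0 \<le> v ((x + y) / x)"
      using iffD1[OF mem[OF q(2)[OF xy \<open>x + y \<noteq> 0\<close>]]] B' by blast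
    then show ?thesis using q(1)[OF xy \<open>x + y \<noteq> 0\<close>] by simp
  qed
  have "valuation ?E v"
    unfolding valuation_def
  proof (intro ballI conjI impI)
    fix x y assume xy: "x \<in> ?E - {0}" "y \<in> ?E - {0}"
    then show "v (x * y) = v x + v y" using mult by simp
    assume *: "x + y \<noteq> 0"
    show "min (v x) (v y) \<le> v (x + y)"
    proof (cases "v x \<le> v y")
      case True
      then show ?thesis using add[of x y] xy * by simp
    next
      case False
      then show ?thesis using add[of y x] xy * by (simp add: add.commute)
    qed
  qed
  then show ?thesis by (intro exI[of _ v] conjI ballI impI mem)
qed

section \<open>Calculus with valuations and Gauss's lemma\<close>

lemma valuation_mult: "valuation F v \<Longrightarrow> x \<in> F \<Longrightarrow> y \<in> F \<Longrightarrow> x \<noteq> 0 \<Longrightarrow> y \<noteq> 0 \<Longrightarrow> v (x * y) = v x + v y"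
  by (simp add: valuation_def)

lemma valuation_add:
  "valuation F v \<Longrightarrow> x \<in> F \<Longrightarrow> y \<in> F \<Longrightarrow> x \<noteq> 0 \<Longrightarrow> y \<noteq> 0 \<Longrightarrow> x + y \<noteq> 0 \<Longrightarrow> min (v x) (v y) \<le> v (x + y)"
  by (simp add: valuation_def)

lemma valuation_one: "field_closed F \<Longrightarrow> valuation F v \<Longrightarrow> v 1 = 0"
  using valuation_mult[of F v 1 1] ring_closed_one[OF field_closed_ring, of F] by simp

lemma valuation_inverse:
  assumes "field_closed F" "valuation F v" "x \<in> F" "x \<noteq> 0"
  shows "v (inverse x) = - v x"
  using valuation_mult[OF assms(2,3) field_closed_inverse[OF assms(1,3)]] valuation_one[OF assms(1,2)] assms(4)
  by simp

lemma valuation_divide: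
  assumes "field_closed F" "valuation F v" "x \<in> F" "x \<noteq> 0" "y \<in> F" "y \<noteq> 0"
  shows "v (x / y) = v x - v y"
  using valuation_mult[OF assms(2,3) field_closed_inverse[OF assms(1,5)]] valuation_inverse[OF assms(1,2,5,6)] assms(4,6)
  by (simp add: divide_inverse)

lemma valuation_power:
  assumes "field_closed F" "valuation F v" "x \<in> F" "x \<noteq> 0"
  shows "v (x ^ k) = int k * v x"
proof (induction k)
  case (Suc k)
  have "v (x * x ^ k) = v x + v (x ^ k)"
    using valuation_mult[OF assms(2,3) ring_closed_power[OF field_closed_ring[OF assms(1)] assms(3)] assms(4)] assms(4)
    by simp
  then show ?case using Suc by (simp add: algebra_simps)
qed (simp add: valuation_one[OF assms(1,2)])

lemma valuation_powi:
  assumes "field_closed F" "valuation F v" "x \<in> F" "x \<noteq> 0"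
  shows "v (x powi k) = k * v x"
proof (cases "k \<ge> 0")
  case True
  then show ?thesis using valuation_power[OF assms, of "nat k"] by (simp add: power_int_def)
next
  case False
  have "v (inverse x ^ nat (- k)) = int (nat (- k)) * v (inverse x)"
    using assms by (intro valuation_power field_closed_inverse) simp_all
  then show ?thesis using False valuation_inverse[OF assms] by (simp add: power_int_def)
qed

lemma valuation_minus:
  assumes "field_closed F" "valuation F v" "x \<in> F"
  shows "v (- x) = v x"
proof (cases "x = 0")
  case False
  have m1: "-1 \<in> F" using ring_closed_uminus[of F 1] ring_closed_one[of F] field_closed_ring[OF assms(1)] by simp
  have "v (-1 * -1) = v (-1) + v (-1)" by (rule valuation_mult[OF assms(2) m1 m1]) simp_all
  then have "v (-1) = 0" using valuation_one[OF assms(1,2)] by simp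
  moreover have "v (-1 * x) = v (-1) + v x"
    using False by (intro valuation_mult[OF assms(2) m1 assms(3)]) simp_all
  ultimately show ?thesis by simp
qed simp

text \<open>Stating estimates as membership in these fractional ideals avoids a separate treatment
  of the junk value at zero in every sum.\<close>

definition val_level :: "'a :: field set \<Rightarrow> ('a \<Rightarrow> int) \<Rightarrow> int \<Rightarrow> 'a set" where
  "val_level F v m = {x \<in> F. x \<noteq> 0 \<longrightarrow> m \<le> v x}"

lemma val_level_zero: "field_closed F \<Longrightarrow> 0 \<in> val_level F v m"
  by (simp add: val_level_def ring_closed_zero field_closed_ring)

lemma val_level_add:
  assumes "field_closed F" "valuation F v" "x \<in> val_level F v m" "y \<in> val_level F v m"
  shows "x + y \<in> val_level F v m"
proof -
  have "x + y \<in> F" using assms by (intro field_closed_intros(3)) (simp_all add: val_level_def)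
  moreover have "m \<le> v (x + y)" if "x + y \<noteq> 0"
    using assms(3,4) that valuation_add[OF assms(2), of x y] by (cases "x = 0"; cases "y = 0") (auto simp: val_level_def)
  ultimately show ?thesis by (simp add: val_level_def)
qed

lemma val_level_uminus:
  assumes "field_closed F" "valuation F v" "x \<in> val_level F v m"
  shows "- x \<in> val_level F v m"
  using assms valuation_minus[OF assms(1,2)] field_closed_intros(5)[OF assms(1)] by (simp add: val_level_def)

lemma val_level_sum:
  assumes "field_closed F" "valuation F v" "\<And>i. i \<in> A \<Longrightarrow> f i \<in> val_level F v m"
  shows "sum f A \<in> val_level F v m"
  using assms(3)
proof (induction A rule: infinite_finite_induct)
  case (insert x A)
  then have "f x \<in> val_level F v m" "sum f A \<in> val_level F v m" by simp_all
  then show ?case using insert.hyps val_level_add[OF assms(1,2)] by simp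
qed (simp_all add: val_level_zero assms(1))

lemma val_level_mult:
  assumes "field_closed F" "valuation F v" "x \<in> val_level F v m" "y \<in> val_level F v k"
  shows "x * y \<in> val_level F v (m + k)"
proof -
  have xy: "x \<in> F" "y \<in> F" using assms by (simp_all add: val_level_def)
  have "m + k \<le> v (x * y)" if "x * y \<noteq> 0"
    using that assms(3,4) valuation_mult[OF assms(2) xy] by (simp add: val_level_def)
  then show ?thesis using field_closed_intros(6)[OF assms(1) xy] by (simp add: val_level_def)
qed

lemma val_level_mono: "x \<in> val_level F v m \<Longrightarrow> k \<le> m \<Longrightarrow> x \<in> val_level F v k"
  by (auto simp: val_level_def)

text \<open>The monomial (Gauss) valuation of a polynomial in which the variable has value \<open>r\<close>.\<close>

definition gauss_val :: "('a :: field \<Rightarrow> int) \<Rightarrow> int \<Rightarrow> 'a poly \<Rightarrow> int" where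
  "gauss_val v r p = Min ((\<lambda>i. v (poly.coeff p i) + r * int i) ` {i. poly.coeff p i \<noteq> 0})"

lemma finite_coeff_support: "finite {i. poly.coeff p i \<noteq> 0}"
  by (rule finite_subset[of _ "{..Polynomial.degree p}"]) (auto intro: le_degree)

lemma gauss_val_le: "poly.coeff p i \<noteq> 0 \<Longrightarrow> gauss_val v r p \<le> v (poly.coeff p i) + r * int i"
  unfolding gauss_val_def by (intro Min_le finite_imageI finite_coeff_support imageI) simp

lemma gauss_val_attained:
  assumes "p \<noteq> 0"
  shows "\<exists>i. poly.coeff p i \<noteq> 0 \<and> gauss_val v r p = v (poly.coeff p i) + r * int i"
proof -
  have "poly.coeff p (Polynomial.degree p) \<noteq> 0" using assms by simp
  then have "(\<lambda>i. v (poly.coeff p i) + r * int i) ` {i. poly.coeff p i \<noteq> 0} \<noteq> {}" by blast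
  then have "gauss_val v r p \<in> (\<lambda>i. v (poly.coeff p i) + r * int i) ` {i. poly.coeff p i \<noteq> 0}"
    unfolding gauss_val_def by (intro Min_in finite_imageI finite_coeff_support)
  then show ?thesis by blast
qed

lemma gauss_val_coeff_level:
  assumes "poly_over F p"
  shows "poly.coeff p i \<in> val_level F v (gauss_val v r p - r * int i)"
  using assms gauss_val_le[of p i v r] by (auto simp: poly_over_def val_level_def)

lemma gauss_val_ge:
  assumes "p \<noteq> 0" "\<And>i. poly.coeff p i \<in> val_level F v (m - r * int i)"
  shows "m \<le> gauss_val v r p"
proof -
  obtain i where i: "poly.coeff p i \<noteq> 0" "gauss_val v r p = v (poly.coeff p i) + r * int i"
    using gauss_val_attained[OF assms(1)] by blast
  then show ?thesis using assms(2)[of i] by (simp add: val_level_def)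
qed

text \<open>Below the least index that attains the minimum the inequality is strict; as values are
  integers, this is the \<open>+ 1\<close> in the level.\<close>

lemma gauss_val_first:
  assumes p: "poly_over F p" "p \<noteq> 0"
  obtains i where "poly.coeff p i \<noteq> 0" "gauss_val v r p = v (poly.coeff p i) + r * int i"
    "\<And>j. j < i \<Longrightarrow> poly.coeff p j \<in> val_level F v (gauss_val v r p - r * int j + 1)"
proof -
  define P where "P i \<longleftrightarrow> poly.coeff p i \<noteq> 0 \<and> gauss_val v r p = v (poly.coeff p i) + r * int i" for i
  define i where "i = (LEAST i. P i)"
  have "\<exists>i. P i" using gauss_val_attained[OF p(2)] by (simp add: P_def)
  then have "P i" unfolding i_def by (rule LeastI_ex)
  moreover have "poly.coeff p j \<in> val_level F v (gauss_val v r p - r * int j + 1)" if "j < i" for j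
  proof -
    have "\<not> P j" using that unfolding i_def by (rule not_less_Least)
    then have "gauss_val v r p - r * int j + 1 \<le> v (poly.coeff p j)" if "poly.coeff p j \<noteq> 0"
      using gauss_val_le[OF that, of v r] that by (simp add: P_def)
    then show ?thesis using p(1) by (simp add: val_level_def poly_over_def)
  qed
  ultimately show ?thesis using that[of i] by (simp add: P_def)
qed

text \<open>Gauss's lemma. At \<open>i + j\<close>, the sum of the first minimal indices of the
  factors, every product other than that of the two minimal coefficients has strictly larger value,
  so the coefficient there cannot cancel.\<close>

lemma gauss_val_mult:
  assumes F: "field_closed F" and v: "valuation F v"
    and p: "poly_over F p" "p \<noteq> 0" and q: "poly_over F q" "q \<noteq> 0"
  shows "gauss_val v r (p * q) = gauss_val v r p + gauss_val v r q"
proof (rule antisym)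
  let ?P = "gauss_val v r p" and ?Q = "gauss_val v r q"
  note mult = val_level_mult[OF F v] and sum = val_level_sum[OF F v]
  show "?P + ?Q \<le> gauss_val v r (p * q)"
  proof (rule gauss_val_ge)
    fix k
    show "poly.coeff (p * q) k \<in> val_level F v (?P + ?Q - r * int k)"
      unfolding coeff_mult
    proof (rule sum)
      fix i assume "i \<in> {..k}"
      then have e: "?P - r * int i + (?Q - r * int (k - i)) = ?P + ?Q - r * int k"
        by (simp add: of_nat_diff algebra_simps)
      show "poly.coeff p i * poly.coeff q (k - i) \<in> val_level F v (?P + ?Q - r * int k)"
        using mult[OF gauss_val_coeff_level[OF p(1), of i v r] gauss_val_coeff_level[OF q(1), of "k - i" v r]]
        unfolding e .
    qed
  qed (use p q in simp)
  obtain i where i: "poly.coeff p i \<noteq> 0" "?P = v (poly.coeff p i) + r * int i"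
    "\<And>j. j < i \<Longrightarrow> poly.coeff p j \<in> val_level F v (?P - r * int j + 1)"
    using gauss_val_first[OF p] by blast
  obtain j where j: "poly.coeff q j \<noteq> 0" "?Q = v (poly.coeff q j) + r * int j"
    "\<And>i. i < j \<Longrightarrow> poly.coeff q i \<in> val_level F v (?Q - r * int i + 1)"
    using gauss_val_first[OF q] by blast
  define M where "M = ?P + ?Q - r * int (i + j)"
  define t where "t = poly.coeff p i * poly.coeff q j"
  define s where "s = (\<Sum>l\<in>{..i + j} - {i}. poly.coeff p l * poly.coeff q (i + j - l))"
  have c: "poly.coeff (p * q) (i + j) = t + s"
    unfolding coeff_mult t_def s_def by (subst sum.remove[of _ i]) simp_all
  have s: "s \<in> val_level F v (M + 1)"
    unfolding s_def
  proof (rule sum)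
    fix l assume l: "l \<in> {..i + j} - {i}"
    then have e: "int (i + j - l) = int i + int j - int l" by (simp add: of_nat_diff)
    show "poly.coeff p l * poly.coeff q (i + j - l) \<in> val_level F v (M + 1)"
    proof (cases "l < i")
      case True
      have e': "?P - r * int l + 1 + (?Q - r * int (i + j - l)) = M + 1"
        by (simp add: M_def e algebra_simps)
      show ?thesis
        using mult[OF i(3)[OF True] gauss_val_coeff_level[OF q(1), of "i + j - l" v r]] unfolding e' .
    next
      case False
      then have lt: "i + j - l < j" using l by auto
      have e': "?P - r * int l + (?Q - r * int (i + j - l) + 1) = M + 1"
        by (simp add: M_def e algebra_simps)
      show ?thesis
        using mult[OF gauss_val_coeff_level[OF p(1), of l v r] j(3)[OF lt]] unfolding e' .
    qed
  qed
  have pF: "poly.coeff p i \<in> F" "poly.coeff q j \<in> F" using p q by (simp_all add: poly_over_def)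
  have vt: "v t = M" unfolding t_def M_def using valuation_mult[OF v pF i(1) j(1)] i(2) j(2) by (simp add: algebra_simps)
  have t: "t \<noteq> 0" "t \<in> F" using i(1) j(1) field_closed_intros(6)[OF F pF] by (simp_all add: t_def)
  have "t + s \<notin> val_level F v (M + 1)"
  proof
    assume "t + s \<in> val_level F v (M + 1)"
    then have "(t + s) + - s \<in> val_level F v (M + 1)"
      by (rule val_level_add[OF F v _ val_level_uminus[OF F v s]])
    then show False using t vt by (simp add: val_level_def)
  qed
  moreover have "t + s \<in> F" using t(2) s field_closed_intros(3)[OF F] by (simp add: val_level_def)
  ultimately have "t + s \<noteq> 0" "v (t + s) \<le> M" by (simp_all add: val_level_def)
  then show "gauss_val v r (p * q) \<le> ?P + ?Q"
    using gauss_val_le[of "p * q" "i + j" v r] c by (simp add: M_def)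
qed

lemma gauss_val_add:
  assumes F: "field_closed F" and v: "valuation F v"
    and p: "poly_over F p" and q: "poly_over F q" and "p + q \<noteq> 0"
  shows "min (gauss_val v r p) (gauss_val v r q) \<le> gauss_val v r (p + q)"
proof (rule gauss_val_ge[OF assms(5)])
  fix i
  show "poly.coeff (p + q) i \<in> val_level F v (min (gauss_val v r p) (gauss_val v r q) - r * int i)"
    unfolding coeff_add
    by (intro val_level_add[OF F v] val_level_mono[OF gauss_val_coeff_level[OF p, of i v r]]
        val_level_mono[OF gauss_val_coeff_level[OF q, of i v r]]) simp_all
qed

text \<open>Quotients of polynomials in \<open>b\<close> have a well-defined Gauss value because
  \<open>b\<close> satisfies no relation. The value \<open>r\<close> of \<open>b\<close> is free:
  \<open>0\<close> is used to extend a given valuation, \<open>-1\<close> over the trivial one to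
  make \<open>b\<close> a pole.\<close>

lemma transcendental_extension:
  assumes F: "field_closed F" and v: "valuation F v"
    and tr: "\<And>p. poly_over F p \<Longrightarrow> p \<noteq> 0 \<Longrightarrow> poly p b \<noteq> 0"
  shows "\<exists>v'. valuation (field_adjoin F b) v' \<and> (\<forall>c\<in>F - {0}. v' c = v c) \<and> v' b = r"
proof -
  note RF = field_closed_ring[OF F]
  note arith = poly_over_arith[OF RF]
  let ?w = "gauss_val v r"
  define v' where "v' x = (THE m. \<exists>p q. poly_over F p \<and> poly_over F q \<and> p \<noteq> 0 \<and> q \<noteq> 0 \<and>
     x = poly p b / poly q b \<and> m = ?w p - ?w q)" for x
  have v'_eq: "v' (poly p b / poly q b) = ?w p - ?w q"
    if pq: "poly_over F p" "poly_over F q" "p \<noteq> 0" "q \<noteq> 0" for p q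
    unfolding v'_def
  proof (rule the_equality)
    show "\<exists>p' q'. poly_over F p' \<and> poly_over F q' \<and> p' \<noteq> 0 \<and> q' \<noteq> 0 \<and>
        poly p b / poly q b = poly p' b / poly q' b \<and> ?w p - ?w q = ?w p' - ?w q'"
      using pq by blast
  next
    fix m assume "\<exists>p' q'. poly_over F p' \<and> poly_over F q' \<and> p' \<noteq> 0 \<and> q' \<noteq> 0 \<and>
        poly p b / poly q b = poly p' b / poly q' b \<and> m = ?w p' - ?w q'"
    then obtain p' q' where p': "poly_over F p'" "poly_over F q'" "p' \<noteq> 0" "q' \<noteq> 0"
      "poly p b / poly q b = poly p' b / poly q' b" "m = ?w p' - ?w q'" by blast
    have "poly (p * q' - p' * q) b = 0"
      using p'(5) tr[OF pq(2,4)] tr[OF p'(2,4)] by (simp add: frac_eq_eq)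
    moreover have "poly_over F (p * q' - p' * q)" using pq p' by (intro arith)
    ultimately have "p * q' - p' * q = 0" using tr by blast
    then have "p * q' = p' * q" by simp
    then have "?w p + ?w q' = ?w p' + ?w q"
      using gauss_val_mult[OF F v pq(1,3) p'(2,4), of r] gauss_val_mult[OF F v p'(1,3) pq(2,4), of r] by simp
    then show "m = ?w p - ?w q" using p'(6) by simp
  qed
  have rep: "\<exists>p q. poly_over F p \<and> poly_over F q \<and> p \<noteq> 0 \<and> q \<noteq> 0 \<and> x = poly p b / poly q b"
    if x: "x \<in> field_adjoin F b" "x \<noteq> 0" for x
  proof -
    obtain p q where "poly_over F p" "poly_over F q" "x = poly p b / poly q b"
      using x(1) unfolding field_adjoin_def ring_adjoin_def by blast
    moreover have "p \<noteq> 0" "q \<noteq> 0" using calculation x(2) by auto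
    ultimately show ?thesis by blast
  qed
  have one: "poly_over F 1" "(1 :: 'a poly) \<noteq> 0" "?w 1 = 0"
  proof -
    show "poly_over F 1" by (rule arith)
    show "(1 :: 'a poly) \<noteq> 0" by simp
    have "{i. poly.coeff (1 :: 'a poly) i \<noteq> 0} = {0}" by auto
    then show "?w 1 = 0" unfolding gauss_val_def by (simp add: valuation_one[OF F v])
  qed
  have "valuation (field_adjoin F b) v'"
    unfolding valuation_def
  proof (intro ballI conjI impI)
    fix x y assume "x \<in> field_adjoin F b - {0}" "y \<in> field_adjoin F b - {0}"
    then have x: "x \<in> field_adjoin F b" "x \<noteq> 0" and y: "y \<in> field_adjoin F b" "y \<noteq> 0" by auto
    obtain p q where p: "poly_over F p" "poly_over F q" "p \<noteq> 0" "q \<noteq> 0" "x = poly p b / poly q b"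
      using rep[OF x] by blast
    obtain p' q' where p': "poly_over F p'" "poly_over F q'" "p' \<noteq> 0" "q' \<noteq> 0" "y = poly p' b / poly q' b"
      using rep[OF y] by blast
    note w = gauss_val_mult[OF F v]
    have vx: "v' x = ?w p - ?w q" unfolding p(5) by (rule v'_eq[OF p(1-4)])
    have vy: "v' y = ?w p' - ?w q'" unfolding p'(5) by (rule v'_eq[OF p'(1-4)])
    have "x * y = poly (p * p') b / poly (q * q') b" using p(5) p'(5) by simp
    moreover have "v' (poly (p * p') b / poly (q * q') b) = ?w (p * p') - ?w (q * q')"
      using p p' by (intro v'_eq arith) simp_all
    ultimately have "v' (x * y) = ?w (p * p') - ?w (q * q')" by (simp only:)
    then show "v' (x * y) = v' x + v' y"
      unfolding vx vy w[OF p(1,3) p'(1,3)] w[OF p(2,4) p'(2,4)] by simp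
    assume xy: "x + y \<noteq> 0"
    define h where "h = p * q' + p' * q"
    have "x + y = poly h b / poly (q * q') b"
      using p(5) p'(5) tr[OF p(2,4)] tr[OF p'(2,4)] by (simp add: h_def add_frac_eq)
    moreover from this have "h \<noteq> 0" using xy by auto
    moreover have "poly_over F h" unfolding h_def using p p' by (intro arith)
    moreover have "poly_over F (q * q')" by (rule arith(7)[OF p(2) p'(2)])
    moreover have "q * q' \<noteq> 0" using p p' by simp
    ultimately have "v' (x + y) = ?w h - ?w (q * q')" using v'_eq[of h "q * q'"] by simp
    moreover have "min (?w (p * q')) (?w (p' * q)) \<le> ?w h"
      using gauss_val_add[OF F v arith(7)[OF p(1) p'(2)] arith(7)[OF p'(1) p(2)] \<open>h \<noteq> 0\<close>[unfolded h_def]]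
      unfolding h_def .
    ultimately show "min (v' x) (v' y) \<le> v' (x + y)"
      unfolding vx vy w[OF p(1,3) p'(2,4)] w[OF p'(1,3) p(2,4)] w[OF p(2,4) p'(2,4)] by linarith
  qed
  moreover have "\<forall>c\<in>F - {0}. v' c = v c"
  proof
    fix c assume c: "c \<in> F - {0}"
    then have "v' (poly [:c:] b / poly 1 b) = ?w [:c:] - ?w 1"
      using one by (intro v'_eq arith) simp_all
    moreover have "poly.coeff [:c:] i \<noteq> 0 \<longleftrightarrow> i = 0" for i using c by (cases i) auto
    then have "?w [:c:] = v c" unfolding gauss_val_def by simp
    ultimately show "v' c = v c" using one by simp
  qed
  moreover have "v' b = r"
  proof -
    have "v' (poly [:0, 1:] b / poly 1 b) = ?w [:0, 1:] - ?w 1"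
      using one by (intro v'_eq arith) simp_all
    moreover have "poly.coeff [:0, 1 :: 'a:] i \<noteq> 0 \<longleftrightarrow> i = 1" for i
      by (cases i) (auto simp: coeff_pCons split: nat.splits)
    then have "?w [:0, 1:] = r" unfolding gauss_val_def by (simp add: valuation_one[OF F v])
    ultimately show ?thesis using one by simp
  qed
  ultimately show ?thesis by blast
qed

section \<open>Discrete valuations with a prescribed pole\<close>

lemma valuation_normalize:
  assumes F: "field_closed F" and v: "valuation F v" and a: "a \<in> F" "a \<noteq> 0" "v a < 0"
  obtains v' \<pi> where "valuation F v'" "\<pi> \<in> F" "\<pi> \<noteq> 0" "v' \<pi> = 1" "v' a < 0"
proof -
  define P where "P d \<longleftrightarrow> d > 0 \<and> (\<exists>x\<in>F - {0}. v x = int d)" for d :: nat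
  have va: "v (inverse a) = int (nat (- v a))" using valuation_inverse[OF F v a(1,2)] a(3) by simp
  have ia: "inverse a \<in> F - {0}" using a field_closed_inverse[OF F] by simp
  have "\<exists>x\<in>F - {0}. v x = int (nat (- v a))" using va ia by blast
  moreover have "nat (- v a) > 0" using a(3) by simp
  ultimately have "P (nat (- v a))" unfolding P_def by blast
  then have least: "P (LEAST d. P d)" by (rule LeastI)
  \<comment> \<open>The least positive value generates the value group, by division with remainder;
    an element attaining it is the uniformiser once all values are divided by
    \<open>d\<close>.\<close>
  define d where "d = (LEAST d. P d)"
  have "P d" using least unfolding d_def .
  then obtain \<pi> where d': "d > 0" "\<pi> \<in> F" "\<pi> \<noteq> 0" "v \<pi> = int d" unfolding P_def by blast
  note d = d_def d'
  have dvd: "int d dvd v x" if x: "x \<in> F" "x \<noteq> 0" for x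
  proof (rule ccontr)
    assume nd: "\<not> int d dvd v x"
    define y where "y = x / \<pi> powi (v x div int d)"
    have "\<pi> powi (v x div int d) \<in> F" using field_closed_powi[OF F d(3)] .
    moreover have "\<pi> powi (v x div int d) \<noteq> 0" using d(4) by simp
    ultimately have y: "y \<in> F" "y \<noteq> 0" "v y = v x - v (\<pi> powi (v x div int d))"
      unfolding y_def using x valuation_divide[OF F v x] field_closed_divide[OF F x(1)] by simp_all
    have "v y = v x mod int d"
      using y(3) valuation_powi[OF F v d(3,4)] d(5) by (simp add: minus_div_mult_eq_mod)
    moreover have "v x mod int d > 0"
    proof -
      have "v x mod int d \<noteq> 0" using nd by (simp only: dvd_eq_mod_eq_0 not_False_eq_True)
      moreover have "v x mod int d \<ge> 0" using d(2) by (intro pos_mod_sign) simp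
      ultimately show ?thesis by linarith
    qed
    moreover have "v x mod int d < int d" using d(2) by simp
    ultimately have vy: "v y = int (nat (v y))" "nat (v y) > 0" "nat (v y) < d" by simp_all
    have "P (nat (v y))" unfolding P_def using vy y by blast
    then show False using not_less_Least[of "nat (v y)" P] d(1) vy(3) by blast
  qed
  define v' where "v' x = v x div int d" for x
  have vv: "v x = int d * v' x" if "x \<in> F" "x \<noteq> 0" for x using dvd[OF that] by (simp add: v'_def)
  have "valuation F v'"
    unfolding valuation_def
  proof (intro ballI conjI impI)
    fix x y assume "x \<in> F - {0}" "y \<in> F - {0}"
    then have x: "x \<in> F" "x \<noteq> 0" and y: "y \<in> F" "y \<noteq> 0" by auto
    have xy: "x * y \<in> F" "x * y \<noteq> 0" using x y field_closed_intros(6)[OF F] by simp_all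
    have "int d * v' (x * y) = int d * (v' x + v' y)"
      using valuation_mult[OF v x(1) y(1) x(2) y(2)] vv[OF x] vv[OF y] vv[OF xy] by (simp add: distrib_left)
    then show "v' (x * y) = v' x + v' y" using d(2) by simp
    assume s: "x + y \<noteq> 0"
    have "x + y \<in> F" using x y field_closed_intros(3)[OF F] by simp
    then have "min (int d * v' x) (int d * v' y) \<le> int d * v' (x + y)"
      using valuation_add[OF v x(1) y(1) x(2) y(2) s] vv[OF x] vv[OF y] vv[of "x + y"] s by simp
    then show "min (v' x) (v' y) \<le> v' (x + y)"
      using d(2) unfolding min_mult_distrib_left[symmetric]
      by (simp add: min_def split: if_splits)
  qed
  moreover have "v' \<pi> = 1" using d by (simp add: v'_def)
  moreover have "v' a < 0" using vv[OF a(1,2)] a(3) d(2) by (simp add: mult_less_0_iff)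
  ultimately show ?thesis using that d(3,4) by blast
qed

text \<open>A transcendental \<open>b\<close> gets Gauss value \<open>0\<close>. For an algebraic
  one a Krull ring is chosen that contains the old valuation ring and still avoids \<open>a\<close>;
  its discreteness is inherited from the normalised valuation on \<open>F\<close>.\<close>

lemma valuation_adjoin:
  assumes F: "field_closed F" and v0: "valuation F v0" and a: "a \<in> F" "a \<noteq> 0" "v0 a < 0"
  shows "\<exists>v'. valuation (field_adjoin F b) v' \<and> v' a < 0"
proof (cases "\<exists>f. poly_over F f \<and> f \<noteq> 0 \<and> poly f b = 0")
  case False
  then show ?thesis using transcendental_extension[OF F v0, of b 0] a by (metis DiffI singletonD)
next
  case True
  then obtain f where f: "poly_over F f" "f \<noteq> 0" "poly f b = 0" by blast
  obtain v \<pi> where v: "valuation F v" and \<pi>: "\<pi> \<in> F" "\<pi> \<noteq> 0" "v \<pi> = 1" and va: "v a < 0"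
    using valuation_normalize[OF F v0 a] by blast
  let ?E = "field_adjoin F b" and ?R = "val_level F v 0"
  note RF = field_closed_ring[OF F]
  note E = field_closed_field_adjoin[OF F, of b]
  have FE: "F \<subseteq> ?E" by (rule field_adjoin(2)[OF RF])
  have R: "ring_closed ?R"
    unfolding ring_closed_def
  proof (intro conjI ballI)
    show "1 \<in> ?R" using ring_closed_one[OF RF] valuation_one[OF F v] by (simp add: val_level_def)
    fix x y assume xy: "x \<in> ?R" "y \<in> ?R"
    show "x - y \<in> ?R"
      using val_level_add[OF F v xy(1) val_level_uminus[OF F v xy(2)]] by simp
    show "x * y \<in> ?R" using val_level_mult[OF F v xy] by simp
  qed
  have RE: "?R \<subseteq> ?E" using FE by (auto simp: val_level_def)
  have "a \<in> ?E" "a \<notin> ?R" "inverse a \<in> ?R"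
    using a va FE valuation_inverse[OF F v a(1,2)] field_closed_inverse[OF F a(1)]
    by (auto simp: val_level_def)
  then obtain B where B: "val_ring ?E B" "?R \<subseteq> B" "a \<notin> B"
    using exists_val_ring[OF E R RE] by blast
  have RB: "ring_closed B" using B(1) by (simp add: val_ring_def)
  have unit: "vunit B (c / \<pi> powi v c)" if c: "c \<in> F" "c \<noteq> 0" for c
  proof -
    have p: "\<pi> powi v c \<in> F" "\<pi> powi v c \<noteq> 0" using field_closed_powi[OF F \<pi>(1)] \<pi>(2) by simp_all
    let ?u = "c / \<pi> powi v c"
    have u: "?u \<in> F" "?u \<noteq> 0" using field_closed_divide[OF F c(1) p(1)] c(2) p(2) by simp_all
    have "v ?u = 0" using valuation_divide[OF F v c p] valuation_powi[OF F v \<pi>(1,2)] \<pi>(3) by simp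
    then have "?u \<in> ?R" "inverse ?u \<in> ?R"
      using u valuation_inverse[OF F v u] field_closed_inverse[OF F u(1)] unfolding val_level_def by simp_all
    then show ?thesis using B(2) u(2) unfolding vunit_def by blast
  qed
  have "\<pi> \<in> ?R" using \<pi> by (simp add: val_level_def)
  then have "\<pi> \<in> B" using B(2) by blast
  \<comment> \<open>Since \<open>a\<close> is a unit times a power of \<open>inverse \<pi>\<close>,
    the latter cannot lie in \<open>B\<close> either.\<close>
  moreover have "inverse \<pi> \<notin> B"
  proof
    assume i: "inverse \<pi> \<in> B"
    have "a = (a / \<pi> powi v a) * inverse \<pi> ^ nat (- v a)"
      using va \<pi>(2) by (simp add: power_int_def)
    moreover have "\<dots> \<in> B"
      using unit[OF a(1,2)] by (intro ring_closed_mult ring_closed_power RB i) (simp only: vunit_def)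
    ultimately show False using B(3) by metis
  qed
  ultimately obtain v' where v': "valuation ?E v'" "\<forall>x\<in>?E. x \<noteq> 0 \<longrightarrow> (x \<in> B \<longleftrightarrow> 0 \<le> v' x)"
    using val_ring_algebraic_valuation[OF F f B(1) \<pi>(2)] unit by blast
  have "a \<in> B \<longleftrightarrow> 0 \<le> v' a" using v'(2) \<open>a \<in> ?E\<close> a(2) by blast
  then have "v' a < 0" using B(3) by simp
  then show ?thesis using v'(1) by blast
qed

text \<open>An expression of \<open>a\<close> as a polynomial of degree \<open>d\<close> in
  \<open>1 / a\<close>, multiplied by \<open>a ^ d\<close>, is a monic integral equation of degree
  \<open>d + 1\<close>.\<close>

lemma not_algebraic_int_ring_adjoin_inverse:
  assumes a: "\<not> algebraic_int a" "a \<noteq> 0"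
  shows "a \<notin> ring_adjoin (range of_int) (inverse a)"
proof
  assume "a \<in> ring_adjoin (range of_int) (inverse a)"
  then obtain p where p: "poly_over (range of_int) p" "a = poly p (inverse a)"
    unfolding ring_adjoin_def by blast
  have Z: "ring_closed (range of_int :: 'a set)"
    unfolding ring_closed_def
    by (auto simp flip: of_int_diff of_int_mult) (metis of_int_1 rangeI)
  let ?d = "Polynomial.degree p"
  have "poly.coeff p (?d - i) \<in> range of_int" for i using p(1) by (simp add: poly_over_def)
  then obtain r where r: "poly_over (range of_int) r" 
    "\<And>x. poly r x = (\<Sum>i\<le>?d. poly.coeff p (?d - i) * x ^ i)"
    "\<And>i. poly.coeff r i = (if i \<le> ?d then poly.coeff p (?d - i) else 0)"
    using poly_over_sum_eval[OF Z, of ?d "\<lambda>i. poly.coeff p (?d - i)"] by blast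
  define q where "q = Polynomial.monom 1 (Suc ?d) - r"
  have c: "poly.coeff q i = (if i = Suc ?d then 1 else - poly.coeff r i)" for i
    by (simp add: q_def r(3))
  have "Polynomial.degree q = Suc ?d"
  proof (rule antisym)
    show "Polynomial.degree q \<le> Suc ?d" by (rule degree_le) (simp add: c r(3))
    show "Suc ?d \<le> Polynomial.degree q" by (rule le_degree) (simp add: c)
  qed
  then have "lead_coeff q = 1" by (simp add: c)
  moreover have "\<forall>i. poly.coeff q i \<in> \<int>"
  proof
    fix i
    obtain k where "poly.coeff r i = of_int k" using r(1) unfolding poly_over_def by blast
    then have "- poly.coeff r i = of_int (- k)" by simp
    then show "poly.coeff q i \<in> \<int>" unfolding c by (metis Ints_1 Ints_of_int)
  qed
  moreover have "poly q a = 0"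
  proof -
    have "a * a ^ ?d = (\<Sum>i\<le>?d. poly.coeff p i * inverse a ^ i) * a ^ ?d"
      using p(2) by (simp only: poly_altdef[symmetric])
    also have "\<dots> = (\<Sum>i\<le>?d. poly.coeff p i * a ^ (?d - i))"
      unfolding sum_distrib_right
    proof (intro sum.cong HOL.refl)
      fix i assume "i \<in> {..?d}"
      then have "a ^ ?d = a ^ i * a ^ (?d - i)" by (simp add: power_add[symmetric])
      then show "poly.coeff p i * inverse a ^ i * a ^ ?d = poly.coeff p i * a ^ (?d - i)"
        using a(2) by (simp add: field_simps)
    qed
    also have "\<dots> = (\<Sum>i\<le>?d. poly.coeff p (?d - i) * a ^ i)"
      by (rule sum.reindex_bij_witness[of _ "\<lambda>i. ?d - i" "\<lambda>i. ?d - i"]) auto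
    finally show ?thesis by (simp add: q_def poly_monom r(2))
  qed
  ultimately have "algebraic_int a" by (rule algebraic_int.intros)
  then show False using a(1) by blast
qed

lemma ring_closed_range_of_int: "ring_closed (range of_int :: 'a :: field set)"
  unfolding ring_closed_def
  by (auto simp flip: of_int_diff of_int_mult) (metis of_int_1 rangeI)

text \<open>Dividing an equation of degree \<open>k + 1\<close> by \<open>a ^ k\<close> expresses
  \<open>a\<close> through powers of \<open>1 / a\<close> with coefficients in \<open>P\<close>.
  Hence a ring with \<open>1 / a\<close> but without \<open>a\<close> cannot contain the prime
  field.\<close>

lemma algebraic_inverse_in_ring:
  assumes P: "field_closed P" and f: "poly_over P f" "f \<noteq> 0" "poly f a = 0"
    and B: "ring_closed B" "P \<subseteq> B" "inverse a \<in> B" "a \<noteq> 0"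
  shows "a \<in> B"
proof -
  let ?d = "Polynomial.degree f"
  have "?d \<noteq> 0"
  proof
    assume "?d = 0"
    then obtain c where "f = [:c:]" by (rule degree_eq_zeroE)
    then show False using f by simp
  qed
  then obtain k where d: "?d = Suc k" by (metis not0_implies_Suc)
  have lc: "poly.coeff f (Suc k) \<noteq> 0" using f(2) d by (metis leading_coeff_0_iff)
  have "0 = (\<Sum>i\<le>k. poly.coeff f i * a ^ i) + poly.coeff f (Suc k) * a ^ Suc k"
    using f(3) by (simp add: poly_altdef d)
  then have "poly.coeff f (Suc k) * a ^ Suc k = - (\<Sum>i\<le>k. poly.coeff f i * a ^ i)"
    by (simp only: eq_neg_iff_add_eq_0 add.commute)
  then have "a ^ Suc k = - (\<Sum>i\<le>k. poly.coeff f i * a ^ i) / poly.coeff f (Suc k)"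
    using lc by (metis nonzero_mult_div_cancel_left)
  then have "a ^ Suc k * inverse a ^ k = (- (\<Sum>i\<le>k. poly.coeff f i * a ^ i) / poly.coeff f (Suc k)) * inverse a ^ k"
    by (simp only:)
  also have "\<dots> = - (\<Sum>i\<le>k. poly.coeff f i / poly.coeff f (Suc k) * (a ^ i * inverse a ^ k))"
    by (simp add: sum_distrib_right sum_divide_distrib mult.assoc)
  also have "(\<Sum>i\<le>k. poly.coeff f i / poly.coeff f (Suc k) * (a ^ i * inverse a ^ k)) =
      (\<Sum>i\<le>k. poly.coeff f i / poly.coeff f (Suc k) * inverse a ^ (k - i))"
  proof (intro sum.cong HOL.refl)
    fix i assume "i \<in> {..k}"
    then have "inverse a ^ k = inverse a ^ i * inverse a ^ (k - i)" by (simp add: power_add[symmetric])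
    moreover have "a ^ i * inverse a ^ i = 1" using B(4) by (simp add: power_mult_distrib[symmetric])
    ultimately have "a ^ i * inverse a ^ k = inverse a ^ (k - i)" by (simp add: mult.assoc[symmetric])
    then show "poly.coeff f i / poly.coeff f (Suc k) * (a ^ i * inverse a ^ k) =
        poly.coeff f i / poly.coeff f (Suc k) * inverse a ^ (k - i)" by simp
  qed
  also have "a ^ Suc k * inverse a ^ k = a * (a * inverse a) ^ k" by (simp only: power_Suc power_mult_distrib mult.assoc)
  finally have "a = - (\<Sum>i\<le>k. poly.coeff f i / poly.coeff f (Suc k) * inverse a ^ (k - i))" using B(4) by simp
  moreover have "\<dots> \<in> B"
  proof (intro ring_closed_uminus ring_closed_sum ring_closed_mult ring_closed_power B(1,3))
    fix i
    show "poly.coeff f i / poly.coeff f (Suc k) \<in> B"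
      using f(1) field_closed_divide[OF P] B(2) unfolding poly_over_def by blast
  qed
  ultimately show ?thesis by metis
qed

text \<open>If \<open>a\<close> is transcendental over the prime field \<open>P\<close>, it gets
  value \<open>-1\<close> over the trivial valuation. If it is algebraic, a Krull ring
  \<open>B\<close> avoiding \<open>a\<close> misses part of \<open>P\<close>, and its trace on
  \<open>P\<close> turns out to be discrete, as for a \<open>p\<close>-adic valuation.\<close>

lemma exists_valuation:
  fixes a :: "'a :: field"
  assumes a: "\<not> algebraic_int a"
  shows "\<exists>F v. field_closed F \<and> countable F \<and> valuation F v \<and> a \<in> F \<and> v a < 0"
proof -
  have a0: "a \<noteq> 0"
  proof
    assume "a = 0"
    moreover have "algebraic_int (0 :: 'a)"
      by (rule algebraic_int.intros[of "[:0, 1:]"]) (auto simp: coeff_pCons split: nat.splits)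
    ultimately show False using a by simp
  qed
  define Z :: "'a set" where "Z = range of_int"
  note RZ = ring_closed_range_of_int[where 'a = 'a, folded Z_def]
  \<comment> \<open>Adjoining \<open>0\<close> adds only fractions, so this is the prime
    field.\<close>
  define P where "P = field_adjoin Z 0"
  have P: "field_closed P" "Z \<subseteq> P" unfolding P_def by (rule field_adjoin[OF RZ])+
  note RP = field_closed_ring[OF P(1)]
  have cP: "countable P" unfolding P_def Z_def by (intro countable_field_adjoin countable_image) simp
  have Prep: "\<exists>m n. c = of_int m / of_int n" if "c \<in> P" for c
  proof -
    have "poly p 0 \<in> Z" if "poly_over Z p" for p
      using that by (simp add: poly_over_def poly_0_coeff_0)
    moreover obtain p q where "poly_over Z p" "poly_over Z q" "c = poly p 0 / poly q 0"
      using \<open>c \<in> P\<close> unfolding P_def field_adjoin_def ring_adjoin_def by blast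
    ultimately have "poly p 0 \<in> Z" "poly q 0 \<in> Z" "c = poly p 0 / poly q 0" by blast+
    then show ?thesis unfolding Z_def by (elim imageE) auto
  qed
  let ?E = "field_adjoin P a"
  note E = field_closed_field_adjoin[OF P(1), of a]
  have PE: "P \<subseteq> ?E" "a \<in> ?E" by (rule field_adjoin[OF RP])+
  have "\<exists>v. valuation ?E v \<and> v a < 0"
  proof (cases "\<exists>f. poly_over P f \<and> f \<noteq> 0 \<and> poly f a = 0")
    case False
    have "valuation P (\<lambda>_. 0)" by (simp add: valuation_def)
    then have "\<exists>v. valuation ?E v \<and> (\<forall>c\<in>P - {0}. v c = 0) \<and> v a = -1"
      using False by (intro transcendental_extension[OF P(1)]) blast+
    then show ?thesis by force
  next
    case True
    then obtain f where f: "poly_over P f" "f \<noteq> 0" "poly f a = 0" by blast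
    let ?R = "ring_adjoin Z (inverse a)"
    have RE: "?R \<subseteq> ?E"
      using P(2) PE field_closed_inverse[OF E PE(2)] by (intro ring_adjoin(4)[OF RZ] field_closed_ring[OF E]) auto
    obtain B where B: "val_ring ?E B" "?R \<subseteq> B" "a \<notin> B"
      using exists_val_ring[OF E ring_adjoin(1)[OF RZ] RE PE(2) not_algebraic_int_ring_adjoin_inverse[OF a a0, folded Z_def] ring_adjoin(3)[OF RZ]]
      by blast
    have RB: "ring_closed B" using B(1) by (simp add: val_ring_def)
    have iB: "inverse a \<in> B" using B(2) ring_adjoin(3)[OF RZ] by blast
    have "\<not> P \<subseteq> B" using algebraic_inverse_in_ring[OF P(1) f RB _ iB a0] B(3) by blast
    then obtain c where c: "c \<in> P" "c \<notin> B" by blast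
    then obtain m n where mn: "c = of_int m / of_int n" using Prep by blast
    define Q where "Q k \<longleftrightarrow> (of_nat k :: 'a) \<noteq> 0 \<and> inverse (of_nat k) \<notin> B" for k
    have n0: "(of_int n :: 'a) \<noteq> 0" using c(2) mn ring_closed_zero[OF RB] by auto
    have inB: "inverse (of_int n) \<notin> B"
      using c(2) mn ring_closed_mult[OF RB ring_closed_of_int[OF RB]] by (auto simp: divide_inverse)
    have "Q (nat \<bar>n\<bar>)"
    proof (cases "n \<ge> 0")
      case True
      then show ?thesis using n0 inB by (simp add: Q_def of_nat_nat)
    next
      case False
      then have "(of_nat (nat \<bar>n\<bar>) :: 'a) = - of_int n" by (simp add: of_nat_nat)
      moreover have "inverse (- of_int n) \<notin> B"
      proof
        assume "inverse (- of_int n) \<in> B"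
        then have "- inverse (- of_int n) \<in> B" by (rule ring_closed_uminus[OF RB])
        then show False using inB by simp
      qed
      ultimately show ?thesis using n0 by (simp add: Q_def)
    qed
    then have "\<exists>k. Q k" by blast
    \<comment> \<open>The least natural number that is nonzero in the field but not invertible in
      \<open>B\<close> becomes the uniformiser; all smaller ones that are nonzero in the field are
      units.\<close>
    define p where "p = (LEAST k. Q k)"
    have Qp: "Q p" unfolding p_def using \<open>\<exists>k. Q k\<close> by (rule LeastI_ex)
    have min: "inverse (of_nat k) \<in> B" if "k < p" "(of_nat k :: 'a) \<noteq> 0" for k
    proof -
      have "\<not> Q k" using that(1) unfolding p_def by (rule not_less_Least)
      then show ?thesis using that(2) by (simp add: Q_def)
    qed
    define \<pi> :: 'a where "\<pi> = of_nat p"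
    have \<pi>: "\<pi> \<noteq> 0" "inverse \<pi> \<notin> B" "\<pi> \<in> B"
      using Qp ring_closed_of_nat[OF RB] by (simp_all add: Q_def \<pi>_def)
    have p1: "p > 1"
    proof (rule ccontr)
      assume "\<not> p > 1"
      then have "p = 0 \<or> p = 1" by auto
      then show False using \<pi> ring_closed_one[OF RB] by (auto simp: \<pi>_def)
    qed
    \<comment> \<open>Division by \<open>p\<close> with remainder: a nonzero remainder is a unit
      while the multiple of \<open>\<pi>\<close> is not, so their sum is a unit; a zero remainder
      leads to the smaller quotient.\<close>
    have nat_unit: "\<exists>k. vunit B (of_nat m / \<pi> powi k)" if "(of_nat m :: 'a) \<noteq> 0" for m
      using that
    proof (induction m rule: less_induct)
      case (less m)
      let ?s = "of_nat (m mod p) :: 'a" and ?q = "of_nat (m div p) :: 'a"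
      have m: "of_nat m = ?q * \<pi> + ?s"
        unfolding \<pi>_def by (metis div_mult_mod_eq of_nat_add of_nat_mult)
      show ?case
      proof (cases "?s = 0")
        case True
        then have q: "?q \<noteq> 0" using less.prems m by auto
        have "m \<noteq> 0" using less.prems by (metis of_nat_0)
        then have "m div p < m" using p1 by simp
        then obtain k where k: "vunit B (?q / \<pi> powi k)" using less.IH q by blast
        have "of_nat m / \<pi> powi (k + 1) = ?q / \<pi> powi k"
          using m True \<pi>(1) by (simp add: power_int_add)
        then show ?thesis using k by metis
      next
        case False
        have "m mod p < p" using p1 by simp
        then have s: "vunit B ?s"
          using False min ring_closed_of_nat[OF RB] by (simp add: vunit_def)
        have mB: "of_nat m \<in> B" "- (?q * \<pi>) \<in> B"
          using \<pi>(3) by (intro ring_closed_of_nat ring_closed_uminus ring_closed_mult RB)+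
        have nu: "\<not> vunit B (- (?q * \<pi>))"
        proof
          assume u: "vunit B (- (?q * \<pi>))"
          have "inverse \<pi> = - ?q * inverse (- (?q * \<pi>))"
            using u \<pi>(1) by (simp add: vunit_def field_simps)
          moreover have "- ?q * inverse (- (?q * \<pi>)) \<in> B"
            using u ring_closed_of_nat[OF RB] by (intro ring_closed_mult ring_closed_uminus RB) (simp_all only: vunit_def)
          ultimately show False using \<pi>(2) by metis
        qed
        have "?s = of_nat m + - (?q * \<pi>)" using m by simp
        then have "vunit B (of_nat m)" using nonunit_add[OF E B(1) mB(1) _ mB(2) nu] s by metis
        then show ?thesis by (intro exI[of _ 0]) simp
      qed
    qed
    have int_unit: "\<exists>k. vunit B (of_int m / \<pi> powi k)" if "(of_int m :: 'a) \<noteq> 0" for m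
    proof -
      obtain j where j: "m = int j \<or> m = - int j" by (metis int_cases2)
      then have "(of_nat j :: 'a) \<noteq> 0" using that by (metis of_int_minus of_int_of_nat_eq neg_0_equal_iff_equal)
      then obtain k where k: "vunit B (of_nat j / \<pi> powi k)" using nat_unit by blast
      have "vunit B (-1 * (of_nat j / \<pi> powi k))" by (rule vunit_mult[OF RB vunit_minus_one[OF RB] k])
      then have neg: "vunit B (- of_nat j / \<pi> powi k)" by simp
      from j show ?thesis
      proof
        assume "m = int j"
        then show ?thesis using k by (intro exI[of _ k]) simp
      next
        assume "m = - int j"
        then show ?thesis using neg by (intro exI[of _ k]) simp
      qed
    qed
    have disc: "\<exists>k. vunit B (c / \<pi> powi k)" if c: "c \<in> P" "c \<noteq> 0" for c
    proof -
      obtain m n where mn: "c = of_int m / of_int n" using Prep c by blast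
      then have nz: "(of_int m :: 'a) \<noteq> 0" "(of_int n :: 'a) \<noteq> 0" using c(2) by auto
      obtain k where k: "vunit B (of_int m / \<pi> powi k)" using int_unit[OF nz(1)] by blast
      obtain l where l: "vunit B (of_int n / \<pi> powi l)" using int_unit[OF nz(2)] by blast
      have "(of_int m / \<pi> powi k) / (of_int n / \<pi> powi l) = of_int m / of_int n / (\<pi> powi k / \<pi> powi l)"
        by simp
      also have "\<dots> = c / \<pi> powi (k - l)" unfolding mn using \<pi>(1) by (simp add: power_int_diff)
      finally show ?thesis using vunit_divide[OF RB k l] by (intro exI[of _ "k - l"]) (simp only:)
    qed
    obtain v where v: "valuation ?E v" "\<forall>x\<in>?E. x \<noteq> 0 \<longrightarrow> (x \<in> B \<longleftrightarrow> 0 \<le> v x)"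
      using val_ring_algebraic_valuation[OF P(1) f B(1) \<pi>(1,3,2) disc] by blast
    have "a \<in> B \<longleftrightarrow> 0 \<le> v a" using v(2) PE(2) a0 by blast
    then have "v a < 0" using B(3) by simp
    then show ?thesis using v(1) by blast
  qed
  then obtain v where "valuation ?E v" "v a < 0" by blast
  then show ?thesis
    using E PE(2) countable_field_adjoin[OF cP] by (intro exI[of _ ?E] exI[of _ v] conjI)
qed

text \<open>Meant for the matrix entries of generators: they are adjoined one at a time, and the
  pole at \<open>a\<close> survives each step.\<close>

theorem exists_valuation_finite:
  fixes a :: "'a :: field"
  assumes a: "\<not> algebraic_int a" and "finite S"
  shows "\<exists>F v. field_closed F \<and> countable F \<and> valuation F v \<and> a \<in> F \<and> S \<subseteq> F \<and> v a < 0"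
  using assms(2)
proof (induction S rule: finite_induct)
  case empty
  then show ?case using exists_valuation[OF a] by blast
next
  case (insert b S)
  then obtain F v where F: "field_closed F" "countable F" "valuation F v" "a \<in> F" "S \<subseteq> F" "v a < 0"
    by blast
  have "a \<noteq> 0"
  proof
    assume "a = 0"
    moreover have "algebraic_int (0 :: 'a)"
      by (rule algebraic_int.intros[of "[:0, 1:]"]) (auto simp: coeff_pCons split: nat.splits)
    ultimately show False using a by simp
  qed
  then obtain v' where v': "valuation (field_adjoin F b) v'" "v' a < 0"
    using valuation_adjoin[OF F(1,3,4) _ F(6)] by blast
  have "F \<subseteq> field_adjoin F b" "b \<in> field_adjoin F b" by (rule field_adjoin[OF field_closed_ring[OF F(1)]])+
  then show ?case
    using v' F field_closed_field_adjoin[OF F(1), of b] countable_field_adjoin[OF F(2), of b]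
    by (intro exI[of _ "field_adjoin F b"] exI[of _ v']) auto
qed

section \<open>Lattices over a valuation ring\<close>

no_notation fps_nth (infixl \<open>$\<close> 75)

section \<open>Matrices with entries in a subring\<close>

definition entries_in :: "'a :: comm_ring_1 set \<Rightarrow> nat \<Rightarrow> 'a mat \<Rightarrow> bool" where
  "entries_in R k m \<longleftrightarrow> m \<in> carrier_mat k k \<and> (\<forall>i<k. \<forall>j<k. m $$ (i, j) \<in> R)"

lemma entries_inI:
  "m \<in> carrier_mat k k \<Longrightarrow> (\<And>i j. i < k \<Longrightarrow> j < k \<Longrightarrow> m $$ (i, j) \<in> R) \<Longrightarrow> entries_in R k m"
  by (simp add: entries_in_def)

lemma ring_closed_prod:
  "ring_closed R \<Longrightarrow> (\<And>i. i \<in> A \<Longrightarrow> f i \<in> R) \<Longrightarrow> prod f A \<in> R"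
  by (induction A rule: infinite_finite_induct) (auto intro: ring_closed_one ring_closed_mult)

lemma det_in_ring:
  assumes R: "ring_closed R" and m: "entries_in R k m"
  shows "det m \<in> R"
proof -
  have mc: "m \<in> carrier_mat k k" using m by (simp add: entries_in_def)
  have "signof p \<in> R" for p :: "nat \<Rightarrow> nat"
    using ring_closed_of_int[OF R, of "sign p"] by (simp add: sign_def ring_closed_one[OF R] ring_closed_uminus[OF R])
  moreover have "(\<Prod>i = 0..<k. m $$ (i, p i)) \<in> R" if "p permutes {0..<k}" for p
    using m permutes_in_image[OF that] by (intro ring_closed_prod[OF R]) (simp add: entries_in_def)
  ultimately show ?thesis
    unfolding det_def'[OF mc] by (intro ring_closed_sum ring_closed_mult R) simp_all
qed

lemma index_mult_mat_vec_sum: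
  assumes "m \<in> carrier_mat k k" "y \<in> carrier_vec k" "i < k"
  shows "(m *\<^sub>v y) $ i = (\<Sum>j<k. m $$ (i, j) * y $ j)"
  using assms by (simp add: scalar_prod_def atLeast0LessThan)

lemma entries_in_mult:
  assumes R: "ring_closed R" and a: "entries_in R k a" and b: "entries_in R k b"
  shows "entries_in R k (a * b)"
proof (rule entries_inI)
  have ab: "a \<in> carrier_mat k k" "b \<in> carrier_mat k k" using a b by (simp_all add: entries_in_def)
  show "a * b \<in> carrier_mat k k" using ab by simp
  fix i j assume ij: "i < k" "j < k"
  have "(a * b) $$ (i, j) = (\<Sum>l = 0..<k. a $$ (i, l) * b $$ (l, j))"
    using ab ij by (simp add: scalar_prod_def)
  also have "\<dots> \<in> R" using a b ij by (intro ring_closed_sum ring_closed_mult R) (simp_all add: entries_in_def)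
  finally show "(a * b) $$ (i, j) \<in> R" .
qed

lemma entries_in_one: "ring_closed R \<Longrightarrow> entries_in R k (1\<^sub>m k)"
  by (rule entries_inI) (simp_all add: ring_closed_one ring_closed_zero)

lemma entries_in_smult:
  assumes R: "ring_closed R" and c: "c \<in> R" and m: "entries_in R k m"
  shows "entries_in R k (c \<cdot>\<^sub>m m)"
proof (rule entries_inI)
  have mc: "m \<in> carrier_mat k k" using m by (simp add: entries_in_def)
  then show "c \<cdot>\<^sub>m m \<in> carrier_mat k k" by simp
  fix i j assume ij: "i < k" "j < k"
  then have "c * m $$ (i, j) \<in> R" using m by (intro ring_closed_mult R c) (simp add: entries_in_def)
  then show "(c \<cdot>\<^sub>m m) $$ (i, j) \<in> R" using ij mc by simp
qed

lemma entries_in_adj: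
  assumes R: "ring_closed R" and m: "entries_in R k m"
  shows "entries_in R k (adj_mat m)"
proof (rule entries_inI)
  have mc: "m \<in> carrier_mat k k" using m by (simp add: entries_in_def)
  show "adj_mat m \<in> carrier_mat k k" by (rule adj_mat(1)[OF mc])
  fix i j assume ij: "i < k" "j < k"
  have "entries_in R (k - 1) (mat_delete m j i)"
  proof (rule entries_inI)
    show "mat_delete m j i \<in> carrier_mat (k - 1) (k - 1)" using mc by (rule mat_delete_carrier)
    fix a b assume "a < k - 1" "b < k - 1"
    then show "mat_delete m j i $$ (a, b) \<in> R"
      using m ij mc by (simp add: mat_delete_def entries_in_def)
  qed
  then have "det (mat_delete m j i) \<in> R" by (rule det_in_ring[OF R])
  moreover have "adj_mat m $$ (i, j) = cofactor m j i" using ij mc by (simp add: adj_mat_def)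
  ultimately show "adj_mat m $$ (i, j) \<in> R"
    unfolding cofactor_def
    using ring_closed_mult[OF R ring_closed_power[OF R ring_closed_uminus[OF R ring_closed_one[OF R]]]] by simp
qed

text \<open>The adjugate form is kept in the conclusion because it shows that the inverse is
  integral whenever the matrix is and its determinant is a unit.\<close>

lemma inverse_mat_field:
  assumes F: "field_closed F" and m: "entries_in F k m" "det m \<noteq> 0"
  obtains m' where "entries_in F k m'" "m * m' = 1\<^sub>m k" "m' * m = 1\<^sub>m k" "m' = inverse (det m) \<cdot>\<^sub>m adj_mat m"
proof -
  note R = field_closed_ring[OF F]
  have mc: "m \<in> carrier_mat k k" using m by (simp add: entries_in_def)
  note ad = adj_mat[OF mc]
  define m' where "m' = inverse (det m) \<cdot>\<^sub>m adj_mat m"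
  have "entries_in F k m'"
    unfolding m'_def
    by (intro entries_in_smult entries_in_adj R m(1) field_closed_inverse[OF F] det_in_ring[OF R m(1)])
  moreover have "m * m' = 1\<^sub>m k" "m' * m = 1\<^sub>m k"
    unfolding m'_def mult_smult_distrib[OF mc ad(1)] mult_smult_assoc_mat[OF ad(1) mc] ad(2,3)
    using m(2) by (auto intro!: eq_matI)
  ultimately show ?thesis using that m'_def by blast
qed

text \<open>The polynomials over \<open>R\<close> themselves form a subring, and the determinant of
  the characteristic matrix is taken in it.\<close>

lemma char_poly_over_ring:
  assumes R: "ring_closed R" and m: "entries_in R k m"
  shows "poly_over R (char_poly m)"
proof -
  note arith = poly_over_arith[OF R]
  have P: "ring_closed {p. poly_over R p}"
    unfolding ring_closed_def using arith by simp
  have mc: "m \<in> carrier_mat k k" using m by (simp add: entries_in_def)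
  have "entries_in {p. poly_over R p} k (char_poly_matrix m)"
  proof (rule entries_inI)
    show "char_poly_matrix m \<in> carrier_mat k k" using mc by simp
    fix i j assume ij: "i < k" "j < k"
    then have "- m $$ (i, j) \<in> R" using m ring_closed_uminus[OF R] by (simp add: entries_in_def)
    then have "poly_over R [:- m $$ (i, j):]" by (rule arith)
    moreover have "char_poly_matrix m $$ (i, j) = (if i = j then [:0, 1:] else 0) + [:- m $$ (i, j):]"
      using ij mc by (simp add: char_poly_matrix_def)
    ultimately show "char_poly_matrix m $$ (i, j) \<in> {p. poly_over R p}"
      using arith(1,4,5) by simp
  qed
  then show ?thesis unfolding char_poly_def using det_in_ring[OF P] by simp
qed

lemma mat_eqI_mult_vec:
  assumes "a \<in> carrier_mat k k" "b \<in> carrier_mat k k" "\<And>j. j < k \<Longrightarrow> a *\<^sub>v unit_vec k j = b *\<^sub>v unit_vec k j"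
  shows "a = (b :: 'a :: field mat)"
proof (rule eq_matI)
  fix i j assume ij: "i < dim_row b" "j < dim_col b"
  have col: "(c *\<^sub>v unit_vec k j) $ i = c $$ (i, j)" if "c \<in> carrier_mat k k" for c :: "'a mat"
    using ij that assms(2) by (simp add: index_mult_mat_vec_sum if_distrib cong: if_cong)
  show "a $$ (i, j) = b $$ (i, j)"
    using col[OF assms(1)] col[OF assms(2)] assms(3)[of j] ij assms(2) by simp
qed (use assms in auto)

section \<open>Lattices, matrices and the standard apartment\<close>

locale lattice_building = affine_type_A n for n :: nat +
  fixes F :: "'k :: field set" and v :: "'k \<Rightarrow> int" and \<pi> :: 'k
  assumes F: "field_closed F" and v: "valuation F v" and \<pi>: "\<pi> \<in> F" "\<pi> \<noteq> 0" "v \<pi> = 1"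
begin

lemmas RF = field_closed_ring[OF F]

abbreviation dm :: nat where "dm \<equiv> n + 1"

definition V :: "'k vec set" where "V = {y \<in> carrier_vec dm. \<forall>i<dm. y $ i \<in> F}"

abbreviation Ov :: "'k set" where "Ov \<equiv> val_level F v 0"

definition GLF :: "'k mat set" where "GLF = {m. entries_in F dm m \<and> det m \<noteq> 0}"

text \<open>These matrices preserve types; a determinant of value \<open>k\<close> would shift them
  by \<open>k\<close> modulo \<open>n + 1\<close>.\<close>

definition H :: "'k mat set" where "H = {m \<in> GLF. v (det m) = 0}"

text \<open>
  The vectors \<open>\<pi>\<^bsup>q\<^esup> e\<^sub>i\<close> are numbered by the integers \<open>i + (n + 1) q\<close>, so that an apartment is
  described by sets of integers.
\<close>

definition lat :: "int set \<Rightarrow> 'k vec set" where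
  "lat S = {y \<in> V. \<forall>i<dm. y $ i \<noteq> 0 \<longrightarrow> int i + N * v (y $ i) \<in> S}"

definition act :: "'k mat \<Rightarrow> 'k vec set \<Rightarrow> 'k vec set" where
  "act m A = (\<lambda>y. m *\<^sub>v y) ` A"

lemma O_ring: "ring_closed Ov"
  unfolding ring_closed_def
proof (intro conjI ballI)
  show "1 \<in> Ov" using ring_closed_one[OF RF] valuation_one[OF F v] by (simp add: val_level_def)
  fix x y assume xy: "x \<in> Ov" "y \<in> Ov"
  show "x - y \<in> Ov" using val_level_add[OF F v xy(1) val_level_uminus[OF F v xy(2)]] by simp
  show "x * y \<in> Ov" using val_level_mult[OF F v xy] by simp
qed

lemma entries_carrier: "entries_in R k m \<Longrightarrow> m \<in> carrier_mat k k"
  by (simp add: entries_in_def)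

lemma GLF_carrier: "m \<in> GLF \<Longrightarrow> m \<in> carrier_mat dm dm"
  by (simp add: GLF_def entries_in_def)

lemma H_GLF: "m \<in> H \<Longrightarrow> m \<in> GLF" by (simp add: H_def)

lemma V_carrier: "y \<in> V \<Longrightarrow> y \<in> carrier_vec dm" by (simp add: V_def)

lemma lat_V: "lat S \<subseteq> V" by (auto simp: lat_def)

lemma det_F: "m \<in> GLF \<Longrightarrow> det m \<in> F" "m \<in> GLF \<Longrightarrow> det m \<noteq> 0"
  using det_in_ring[OF RF, of dm m] by (simp_all add: GLF_def)

lemma GLF_mult: "a \<in> GLF \<Longrightarrow> b \<in> GLF \<Longrightarrow> a * b \<in> GLF"
  using entries_in_mult[OF RF, of dm a b] det_mult[OF GLF_carrier GLF_carrier, of a b] by (simp add: GLF_def)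

lemma v_det_mult: "a \<in> GLF \<Longrightarrow> b \<in> GLF \<Longrightarrow> v (det (a * b)) = v (det a) + v (det b)"
  using valuation_mult[OF v det_F(1) det_F(1) det_F(2) det_F(2), of a b]
    det_mult[OF GLF_carrier GLF_carrier, of a b] by simp

lemma H_mult: "a \<in> H \<Longrightarrow> b \<in> H \<Longrightarrow> a * b \<in> H"
  using GLF_mult[of a b] v_det_mult[of a b] by (simp add: H_def)

lemma GLF_one: "1\<^sub>m dm \<in> GLF"
  using entries_in_one[OF RF] by (simp add: GLF_def)

lemma H_one: "1\<^sub>m dm \<in> H"
  using GLF_one valuation_one[OF F v] by (simp add: H_def)

lemma GLF_inverse:
  assumes m: "m \<in> GLF"
  obtains m' where "m' \<in> GLF" "m * m' = 1\<^sub>m dm" "m' * m = 1\<^sub>m dm" "v (det m') = - v (det m)"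
    "m' = inverse (det m) \<cdot>\<^sub>m adj_mat m"
proof -
  obtain m' where m': "entries_in F dm m'" "m * m' = 1\<^sub>m dm" "m' * m = 1\<^sub>m dm"
    "m' = inverse (det m) \<cdot>\<^sub>m adj_mat m"
    using inverse_mat_field[OF F, of dm m] m unfolding GLF_def by blast
  have "det m * det m' = 1" using det_mult[OF GLF_carrier[OF m] entries_carrier[OF m'(1)]] m'(2) by simp
  then have "det m' \<noteq> 0" by (metis mult_zero_right zero_neq_one)
  then have g: "m' \<in> GLF" using m'(1) by (simp add: GLF_def)
  moreover have "v (det m) + v (det m') = 0"
    using v_det_mult[OF m g] m'(2) valuation_one[OF F v] by simp
  ultimately show ?thesis using that[of m'] m' by simp
qed

lemma H_inverse:
  assumes m: "m \<in> H"
  obtains m' where "m' \<in> H" "m * m' = 1\<^sub>m dm" "m' * m = 1\<^sub>m dm"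
proof -
  obtain m' where "m' \<in> GLF" "m * m' = 1\<^sub>m dm" "m' * m = 1\<^sub>m dm" "v (det m') = - v (det m)"
    using GLF_inverse[OF H_GLF[OF m]] by metis
  then show ?thesis using that[of m'] m by (simp add: H_def)
qed

lemma V_zero: "0\<^sub>v dm \<in> V" using ring_closed_zero[OF RF] by (simp add: V_def)

lemma V_add: "x \<in> V \<Longrightarrow> y \<in> V \<Longrightarrow> x + y \<in> V"
  using ring_closed_add[OF RF] by (auto simp: V_def)

lemma V_smult: "c \<in> F \<Longrightarrow> y \<in> V \<Longrightarrow> c \<cdot>\<^sub>v y \<in> V"
  using ring_closed_mult[OF RF] by (auto simp: V_def)

lemma V_unit: "j < dm \<Longrightarrow> unit_vec dm j \<in> V"
  using ring_closed_zero[OF RF] ring_closed_one[OF RF] by (simp add: V_def)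

lemma V_mult:
  assumes "entries_in F dm m" "y \<in> V"
  shows "m *\<^sub>v y \<in> V"
proof -
  have c: "m \<in> carrier_mat dm dm" "y \<in> carrier_vec dm" using assms by (simp_all add: entries_in_def V_def)
  have "(m *\<^sub>v y) $ i \<in> F" if "i < dm" for i
    unfolding index_mult_mat_vec_sum[OF c that] using assms that
    by (intro ring_closed_sum ring_closed_mult RF) (simp_all add: entries_in_def V_def)
  then show ?thesis using c by (simp add: V_def)
qed

lemma act_one: "A \<subseteq> V \<Longrightarrow> act (1\<^sub>m dm) A = A"
  unfolding act_def using one_mult_mat_vec[OF V_carrier] by (simp add: subset_iff cong: image_cong_simp)

lemma act_mult: "a \<in> GLF \<Longrightarrow> b \<in> GLF \<Longrightarrow> A \<subseteq> V \<Longrightarrow> act (a * b) A = act a (act b A)"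
  unfolding act_def image_image
  using assoc_mult_mat_vec[OF GLF_carrier GLF_carrier V_carrier, of a b] by (intro image_cong HOL.refl) blast

lemma act_V: "m \<in> GLF \<Longrightarrow> A \<subseteq> V \<Longrightarrow> act m A \<subseteq> V"
  unfolding act_def GLF_def using V_mult by blast

lemma act_mono: "A \<subseteq> B \<Longrightarrow> act m A \<subseteq> act m B"
  by (auto simp: act_def)

lemma act_cancel:
  assumes "a \<in> GLF" "b \<in> GLF" "b * a = 1\<^sub>m dm" "A \<subseteq> V"
  shows "act b (act a A) = A"
  using act_mult[OF assms(2,1,4)] act_one[OF assms(4)] assms(3) by simp

lemma lat_0: "lat {0..} = {y \<in> carrier_vec dm. \<forall>i<dm. y $ i \<in> Ov}"
proof -
  have "0 \<le> int i + N * x \<longleftrightarrow> 0 \<le> x" if "i < dm" for i x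
  proof
    assume *: "0 \<le> int i + N * x"
    show "0 \<le> x"
    proof (rule ccontr)
      assume "\<not> 0 \<le> x"
      then have "N * x \<le> N * -1" by (intro mult_left_mono) auto
      then show False using * that by simp
    qed
  qed simp
  then show ?thesis unfolding lat_def V_def val_level_def by auto
qed

lemma act_lat_0_iff:
  assumes m: "m \<in> GLF"
  shows "act m (lat {0..}) \<subseteq> lat {0..} \<longleftrightarrow> entries_in Ov dm m"
proof
  assume *: "act m (lat {0..}) \<subseteq> lat {0..}"
  show "entries_in Ov dm m"
  proof (rule entries_inI)
    show mc: "m \<in> carrier_mat dm dm" by (rule GLF_carrier[OF m])
    fix i j assume ij: "i < dm" "j < dm"
    have "unit_vec dm j \<in> lat {0..}"
      using ring_closed_zero[OF O_ring] ring_closed_one[OF O_ring] ij unfolding lat_0 by simp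
    then have "m *\<^sub>v unit_vec dm j \<in> lat {0..}" using * by (auto simp: act_def)
    then have "(m *\<^sub>v unit_vec dm j) $ i \<in> Ov" using ij unfolding lat_0 by simp
    then show "m $$ (i, j) \<in> Ov"
      using ij mc by (simp add: index_mult_mat_vec_sum if_distrib cong: if_cong)
  qed
next
  assume *: "entries_in Ov dm m"
  show "act m (lat {0..}) \<subseteq> lat {0..}"
    unfolding act_def
  proof (rule image_subsetI)
    fix y assume y: "y \<in> lat {0..}"
    have c: "m \<in> carrier_mat dm dm" "y \<in> carrier_vec dm" using * y by (simp_all add: entries_in_def lat_0)
    have "(m *\<^sub>v y) $ i \<in> Ov" if "i < dm" for i
      unfolding index_mult_mat_vec_sum[OF c that] using * y that
      by (intro ring_closed_sum ring_closed_mult O_ring) (simp_all add: entries_in_def lat_0)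
    then show "m *\<^sub>v y \<in> lat {0..}" using c by (simp add: lat_0)
  qed
qed

text \<open>The inverse is the adjugate divided by a determinant of value zero, so it is integral as
  well and gives the opposite inclusion.\<close>

lemma H_stabilizes:
  assumes m: "m \<in> H" and sub: "act m (lat {0..}) \<subseteq> lat {0..}"
  shows "act m (lat {0..}) = lat {0..}"
proof -
  have mO: "entries_in Ov dm m" using act_lat_0_iff[OF H_GLF[OF m]] sub by blast
  obtain m' where m': "m' \<in> GLF" "m * m' = 1\<^sub>m dm" "m' * m = 1\<^sub>m dm" 
    "m' = inverse (det m) \<cdot>\<^sub>m adj_mat m"
    using GLF_inverse[OF H_GLF[OF m]] by metis
  have "det m \<in> F" "det m \<noteq> 0" "v (det m) = 0" using det_F[OF H_GLF[OF m]] m by (simp_all add: H_def)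
  then have "inverse (det m) \<in> Ov"
    using field_closed_inverse[OF F] valuation_inverse[OF F v] by (simp add: val_level_def)
  then have "entries_in Ov dm m'"
    unfolding m'(4) by (intro entries_in_smult entries_in_adj O_ring mO)
  then have "act m' (lat {0..}) \<subseteq> lat {0..}" using act_lat_0_iff[OF m'(1)] by blast
  then have "act m (act m' (lat {0..})) \<subseteq> act m (lat {0..})" by (rule act_mono)
  then show ?thesis using act_cancel[OF m'(1) H_GLF[OF m] m'(2) lat_V] sub by auto
qed

text \<open>Both \<open>m\<close> and its inverse are integral, so both determinants have
  nonnegative value, and these two values are opposite.\<close>

lemma stabilizer_v_det:
  assumes m: "m \<in> GLF" and eq: "act m (lat {0..}) = lat {0..}"
  shows "v (det m) = 0"
proof -
  have nonneg: "v (det a) \<ge> 0" if "a \<in> GLF" "act a (lat {0..}) = lat {0..}" for a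
  proof -
    have "entries_in Ov dm a" using act_lat_0_iff[OF that(1)] that(2) by blast
    then have "det a \<in> Ov" by (rule det_in_ring[OF O_ring])
    then show ?thesis using det_F[OF that(1)] by (simp add: val_level_def)
  qed
  obtain m' where m': "m' \<in> GLF" "m' * m = 1\<^sub>m dm" "v (det m') = - v (det m)"
    using GLF_inverse[OF m] by metis
  have "act m' (lat {0..}) = lat {0..}" using act_cancel[OF m m'(1,2) lat_V[of "{0..}"]] eq by simp
  then show ?thesis using nonneg[OF m eq] nonneg[OF m'(1)] m'(3) by simp
qed

text \<open>The vector numbered \<open>x\<close>. It lies in exactly those \<open>lat S\<close> with
  \<open>x \<in> S\<close>, so a set of numbers can be recovered from its lattice.\<close>

definition std :: "int \<Rightarrow> 'k vec" where
  "std x = (\<pi> powi (x div N)) \<cdot>\<^sub>v unit_vec dm (nat (x mod N))"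

lemma res_lt: "nat (x mod N) < dm" "int (nat (x mod N)) = x mod N"
  using pos_mod_bound[of N x] pos_mod_sign[of N x] by simp_all

lemma std_V: "std x \<in> V"
  unfolding std_def using res_lt field_closed_powi[OF F \<pi>(1)] by (intro V_smult V_unit)

lemma std_lat: "std x \<in> lat S \<longleftrightarrow> x \<in> S"
proof -
  have p: "\<pi> powi k \<noteq> 0" "v (\<pi> powi k) = k" for k using valuation_powi[OF F v \<pi>(1,2)] \<pi> by simp_all
  have "int i + N * v (std x $ i) = x" "std x $ i \<noteq> 0" if "i = nat (x mod N)" for i
    using that res_lt[of x] p by (simp_all add: std_def)
  moreover have "std x $ i = 0" if "i < dm" "i \<noteq> nat (x mod N)" for i
    using that res_lt[of x] by (simp add: std_def)
  ultimately have i: "i < dm \<Longrightarrow> std x $ i \<noteq> 0 \<Longrightarrow> int i + N * v (std x $ i) = x" 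
    and i0: "std x $ nat (x mod N) \<noteq> 0" for i by blast+
  show ?thesis
  proof
    assume "std x \<in> lat S"
    then show "x \<in> S" using i[OF res_lt(1) i0] i0 res_lt(1)[of x] unfolding lat_def by force
  next
    assume "x \<in> S"
    then show "std x \<in> lat S" unfolding lat_def using std_V[of x] i by simp
  qed
qed

lemma lat_subset_iff: "lat S \<subseteq> lat T \<longleftrightarrow> S \<subseteq> T"
proof
  assume "lat S \<subseteq> lat T"
  then show "S \<subseteq> T" using std_lat by blast
qed (auto simp: lat_def)

lemma lat_eq_iff: "lat S = lat T \<longleftrightarrow> S = T"
  using lat_subset_iff[of S T] lat_subset_iff[of T S] by blast

lemma lat_Int: "lat S \<inter> lat T = lat (S \<inter> T)"
  by (auto simp: lat_def)

text \<open>The monomial matrix that realises the reflection on the numbered vectors. Nontrivial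
  powers of \<open>\<pi>\<close> occur only when \<open>N\<close> divides \<open>k\<close>, where
  the reflection leaves \<open>{0..n}\<close>.\<close>

definition refl_mat :: "nat \<Rightarrow> 'k mat" where
  "refl_mat k = mat dm dm (\<lambda>(r, c). if int r = refl_perm (int k) (int c) mod N
     then \<pi> powi (refl_perm (int k) (int c) div N) else 0)"

lemma affine_perm_div_mod: "affine_perm w \<Longrightarrow> w (x mod N) = w x - N * (x div N)"
  using affine_perm_shift[of w "x mod N" "x div N"] by (simp add: mult.commute)

text \<open>Because the reflection is an involution, row \<open>r\<close> has its only nonzero entry
  in the column given by the residue of the reflected \<open>r\<close>, and the exponent changes
  sign.\<close>

lemma refl_mat_mult_vec:
  assumes y: "y \<in> carrier_vec dm" and r: "r < dm"
  shows "(refl_mat k *\<^sub>v y) $ r =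
    \<pi> powi (- (refl_perm (int k) (int r) div N)) * y $ nat (refl_perm (int k) (int r) mod N)"
proof -
  let ?s = "refl_perm (int k)"
  define c where "c = nat (?s (int r) mod N)"
  have c: "c < dm" "int c = ?s (int r) mod N" using res_lt by (simp_all add: c_def)
  have aff: "affine_perm ?s" by (rule affine_perm_refl)
  have sc: "?s (int c) = int r - N * (?s (int r) div N)"
    using affine_perm_div_mod[OF aff, of "?s (int r)"] c(2) by (simp add: refl_perm_invol)
  have r0: "int r mod N = int r" "int r div N = 0" using r by (simp_all add: div_pos_pos_trivial mod_pos_pos_trivial)
  have sc_md: "?s (int c) mod N = int r" "?s (int c) div N = - (?s (int r) div N)"
  proof -
    have e: "?s (int c) = int r + (- (?s (int r) div N)) * N" using sc by simp
    show "?s (int c) mod N = int r" unfolding e mod_mult_self1 using r0 by simp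
    show "?s (int c) div N = - (?s (int r) div N)" unfolding e using r0 by (subst div_mult_self1) simp_all
  qed
  have uniq: "j = c" if j: "j < dm" "int r = ?s (int j) mod N" for j
  proof -
    have "?s (?s (int j) mod N) = int j - N * (?s (int j) div N)"
      using affine_perm_div_mod[OF aff, of "?s (int j)"] by (simp add: refl_perm_invol)
    then have "?s (int r) = int j + (- (?s (int j) div N)) * N" using j(2) by simp
    then have "?s (int r) mod N = int j mod N" by (metis mod_mult_self1)
    then show ?thesis using c(2) j(1) by (simp add: mod_pos_pos_trivial)
  qed
  have "(refl_mat k *\<^sub>v y) $ r = (\<Sum>j<dm. refl_mat k $$ (r, j) * y $ j)"
    using y r by (intro index_mult_mat_vec_sum) (simp_all add: refl_mat_def)
  also have "\<dots> = (\<Sum>j<dm. if j = c then \<pi> powi (?s (int c) div N) * y $ c else 0)"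
  proof (intro sum.cong HOL.refl)
    fix j assume "j \<in> {..<dm}"
    then have j: "j < dm" by simp
    show "refl_mat k $$ (r, j) * y $ j = (if j = c then \<pi> powi (?s (int c) div N) * y $ c else 0)"
    proof (cases "j = c")
      case True
      then show ?thesis using r c(1) sc_md(1) by (simp add: refl_mat_def)
    next
      case False
      then have "int r \<noteq> ?s (int j) mod N" using uniq[OF j] by blast
      then show ?thesis using r j False by (simp add: refl_mat_def)
    qed
  qed
  also have "\<dots> = \<pi> powi (?s (int c) div N) * y $ c" using c(1) by simp
  finally have "(refl_mat k *\<^sub>v y) $ r = \<pi> powi (- (?s (int r) div N)) * y $ c"
    unfolding sc_md(2) .
  then show ?thesis by (simp only: c_def)
qed

lemma refl_mat_carrier: "refl_mat k \<in> carrier_mat dm dm" by (simp add: refl_mat_def)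

lemma refl_mat_entries: "entries_in F dm (refl_mat k)"
  using field_closed_powi[OF F \<pi>(1)] ring_closed_zero[OF RF]
  by (auto simp: entries_in_def refl_mat_def)

lemma refl_mat_invol: "refl_mat k * refl_mat k = 1\<^sub>m dm"
proof (rule mat_eqI_mult_vec)
  fix j assume j: "j < dm"
  let ?s = "refl_perm (int k)" and ?e = "unit_vec dm j :: 'k vec"
  note mc = refl_mat_carrier[of k]
  have c: "refl_mat k *\<^sub>v ?e \<in> carrier_vec dm" using mc by simp
  have "refl_mat k *\<^sub>v (refl_mat k *\<^sub>v ?e) = ?e"
  proof (rule eq_vecI)
    fix r assume "r < dim_vec ?e"
    then have r: "r < dm" by simp
    define c where "c = nat (?s (int r) mod N)"
    have cc: "c < dm" "int c = ?s (int r) mod N" using res_lt by (simp_all add: c_def)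
    have e: "?s (int c) = int r + (- (?s (int r) div N)) * N"
      using affine_perm_div_mod[OF affine_perm_refl, of "int k" "?s (int r)"] cc(2) by (simp add: refl_perm_invol)
    have r0: "int r mod N = int r" "int r div N = 0"
      using r by (intro mod_pos_pos_trivial div_pos_pos_trivial; simp)+
    have sc: "?s (int c) mod N = int r" "?s (int c) div N = - (?s (int r) div N)"
      unfolding e mod_mult_self1 using r0 by (simp, subst div_mult_self1, simp_all)
    have "(refl_mat k *\<^sub>v (refl_mat k *\<^sub>v ?e)) $ r = \<pi> powi (- (?s (int r) div N)) * (refl_mat k *\<^sub>v ?e) $ c"
      unfolding c_def by (rule refl_mat_mult_vec[OF c r])
    also have "(refl_mat k *\<^sub>v ?e) $ c = \<pi> powi (- (?s (int c) div N)) * ?e $ nat (?s (int c) mod N)"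
      by (rule refl_mat_mult_vec[OF _ cc(1)]) simp
    also have "\<pi> powi (- (?s (int r) div N)) * (\<pi> powi (- (?s (int c) div N)) * ?e $ nat (?s (int c) mod N)) = ?e $ r"
      unfolding sc using \<pi>(2) by (simp add: power_int_minus)
    finally show "(refl_mat k *\<^sub>v (refl_mat k *\<^sub>v ?e)) $ r = ?e $ r" .
  qed (use mc in simp)
  then show "refl_mat k * refl_mat k *\<^sub>v ?e = 1\<^sub>m dm *\<^sub>v ?e" using mc j by simp
qed (rule mult_carrier_mat[OF refl_mat_carrier refl_mat_carrier], rule one_carrier_mat)

lemma refl_mat_H: "refl_mat k \<in> H"
proof -
  have "det (refl_mat k) * det (refl_mat k) = 1"
    using det_mult[OF refl_mat_carrier refl_mat_carrier, of k k] refl_mat_invol by simp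
  then have g: "refl_mat k \<in> GLF" using refl_mat_entries by (auto simp: GLF_def)
  have "v (det (refl_mat k)) + v (det (refl_mat k)) = 0"
    using v_det_mult[OF g g] refl_mat_invol valuation_one[OF F v] by simp
  then show ?thesis using g by (simp add: H_def)
qed

lemma act_refl_mat: "act (refl_mat k) (lat S) = lat (refl_perm (int k) ` S)"
proof -
  let ?s = "refl_perm (int k)"
  note g = H_GLF[OF refl_mat_H, of k]
  have sub: "act (refl_mat k) (lat S) \<subseteq> lat (?s ` S)" for S
    unfolding act_def
  proof (rule image_subsetI)
    fix y assume y: "y \<in> lat S"
    have yV: "y \<in> V" using y lat_V by blast
    have "int r + N * v ((refl_mat k *\<^sub>v y) $ r) \<in> ?s ` S"
      if r: "r < dm" and nz: "(refl_mat k *\<^sub>v y) $ r \<noteq> 0" for r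
    proof -
      define q where "q = ?s (int r) div N"
      define c where "c = nat (?s (int r) mod N)"
      have c: "c < dm" "int c = ?s (int r) - N * q" 
        using res_lt by (simp_all add: c_def q_def minus_mult_div_eq_mod)
      have eq: "(refl_mat k *\<^sub>v y) $ r = \<pi> powi (- q) * y $ c"
        unfolding q_def c_def by (rule refl_mat_mult_vec[OF V_carrier[OF yV] r])
      have yc: "y $ c \<noteq> 0" "y $ c \<in> F" using nz eq yV c(1) by (auto simp: V_def)
      have pq: "\<pi> powi (- q) \<in> F" "\<pi> powi (- q) \<noteq> 0" using field_closed_powi[OF F \<pi>(1)] \<pi>(2) by simp_all
      have vv: "v ((refl_mat k *\<^sub>v y) $ r) = - q + v (y $ c)"
        unfolding eq valuation_mult[OF v pq(1) yc(2) pq(2) yc(1)] valuation_powi[OF F v \<pi>(1,2)] \<pi>(3) by simp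
      have "int c + N * v (y $ c) \<in> S" using y c(1) yc(1) unfolding lat_def by blast
      then have "?s (int c + N * v (y $ c)) \<in> ?s ` S" by (rule imageI)
      moreover have "?s (int c + N * v (y $ c)) = int r + N * v ((refl_mat k *\<^sub>v y) $ r)"
      proof -
        have "int c + N * v (y $ c) = ?s (int r) + (v (y $ c) - q) * N" using c(2) by (simp add: algebra_simps)
        then have "?s (int c + N * v (y $ c)) = ?s (?s (int r)) + (v (y $ c) - q) * N"
          using affine_perm_shift[OF affine_perm_refl] by simp
        then show ?thesis unfolding vv refl_perm_invol by (simp add: algebra_simps)
      qed
      ultimately show ?thesis by simp
    qed
    moreover have "refl_mat k *\<^sub>v y \<in> V" by (rule V_mult[OF refl_mat_entries yV])
    ultimately show "refl_mat k *\<^sub>v y \<in> lat (?s ` S)" unfolding lat_def by blast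
  qed
  moreover have "lat (?s ` S) \<subseteq> act (refl_mat k) (lat S)"
  proof -
    have "act (refl_mat k) (lat (?s ` S)) \<subseteq> lat S"
      using sub[of "?s ` S"] by (simp add: image_image refl_perm_invol)
    then have "act (refl_mat k) (act (refl_mat k) (lat (?s ` S))) \<subseteq> act (refl_mat k) (lat S)" by (rule act_mono)
    then show ?thesis using act_cancel[OF g g refl_mat_invol lat_V] by simp
  qed
  ultimately show ?thesis by blast
qed

lemma word_mat: "\<exists>m\<in>H. \<forall>S. act m (lat S) = lat (wperm u ` S)"
proof (induction u)
  case Nil
  show ?case using H_one act_one[OF lat_V] by (intro bexI[of _ "1\<^sub>m dm"]) simp_all
next
  case (Cons i u)
  then obtain m where m: "m \<in> H" "\<And>S. act m (lat S) = lat (wperm u ` S)" by blast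
  have "act (refl_mat i * m) (lat S) = lat (wperm (i # u) ` S)" for S
    using act_mult[OF H_GLF[OF refl_mat_H] H_GLF[OF m(1)] lat_V, of i S] m(2) act_refl_mat
    unfolding wperm_image by simp
  then show ?case using H_mult[OF refl_mat_H m(1)] by blast
qed

text \<open>The determinant of a matrix carrying one standard lattice to another gives the type.\<close>

lemma shift_mat:
  assumes "k \<le> n"
  shows "\<exists>m\<in>GLF. v (det m) = int k \<and> act m (lat {0..}) = lat {int k..}"
proof -
  \<comment> \<open>Multiplying the first \<open>k\<close> coordinates by \<open>\<pi>\<close> moves
    the numbers with residue below \<open>k\<close> on by one period, which turns the ray from
    \<open>0\<close> into the ray from \<open>k\<close>.\<close>
  define m where "m = mat dm dm (\<lambda>(i, j). if i = j then if i < k then \<pi> else 1 else 0 :: 'k)"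
  have mc: "m \<in> carrier_mat dm dm" by (simp add: m_def)
  have "det m = prod_list (diag_mat m)"
    by (rule det_upper_triangular[OF _ mc]) (auto simp: m_def upper_triangular_def)
  also have "\<dots> = (\<Prod>i = 0..<dm. m $$ (i, i))" using mc by (simp add: prod_list_diag_prod)
  also have "\<dots> = (\<Prod>i = 0..<dm. if i < k then \<pi> else 1)" by (intro prod.cong) (simp_all add: m_def)
  also have "\<dots> = (\<Prod>i\<in>{0..<dm} \<inter> {i. i < k}. \<pi>)" by (subst prod.inter_restrict) simp_all
  also have "{0..<dm} \<inter> {i. i < k} = {0..<k}" using assms by auto
  finally have dt: "det m = \<pi> ^ k" by simp
  have g: "m \<in> GLF"
    using \<pi> ring_closed_one[OF RF] ring_closed_zero[OF RF] mc dt
    by (simp add: GLF_def entries_in_def) (simp add: m_def)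
  have mv: "(m *\<^sub>v y) $ i = (if i < k then \<pi> else 1) * y $ i" if "y \<in> carrier_vec dm" "i < dm" for y i
  proof -
    have "(m *\<^sub>v y) $ i = (\<Sum>j<dm. if j = i then (if i < k then \<pi> else 1) * y $ i else 0)"
      unfolding index_mult_mat_vec_sum[OF mc that] using that(2)
      by (intro sum.cong HOL.refl) (auto simp: m_def)
    then show ?thesis using that(2) by simp
  qed
  have lvl: "int k \<le> int i + N * a \<longleftrightarrow> (if i < k then 1 else 0) \<le> a" if "i < dm" for i a
  proof -
    consider "a \<le> -1" | "a = 0" | "1 \<le> a" by linarith
    then show ?thesis
    proof cases
      case 1
      then have "N * a \<le> N * -1" by (intro mult_left_mono) auto
      then have "N * a \<le> - N" by simp
      moreover have "int i < N" using that by simp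
      ultimately have "int i + N * a < 0" by linarith
      then show ?thesis using 1 by auto
    next
      case 2
      then show ?thesis by simp
    next
      case 3
      then have "N * 1 \<le> N * a" by (intro mult_left_mono) auto
      then have "N \<le> N * a" by simp
      moreover have "int k < N" using assms by simp
      ultimately have "int k \<le> int i + N * a" by linarith
      then show ?thesis using 3 by auto
    qed
  qed
  have lat_k: "y \<in> lat {int k..} \<longleftrightarrow> y \<in> V \<and> (\<forall>i<dm. y $ i \<noteq> 0 \<longrightarrow> (if i < k then 1 else 0) \<le> v (y $ i))" for y
    unfolding lat_def using lvl by auto
  have lat_z: "y \<in> lat {0..} \<longleftrightarrow> y \<in> V \<and> (\<forall>i<dm. y $ i \<noteq> 0 \<longrightarrow> 0 \<le> v (y $ i))" for y
    unfolding lat_0 V_def val_level_def by auto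
  have vm: "v (\<pi> * x) = 1 + v x" if "x \<in> F" "x \<noteq> 0" for x
    using valuation_mult[OF v \<pi>(1) that(1) \<pi>(2) that(2)] \<pi>(3) by simp
  have m_iff: "m *\<^sub>v y \<in> lat {int k..} \<longleftrightarrow> y \<in> lat {0..}" if y: "y \<in> V" for y
  proof -
    have "m *\<^sub>v y \<in> V" using V_mult g y by (simp add: GLF_def)
    moreover have "((m *\<^sub>v y) $ i \<noteq> 0 \<longrightarrow> (if i < k then 1 else 0) \<le> v ((m *\<^sub>v y) $ i)) \<longleftrightarrow>
        (y $ i \<noteq> 0 \<longrightarrow> 0 \<le> v (y $ i))" if i: "i < dm" for i
      unfolding mv[OF V_carrier[OF y] i] using vm[of "y $ i"] y i \<pi>(2) by (auto simp: V_def)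
    ultimately show ?thesis unfolding lat_k lat_z using y by blast
  qed
  obtain m' where m': "m' \<in> GLF" "m * m' = 1\<^sub>m dm" using GLF_inverse[OF g] by metis
  have "act m (lat {0..}) = lat {int k..}"
  proof
    show "act m (lat {0..}) \<subseteq> lat {int k..}" using m_iff lat_V unfolding act_def by blast
    show "lat {int k..} \<subseteq> act m (lat {0..})"
    proof
      fix y assume y: "y \<in> lat {int k..}"
      then have yV: "y \<in> V" using lat_V by blast
      have m'y: "m' *\<^sub>v y \<in> V" using V_mult m'(1) yV by (simp add: GLF_def)
      have e: "m *\<^sub>v (m' *\<^sub>v y) = y"
        using assoc_mult_mat_vec[OF mc GLF_carrier[OF m'(1)] V_carrier[OF yV]] m'(2) V_carrier[OF yV] by simp
      then have "m' *\<^sub>v y \<in> lat {0..}" using m_iff[OF m'y] y by simp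
      then show "y \<in> act m (lat {0..})" unfolding act_def using e by (metis imageI)
    qed
  qed
  then show ?thesis using g dt valuation_power[OF F v \<pi>(1,2)] \<pi>(3) by (intro bexI[of _ m]) simp_all
qed

text \<open>Conjugated back to the standard lattice by matrices of determinant value
  \<open>k\<close> and \<open>l\<close>, the map fixes that lattice, so the total determinant value
  \<open>k - l\<close> is zero.\<close>

lemma type_unique:
  assumes m: "m \<in> H" and kl: "k \<le> n" "l \<le> n" and eq: "act m (lat {int k..}) = lat {int l..}"
  shows "k = l"
proof -
  obtain a where a: "a \<in> GLF" "v (det a) = int k" "act a (lat {0..}) = lat {int k..}" using shift_mat[OF kl(1)] by blast
  obtain b where b: "b \<in> GLF" "v (det b) = int l" "act b (lat {0..}) = lat {int l..}" using shift_mat[OF kl(2)] by blast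
  obtain b' where b': "b' \<in> GLF" "b' * b = 1\<^sub>m dm" "v (det b') = - int l"
    using GLF_inverse[OF b(1)] b(2) by metis
  note mG = H_GLF[OF m]
  have ma: "m * a \<in> GLF" by (rule GLF_mult[OF mG a(1)])
  have "act (b' * (m * a)) (lat {0..}) = act b' (act m (act a (lat {0..})))"
    using act_mult[OF b'(1) ma lat_V] act_mult[OF mG a(1) lat_V] by simp
  also have "\<dots> = lat {0..}" unfolding a(3) eq b(3)[symmetric] by (rule act_cancel[OF b(1) b'(1,2) lat_V])
  finally have "v (det (b' * (m * a))) = 0" by (rule stabilizer_v_det[OF GLF_mult[OF b'(1) ma]])
  then show ?thesis using v_det_mult[OF b'(1) ma] v_det_mult[OF mG a(1)] a(2) b'(3) m by (simp add: H_def)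
qed

section \<open>Level functions and the Bruhat decomposition\<close>

definition level :: "'k vec \<Rightarrow> int" where
  "level y = Min ((\<lambda>i. int i + N * v (y $ i)) ` {i. i < dm \<and> y $ i \<noteq> 0})"

text \<open>Different coordinates contribute to \<open>level\<close> in different residue classes,
  so its minimum is attained only once.\<close>

lemma residue_inj:
  assumes "i < dm" "j < dm" "int i + N * a = int j + N * b"
  shows "i = j"
proof -
  have "(int l + N * c) mod N = int l" if "l < dm" for l c
    unfolding mod_mult_self2 using that by (intro mod_pos_pos_trivial) simp_all
  from this[OF assms(1), of a] this[OF assms(2), of b] assms(3) show ?thesis by simp
qed

definition NZ :: "'k vec set" where "NZ = V - {0\<^sub>v dm}"

lemma NZ_V: "y \<in> NZ \<Longrightarrow> y \<in> V" by (simp add: NZ_def)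

lemma NZ_coord:
  assumes "y \<in> NZ"
  obtains i where "i < dm" "y $ i \<noteq> 0"
proof -
  have c: "y \<in> carrier_vec dm" "y \<noteq> 0\<^sub>v dm" using assms by (simp_all add: NZ_def V_def)
  have "\<exists>i<dm. y $ i \<noteq> 0"
  proof (rule ccontr)
    assume "\<not> ?thesis"
    then have "y = 0\<^sub>v dm" using c(1) by (intro eq_vecI) auto
    then show False using c(2) by simp
  qed
  then show ?thesis using that by blast
qed

lemma level_le: "i < dm \<Longrightarrow> y $ i \<noteq> 0 \<Longrightarrow> level y \<le> int i + N * v (y $ i)"
  unfolding level_def by (intro Min_le finite_imageI imageI) simp_all

lemma level_attained:
  assumes "y \<in> NZ"
  obtains i where "i < dm" "y $ i \<noteq> 0" "level y = int i + N * v (y $ i)"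
proof -
  have "{i. i < dm \<and> y $ i \<noteq> 0} \<noteq> {}" using NZ_coord[OF assms] by blast
  then have "level y \<in> (\<lambda>i. int i + N * v (y $ i)) ` {i. i < dm \<and> y $ i \<noteq> 0}"
    unfolding level_def by (intro Min_in) simp_all
  then show ?thesis using that by blast
qed

lemma level_ge:
  assumes "y \<in> NZ" "\<And>i. i < dm \<Longrightarrow> y $ i \<noteq> 0 \<Longrightarrow> k \<le> int i + N * v (y $ i)"
  shows "k \<le> level y"
  using level_attained[OF assms(1)] assms(2) by metis

lemma lat_ray_iff: "y \<in> NZ \<Longrightarrow> y \<in> lat {k..} \<longleftrightarrow> k \<le> level y"
proof
  assume y: "y \<in> NZ" and "y \<in> lat {k..}"
  then show "k \<le> level y" by (intro level_ge) (simp_all add: lat_def)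
next
  assume y: "y \<in> NZ" and k: "k \<le> level y"
  have "k \<le> int i + N * v (y $ i)" if "i < dm" "y $ i \<noteq> 0" for i
    using level_le[OF that] k by simp
  then show "y \<in> lat {k..}" using NZ_V[OF y] by (simp add: lat_def)
qed

lemma zero_lat: "0\<^sub>v dm \<in> lat S"
  using V_zero by (simp add: lat_def)

lemma NZ_smult: "c \<in> F \<Longrightarrow> c \<noteq> 0 \<Longrightarrow> y \<in> NZ \<Longrightarrow> c \<cdot>\<^sub>v y \<in> NZ"
proof -
  assume c: "c \<in> F" "c \<noteq> 0" and y: "y \<in> NZ"
  obtain i where i: "i < dm" "y $ i \<noteq> 0" using NZ_coord[OF y] .
  have yc: "y \<in> carrier_vec dm" by (rule V_carrier[OF NZ_V[OF y]])
  have "(c \<cdot>\<^sub>v y) $ i \<noteq> 0" using i c yc by simp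
  then have "c \<cdot>\<^sub>v y \<noteq> 0\<^sub>v dm" using i(1) by auto
  then show ?thesis using V_smult[OF c(1) NZ_V[OF y]] by (simp add: NZ_def)
qed

text \<open>
  What Bruhat's argument needs to know about the level function of a chamber, that is, of a
  complete periodic chain of lattices.
\<close>

definition level_fun :: "('k vec \<Rightarrow> int) \<Rightarrow> bool" where
  "level_fun \<mu> \<longleftrightarrow>
     (\<forall>c\<in>F - {0}. \<forall>y\<in>NZ. \<mu> (c \<cdot>\<^sub>v y) = N * v c + \<mu> y) \<and>
     (\<forall>x\<in>NZ. \<forall>y\<in>NZ. x + y \<noteq> 0\<^sub>v dm \<longrightarrow> min (\<mu> x) (\<mu> y) \<le> \<mu> (x + y)) \<and>
     (\<forall>x\<in>NZ. \<forall>y\<in>NZ. \<mu> x = \<mu> y \<longrightarrow>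
        (\<exists>c\<in>F - {0}. v c = 0 \<and> (x + c \<cdot>\<^sub>v y \<noteq> 0\<^sub>v dm \<longrightarrow> \<mu> x < \<mu> (x + c \<cdot>\<^sub>v y))))"

lemma level_fun_smult: "level_fun \<mu> \<Longrightarrow> c \<in> F \<Longrightarrow> c \<noteq> 0 \<Longrightarrow> y \<in> NZ \<Longrightarrow> \<mu> (c \<cdot>\<^sub>v y) = N * v c + \<mu> y"
  by (simp add: level_fun_def)

lemma level_fun_add: "level_fun \<mu> \<Longrightarrow> x \<in> NZ \<Longrightarrow> y \<in> NZ \<Longrightarrow> x + y \<noteq> 0\<^sub>v dm \<Longrightarrow> min (\<mu> x) (\<mu> y) \<le> \<mu> (x + y)"
  by (simp add: level_fun_def)

lemma level_fun_cancel:
  assumes "level_fun \<mu>" "x \<in> NZ" "y \<in> NZ" "\<mu> x = \<mu> y"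
  obtains c where "c \<in> F" "c \<noteq> 0" "v c = 0" "x + c \<cdot>\<^sub>v y \<noteq> 0\<^sub>v dm \<Longrightarrow> \<mu> x < \<mu> (x + c \<cdot>\<^sub>v y)"
proof -
  have "\<exists>c\<in>F - {0}. v c = 0 \<and> (x + c \<cdot>\<^sub>v y \<noteq> 0\<^sub>v dm \<longrightarrow> \<mu> x < \<mu> (x + c \<cdot>\<^sub>v y))"
    using assms unfolding level_fun_def by blast
  then show ?thesis using that by blast
qed

lemma minus_one: "-1 \<in> F" "(-1 :: 'k) \<noteq> 0" "v (-1) = 0"
  using ring_closed_uminus[OF RF ring_closed_one[OF RF]] valuation_minus[OF F v ring_closed_one[OF RF]]
    valuation_one[OF F v] by simp_all

text \<open>The usual sharpening of the ultrametric inequality: \<open>x\<close> is recovered as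
  \<open>(x + y) - y\<close>, and the sum is nonzero because \<open>x = - y\<close> would force
  equal levels.\<close>

lemma level_fun_add_distinct:
  assumes \<mu>: "level_fun \<mu>" and x: "x \<in> NZ" and y: "y \<in> NZ" and lt: "\<mu> x < \<mu> y"
  shows "x + y \<in> NZ" "\<mu> (x + y) = \<mu> x"
proof -
  have c: "x \<in> carrier_vec dm" "y \<in> carrier_vec dm" by (rule V_carrier[OF NZ_V[OF x]], rule V_carrier[OF NZ_V[OF y]])
  have my: "(-1) \<cdot>\<^sub>v y \<in> NZ" "\<mu> ((-1) \<cdot>\<^sub>v y) = \<mu> y"
    using NZ_smult[OF minus_one(1,2) y] level_fun_smult[OF \<mu> minus_one(1,2) y] minus_one(3) by simp_all
  have nz: "x + y \<noteq> 0\<^sub>v dm"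
  proof
    assume 0: "x + y = 0\<^sub>v dm"
    have "x = (-1) \<cdot>\<^sub>v y"
    proof (rule eq_vecI)
      fix i assume "i < dim_vec ((-1) \<cdot>\<^sub>v y)"
      then have i: "i < dm" using c by simp
      have "(x + y) $ i = 0" using 0 i by simp
      then have "x $ i + y $ i = 0" using c i by simp
      then show "x $ i = ((-1) \<cdot>\<^sub>v y) $ i" using c i by (simp add: eq_neg_iff_add_eq_0)
    qed (use c in simp)
    then show False using my(2) lt by simp
  qed
  then show s: "x + y \<in> NZ" using V_add[OF NZ_V[OF x] NZ_V[OF y]] by (simp add: NZ_def)
  have e: "(x + y) + (-1) \<cdot>\<^sub>v y = x" using c by (intro eq_vecI) auto
  have "x \<noteq> 0\<^sub>v dm" using x by (simp add: NZ_def)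
  then have "min (\<mu> (x + y)) (\<mu> y) \<le> \<mu> x"
    using level_fun_add[OF \<mu> s my(1)] unfolding e my(2) by blast
  moreover have "min (\<mu> x) (\<mu> y) \<le> \<mu> (x + y)" by (rule level_fun_add[OF \<mu> x y nz])
  ultimately show "\<mu> (x + y) = \<mu> x" using lt by linarith
qed

text \<open>In the third clause equal levels single out the same coordinate \<open>i\<close>, and
  \<open>c = - (x $ i / y $ i)\<close> cancels it. The new level is then outside the residue class
  of \<open>i\<close>, hence strictly larger.\<close>

lemma level_fun_level: "level_fun level"
  unfolding level_fun_def
proof (intro conjI ballI impI)
  fix c y assume c': "c \<in> F - {0}" and y: "y \<in> NZ"
  then have c: "c \<in> F" "c \<noteq> 0" by auto
  have yc: "y \<in> carrier_vec dm" by (rule V_carrier[OF NZ_V[OF y]])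
  have cy: "(c \<cdot>\<^sub>v y) $ i = c * y $ i" "y $ i \<noteq> 0 \<Longrightarrow> v (c * y $ i) = v c + v (y $ i)" if "i < dm" for i
  proof -
    show "(c \<cdot>\<^sub>v y) $ i = c * y $ i" using that yc by simp
    have "y $ i \<in> F" using NZ_V[OF y] that by (simp add: V_def)
    then show "v (c * y $ i) = v c + v (y $ i)" if "y $ i \<noteq> 0"
      using valuation_mult[OF v c(1) _ c(2) that] by blast
  qed
  show "level (c \<cdot>\<^sub>v y) = N * v c + level y"
  proof (rule antisym)
    obtain i where i: "i < dm" "y $ i \<noteq> 0" "level y = int i + N * v (y $ i)" using level_attained[OF y] .
    have "(c \<cdot>\<^sub>v y) $ i \<noteq> 0" unfolding cy(1)[OF i(1)] using i(2) c(2) by simp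
    then have "level (c \<cdot>\<^sub>v y) \<le> int i + N * v ((c \<cdot>\<^sub>v y) $ i)" by (rule level_le[OF i(1)])
    also have "\<dots> = N * v c + level y" unfolding cy(1)[OF i(1)] cy(2)[OF i(1,2)] i(3) by (simp add: algebra_simps)
    finally show "level (c \<cdot>\<^sub>v y) \<le> N * v c + level y" .
    show "N * v c + level y \<le> level (c \<cdot>\<^sub>v y)"
    proof (rule level_ge[OF NZ_smult[OF c y]])
      fix i assume i: "i < dm" "(c \<cdot>\<^sub>v y) $ i \<noteq> 0"
      have nz: "y $ i \<noteq> 0" using i(2) unfolding cy(1)[OF i(1)] by auto
      show "N * v c + level y \<le> int i + N * v ((c \<cdot>\<^sub>v y) $ i)"
        using level_le[OF i(1) nz] unfolding cy(1)[OF i(1)] cy(2)[OF i(1) nz] by (simp add: algebra_simps)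
    qed
  qed
next
  fix x y assume x: "x \<in> NZ" and y: "y \<in> NZ" and nz: "x + y \<noteq> 0\<^sub>v dm"
  have c: "x \<in> carrier_vec dm" "y \<in> carrier_vec dm" by (rule V_carrier[OF NZ_V[OF x]], rule V_carrier[OF NZ_V[OF y]])
  show "min (level x) (level y) \<le> level (x + y)"
  proof (rule level_ge)
    show "x + y \<in> NZ" using nz V_add[OF NZ_V[OF x] NZ_V[OF y]] by (simp add: NZ_def)
    fix i assume i: "i < dm" "(x + y) $ i \<noteq> 0"
    have e: "(x + y) $ i = x $ i + y $ i" using c i(1) by simp
    have mem: "x $ i \<in> F" "y $ i \<in> F" using NZ_V[OF x] NZ_V[OF y] i(1) by (simp_all add: V_def)
    define M where "M = min (level x) (level y)"
    have 1: "M - int i \<le> N * v (x $ i)" if "x $ i \<noteq> 0" using level_le[OF i(1) that] by (simp add: M_def)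
    have 2: "M - int i \<le> N * v (y $ i)" if "y $ i \<noteq> 0" using level_le[OF i(1) that] by (simp add: M_def)
    have "M - int i \<le> N * v (x $ i + y $ i)"
    proof (cases "x $ i = 0 \<or> y $ i = 0")
      case True
      then show ?thesis using 1 2 i(2) unfolding e by auto
    next
      case False
      then have "min (v (x $ i)) (v (y $ i)) \<le> v (x $ i + y $ i)"
        using valuation_add[OF v mem] i(2) unfolding e by blast
      then have "v (x $ i) \<le> v (x $ i + y $ i) \<or> v (y $ i) \<le> v (x $ i + y $ i)" by linarith
      then have "N * v (x $ i) \<le> N * v (x $ i + y $ i) \<or> N * v (y $ i) \<le> N * v (x $ i + y $ i)"
        by (elim disjE) (simp_all add: mult_left_mono)
      then show ?thesis using 1 2 False by linarith
    qed
    then have "min (level x) (level y) - int i \<le> N * v (x $ i + y $ i)" unfolding M_def .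
    then show "min (level x) (level y) \<le> int i + N * v ((x + y) $ i)" unfolding e by simp
  qed
next
  fix x y assume x: "x \<in> NZ" and y: "y \<in> NZ" and eq: "level x = level y"
  have cv: "x \<in> carrier_vec dm" "y \<in> carrier_vec dm" by (rule V_carrier[OF NZ_V[OF x]], rule V_carrier[OF NZ_V[OF y]])
  obtain i where i: "i < dm" "x $ i \<noteq> 0" "level x = int i + N * v (x $ i)" using level_attained[OF x] .
  obtain j where j: "j < dm" "y $ j \<noteq> 0" "level y = int j + N * v (y $ j)" using level_attained[OF y] .
  have ij: "i = j" using residue_inj[OF i(1) j(1), of "v (x $ i)" "v (y $ j)"] i(3) j(3) eq by simp
  have vij: "v (x $ i) = v (y $ i)" using i(3) j(3) eq ij by simp
  have mem: "x $ i \<in> F" "y $ i \<in> F" using NZ_V[OF x] NZ_V[OF y] i(1) by (simp_all add: V_def)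
  define c where "c = - (x $ i / y $ i)"
  have yi: "y $ i \<noteq> 0" using j(2) ij by simp
  have cF: "c \<in> F" "c \<noteq> 0" unfolding c_def
    using field_closed_divide[OF F mem] ring_closed_uminus[OF RF] i(2) yi by simp_all
  have vc: "v c = 0"
    unfolding c_def valuation_minus[OF F v field_closed_divide[OF F mem]] valuation_divide[OF F v mem(1) i(2) mem(2) yi]
    using vij by simp
  have "level x < level (x + c \<cdot>\<^sub>v y)" if nz: "x + c \<cdot>\<^sub>v y \<noteq> 0\<^sub>v dm"
  proof -
    have z: "x + c \<cdot>\<^sub>v y \<in> NZ" using nz V_add[OF NZ_V[OF x] V_smult[OF cF(1) NZ_V[OF y]]] by (simp add: NZ_def)
    obtain l where l: "l < dm" "(x + c \<cdot>\<^sub>v y) $ l \<noteq> 0" "level (x + c \<cdot>\<^sub>v y) = int l + N * v ((x + c \<cdot>\<^sub>v y) $ l)"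
      using level_attained[OF z] .
    have e: "(x + c \<cdot>\<^sub>v y) $ k = x $ k + c * y $ k" if "k < dm" for k using that cv by simp
    have "l \<noteq> i" using l(2) unfolding e[OF l(1)] using yi by (auto simp: c_def)
    have ml: "x $ l \<in> F" "y $ l \<in> F" using NZ_V[OF x] NZ_V[OF y] l(1) by (simp_all add: V_def)
    have cy: "c * y $ l \<in> F" by (rule ring_closed_mult[OF RF cF(1) ml(2)])
    define w where "w = v ((x + c \<cdot>\<^sub>v y) $ l)"
    have 1: "level x \<le> int l + N * v (x $ l)" if "x $ l \<noteq> 0" by (rule level_le[OF l(1) that])
    have 2: "level x \<le> int l + N * v (c * y $ l)" if "y $ l \<noteq> 0"
      using level_le[OF l(1) that] valuation_mult[OF v cF(1) ml(2) cF(2) that] vc eq by simp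
    have "level x \<le> int l + N * w"
    proof (cases "x $ l = 0 \<or> c * y $ l = 0")
      case True
      then show ?thesis using l(2) 1 2 unfolding w_def e[OF l(1)] by auto
    next
      case False
      then have "min (v (x $ l)) (v (c * y $ l)) \<le> w"
        using valuation_add[OF v ml(1) cy] l(2) unfolding w_def e[OF l(1)] by blast
      then have "v (x $ l) \<le> w \<or> v (c * y $ l) \<le> w" by linarith
      then have "N * v (x $ l) \<le> N * w \<or> N * v (c * y $ l) \<le> N * w"
        by (elim disjE) (simp_all add: mult_left_mono)
      moreover have "x $ l \<noteq> 0" "y $ l \<noteq> 0" using False by auto
      ultimately show ?thesis using 1 2 by linarith
    qed
    moreover have "level x \<noteq> int l + N * w"
    proof
      assume "level x = int l + N * w"
      then have "i = l" using i(3) by (intro residue_inj[OF i(1) l(1)]) simp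
      then show False using \<open>l \<noteq> i\<close> by simp
    qed
    ultimately show ?thesis unfolding l(3) w_def[symmetric] by simp
  qed
  then show "\<exists>c\<in>F - {0}. v c = 0 \<and> (x + c \<cdot>\<^sub>v y \<noteq> 0\<^sub>v dm \<longrightarrow> level x < level (x + c \<cdot>\<^sub>v y))"
    using cF vc by (intro bexI[of _ c]) simp_all
qed

lemma GLF_NZ:
  assumes m: "m \<in> GLF" and y: "y \<in> NZ"
  shows "m *\<^sub>v y \<in> NZ"
proof -
  obtain m' where m': "m' \<in> GLF" "m' * m = 1\<^sub>m dm" using GLF_inverse[OF m] by metis
  have yc: "y \<in> carrier_vec dm" by (rule V_carrier[OF NZ_V[OF y]])
  have e: "m' *\<^sub>v (m *\<^sub>v y) = y"
    using assoc_mult_mat_vec[OF GLF_carrier[OF m'(1)] GLF_carrier[OF m] yc] m'(2) yc by simp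
  have "m *\<^sub>v y \<noteq> 0\<^sub>v dm"
  proof
    assume "m *\<^sub>v y = 0\<^sub>v dm"
    then have "y = m' *\<^sub>v 0\<^sub>v dm" using e by simp
    also have "\<dots> = 0\<^sub>v dm" using GLF_carrier[OF m'(1)] by (intro eq_vecI) auto
    finally show False using y by (simp add: NZ_def)
  qed
  moreover have "m *\<^sub>v y \<in> V" using V_mult m NZ_V[OF y] by (simp add: GLF_def)
  ultimately show ?thesis by (simp add: NZ_def)
qed

lemma level_fun_comp:
  assumes \<mu>: "level_fun \<mu>" and m: "m \<in> GLF"
  shows "level_fun (\<lambda>y. \<mu> (m *\<^sub>v y))"
proof -
  note mc = GLF_carrier[OF m]
  have car: "y \<in> carrier_vec dm" if "y \<in> NZ" for y by (rule V_carrier[OF NZ_V[OF that]])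
  have sm: "m *\<^sub>v (c \<cdot>\<^sub>v y) = c \<cdot>\<^sub>v (m *\<^sub>v y)" if "y \<in> NZ" for c y
    by (rule mult_mat_vec[OF mc car[OF that]])
  have ad: "m *\<^sub>v (x + y) = m *\<^sub>v x + m *\<^sub>v y" if "x \<in> carrier_vec dm" "y \<in> carrier_vec dm" for x y
    by (rule mult_add_distrib_mat_vec[OF mc that])
  have nz: "m *\<^sub>v x + m *\<^sub>v y \<noteq> 0\<^sub>v dm" if "x \<in> V" "y \<in> V" "x + y \<noteq> 0\<^sub>v dm" for x y
  proof -
    have "x + y \<in> NZ" using that V_add by (simp add: NZ_def)
    then have "m *\<^sub>v (x + y) \<in> NZ" by (rule GLF_NZ[OF m])
    then show ?thesis using ad[OF V_carrier[OF that(1)] V_carrier[OF that(2)]] by (simp add: NZ_def)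
  qed
  show ?thesis
    unfolding level_fun_def
  proof (intro conjI ballI impI)
    fix c y assume "c \<in> F - {0}" "y \<in> NZ"
    then show "\<mu> (m *\<^sub>v (c \<cdot>\<^sub>v y)) = N * v c + \<mu> (m *\<^sub>v y)"
      using level_fun_smult[OF \<mu> _ _ GLF_NZ[OF m]] sm by simp
  next
    fix x y assume xy: "x \<in> NZ" "y \<in> NZ" "x + y \<noteq> 0\<^sub>v dm"
    show "min (\<mu> (m *\<^sub>v x)) (\<mu> (m *\<^sub>v y)) \<le> \<mu> (m *\<^sub>v (x + y))"
      unfolding ad[OF car[OF xy(1)] car[OF xy(2)]]
      by (rule level_fun_add[OF \<mu> GLF_NZ[OF m xy(1)] GLF_NZ[OF m xy(2)] nz[OF NZ_V[OF xy(1)] NZ_V[OF xy(2)] xy(3)]])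
  next
    fix x y assume x: "x \<in> NZ" and y: "y \<in> NZ" and eq: "\<mu> (m *\<^sub>v x) = \<mu> (m *\<^sub>v y)"
    obtain c where c: "c \<in> F" "c \<noteq> 0" "v c = 0"
      "m *\<^sub>v x + c \<cdot>\<^sub>v (m *\<^sub>v y) \<noteq> 0\<^sub>v dm \<Longrightarrow> \<mu> (m *\<^sub>v x) < \<mu> (m *\<^sub>v x + c \<cdot>\<^sub>v (m *\<^sub>v y))"
      using level_fun_cancel[OF \<mu> GLF_NZ[OF m x] GLF_NZ[OF m y] eq] by blast
    have cy: "c \<cdot>\<^sub>v y \<in> V" by (rule V_smult[OF c(1) NZ_V[OF y]])
    have e: "m *\<^sub>v (x + c \<cdot>\<^sub>v y) = m *\<^sub>v x + c \<cdot>\<^sub>v (m *\<^sub>v y)"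
      unfolding ad[OF car[OF x] V_carrier[OF cy]] sm[OF y] ..
    have "\<mu> (m *\<^sub>v x) < \<mu> (m *\<^sub>v (x + c \<cdot>\<^sub>v y))" if "x + c \<cdot>\<^sub>v y \<noteq> 0\<^sub>v dm"
      unfolding e using nz[OF NZ_V[OF x] cy that] unfolding sm[OF y] by (rule c(4))
    then show "\<exists>c\<in>F - {0}. v c = 0 \<and> (x + c \<cdot>\<^sub>v y \<noteq> 0\<^sub>v dm \<longrightarrow> \<mu> (m *\<^sub>v x) < \<mu> (m *\<^sub>v (x + c \<cdot>\<^sub>v y)))"
      using c(1-3) by (intro bexI[of _ c]) simp_all
  qed
qed

text \<open>The entries of \<open>m\<close> have values at least \<open>- C0\<close>; the constant
  \<open>2 * N + N * C0\<close> also absorbs the rounding between levels and values.\<close>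

lemma level_bounded:
  assumes m: "m \<in> GLF"
  shows "\<exists>C. \<forall>z\<in>NZ. level z - C \<le> level (m *\<^sub>v z)"
proof -
  define C0 where "C0 = Max ((\<lambda>(i, j). - v (m $$ (i, j))) ` ({..<dm} \<times> {..<dm}))"
  have C0: "- C0 \<le> v (m $$ (i, j))" if "i < dm" "j < dm" for i j
  proof -
    have "- v (m $$ (i, j)) \<le> C0"
      unfolding C0_def using that by (intro Max_ge) (auto intro!: image_eqI[of _ _ "(i, j)"])
    then show ?thesis by simp
  qed
  have "level z - (2 * N + N * C0) \<le> level (m *\<^sub>v z)" if z: "z \<in> NZ" for z
  proof (rule level_ge[OF GLF_NZ[OF m z]])
    fix i assume i: "i < dm" "(m *\<^sub>v z) $ i \<noteq> 0"
    define q where "q = (level z - int n) div N"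
    have qN: "N * q > level z - int n - N" "N * q \<le> level z - int n"
    proof -
      have "level z - int n = N * q + (level z - int n) mod N" by (simp add: q_def)
      moreover have "0 \<le> (level z - int n) mod N" "(level z - int n) mod N < N"
        by (rule pos_mod_sign, simp, rule pos_mod_bound, simp)
      ultimately show "N * q > level z - int n - N" "N * q \<le> level z - int n" by linarith+
    qed
    have zc: "z \<in> carrier_vec dm" by (rule V_carrier[OF NZ_V[OF z]])
    have "m $$ (i, j) * z $ j \<in> val_level F v (- C0 + q)" if j: "j < dm" for j
    proof (rule val_level_mult[OF F v])
      show "m $$ (i, j) \<in> val_level F v (- C0)"
        using m C0[OF i(1) j] i(1) j by (simp add: val_level_def GLF_def entries_in_def)
      have "q \<le> v (z $ j)" if "z $ j \<noteq> 0"
      proof (rule ccontr)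
        assume "\<not> q \<le> v (z $ j)"
        then have "N * (v (z $ j) + 1) \<le> N * q" by (intro mult_left_mono) simp_all
        then have "N * v (z $ j) + N \<le> level z - int n" using qN(2) by (simp add: distrib_left)
        then show False using level_le[OF j that] j by simp
      qed
      then show "z $ j \<in> val_level F v q" using NZ_V[OF z] j by (simp add: val_level_def V_def)
    qed
    then have "(m *\<^sub>v z) $ i \<in> val_level F v (- C0 + q)"
      unfolding index_mult_mat_vec_sum[OF GLF_carrier[OF m] zc i(1)] by (intro val_level_sum[OF F v]) simp
    then have "- C0 + q \<le> v ((m *\<^sub>v z) $ i)" using i(2) by (simp add: val_level_def)
    then have "N * (- C0 + q) \<le> N * v ((m *\<^sub>v z) $ i)" by (intro mult_left_mono) simp_all
    then show "level z - (2 * N + N * C0) \<le> int i + N * v ((m *\<^sub>v z) $ i)"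
      using qN(1) by (simp add: algebra_simps)
  qed
  then show ?thesis by blast
qed

lemma level_unit:
  assumes i: "i < dm"
  shows "unit_vec dm i \<in> NZ" "level (unit_vec dm i) = int i"
proof -
  have ui: "unit_vec dm i $ i = (1 :: 'k)" "\<And>j. j < dm \<Longrightarrow> j \<noteq> i \<Longrightarrow> unit_vec dm i $ j = (0 :: 'k)"
    using i by simp_all
  have "unit_vec dm i \<noteq> (0\<^sub>v dm :: 'k vec)"
  proof
    assume "unit_vec dm i = (0\<^sub>v dm :: 'k vec)"
    then have "unit_vec dm i $ i = (0 :: 'k)" using i by simp
    then show False using ui(1) by simp
  qed
  then show nz: "unit_vec dm i \<in> NZ" using V_unit[OF i] by (simp add: NZ_def)
  obtain j where j: "j < dm" "unit_vec dm i $ j \<noteq> (0 :: 'k)" "level (unit_vec dm i) = int j + N * v (unit_vec dm i $ j)"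
    using level_attained[OF nz] .
  have "j = i" using ui(2)[OF j(1)] j(2) by blast
  then show "level (unit_vec dm i) = int i" using j(3) ui(1) valuation_one[OF F v] by simp
qed

text \<open>The analogue of an orthogonal basis: the terms have levels in different residue classes,
  so no two tie and the level of the sum is the least of theirs. The induction removes one nonzero
  coordinate at a time.\<close>

lemma level_fun_combination:
  assumes \<mu>: "level_fun \<mu>" and E: "E \<in> carrier_mat dm dm"
    and e: "\<And>i. i < dm \<Longrightarrow> E *\<^sub>v unit_vec dm i \<in> NZ" "\<And>i. i < dm \<Longrightarrow> \<mu> (E *\<^sub>v unit_vec dm i) = \<omega> i"
    and inj: "\<And>i j a b. i < dm \<Longrightarrow> j < dm \<Longrightarrow> \<omega> i + N * a = \<omega> j + N * b \<Longrightarrow> i = j"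
    and y: "y \<in> NZ"
  shows "E *\<^sub>v y \<in> NZ \<and> (\<exists>i<dm. y $ i \<noteq> 0 \<and> \<mu> (E *\<^sub>v y) = \<omega> i + N * v (y $ i)) \<and>
    (\<forall>i<dm. y $ i \<noteq> 0 \<longrightarrow> \<mu> (E *\<^sub>v y) \<le> \<omega> i + N * v (y $ i))"
  using y
proof (induction "card {i. i < dm \<and> y $ i \<noteq> 0}" arbitrary: y rule: less_induct)
  case less
  obtain i where i: "i < dm" "y $ i \<noteq> 0" using NZ_coord[OF less.prems] .
  have yV: "y \<in> V" by (rule NZ_V[OF less.prems])
  have yc: "y \<in> carrier_vec dm" by (rule V_carrier[OF yV])
  define c where "c = y $ i"
  have c: "c \<in> F" "c \<noteq> 0" using yV i by (simp_all add: c_def V_def)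
  define z where "z = vec dm (\<lambda>j. if j = i then 0 else y $ j)"
  have zc: "z \<in> carrier_vec dm" by (simp add: z_def)
  have zj: "z $ j = (if j = i then 0 else y $ j)" if "j < dm" for j using that by (simp add: z_def)
  have zV: "z \<in> V" using yV zc zj ring_closed_zero[OF RF] by (simp add: V_def)
  have y_eq: "y = z + c \<cdot>\<^sub>v unit_vec dm i"
  proof (rule eq_vecI)
    fix j assume "j < dim_vec (z + c \<cdot>\<^sub>v unit_vec dm i)"
    then have j: "j < dm" by simp
    then show "y $ j = (z + c \<cdot>\<^sub>v unit_vec dm i) $ j" using zj[OF j] i(1) by (simp add: c_def)
  qed (use yc in simp)
  let ?u = "E *\<^sub>v unit_vec dm i"
  have cu: "c \<cdot>\<^sub>v ?u \<in> NZ" "\<mu> (c \<cdot>\<^sub>v ?u) = \<omega> i + N * v (y $ i)"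
    using NZ_smult[OF c e(1)[OF i(1)]] level_fun_smult[OF \<mu> c e(1)[OF i(1)]] e(2)[OF i(1)]
    by (simp_all add: c_def)
  have Ey: "E *\<^sub>v y = E *\<^sub>v z + c \<cdot>\<^sub>v ?u"
    unfolding y_eq using mult_add_distrib_mat_vec[OF E zc, of "c \<cdot>\<^sub>v unit_vec dm i"]
      mult_mat_vec[OF E unit_vec_carrier, of c i] by simp
  show ?case
  proof (cases "z = 0\<^sub>v dm")
    case True
    have "E *\<^sub>v z = 0\<^sub>v dm" unfolding True using E by (intro eq_vecI) auto
    then have Ey': "E *\<^sub>v y = c \<cdot>\<^sub>v ?u" using Ey V_carrier[OF NZ_V[OF cu(1)]] by simp
    have ji: "j = i" if "j < dm" "y $ j \<noteq> 0" for j
    proof (rule ccontr)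
      assume "j \<noteq> i"
      then have "z $ j = y $ j" using zj[OF that(1)] by simp
      then show False using that True by simp
    qed
    have le: "\<mu> (E *\<^sub>v y) \<le> \<omega> j + N * v (y $ j)" if "j < dm" "y $ j \<noteq> 0" for j
      unfolding Ey' cu(2) ji[OF that] by (rule order_refl)
    have eq: "\<mu> (E *\<^sub>v y) = \<omega> i + N * v (y $ i)" unfolding Ey' by (rule cu(2))
    have "E *\<^sub>v y \<in> NZ" unfolding Ey' by (rule cu(1))
    then show ?thesis using le eq i by blast
  next
    case False
    then have zN: "z \<in> NZ" using zV by (simp add: NZ_def)
    have "{j. j < dm \<and> z $ j \<noteq> 0} \<subset> {j. j < dm \<and> y $ j \<noteq> 0}"
    proof
      show "{j. j < dm \<and> z $ j \<noteq> 0} \<subseteq> {j. j < dm \<and> y $ j \<noteq> 0}"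
      proof
        fix j assume "j \<in> {j. j < dm \<and> z $ j \<noteq> 0}"
        then have j: "j < dm" "z $ j \<noteq> 0" by simp_all
        have "j \<noteq> i" using zj[OF j(1)] j(2) by (cases "j = i") simp_all
        then show "j \<in> {j. j < dm \<and> y $ j \<noteq> 0}" using zj[OF j(1)] j by simp
      qed
      have "i \<notin> {j. j < dm \<and> z $ j \<noteq> 0}" using zj[OF i(1)] by simp
      then show "{j. j < dm \<and> z $ j \<noteq> 0} \<noteq> {j. j < dm \<and> y $ j \<noteq> 0}" using i by blast
    qed
    then have "card {j. j < dm \<and> z $ j \<noteq> 0} < card {j. j < dm \<and> y $ j \<noteq> 0}"
      by (intro psubset_card_mono) simp_all
    from less.hyps[OF this zN] obtain l where l: "E *\<^sub>v z \<in> NZ" "l < dm" "z $ l \<noteq> 0"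
      "\<mu> (E *\<^sub>v z) = \<omega> l + N * v (z $ l)"
      and le: "\<And>j. j < dm \<Longrightarrow> z $ j \<noteq> 0 \<Longrightarrow> \<mu> (E *\<^sub>v z) \<le> \<omega> j + N * v (z $ j)" by blast
    have li: "l \<noteq> i" using zj[OF l(2)] l(3) by (cases "l = i") simp_all
    then have li: "l \<noteq> i" "z $ l = y $ l" using zj[OF l(2)] by simp_all
    have le': "\<mu> (E *\<^sub>v z) \<le> \<omega> j + N * v (y $ j)" if "j < dm" "y $ j \<noteq> 0" "j \<noteq> i" for j
      using le[OF that(1)] zj[OF that(1)] that by simp
    have ne: "\<mu> (E *\<^sub>v z) \<noteq> \<mu> (c \<cdot>\<^sub>v ?u)"
      using inj[OF l(2) i(1), of "v (z $ l)" "v (y $ i)"] li(1) l(4) cu(2) by auto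
    show ?thesis
    proof (cases "\<mu> (E *\<^sub>v z) < \<mu> (c \<cdot>\<^sub>v ?u)")
      case True
      note s = level_fun_add_distinct[OF \<mu> l(1) cu(1) True]
      have "\<mu> (E *\<^sub>v y) \<le> \<omega> j + N * v (y $ j)" if "j < dm" "y $ j \<noteq> 0" for j
        using le'[OF that] True cu(2) unfolding Ey s(2) by (cases "j = i") simp_all
      moreover have "\<mu> (E *\<^sub>v y) = \<omega> l + N * v (y $ l)" unfolding Ey s(2) l(4) li(2) ..
      moreover have "E *\<^sub>v y \<in> NZ" unfolding Ey by (rule s(1))
      moreover have "y $ l \<noteq> 0" using l(3) li(2) by simp
      ultimately show ?thesis using l(2) by blast
    next
      case False
      then have lt: "\<mu> (c \<cdot>\<^sub>v ?u) < \<mu> (E *\<^sub>v z)" using ne by simp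
      have comm: "E *\<^sub>v z + c \<cdot>\<^sub>v ?u = c \<cdot>\<^sub>v ?u + E *\<^sub>v z"
        using V_carrier[OF NZ_V[OF cu(1)]] V_carrier[OF NZ_V[OF l(1)]] by (rule comm_add_vec[symmetric])
      note s = level_fun_add_distinct[OF \<mu> cu(1) l(1) lt]
      have "\<mu> (E *\<^sub>v y) \<le> \<omega> j + N * v (y $ j)" if "j < dm" "y $ j \<noteq> 0" for j
        using le'[OF that] lt cu(2) unfolding Ey comm s(2) by (cases "j = i") simp_all
      moreover have "\<mu> (E *\<^sub>v y) = \<omega> i + N * v (y $ i)" unfolding Ey comm s(2) cu(2) ..
      moreover have "E *\<^sub>v y \<in> NZ" unfolding Ey comm by (rule s(1))
      ultimately show ?thesis using i by blast
    qed
  qed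
qed

text \<open>The \<open>dm\<close> columns of \<open>E\<close> and a unit vector are dependent;
  injectivity forces the unit vector to occur in the relation, which puts it into the image and
  yields the inverse column by column.\<close>

lemma injective_GLF:
  assumes E: "entries_in F dm E" and inj: "\<And>y. y \<in> NZ \<Longrightarrow> E *\<^sub>v y \<in> NZ"
  shows "E \<in> GLF"
proof -
  have Ec: "E \<in> carrier_mat dm dm" by (rule entries_carrier[OF E])
  have ex: "\<exists>b\<in>V. E *\<^sub>v b = unit_vec dm j" if j: "j < dm" for j
  proof -
    define c where "c r i = (if r < dm then E $$ (i, r) else unit_vec dm j $ i)" for r i
    have "\<exists>\<alpha>. (\<forall>r\<in>{..dm}. \<alpha> r \<in> F) \<and> (\<exists>r\<in>{..dm}. \<alpha> r \<noteq> 0) \<and>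
        (\<forall>i\<in>{..<dm}. (\<Sum>r\<in>{..dm}. \<alpha> r * c r i) = 0)"
    proof (rule dependent_family[OF F])
      fix r i assume "r \<in> {..dm}" "i \<in> {..<dm}"
      then show "c r i \<in> F"
        using E ring_closed_zero[OF RF] ring_closed_one[OF RF] j by (simp add: c_def entries_in_def)
    qed simp_all
    then obtain \<alpha> where \<alpha>: "\<And>r. r \<le> dm \<Longrightarrow> \<alpha> r \<in> F" "\<exists>r\<in>{..dm}. \<alpha> r \<noteq> 0"
      "\<And>i. i < dm \<Longrightarrow> (\<Sum>r\<in>{..dm}. \<alpha> r * c r i) = 0" by auto
    define y where "y = vec dm \<alpha>"
    have yc: "y \<in> carrier_vec dm" by (simp add: y_def)
    have yV: "y \<in> V" using \<alpha>(1) by (simp add: V_def y_def)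
    have rel: "(E *\<^sub>v y) $ i + \<alpha> dm * unit_vec dm j $ i = 0" if i: "i < dm" for i
    proof -
      have "{..dm} = insert dm {..<dm}" by auto
      then have "(\<Sum>r\<in>{..dm}. \<alpha> r * c r i) = \<alpha> dm * c dm i + (\<Sum>r<dm. \<alpha> r * c r i)" by simp
      also have "(\<Sum>r<dm. \<alpha> r * c r i) = (\<Sum>r<dm. E $$ (i, r) * y $ r)"
        by (intro sum.cong HOL.refl) (simp add: c_def y_def mult.commute)
      also have "\<dots> = (E *\<^sub>v y) $ i" by (rule index_mult_mat_vec_sum[OF Ec yc i, symmetric])
      finally show ?thesis using \<alpha>(3)[OF i] by (simp add: c_def add.commute)
    qed
    have nz: "\<alpha> dm \<noteq> 0"
    proof
      assume 0: "\<alpha> dm = 0"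
      obtain r where r: "r \<le> dm" "\<alpha> r \<noteq> 0" using \<alpha>(2) by auto
      then have r': "r < dm" using 0 by (cases "r = dm") auto
      have "y $ r \<noteq> 0" using r r' by (simp add: y_def)
      then have "y \<noteq> 0\<^sub>v dm" using r' by auto
      then have "E *\<^sub>v y \<in> NZ" using inj yV by (simp add: NZ_def)
      then obtain i where "i < dm" "(E *\<^sub>v y) $ i \<noteq> 0" using NZ_coord by blast
      then show False using rel 0 by simp
    qed
    let ?c = "- inverse (\<alpha> dm)"
    have cF: "?c \<in> F" by (intro ring_closed_uminus RF field_closed_inverse[OF F] \<alpha>(1)) simp
    have "E *\<^sub>v (?c \<cdot>\<^sub>v y) = unit_vec dm j"
    proof (rule eq_vecI)
      fix i assume "i < dim_vec (unit_vec dm j :: 'k vec)"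
      then have i: "i < dm" by simp
      have "(E *\<^sub>v (?c \<cdot>\<^sub>v y)) $ i = ?c * (E *\<^sub>v y) $ i"
        unfolding mult_mat_vec[OF Ec yc] using i Ec by simp
      also have "(E *\<^sub>v y) $ i = - (\<alpha> dm * unit_vec dm j $ i)" using rel[OF i] by (simp only: eq_neg_iff_add_eq_0)
      also have "?c * - (\<alpha> dm * unit_vec dm j $ i) = unit_vec dm j $ i" using nz by simp
      finally show "(E *\<^sub>v (?c \<cdot>\<^sub>v y)) $ i = unit_vec dm j $ i" .
    qed (use Ec in simp)
    then show ?thesis using V_smult[OF cF yV] by blast
  qed
  then obtain b where b: "\<And>j. j < dm \<Longrightarrow> b j \<in> V \<and> E *\<^sub>v b j = unit_vec dm j" by metis
  define E' where "E' = mat dm dm (\<lambda>(i, j). b j $ i)"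
  have E'c: "E' \<in> carrier_mat dm dm" by (simp add: E'_def)
  have col: "E' *\<^sub>v unit_vec dm j = b j" if j: "j < dm" for j
  proof (rule eq_vecI)
    have bc: "b j \<in> carrier_vec dm" using b[OF j] V_carrier by blast
    show "dim_vec (E' *\<^sub>v unit_vec dm j) = dim_vec (b j)" using bc E'c by simp
    fix i assume "i < dim_vec (b j)"
    then have i: "i < dm" using bc by simp
    have "(E' *\<^sub>v unit_vec dm j) $ i = (\<Sum>l<dm. E' $$ (i, l) * unit_vec dm j $ l)"
      by (rule index_mult_mat_vec_sum[OF E'c unit_vec_carrier i])
    also have "\<dots> = (\<Sum>l<dm. if l = j then b j $ i else 0)"
      using i j by (intro sum.cong HOL.refl) (simp add: E'_def)
    finally show "(E' *\<^sub>v unit_vec dm j) $ i = b j $ i" using j by simp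
  qed
  have "E * E' = 1\<^sub>m dm"
  proof (rule mat_eqI_mult_vec)
    fix j assume j: "j < dm"
    have "E * E' *\<^sub>v unit_vec dm j = E *\<^sub>v (E' *\<^sub>v unit_vec dm j)"
      by (rule assoc_mult_mat_vec[OF Ec E'c unit_vec_carrier])
    also have "\<dots> = unit_vec dm j" unfolding col[OF j] using b[OF j] by blast
    also have "\<dots> = 1\<^sub>m dm *\<^sub>v unit_vec dm j" by simp
    finally show "E * E' *\<^sub>v unit_vec dm j = 1\<^sub>m dm *\<^sub>v unit_vec dm j" .
  qed (rule mult_carrier_mat[OF Ec E'c], rule one_carrier_mat)
  then have "det E * det E' = 1" using det_mult[OF Ec E'c] by simp
  then show ?thesis using E by (auto simp: GLF_def)
qed

lemma act_iff:
  assumes m: "m \<in> GLF" "m' \<in> GLF" "m * m' = 1\<^sub>m dm" "m' * m = 1\<^sub>m dm" and A: "A \<subseteq> V"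
  shows "x \<in> act m A \<longleftrightarrow> x \<in> V \<and> m' *\<^sub>v x \<in> A"
proof
  assume "x \<in> act m A"
  then obtain y where y: "y \<in> A" "x = m *\<^sub>v y" unfolding act_def by blast
  have yV: "y \<in> V" using y A by blast
  have "m' *\<^sub>v (m *\<^sub>v y) = y"
    using assoc_mult_mat_vec[OF GLF_carrier[OF m(2)] GLF_carrier[OF m(1)] V_carrier[OF yV]] m(4) V_carrier[OF yV] by simp
  moreover have "x \<in> V" using V_mult m(1) yV y(2) by (simp add: GLF_def)
  ultimately show "x \<in> V \<and> m' *\<^sub>v x \<in> A" using y by simp
next
  assume x: "x \<in> V \<and> m' *\<^sub>v x \<in> A"
  have "m *\<^sub>v (m' *\<^sub>v x) = x"
    using assoc_mult_mat_vec[OF GLF_carrier[OF m(1)] GLF_carrier[OF m(2)], of x] m(3) V_carrier[of x] x by simp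
  then show "x \<in> act m A" unfolding act_def using x by (metis imageI)
qed

lemma maximal_level:
  assumes i: "i < dm" and bd: "\<And>y. y \<in> NZ \<Longrightarrow> \<mu> y \<le> level y + C"
  shows "\<exists>e\<in>NZ. level e = int i \<and> (\<forall>y\<in>NZ. level y = int i \<longrightarrow> \<mu> y \<le> \<mu> e)"
proof -
  define P where "P y \<longleftrightarrow> y \<in> NZ \<and> level y = int i" for y
  have "P (unit_vec dm i)" using level_unit[OF i] by (simp add: P_def)
  then obtain e where e: "P e" "\<And>y. P y \<Longrightarrow> nat (int i + C - \<mu> e) \<le> nat (int i + C - \<mu> y)"
    using ex_has_least_nat[of P "unit_vec dm i" "\<lambda>y. nat (int i + C - \<mu> y)"] by blast
  have "\<mu> y \<le> \<mu> e" if y: "y \<in> NZ" "level y = int i" for y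
  proof -
    have "\<mu> y \<le> int i + C" "\<mu> e \<le> int i + C" using bd[OF y(1)] bd[of e] y(2) e(1) by (simp_all add: P_def)
    moreover have "nat (int i + C - \<mu> e) \<le> nat (int i + C - \<mu> y)" using e(2)[of y] y by (simp add: P_def)
    ultimately show ?thesis by linarith
  qed
  then show ?thesis using e(1) by (intro bexI[of _ e]) (simp_all add: P_def)
qed

text \<open>If two maximisers had \<open>\<mu>\<close>-values in the same residue class, rescaling
  one would make the values equal, and the cancelling combination would have larger
  \<open>\<mu>\<close>. Its level is that of the summand of smaller level, against the maximality of
  that one.\<close>

lemma maximal_levels_distinct:
  assumes \<mu>: "level_fun \<mu>"
    and e: "\<And>i. i < dm \<Longrightarrow> e i \<in> NZ" "\<And>i. i < dm \<Longrightarrow> level (e i) = int i"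
      "\<And>i y. i < dm \<Longrightarrow> y \<in> NZ \<Longrightarrow> level y = int i \<Longrightarrow> \<mu> y \<le> \<mu> (e i)"
    and ij: "i < dm" "j < dm" and eq: "\<mu> (e i) + N * a = \<mu> (e j) + N * b"
  shows "i = j"
proof (rule ccontr)
  assume ne: "i \<noteq> j"
  define q where "q = b - a"
  have q: "\<mu> (e i) = \<mu> (e j) + N * q" using eq by (simp add: q_def algebra_simps)
  have p: "\<pi> powi k \<in> F" "\<pi> powi k \<noteq> 0" "v (\<pi> powi k) = k" for k
    using field_closed_powi[OF F \<pi>(1)] \<pi>(2,3) valuation_powi[OF F v \<pi>(1,2)] by simp_all
  define y where "y = \<pi> powi q \<cdot>\<^sub>v e j"
  note x = e(1)[OF ij(1)]
  have y: "y \<in> NZ" "\<mu> y = \<mu> (e i)" "level y = int j + N * q"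
    unfolding y_def using NZ_smult[OF p(1,2) e(1)[OF ij(2)]] level_fun_smult[OF \<mu> p(1,2) e(1)[OF ij(2)]]
      level_fun_smult[OF level_fun_level p(1,2) e(1)[OF ij(2)]] e(2)[OF ij(2)] q p(3) by simp_all
  obtain c where c: "c \<in> F" "c \<noteq> 0" "v c = 0" "e i + c \<cdot>\<^sub>v y \<noteq> 0\<^sub>v dm \<Longrightarrow> \<mu> (e i) < \<mu> (e i + c \<cdot>\<^sub>v y)"
    using level_fun_cancel[OF \<mu> x y(1) y(2)[symmetric]] by blast
  have cy: "c \<cdot>\<^sub>v y \<in> NZ" "level (c \<cdot>\<^sub>v y) = int j + N * q"
    using NZ_smult[OF c(1,2) y(1)] level_fun_smult[OF level_fun_level c(1,2) y(1)] c(3) y(3) by simp_all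
  have lne: "int i \<noteq> int j + N * q" using residue_inj[OF ij, of 0 q] ne by auto
  show False
  proof (cases "int i < int j + N * q")
    case True
    then have "level (e i) < level (c \<cdot>\<^sub>v y)" using e(2)[OF ij(1)] cy(2) by simp
    note s = level_fun_add_distinct[OF level_fun_level x cy(1) this]
    have "\<mu> (e i + c \<cdot>\<^sub>v y) \<le> \<mu> (e i)" using e(3)[OF ij(1) s(1)] s(2) e(2)[OF ij(1)] by simp
    moreover have "e i + c \<cdot>\<^sub>v y \<noteq> 0\<^sub>v dm" using s(1) by (simp add: NZ_def)
    ultimately show False using c(4) by simp
  next
    case False
    then have "level (c \<cdot>\<^sub>v y) < level (e i)" using lne e(2)[OF ij(1)] cy(2) by simp
    note s = level_fun_add_distinct[OF level_fun_level cy(1) x this]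
    have comm: "c \<cdot>\<^sub>v y + e i = e i + c \<cdot>\<^sub>v y"
      by (rule comm_add_vec[OF V_carrier[OF NZ_V[OF cy(1)]] V_carrier[OF NZ_V[OF x]]])
    let ?z = "e i + c \<cdot>\<^sub>v y"
    have z: "?z \<in> NZ" "level ?z = int j + N * q" using s cy(2) unfolding comm by simp_all
    have "?z \<noteq> 0\<^sub>v dm" using z(1) by (simp add: NZ_def)
    then have lt: "\<mu> (e i) < \<mu> ?z" by (rule c(4))
    have w: "\<pi> powi (- q) \<cdot>\<^sub>v ?z \<in> NZ" "level (\<pi> powi (- q) \<cdot>\<^sub>v ?z) = int j" "\<mu> (\<pi> powi (- q) \<cdot>\<^sub>v ?z) = \<mu> ?z - N * q"
      using NZ_smult[OF p(1,2) z(1)] level_fun_smult[OF level_fun_level p(1,2) z(1), of "- q"]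
        level_fun_smult[OF \<mu> p(1,2) z(1), of "- q"] z(2) p(3)[of "- q"] by simp_all
    have "\<mu> ?z - N * q \<le> \<mu> (e j)" using e(3)[OF ij(2) w(1,2)] w(3) by simp
    then show False using lt q by simp
  qed
qed

lemma mult_vec_zero: "m \<in> carrier_mat dm dm \<Longrightarrow> m *\<^sub>v 0\<^sub>v dm = (0\<^sub>v dm :: 'k vec)"
  by (intro eq_vecI) auto

text \<open>
  Bruhat decomposition: \<open>e\<close> fixes the standard chamber and carries its apartment to one that
  contains the chamber of \<open>h\<close>. The columns of \<open>e\<close> maximise the level function of \<open>h\<close> among the
  vectors of given standard level.
\<close>

lemma bruhat:
  assumes h: "h \<in> H"
  shows "\<exists>e\<in>H. \<exists>u\<in>lists {..n}. (\<forall>k. act e (lat {k..}) = lat {k..}) \<and>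
    (\<forall>k. act h (lat {k..}) = act e (lat (wperm u ` {k..})))"
proof -
  obtain h' where h': "h' \<in> H" "h * h' = 1\<^sub>m dm" "h' * h = 1\<^sub>m dm" using H_inverse[OF h] .
  note hG = H_GLF[OF h] and h'G = H_GLF[OF h'(1)]
  \<comment> \<open>The standard level transported by \<open>h\<close>. The bound \<open>C\<close>
    against the standard level guarantees that the maxima below exist.\<close>
  define \<mu> where "\<mu> y = level (h' *\<^sub>v y)" for y
  have \<mu>: "level_fun \<mu>" unfolding \<mu>_def by (rule level_fun_comp[OF level_fun_level h'G])
  obtain C where C: "\<And>z. z \<in> NZ \<Longrightarrow> level z - C \<le> level (h *\<^sub>v z)" using level_bounded[OF hG] by blast
  have bd: "\<mu> y \<le> level y + C" if y: "y \<in> NZ" for y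
  proof -
    have "h *\<^sub>v (h' *\<^sub>v y) = y"
      using assoc_mult_mat_vec[OF GLF_carrier[OF hG] GLF_carrier[OF h'G] V_carrier[OF NZ_V[OF y]]] h'(2)
        V_carrier[OF NZ_V[OF y]] by simp
    then show ?thesis using C[OF GLF_NZ[OF h'G y]] by (simp add: \<mu>_def)
  qed
  have "\<forall>i. i < dm \<longrightarrow> (\<exists>e. e \<in> NZ \<and> level e = int i \<and> (\<forall>y\<in>NZ. level y = int i \<longrightarrow> \<mu> y \<le> \<mu> e))"
    using maximal_level[of _ \<mu> C, OF _ bd] by blast
  then obtain e where e: "\<And>i. i < dm \<Longrightarrow> e i \<in> NZ" "\<And>i. i < dm \<Longrightarrow> level (e i) = int i"
    and emax: "\<And>i. i < dm \<Longrightarrow> \<forall>y\<in>NZ. level y = int i \<longrightarrow> \<mu> y \<le> \<mu> (e i)" by metis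
  have emax': "\<mu> y \<le> \<mu> (e i)" if "i < dm" "y \<in> NZ" "level y = int i" for i y
    using emax[OF that(1)] that(2,3) by blast
  define \<omega> where "\<omega> i = \<mu> (e i)" for i
  have inj: "i = j" if "i < dm" "j < dm" "\<omega> i + N * a = \<omega> j + N * b" for i j a b
    using maximal_levels_distinct[OF \<mu> e emax' that(1,2)] that(3) unfolding \<omega>_def by blast
  define E where "E = mat dm dm (\<lambda>(r, i). e i $ r)"
  have Ec: "E \<in> carrier_mat dm dm" by (simp add: E_def)
  have col: "E *\<^sub>v unit_vec dm j = e j" if j: "j < dm" for j
  proof (rule eq_vecI)
    have bc: "e j \<in> carrier_vec dm" using V_carrier[OF NZ_V[OF e(1)[OF j]]] .
    show "dim_vec (E *\<^sub>v unit_vec dm j) = dim_vec (e j)" using bc Ec by simp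
    fix i assume "i < dim_vec (e j)"
    then have i: "i < dm" using bc by simp
    have "(E *\<^sub>v unit_vec dm j) $ i = (\<Sum>l<dm. E $$ (i, l) * unit_vec dm j $ l)"
      by (rule index_mult_mat_vec_sum[OF Ec unit_vec_carrier i])
    also have "\<dots> = (\<Sum>l<dm. if l = j then e j $ i else 0)"
      using i j by (intro sum.cong HOL.refl) (simp add: E_def)
    finally show "(E *\<^sub>v unit_vec dm j) $ i = e j $ i" using j by simp
  qed
  have Ent: "entries_in F dm E"
  proof (rule entries_inI[OF Ec])
    fix i j assume ij: "i < dm" "j < dm"
    then have "e j $ i \<in> F" using NZ_V[OF e(1)[OF ij(2)]] by (simp add: V_def)
    then show "E $$ (i, j) \<in> F" using ij by (simp add: E_def)
  qed
  have colN: "E *\<^sub>v unit_vec dm i \<in> NZ" "level (E *\<^sub>v unit_vec dm i) = int i" "\<mu> (E *\<^sub>v unit_vec dm i) = \<omega> i"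
    if "i < dm" for i
    unfolding col[OF that] \<omega>_def using e[OF that] by simp_all
  \<comment> \<open>The columns split both level functions at once: their standard levels are
    \<open>0, ..., n\<close>, and their values \<open>\<omega>\<close> are distinct modulo
    \<open>N\<close>.\<close>
  have lev: "E *\<^sub>v y \<in> NZ" "\<exists>i<dm. y $ i \<noteq> 0 \<and> level (E *\<^sub>v y) = int i + N * v (y $ i)"
    "\<And>i. i < dm \<Longrightarrow> y $ i \<noteq> 0 \<Longrightarrow> level (E *\<^sub>v y) \<le> int i + N * v (y $ i)" if y: "y \<in> NZ" for y
  proof -
    have "E *\<^sub>v y \<in> NZ \<and> (\<exists>i<dm. y $ i \<noteq> 0 \<and> level (E *\<^sub>v y) = int i + N * v (y $ i)) \<and>
      (\<forall>i<dm. y $ i \<noteq> 0 \<longrightarrow> level (E *\<^sub>v y) \<le> int i + N * v (y $ i))"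
      by (rule level_fun_combination[where \<omega> = int, OF level_fun_level Ec colN(1,2) _ y]) (assumption, assumption, erule (2) residue_inj)
    then show "E *\<^sub>v y \<in> NZ" "\<exists>i<dm. y $ i \<noteq> 0 \<and> level (E *\<^sub>v y) = int i + N * v (y $ i)"
      "\<And>i. i < dm \<Longrightarrow> y $ i \<noteq> 0 \<Longrightarrow> level (E *\<^sub>v y) \<le> int i + N * v (y $ i)" by blast+
  qed
  have mu: "\<exists>i<dm. y $ i \<noteq> 0 \<and> \<mu> (E *\<^sub>v y) = \<omega> i + N * v (y $ i)"
    "\<And>i. i < dm \<Longrightarrow> y $ i \<noteq> 0 \<Longrightarrow> \<mu> (E *\<^sub>v y) \<le> \<omega> i + N * v (y $ i)" if y: "y \<in> NZ" for y
  proof -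
    have "E *\<^sub>v y \<in> NZ \<and> (\<exists>i<dm. y $ i \<noteq> 0 \<and> \<mu> (E *\<^sub>v y) = \<omega> i + N * v (y $ i)) \<and>
      (\<forall>i<dm. y $ i \<noteq> 0 \<longrightarrow> \<mu> (E *\<^sub>v y) \<le> \<omega> i + N * v (y $ i))"
      by (rule level_fun_combination[where \<omega> = \<omega>, OF \<mu> Ec colN(1,3) _ y]) (assumption, assumption, erule (2) inj)
    then show "\<exists>i<dm. y $ i \<noteq> 0 \<and> \<mu> (E *\<^sub>v y) = \<omega> i + N * v (y $ i)"
      "\<And>i. i < dm \<Longrightarrow> y $ i \<noteq> 0 \<Longrightarrow> \<mu> (E *\<^sub>v y) \<le> \<omega> i + N * v (y $ i)" by blast+
  qed
  have EG: "E \<in> GLF" by (rule injective_GLF[OF Ent lev(1)])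
  obtain E' where E': "E' \<in> GLF" "E * E' = 1\<^sub>m dm" "E' * E = 1\<^sub>m dm" using GLF_inverse[OF EG] by metis
  have EE': "E *\<^sub>v (E' *\<^sub>v z) = z" if "z \<in> V" for z
    using assoc_mult_mat_vec[OF Ec GLF_carrier[OF E'(1)] V_carrier[OF that]] E'(2) V_carrier[OF that] by simp
  have act_E: "act A (lat {k..}) = act E (lat S)"
    if A: "A \<in> GLF" "A' \<in> GLF" "A * A' = 1\<^sub>m dm" "A' * A = 1\<^sub>m dm"
      and iff: "\<And>y. y \<in> NZ \<Longrightarrow> k \<le> level (A' *\<^sub>v (E *\<^sub>v y)) \<longleftrightarrow> y \<in> lat S" for A A' k S
  proof (rule Set.set_eqI)
    fix z
    show "z \<in> act A (lat {k..}) \<longleftrightarrow> z \<in> act E (lat S)"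
      unfolding act_iff[OF A lat_V] act_iff[OF EG E'(1-3) lat_V]
    proof (rule conj_cong[OF HOL.refl])
      assume z: "z \<in> V"
      show "A' *\<^sub>v z \<in> lat {k..} \<longleftrightarrow> E' *\<^sub>v z \<in> lat S"
      proof (cases "z = 0\<^sub>v dm")
        case True
        then show ?thesis
          using mult_vec_zero[OF GLF_carrier[OF A(2)]] mult_vec_zero[OF GLF_carrier[OF E'(1)]] zero_lat by simp
      next
        case False
        then have zN: "z \<in> NZ" using z by (simp add: NZ_def)
        note yN = GLF_NZ[OF E'(1) zN] and wN = GLF_NZ[OF A(2) zN]
        show ?thesis using iff[OF yN] lat_ray_iff[OF wN, of k] unfolding EE'[OF z] by blast
      qed
    qed
  qed
  \<comment> \<open>\<open>w\<close> compares two numberings: the image under \<open>E\<close> of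
    the vector numbered \<open>x\<close> has level \<open>w x\<close> with respect to
    \<open>h\<close>.\<close>
  define w where "w x = \<omega> (nat (x mod N)) + N * (x div N)" for x
  have w_coord: "w (int i + N * a) = \<omega> i + N * a" if "i < dm" for i a
  proof -
    have "(int i + N * a) mod N = int i" "(int i + N * a) div N = a"
      unfolding mod_mult_self2 using that by (simp_all add: mod_pos_pos_trivial div_pos_pos_trivial)
    then show ?thesis by (simp add: w_def)
  qed
  have decomp: "x = int (nat (x mod N)) + N * (x div N)" for x using res_lt(2)[of x] by simp
  have inj_w: "inj w"
  proof (rule injI)
    fix x y assume "w x = w y"
    then have *: "\<omega> (nat (x mod N)) + N * (x div N) = \<omega> (nat (y mod N)) + N * (y div N)" by (simp add: w_def)
    then have r: "nat (x mod N) = nat (y mod N)" by (rule inj[OF res_lt(1) res_lt(1)])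
    then have "N * (x div N) = N * (y div N)" using * by simp
    then show "x = y" using decomp[of x] decomp[of y] r by simp
  qed
  \<comment> \<open>The \<open>n + 1\<close> values \<open>\<omega> i\<close> lie in different
    residue classes and therefore meet every class.\<close>
  have surj_w: "surj w"
  proof -
    define g where "g i = nat (\<omega> i mod N)" for i
    have g_inj: "inj_on g {..<dm}"
    proof (rule inj_onI)
      fix i j assume ij: "i \<in> {..<dm}" "j \<in> {..<dm}" "g i = g j"
      then have "\<omega> i mod N = \<omega> j mod N" using res_lt(2) by (metis g_def)
      then have "\<omega> i + N * (\<omega> j div N) = \<omega> j + N * (\<omega> i div N)"
        using mult_div_mod_eq[of N "\<omega> i"] mult_div_mod_eq[of N "\<omega> j"] by linarith
      then show "i = j" using ij by (intro inj) simp_all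
    qed
    have "g ` {..<dm} = {..<dm}"
      using g_inj res_lt(1) by (intro endo_inj_surj) (auto simp: g_def)
    have "\<exists>x. z = w x" for z
    proof -
      have "nat (z mod N) \<in> g ` {..<dm}" unfolding \<open>g ` {..<dm} = {..<dm}\<close> using res_lt(1) by simp
      then obtain i where i: "i < dm" "nat (z mod N) = nat (\<omega> i mod N)" by (auto simp: g_def)
      then have "z mod N = \<omega> i mod N" using res_lt(2) by metis
      then have "z = \<omega> i + N * (z div N - \<omega> i div N)"
        using mult_div_mod_eq[of N z] mult_div_mod_eq[of N "\<omega> i"] right_diff_distrib[of N "z div N" "\<omega> i div N"]
        by linarith
      then show ?thesis using w_coord[OF i(1)] by metis
    qed
    then show ?thesis unfolding surj_def by blast
  qed
  have aff: "affine_perm w"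
  proof -
    have "w (x + N) = w x + N" for x
      by (simp add: w_def div_add_N distrib_left)
    then show ?thesis using inj_w surj_w by (simp add: affine_perm_def bij_def)
  qed
  \<comment> \<open>A translation \<open>c\<close> may remain, since \<open>w\<close> is only an
    extended affine permutation; the determinants exclude it at the end.\<close>
  obtain u c where u: "u \<in> lists {..n}" "w = (\<lambda>x. wperm u x + c)"
    using reduced_word_up_to_shift[OF aff] by blast
  have pre: "{x. k \<le> w x} = wperm (rev u) ` {k - c..}" for k
  proof (intro Set.set_eqI iffI)
    fix x assume "x \<in> {x. k \<le> w x}"
    then have "wperm u x \<in> {k - c..}" using u(2) by simp
    moreover have "x = wperm (rev u) (wperm u x)" using fun_cong[OF wperm_rev(1), of u x] by simp
    ultimately show "x \<in> wperm (rev u) ` {k - c..}" by (metis imageI)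
  next
    fix x assume "x \<in> wperm (rev u) ` {k - c..}"
    then obtain y where "y \<ge> k - c" "x = wperm (rev u) y" by auto
    moreover from this have "wperm u x = y" using fun_cong[OF wperm_rev(2), of u y] by simp
    ultimately show "x \<in> {x. k \<le> w x}" using u(2) by simp
  qed
  have act_h: "act h (lat {k..}) = act E (lat (wperm (rev u) ` {k - c..}))" for k
  proof (rule act_E[OF hG h'G h'(2,3)])
    fix y assume y: "y \<in> NZ"
    have "k \<le> \<mu> (E *\<^sub>v y) \<longleftrightarrow> (\<forall>i<dm. y $ i \<noteq> 0 \<longrightarrow> k \<le> \<omega> i + N * v (y $ i))"
    proof
      assume "k \<le> \<mu> (E *\<^sub>v y)"
      then show "\<forall>i<dm. y $ i \<noteq> 0 \<longrightarrow> k \<le> \<omega> i + N * v (y $ i)" using mu(2)[OF y] by (meson order_trans)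
    next
      assume "\<forall>i<dm. y $ i \<noteq> 0 \<longrightarrow> k \<le> \<omega> i + N * v (y $ i)"
      then show "k \<le> \<mu> (E *\<^sub>v y)" using mu(1)[OF y] by auto
    qed
    also have "\<dots> \<longleftrightarrow> y \<in> lat {x. k \<le> w x}"
      using NZ_V[OF y] w_coord by (simp add: lat_def)
    finally show "k \<le> level (h' *\<^sub>v (E *\<^sub>v y)) \<longleftrightarrow> y \<in> lat (wperm (rev u) ` {k - c..})"
      unfolding \<mu>_def pre .
  qed
  have act_E0: "act E (lat {k..}) = lat {k..}" for k
  proof -
    have "act (1\<^sub>m dm) (lat {k..}) = act E (lat {k..})"
    proof (rule act_E[OF GLF_one GLF_one])
      fix y assume y: "y \<in> NZ"
      have "k \<le> level (E *\<^sub>v y) \<longleftrightarrow> k \<le> level y"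
      proof (intro iffI)
        assume "k \<le> level (E *\<^sub>v y)"
        then show "k \<le> level y" using lev(3)[OF y] by (intro level_ge[OF y]) (meson order_trans)
      next
        assume "k \<le> level y"
        then show "k \<le> level (E *\<^sub>v y)" using lev(2)[OF y] level_le by (metis order_trans)
      qed
      then show "k \<le> level (1\<^sub>m dm *\<^sub>v (E *\<^sub>v y)) \<longleftrightarrow> y \<in> lat {k..}"
        using lat_ray_iff[OF y] V_carrier[OF NZ_V[OF lev(1)[OF y]]] by simp
    qed simp_all
    then show ?thesis using act_one[OF lat_V] by simp
  qed
  have EH: "E \<in> H" using EG stabilizer_v_det[OF EG act_E0[of 0]] by (simp add: H_def)
  obtain m where m: "m \<in> H" "\<And>S. act m (lat S) = lat (wperm (rev u) ` S)" using word_mat[of "rev u"] by blast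
  have Em: "E * m \<in> H" by (rule H_mult[OF EH m(1)])
  have act_h': "act h (lat {k..}) = act (E * m) (lat {k - c..})" for k
    unfolding act_h act_mult[OF EG H_GLF[OF m(1)] lat_V] m(2) ..
  obtain a where a: "a \<in> H" "E * m * a = 1\<^sub>m dm" "a * (E * m) = 1\<^sub>m dm" using H_inverse[OF Em] .
  define b where "b = a * h"
  have bH: "b \<in> H" unfolding b_def by (rule H_mult[OF a(1) h])
  have act_b: "act b (lat {0..}) = lat {- c..}"
    unfolding b_def act_mult[OF H_GLF[OF a(1)] hG lat_V] act_h'[of 0]
    using act_cancel[OF H_GLF[OF Em] H_GLF[OF a(1)] a(3) lat_V] by simp
  \<comment> \<open>\<open>b\<close> has determinant of value zero and maps the standard lattice to
    the one starting at \<open>- c\<close>. Whichever of the two contains the other,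
    \<open>H_stabilizes\<close> turns the inclusion into equality.\<close>
  have "c = 0"
  proof (cases "c \<le> 0")
    case True
    then have "act b (lat {0..}) \<subseteq> lat {0..}" unfolding act_b lat_subset_iff by auto
    then have "lat {- c..} = lat {0..}" using H_stabilizes[OF bH] act_b by simp
    then have "{- c..} = {0..}" unfolding lat_eq_iff .
    then show ?thesis by simp
  next
    case False
    obtain b' where b': "b' \<in> H" "b * b' = 1\<^sub>m dm" "b' * b = 1\<^sub>m dm" using H_inverse[OF bH] .
    have "act b' (lat {- c..}) = lat {0..}"
      unfolding act_b[symmetric] by (rule act_cancel[OF H_GLF[OF bH] H_GLF[OF b'(1)] b'(3) lat_V])
    moreover have "lat {0..} \<subseteq> lat {- c..}" unfolding lat_subset_iff using False by auto
    ultimately have "act b' (lat {0..}) \<subseteq> lat {0..}" using act_mono by blast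
    then have "act b' (lat {0..}) = lat {0..}" by (rule H_stabilizes[OF b'(1)])
    then have "act b (lat {0..}) = lat {0..}"
      using act_cancel[OF H_GLF[OF b'(1)] H_GLF[OF bH] b'(2) lat_V[of "{0..}"]] by simp
    then have "{- c..} = {0..}" unfolding act_b lat_eq_iff .
    then show ?thesis by simp
  qed
  then have "act h (lat {k..}) = act E (lat (wperm (rev u) ` {k..}))" for k using act_h[of k] by simp
  then show ?thesis using EH act_E0 u(1) rev_lists[of u "{..n}"] by blast
qed

section \<open>Vertices, types and common apartments\<close>

definition vtx :: "'k mat \<Rightarrow> int set \<Rightarrow> 'k vec set" where
  "vtx g S = act g (lat S)"

lemma vtx_inj: "g \<in> H \<Longrightarrow> vtx g S = vtx g T \<Longrightarrow> S = T"
proof -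
  assume g: "g \<in> H" and eq: "vtx g S = vtx g T"
  obtain g' where g': "g' \<in> H" "g' * g = 1\<^sub>m dm" using H_inverse[OF g] by metis
  have "act g' (vtx g A) = lat A" for A
    unfolding vtx_def by (rule act_cancel[OF H_GLF[OF g] H_GLF[OF g'(1)] g'(2) lat_V])
  then have "lat S = lat T" using eq by metis
  then show "S = T" unfolding lat_eq_iff .
qed

lemma vtx_mult: "a \<in> H \<Longrightarrow> b \<in> H \<Longrightarrow> vtx (a * b) S = act a (vtx b S)"
  unfolding vtx_def by (intro act_mult H_GLF lat_V)

lemma vtx_word:
  assumes g: "g \<in> H"
  shows "\<exists>a\<in>H. \<forall>S. vtx a S = vtx g (wperm u ` S)"
proof -
  obtain m where m: "m \<in> H" "\<And>S. act m (lat S) = lat (wperm u ` S)" using word_mat[of u] by blast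
  have "vtx (g * m) S = vtx g (wperm u ` S)" for S
    unfolding vtx_mult[OF g m(1)] unfolding vtx_def m(2) ..
  then show ?thesis using H_mult[OF g m(1)] by blast
qed

lemma ray_Nil: "ray [] k = {int k..}" by (simp add: ray_def)

text \<open>The words are absorbed into matrices \<open>a\<close> and \<open>b\<close>; the Bruhat
  decomposition of \<open>a' * b\<close> finds an apartment containing the standard chamber and its
  image, and \<open>a\<close> moves it back.\<close>

lemma chambers_common_apartment:
  assumes g: "g \<in> H" "g' \<in> H"
  shows "\<exists>e\<in>H. \<exists>x\<in>lists {..n}. \<exists>y\<in>lists {..n}. \<forall>k. vtx e (ray x k) = vtx g (ray u k) \<and> vtx e (ray y k) = vtx g' (ray u' k)"
proof -
  obtain a where a: "a \<in> H" "\<And>S. vtx a S = vtx g (wperm u ` S)" using vtx_word[OF g(1)] by blast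
  obtain b where b: "b \<in> H" "\<And>S. vtx b S = vtx g' (wperm u' ` S)" using vtx_word[OF g(2)] by blast
  obtain a' where a': "a' \<in> H" "a * a' = 1\<^sub>m dm" using H_inverse[OF a(1)] by metis
  obtain e x where e: "e \<in> H" "x \<in> lists {..n}" "\<And>k. act e (lat {k..}) = lat {k..}"
    "\<And>k. act (a' * b) (lat {k..}) = act e (lat (wperm x ` {k..}))"
    using bruhat[OF H_mult[OF a'(1) b(1)]] by blast
  have ae: "a * e \<in> H" by (rule H_mult[OF a(1) e(1)])
  have 1: "vtx (a * e) (ray [] k) = vtx g (ray u k)" for k
    unfolding vtx_mult[OF a(1) e(1)] ray_Nil unfolding vtx_def[of e] e(3)
    using a(2)[of "{int k..}"] by (simp add: vtx_def ray_def)
  have 2: "vtx (a * e) (ray x k) = vtx g' (ray u' k)" for k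
  proof -
    have "vtx (a * e) (ray x k) = act a (act (a' * b) (lat {int k..}))"
      unfolding vtx_mult[OF a(1) e(1)] unfolding vtx_def ray_def e(4) ..
    also have "\<dots> = act a (act a' (vtx b {int k..}))"
      unfolding vtx_def by (simp only: act_mult[OF H_GLF[OF a'(1)] H_GLF[OF b(1)] lat_V])
    also have "\<dots> = vtx b {int k..}"
      unfolding vtx_def using act_V[OF H_GLF[OF b(1)] lat_V]
      by (intro act_cancel[OF H_GLF[OF a'(1)] H_GLF[OF a(1)] a'(2)])
    finally show ?thesis unfolding b(2) ray_def .
  qed
  show ?thesis using ae 1 2 e(2) by (intro bexI[of _ "a * e"] bexI[of _ "[]"] bexI[of _ x]) simp_all
qed

lemma vtx_type:
  assumes g: "g \<in> H" "g' \<in> H" and eq: "vtx g (ray u k) = vtx g' (ray u' l)" and kl: "k \<le> n" "l \<le> n"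
  shows "k = l"
proof -
  obtain a where a: "a \<in> H" "\<And>S. vtx a S = vtx g (wperm u ` S)" using vtx_word[OF g(1)] by blast
  obtain b where b: "b \<in> H" "\<And>S. vtx b S = vtx g' (wperm u' ` S)" using vtx_word[OF g(2)] by blast
  obtain b' where b': "b' \<in> H" "b' * b = 1\<^sub>m dm" using H_inverse[OF b(1)] by metis
  have "vtx a {int k..} = vtx b {int l..}" unfolding a(2) b(2) using eq by (simp add: ray_def)
  then have "act (b' * a) (lat {int k..}) = act b' (act b (lat {int l..}))"
    using act_mult[OF H_GLF[OF b'(1)] H_GLF[OF a(1)] lat_V] by (simp add: vtx_def)
  also have "\<dots> = lat {int l..}" by (rule act_cancel[OF H_GLF[OF b(1)] H_GLF[OF b'(1)] b'(2) lat_V])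
  finally show ?thesis by (rule type_unique[OF H_mult[OF b'(1) a(1)] kl])
qed

text \<open>Translating numbers by whole periods is scaling by powers of \<open>\<pi>\<close>; this
  extends agreement on the \<open>n + 1\<close> rays of a chamber to the whole periodic
  chain.\<close>

lemma lat_shift: "lat ((\<lambda>x. x + N * q) ` S) = (\<lambda>y. \<pi> powi q \<cdot>\<^sub>v y) ` lat S"
proof -
  have p: "\<pi> powi k \<in> F" "\<pi> powi k \<noteq> 0" "v (\<pi> powi k) = k" for k
    using field_closed_powi[OF F \<pi>(1)] \<pi>(2,3) valuation_powi[OF F v \<pi>(1,2)] by simp_all
  have sub: "(\<lambda>y. \<pi> powi q \<cdot>\<^sub>v y) ` lat S \<subseteq> lat ((\<lambda>x. x + N * q) ` S)" for q S
  proof (rule image_subsetI)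
    fix y assume y: "y \<in> lat S"
    then have yV: "y \<in> V" using lat_V by blast
    have "int i + N * v ((\<pi> powi q \<cdot>\<^sub>v y) $ i) \<in> (\<lambda>x. x + N * q) ` S"
      if i: "i < dm" "(\<pi> powi q \<cdot>\<^sub>v y) $ i \<noteq> 0" for i
    proof -
      have e: "(\<pi> powi q \<cdot>\<^sub>v y) $ i = \<pi> powi q * y $ i" using V_carrier[OF yV] i(1) by simp
      have yi: "y $ i \<noteq> 0" using i(2) e by auto
      have "y $ i \<in> F" using yV i(1) by (simp add: V_def)
      then have "int i + N * v ((\<pi> powi q \<cdot>\<^sub>v y) $ i) = (int i + N * v (y $ i)) + N * q"
        unfolding e using valuation_mult[OF v p(1) _ p(2) yi] p(3) by (simp add: distrib_left)
      moreover have "int i + N * v (y $ i) \<in> S" using y i(1) yi by (simp add: lat_def)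
      ultimately show ?thesis by blast
    qed
    then show "\<pi> powi q \<cdot>\<^sub>v y \<in> lat ((\<lambda>x. x + N * q) ` S)" using V_smult[OF p(1) yV] by (simp add: lat_def)
  qed
  moreover have "lat ((\<lambda>x. x + N * q) ` S) \<subseteq> (\<lambda>y. \<pi> powi q \<cdot>\<^sub>v y) ` lat S"
  proof
    fix y assume y: "y \<in> lat ((\<lambda>x. x + N * q) ` S)"
    have "\<pi> powi (- q) \<cdot>\<^sub>v y \<in> lat ((\<lambda>x. x + N * - q) ` (\<lambda>x. x + N * q) ` S)" using sub[of "- q"] y by blast
    moreover have "(\<lambda>x. x + N * - q) ` (\<lambda>x. x + N * q) ` S = S" by (simp add: image_image)
    ultimately have "\<pi> powi (- q) \<cdot>\<^sub>v y \<in> lat S" by simp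
    moreover have "y = \<pi> powi q \<cdot>\<^sub>v (\<pi> powi (- q) \<cdot>\<^sub>v y)"
      using \<pi>(2) by (simp add: smult_smult_assoc power_int_minus)
    ultimately show "y \<in> (\<lambda>y. \<pi> powi q \<cdot>\<^sub>v y) ` lat S" by blast
  qed
  ultimately show ?thesis by blast
qed

lemma vtx_shift:
  assumes g: "g \<in> H"
  shows "vtx g ((\<lambda>x. x + N * q) ` S) = (\<lambda>y. \<pi> powi q \<cdot>\<^sub>v y) ` vtx g S"
proof -
  have "g *\<^sub>v (\<pi> powi q \<cdot>\<^sub>v y) = \<pi> powi q \<cdot>\<^sub>v (g *\<^sub>v y)" if "y \<in> lat S" for y
    using mult_mat_vec[OF GLF_carrier[OF H_GLF[OF g]] V_carrier] that lat_V by blast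
  then show ?thesis unfolding vtx_def act_def lat_shift image_image by (intro image_cong HOL.refl) simp
qed

text \<open>
  A lattice in two apartments with a common chamber has the same coordinates in both: they are
  the positions at which its intersection with the chain of the chamber jumps.
\<close>

lemma common_chamber_retraction:
  assumes g: "g \<in> H" "g' \<in> H" and eq: "\<And>k. k \<le> n \<Longrightarrow> vtx g {int k..} = vtx g' {int k..}"
    and ST: "vtx g S = vtx g' T"
  shows "S = T"
proof -
  have all: "vtx g {x..} = vtx g' {x..}" for x
  proof -
    have k: "nat (x mod N) \<le> n" using res_lt(1)[of x] by simp
    have e: "{x..} = (\<lambda>y. y + N * (x div N)) ` {int (nat (x mod N))..}"
    proof -
      have x: "x = int (nat (x mod N)) + N * (x div N)" using res_lt(2)[of x] by simp
      define r where "r = int (nat (x mod N))"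
      define q where "q = N * (x div N)"
      have "x = r + q" using x unfolding r_def q_def .
      have "{x..} = (\<lambda>y. y + q) ` {r..}"
      proof (intro Set.set_eqI iffI)
        fix y assume "y \<in> {x..}"
        then show "y \<in> (\<lambda>y. y + q) ` {r..}" using \<open>x = r + q\<close> by (intro image_eqI[of _ _ "y - q"]) simp_all
      next
        fix y assume "y \<in> (\<lambda>y. y + q) ` {r..}"
        then show "y \<in> {x..}" using \<open>x = r + q\<close> by auto
      qed
      then show ?thesis unfolding r_def q_def .
    qed
    show ?thesis unfolding e vtx_shift[OF g(1)] vtx_shift[OF g(2)] eq[OF k] ..
  qed
  have Int: "vtx a A \<inter> vtx a B = vtx a (A \<inter> B)" if a: "a \<in> H" for a A B
  proof -
    obtain a' where a': "a' \<in> H" "a * a' = 1\<^sub>m dm" "a' * a = 1\<^sub>m dm" using H_inverse[OF a] .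
    note ai = act_iff[OF H_GLF[OF a] H_GLF[OF a'(1)] a'(2,3) lat_V]
    show ?thesis unfolding vtx_def
      by (rule Set.set_eqI, unfold Int_iff ai, unfold lat_Int[symmetric] Int_iff) blast
  qed
  have sub: "vtx a A \<subseteq> vtx a B \<longleftrightarrow> A \<subseteq> B" if a: "a \<in> H" for a A B
  proof -
    have "vtx a A \<subseteq> vtx a B \<longleftrightarrow> vtx a A \<inter> vtx a B = vtx a A" by blast
    also have "\<dots> \<longleftrightarrow> A \<inter> B = A" unfolding Int[OF a] using vtx_inj[OF a, of "A \<inter> B" A] by auto
    finally show ?thesis by blast
  qed
  \<comment> \<open>The number \<open>x\<close> belongs to \<open>A\<close> exactly when the
    intersections with the chain jump between \<open>x\<close> and \<open>x + 1\<close>, a condition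
    on lattices alone.\<close>
  have mem: "x \<in> A \<longleftrightarrow> \<not> vtx a A \<inter> vtx a {x..} \<subseteq> vtx a {x + 1..}" if a: "a \<in> H" for a A x
  proof -
    have "A \<inter> {x..} \<subseteq> {x + 1..} \<longleftrightarrow> x \<notin> A"
    proof
      assume "A \<inter> {x..} \<subseteq> {x + 1..}"
      then show "x \<notin> A" by auto
    next
      assume "x \<notin> A"
      show "A \<inter> {x..} \<subseteq> {x + 1..}"
      proof
        fix y assume "y \<in> A \<inter> {x..}"
        then have "y \<noteq> x" "x \<le> y" using \<open>x \<notin> A\<close> by auto
        then show "y \<in> {x + 1..}" by simp
      qed
    qed
    then show ?thesis unfolding Int[OF a] sub[OF a] by (metis (no_types))
  qed
  show ?thesis
  proof (rule Set.set_eqI)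
    fix x
    show "x \<in> S \<longleftrightarrow> x \<in> T" unfolding mem[OF g(1), of x S] mem[OF g(2), of x T] ST all ..
  qed
qed

end

section \<open>Buildings from charts\<close>

lemma iso_coxeter_complex_image:
  assumes f: "inj_on f (vertices \<Delta>)" and iso: "iso_coxeter_complex I m \<Delta>"
  shows "iso_coxeter_complex I m ((`) f ` \<Delta>)"
proof -
  obtain h where h0: "bij_betw h \<Delta> (coxeter_complex I m) \<and> (\<forall>s\<in>\<Delta>. \<forall>t\<in>\<Delta>. s \<subseteq> t \<longleftrightarrow> h t \<subseteq> h s)"
    using iso unfolding iso_coxeter_complex_def by (elim exE)
  note h = conjunct1[OF h0] conjunct2[OF h0, rule_format]
  have inj: "inj_on ((`) f) \<Delta>" using f unfolding vertices_def by (rule inj_on_image)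
  define k where "k = inv_into \<Delta> ((`) f)"
  have k: "k (f ` s) = s" if "s \<in> \<Delta>" for s unfolding k_def using inj that by (rule inv_into_f_f)
  have "bij_betw k ((`) f ` \<Delta>) \<Delta>"
    unfolding k_def by (rule bij_betw_inv_into[OF inj_on_imp_bij_betw[OF inj]])
  then have "bij_betw (h \<circ> k) ((`) f ` \<Delta>) (coxeter_complex I m)" using h(1) by (rule bij_betw_trans)
  moreover have "f ` s \<subseteq> f ` t \<longleftrightarrow> (h \<circ> k) (f ` t) \<subseteq> (h \<circ> k) (f ` s)" if "s \<in> \<Delta>" "t \<in> \<Delta>" for s t
  proof -
    have "s \<subseteq> vertices \<Delta>" "t \<subseteq> vertices \<Delta>" using that unfolding vertices_def by blast+
    then have "f ` s \<subseteq> f ` t \<longleftrightarrow> s \<subseteq> t"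
      using inj_on_image_eq_iff[OF f, of "s \<union> t" t] by (simp add: image_Un Un_subset_iff subset_Un_eq[of "f ` s"] subset_Un_eq[of s t])
    then show ?thesis using h(2)[OF that] k that by simp
  qed
  ultimately show ?thesis
    unfolding iso_coxeter_complex_def by (intro exI[of _ "h \<circ> k"] conjI ballI) (assumption, elim imageE, simp)
qed

lemma vertices_image: "vertices ((`) f ` \<Delta>) = f ` vertices \<Delta>"
  unfolding vertices_def by blast

lemma simplicial_complex_image: "simplicial_complex \<Delta> \<Longrightarrow> simplicial_complex ((`) f ` \<Delta>)"
  unfolding simplicial_complex_def
proof (intro ballI conjI allI impI)
  assume *: "\<forall>s\<in>\<Delta>. finite s \<and> s \<noteq> {} \<and> (\<forall>t. t \<subseteq> s \<and> t \<noteq> {} \<longrightarrow> t \<in> \<Delta>)"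
  fix s' assume "s' \<in> (`) f ` \<Delta>"
  then obtain s where s: "s \<in> \<Delta>" "s' = f ` s" by blast
  show "finite s'" "s' \<noteq> {}" using s * by auto
  fix t assume t: "t \<subseteq> s' \<and> t \<noteq> {}"
  then obtain t0 where "t0 \<subseteq> s" "t = f ` t0" using s(2) by (metis subset_imageE)
  moreover from this t have "t0 \<noteq> {}" by blast
  ultimately show "t \<in> (`) f ` \<Delta>" using * s(1) by blast
qed

lemma simplicial_iso_image:
  assumes f: "inj_on f (vertices \<Delta>)"
  shows "simplicial_iso f \<Delta> ((`) f ` \<Delta>)"
  unfolding simplicial_iso_def vertices_image
proof (intro conjI allI impI)
  show "bij_betw f (vertices \<Delta>) (f ` vertices \<Delta>)" using f by (rule inj_on_imp_bij_betw)
  fix s assume s: "s \<subseteq> vertices \<Delta>"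
  have "s = t" if "t \<in> \<Delta>" "f ` s = f ` t" for t
    using inj_on_image_eq_iff[OF f s, of t] that unfolding vertices_def by blast
  then show "s \<in> \<Delta> \<longleftrightarrow> f ` s \<in> (`) f ` \<Delta>" by blast
qed

lemma simplicial_iso_inv:
  assumes f: "simplicial_iso f \<Delta> \<Delta>'"
  shows "simplicial_iso (inv_into (vertices \<Delta>) f) \<Delta>' \<Delta>"
  unfolding simplicial_iso_def
proof (intro conjI allI impI)
  have b: "bij_betw f (vertices \<Delta>) (vertices \<Delta>')"
    and iff: "\<And>s. s \<subseteq> vertices \<Delta> \<Longrightarrow> s \<in> \<Delta> \<longleftrightarrow> f ` s \<in> \<Delta>'" using f unfolding simplicial_iso_def by blast+
  show bi: "bij_betw (inv_into (vertices \<Delta>) f) (vertices \<Delta>') (vertices \<Delta>)" by (rule bij_betw_inv_into[OF b])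
  fix s assume s: "s \<subseteq> vertices \<Delta>'"
  have "inv_into (vertices \<Delta>) f ` s \<subseteq> vertices \<Delta>" using s bij_betw_imp_surj_on[OF bi] by blast
  moreover have "f ` inv_into (vertices \<Delta>) f ` s = s"
    using s bij_betw_imp_surj_on[OF b] by (intro image_inv_into_cancel) auto
  ultimately show "s \<in> \<Delta>' \<longleftrightarrow> inv_into (vertices \<Delta>) f ` s \<in> \<Delta>" using iff by metis
qed

lemma simplicial_iso_comp:
  assumes f: "simplicial_iso f A B" and g: "simplicial_iso g B C"
  shows "simplicial_iso (g \<circ> f) A C"
  unfolding simplicial_iso_def
proof (intro conjI allI impI)
  have b: "bij_betw f (vertices A) (vertices B)" "bij_betw g (vertices B) (vertices C)"
    using f g unfolding simplicial_iso_def by blast+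
  show "bij_betw (g \<circ> f) (vertices A) (vertices C)" using b by (rule bij_betw_trans)
  fix s assume s: "s \<subseteq> vertices A"
  then have "f ` s \<subseteq> vertices B" using bij_betw_imp_surj_on[OF b(1)] by blast
  then show "s \<in> A \<longleftrightarrow> (g \<circ> f) ` s \<in> C"
    using f g s unfolding simplicial_iso_def image_comp[symmetric] by simp
qed

text \<open>A vertex \<open>z\<close> in the support of a fixed point is sent into the support
  again; type preservation and injectivity of the types on a simplex leave only \<open>z\<close>
  itself.\<close>

lemma fixed_vertex:
  assumes fp: "has_fixed_point G \<Delta> \<phi>" and \<Delta>: "simplicial_complex \<Delta>"
    and tp: "type_preserving G \<Delta> \<tau> \<phi>" and \<tau>: "\<And>s. s \<in> \<Delta> \<Longrightarrow> inj_on \<tau> s"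
  shows "\<exists>z\<in>vertices \<Delta>. \<forall>g\<in>carrier G. \<phi> g z = z"
proof -
  obtain x where x: "x \<in> realisation \<Delta>" "\<And>g. g \<in> carrier G \<Longrightarrow> realisation_map (\<phi> g) x = x"
    using fp unfolding has_fixed_point_def by blast
  define s where "s = {w. x w \<noteq> 0}"
  have s: "s \<in> \<Delta>" "\<And>w. 0 \<le> x w" using x(1) unfolding realisation_def s_def by blast+
  have fin: "finite s" "s \<noteq> {}" using s(1) \<Delta> unfolding simplicial_complex_def by blast+
  then obtain z where z: "z \<in> s" by blast
  have zV: "z \<in> vertices \<Delta>" using z s(1) unfolding vertices_def by blast
  have "\<phi> g z = z" if g: "g \<in> carrier G" for g
  proof -
    have "0 < x z" using z s(2)[of z] unfolding s_def by simp
    also have "\<dots> \<le> (\<Sum>w | x w \<noteq> 0 \<and> \<phi> g w = \<phi> g z. x w)"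
      using z fin(1) s(2) unfolding s_def by (intro member_le_sum) (auto intro: finite_subset)
    also have "\<dots> = x (\<phi> g z)" using fun_cong[OF x(2)[OF g], of "\<phi> g z"] unfolding realisation_map_def .
    finally have "\<phi> g z \<in> s" unfolding s_def by simp
    moreover have "\<tau> (\<phi> g z) = \<tau> z" using tp g zV unfolding type_preserving_def by blast
    ultimately show ?thesis using inj_onD[OF \<tau>[OF s(1)]] z by blast
  qed
  then show ?thesis using zV by blast
qed

text \<open>\<open>BijGroup\<close> consists of extensional bijections, hence the
  \<open>restrict\<close>.\<close>

lemma group_actionI:
  fixes \<phi> :: "'g \<Rightarrow> 'a \<Rightarrow> 'a"
  assumes G: "group G" and E: "\<And>g z. g \<in> carrier G \<Longrightarrow> z \<in> E \<Longrightarrow> \<phi> g z \<in> E"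
    and one: "\<And>z. z \<in> E \<Longrightarrow> \<phi> \<one>\<^bsub>G\<^esub> z = z"
    and mult: "\<And>g h z. g \<in> carrier G \<Longrightarrow> h \<in> carrier G \<Longrightarrow> z \<in> E \<Longrightarrow> \<phi> (g \<otimes>\<^bsub>G\<^esub> h) z = \<phi> g (\<phi> h z)"
  shows "group_action G E (\<lambda>g. restrict (\<phi> g) E)"
proof -
  interpret group G by (rule G)
  have bij: "bij_betw (\<phi> g) E E" if g: "g \<in> carrier G" for g
  proof (rule bij_betw_byWitness[of _ "\<phi> (inv\<^bsub>G\<^esub> g)"])
    have i: "inv\<^bsub>G\<^esub> g \<in> carrier G" using g by simp
    show "\<forall>a\<in>E. \<phi> (inv\<^bsub>G\<^esub> g) (\<phi> g a) = a" using mult[OF i g] one g by simp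
    show "\<forall>a\<in>E. \<phi> g (\<phi> (inv\<^bsub>G\<^esub> g) a) = a" using mult[OF g i] one g by simp
    show "\<phi> g ` E \<subseteq> E" "\<phi> (inv\<^bsub>G\<^esub> g) ` E \<subseteq> E" using E[OF g] E[OF i] by blast+
  qed
  have B: "restrict (\<phi> g) E \<in> Bij E" if "g \<in> carrier G" for g
    using bij[OF that] unfolding Bij_def by simp
  have "(\<lambda>g. restrict (\<phi> g) E) \<in> hom G (BijGroup E)"
  proof (rule homI)
    fix g h assume gh: "g \<in> carrier G" "h \<in> carrier G"
    show "restrict (\<phi> g) E \<in> carrier (BijGroup E)" using B[OF gh(1)] by (simp add: BijGroup_def)
    have "restrict (\<phi> (g \<otimes>\<^bsub>G\<^esub> h)) E = compose E (restrict (\<phi> g) E) (restrict (\<phi> h) E)"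
      unfolding compose_def using mult[OF gh] E[OF gh(2)] by (intro ext) (simp add: restrict_def)
    then show "restrict (\<phi> (g \<otimes>\<^bsub>G\<^esub> h)) E = restrict (\<phi> g) E \<otimes>\<^bsub>BijGroup E\<^esub> restrict (\<phi> h) E"
      using B[OF gh(1)] B[OF gh(2)] by (simp add: BijGroup_def)
  qed
  then show ?thesis
    unfolding group_action_def group_hom_def group_hom_axioms_def using G group_BijGroup by blast
qed

context affine_type_A begin

lemma wperm_apartment:
  assumes u: "u \<in> lists {..n}"
  shows "(`) ((`) (wperm u)) ` apartment = apartment"
proof -
  have sub: "(`) ((`) (wperm u)) ` apartment \<subseteq> apartment" if u: "u \<in> lists {..n}" for u
  proof (rule image_subsetI)
    fix s assume "s \<in> apartment"
    then obtain w T where w: "w \<in> lists {..n}" "T \<subseteq> {..n}" "T \<noteq> {}" "s = ray w ` T" by (rule apartment_cases)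
    have "(`) (wperm u) ` s = ray (u @ w) ` T" unfolding w(4) image_image ray_append ..
    then show "(`) (wperm u) ` s \<in> apartment" using ray_image_in_apartment[OF append_lists[OF u w(1)] w(2,3)] by simp
  qed
  have "s \<in> (`) ((`) (wperm u)) ` apartment" if s: "s \<in> apartment" for s
  proof (rule image_eqI)
    have r: "rev u \<in> lists {..n}" using u unfolding rev_lists .
    show "(`) (wperm (rev u)) ` s \<in> apartment" using sub[OF r] s by blast
    have "wperm u ` wperm (rev u) ` S = S" for S
      using wperm_rev[of u] by (simp add: image_image o_def fun_eq_iff)
    then show "s = (`) (wperm u) ` (`) (wperm (rev u)) ` s" by (simp add: image_image)
  qed
  then show ?thesis using sub[OF u] by blast
qed

end

text \<open>
  An atlas of charts of the standard apartment: any two chambers lie in a common chart, and two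
  charts that agree on the fundamental chamber agree wherever their images meet.
\<close>

locale charts = affine_type_A n for n :: nat +
  fixes E :: "'e set" and f :: "'e \<Rightarrow> int set \<Rightarrow> 'w"
  assumes E_ne: "E \<noteq> {}"
    and f_inj: "e \<in> E \<Longrightarrow> inj_on (f e) (vertices apartment)"
    and f_word: "e \<in> E \<Longrightarrow> u \<in> lists {..n} \<Longrightarrow> \<exists>a\<in>E. \<forall>S\<in>vertices apartment. f a S = f e (wperm u ` S)"
    and f_common: "e \<in> E \<Longrightarrow> e' \<in> E \<Longrightarrow> u \<in> lists {..n} \<Longrightarrow> u' \<in> lists {..n} \<Longrightarrow>
      \<exists>a\<in>E. \<exists>x\<in>lists {..n}. \<exists>y\<in>lists {..n}. \<forall>k\<le>n. f a (ray x k) = f e (ray u k) \<and> f a (ray y k) = f e' (ray u' k)"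
    and f_type: "e \<in> E \<Longrightarrow> e' \<in> E \<Longrightarrow> u \<in> lists {..n} \<Longrightarrow> u' \<in> lists {..n} \<Longrightarrow> k \<le> n \<Longrightarrow> l \<le> n \<Longrightarrow>
      f e (ray u k) = f e' (ray u' l) \<Longrightarrow> k = l"
    and f_agree: "e \<in> E \<Longrightarrow> e' \<in> E \<Longrightarrow> (\<And>k. k \<le> n \<Longrightarrow> f e (ray [] k) = f e' (ray [] k)) \<Longrightarrow>
      S \<in> vertices apartment \<Longrightarrow> T \<in> vertices apartment \<Longrightarrow> f e S = f e' T \<Longrightarrow> S = T"
begin

definition Ap :: "'e \<Rightarrow> 'w set set" where "Ap e = (`) (f e) ` apartment"

definition complex :: "'w set set" where "complex = \<Union> (Ap ` E)"

definition vtype :: "'w \<Rightarrow> nat" where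
  "vtype z = (THE k. k \<le> n \<and> (\<exists>e\<in>E. \<exists>u\<in>lists {..n}. z = f e (ray u k)))"

lemma vertices_Ap: "vertices (Ap e) = f e ` vertices apartment"
  unfolding Ap_def by (rule vertices_image)

lemma vertices_complex: "vertices complex = (\<Union>e\<in>E. f e ` vertices apartment)"
  unfolding complex_def vertices_Ap[symmetric] unfolding vertices_def by blast

lemma Ap_word:
  assumes u: "u \<in> lists {..n}" and a: "\<And>S. S \<in> vertices apartment \<Longrightarrow> f a S = f e (wperm u ` S)"
  shows "Ap a = Ap e"
proof -
  have "Ap a = (`) (f e) ` (`) ((`) (wperm u)) ` apartment"
    unfolding Ap_def image_image
  proof (rule image_cong[OF HOL.refl])
    fix s assume "s \<in> apartment"
    then have "s \<subseteq> vertices apartment" unfolding vertices_def by blast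
    then show "f a ` s = (\<lambda>x. f e (wperm u ` x)) ` s" using a by (intro image_cong HOL.refl) blast
  qed
  then show ?thesis unfolding wperm_apartment[OF u] Ap_def .
qed

text \<open>Both charts are precomposed with words so that the common chamber becomes the
  fundamental one. The transition map is then the isomorphism, and \<open>f_agree\<close> makes it
  the identity on the intersection.\<close>

lemma iso_of_common_chamber:
  assumes e: "e \<in> E" "e' \<in> E" and u: "u \<in> lists {..n}" "u' \<in> lists {..n}"
    and eq: "\<And>k. k \<le> n \<Longrightarrow> f e (ray u k) = f e' (ray u' k)"
  shows "\<exists>h. simplicial_iso h (Ap e) (Ap e') \<and> (\<forall>z\<in>vertices (Ap e) \<inter> vertices (Ap e'). h z = z)"
proof -
  obtain a where a: "a \<in> E" "\<And>S. S \<in> vertices apartment \<Longrightarrow> f a S = f e (wperm u ` S)" using f_word[OF e(1) u(1)] by blast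
  obtain b where b: "b \<in> E" "\<And>S. S \<in> vertices apartment \<Longrightarrow> f b S = f e' (wperm u' ` S)" using f_word[OF e(2) u(2)] by blast
  have Aa: "Ap a = Ap e" and Ab: "Ap b = Ap e'" using Ap_word[OF u(1) a(2)] Ap_word[OF u(2) b(2)] by blast+
  have ab: "f a (ray [] k) = f b (ray [] k)" if k: "k \<le> n" for k
  proof -
    have "ray [] k \<in> vertices apartment" unfolding vertices_apartment by (intro CollectI exI[of _ "[]"] exI[of _ k] conjI HOL.refl lists.Nil k)
    then have "f a (ray [] k) = f e (wperm u ` ray [] k)" "f b (ray [] k) = f e' (wperm u' ` ray [] k)" by (rule a(2), rule b(2))
    then show ?thesis unfolding ray_append[symmetric] using eq[OF k] by simp
  qed
  define h where "h = f b \<circ> inv_into (vertices apartment) (f a)"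
  have "simplicial_iso h (Ap a) (Ap b)"
    unfolding h_def Ap_def
    by (rule simplicial_iso_comp[OF simplicial_iso_inv[OF simplicial_iso_image[OF f_inj[OF a(1)]]] simplicial_iso_image[OF f_inj[OF b(1)]]])
  moreover have "h z = z" if z: "z \<in> vertices (Ap a) \<inter> vertices (Ap b)" for z
  proof -
    obtain S T where S: "S \<in> vertices apartment" "z = f a S" and T: "T \<in> vertices apartment" "z = f b T"
      using z unfolding vertices_Ap by blast
    have "S = T" using f_agree[OF a(1) b(1) ab S(1) T(1)] S(2) T(2) by blast
    then show ?thesis unfolding h_def using S T(2) inv_into_f_f[OF f_inj[OF a(1)] S(1)] by simp
  qed
  ultimately show ?thesis unfolding Aa Ab by blast
qed

lemma simplex_in_chamber:
  assumes "s \<in> Ap e"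
  obtains u where "u \<in> lists {..n}" "s \<subseteq> (\<lambda>k. f e (ray u k)) ` {..n}" "s \<noteq> {}"
proof -
  obtain s0 where s0: "s0 \<in> apartment" "s = f e ` s0" using assms unfolding Ap_def by blast
  obtain u T where u: "u \<in> lists {..n}" "T \<subseteq> {..n}" "T \<noteq> {}" "s0 = ray u ` T" using apartment_cases[OF s0(1)] .
  have "s \<subseteq> (\<lambda>k. f e (ray u k)) ` {..n}" "s \<noteq> {}" unfolding s0(2) u(4) image_image using u(2,3) by blast+
  then show ?thesis using that u(1) by blast
qed

lemma chamber_face_in_Ap:
  assumes "u \<in> lists {..n}" "s \<subseteq> (\<lambda>k. f e (ray u k)) ` {..n}" "s \<noteq> {}"
  shows "s \<in> Ap e"
proof -
  obtain T where T: "T \<subseteq> {..n}" "s = (\<lambda>k. f e (ray u k)) ` T" using assms(2) by (metis subset_imageE)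
  have "s = f e ` ray u ` T" unfolding image_image T(2) ..
  moreover have "ray u ` T \<in> apartment" using assms(1,3) T by (intro ray_image_in_apartment) auto
  ultimately show ?thesis unfolding Ap_def by blast
qed

lemma simplicial_complex_Ap: "simplicial_complex (Ap e)"
  unfolding Ap_def by (rule simplicial_complex_image[OF simplicial_complex_apartment])

lemma simplicial_complex_complex: "simplicial_complex complex"
  using simplicial_complex_Ap unfolding simplicial_complex_def complex_def by blast

lemma building_complex: "building {..n} (Atilde n) complex"
  unfolding building_def
proof (intro conjI exI[of _ "Ap ` E"] ballI)
  show "simplicial_complex complex" by (rule simplicial_complex_complex)
  obtain e where "e \<in> E" using E_ne by blast
  moreover have "ray [] ` {..n} \<in> apartment" by (rule ray_image_in_apartment) auto
  ultimately show "complex \<noteq> {}" unfolding complex_def Ap_def by blast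
  show "\<Union> (Ap ` E) = complex" unfolding complex_def ..
next
  fix A assume "A \<in> Ap ` E"
  then obtain e where e: "e \<in> E" "A = Ap e" by blast
  show "simplicial_complex A" unfolding e(2) by (rule simplicial_complex_Ap)
  show "iso_coxeter_complex {..n} (Atilde n) A"
    unfolding e(2) Ap_def by (rule iso_coxeter_complex_image[OF f_inj[OF e(1)] iso_coxeter_complex_apartment])
next
  fix s t assume "s \<in> complex" "t \<in> complex"
  then obtain e e' where e: "e \<in> E" "s \<in> Ap e" "e' \<in> E" "t \<in> Ap e'" unfolding complex_def by blast
  obtain u where u: "u \<in> lists {..n}" "s \<subseteq> (\<lambda>k. f e (ray u k)) ` {..n}" "s \<noteq> {}" using simplex_in_chamber[OF e(2)] .
  obtain w where w: "w \<in> lists {..n}" "t \<subseteq> (\<lambda>k. f e' (ray w k)) ` {..n}" "t \<noteq> {}" using simplex_in_chamber[OF e(4)] .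
  obtain a x y where a: "a \<in> E" "x \<in> lists {..n}" "y \<in> lists {..n}"
    "\<forall>k\<le>n. f a (ray x k) = f e (ray u k) \<and> f a (ray y k) = f e' (ray w k)"
    using f_common[OF e(1,3) u(1) w(1)] by blast
  have "(\<lambda>k. f a (ray x k)) ` {..n} = (\<lambda>k. f e (ray u k)) ` {..n}"
    "(\<lambda>k. f a (ray y k)) ` {..n} = (\<lambda>k. f e' (ray w k)) ` {..n}" using a(4) by (auto intro!: image_cong)
  then have "s \<in> Ap a" "t \<in> Ap a"
    using chamber_face_in_Ap[OF a(2), of s a] chamber_face_in_Ap[OF a(3), of t a] u(2,3) w(2,3) by simp_all
  then show "\<exists>A\<in>Ap ` E. s \<in> A \<and> t \<in> A" using a(1) by blast
next
  fix A B s t assume A: "A \<in> Ap ` E" and B: "B \<in> Ap ` E" and s: "s \<in> A \<inter> B" and t: "t \<in> A \<inter> B"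
  obtain e e' where e: "e \<in> E" "A = Ap e" "e' \<in> E" "B = Ap e'" using A B by blast
  obtain u where u: "u \<in> lists {..n}" "s \<subseteq> (\<lambda>k. f e (ray u k)) ` {..n}" "s \<noteq> {}"
    using s simplex_in_chamber[of s e] unfolding e(2) by blast
  obtain w where w: "w \<in> lists {..n}" "t \<subseteq> (\<lambda>k. f e' (ray w k)) ` {..n}" "t \<noteq> {}"
    using t simplex_in_chamber[of t e'] unfolding e(4) by blast
  \<comment> \<open>A third chart contains a chamber of the first apartment around \<open>s\<close>
    and a chamber of the second around \<open>t\<close>. The isomorphism is composed through it;
    each factor fixes \<open>s\<close> and \<open>t\<close>, which lie in all three
    apartments.\<close>
  obtain a x y where a: "a \<in> E" "x \<in> lists {..n}" "y \<in> lists {..n}"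
    "\<And>k. k \<le> n \<Longrightarrow> f e (ray u k) = f a (ray x k)" "\<And>k. k \<le> n \<Longrightarrow> f a (ray y k) = f e' (ray w k)"
    using f_common[OF e(1,3) u(1) w(1)] by metis
  obtain h1 where h1: "simplicial_iso h1 (Ap e) (Ap a)" "\<And>z. z \<in> vertices (Ap e) \<inter> vertices (Ap a) \<Longrightarrow> h1 z = z"
    using iso_of_common_chamber[OF e(1) a(1) u(1) a(2,4)] by blast
  obtain h2 where h2: "simplicial_iso h2 (Ap a) (Ap e')" "\<And>z. z \<in> vertices (Ap a) \<inter> vertices (Ap e') \<Longrightarrow> h2 z = z"
    using iso_of_common_chamber[OF a(1) e(3) a(3) w(1) a(5)] by blast
  have "(\<lambda>k. f e (ray u k)) ` {..n} = (\<lambda>k. f a (ray x k)) ` {..n}"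
    "(\<lambda>k. f e' (ray w k)) ` {..n} = (\<lambda>k. f a (ray y k)) ` {..n}" using a(4,5) by (auto intro!: image_cong)
  then have "s \<in> Ap a" "t \<in> Ap a"
    using chamber_face_in_Ap[OF a(2), of s a] chamber_face_in_Ap[OF a(3), of t a] u(2,3) w(2,3) by simp_all
  then have "z \<in> vertices (Ap e)" "z \<in> vertices (Ap a)" "z \<in> vertices (Ap e')" if "z \<in> s \<union> t" for z
    using that s t unfolding e(2,4) vertices_def by blast+
  then have "(h2 \<circ> h1) z = z" if "z \<in> s \<union> t" for z using that h1(2)[of z] h2(2)[of z] by simp
  then show "\<exists>h. simplicial_iso h A B \<and> (\<forall>z\<in>s \<union> t. h z = z)"
    unfolding e(2,4) using simplicial_iso_comp[OF h1(1) h2(1)] by blast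
qed

lemma vtype_eq:
  assumes "e \<in> E" "u \<in> lists {..n}" "k \<le> n"
  shows "vtype (f e (ray u k)) = k"
  unfolding vtype_def
proof (rule the_equality)
  show "k \<le> n \<and> (\<exists>e'\<in>E. \<exists>u'\<in>lists {..n}. f e (ray u k) = f e' (ray u' k))" using assms by blast
  fix l assume "l \<le> n \<and> (\<exists>e'\<in>E. \<exists>u'\<in>lists {..n}. f e (ray u k) = f e' (ray u' l))"
  then obtain e' u' where "l \<le> n" "e' \<in> E" "u' \<in> lists {..n}" "f e (ray u k) = f e' (ray u' l)" by blast
  then show "l = k" using f_type[of e e' u u' k l] assms by simp
qed

lemma vtype_chamber:
  assumes "e \<in> E" "u \<in> lists {..n}"
  shows "bij_betw vtype ((\<lambda>k. f e (ray u k)) ` {..n}) {..n}"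
  by (rule bij_betw_byWitness[of _ "\<lambda>k. f e (ray u k)"]) (use vtype_eq[OF assms] in auto)

lemma inj_on_vtype:
  assumes "s \<in> complex"
  shows "inj_on vtype s"
proof -
  obtain e where e: "e \<in> E" "s \<in> Ap e" using assms unfolding complex_def by blast
  obtain u where u: "u \<in> lists {..n}" "s \<subseteq> (\<lambda>k. f e (ray u k)) ` {..n}" using simplex_in_chamber[OF e(2)] .
  show ?thesis by (rule inj_on_subset[OF bij_betw_imp_inj_on[OF vtype_chamber[OF e(1) u(1)]] u(2)])
qed

lemma type_function_vtype: "type_function {..n} complex vtype"
  unfolding type_function_def
proof
  fix c assume c: "c \<in> chambers complex"
  then have "c \<in> complex" unfolding chambers_def by blast
  then obtain e where e: "e \<in> E" "c \<in> Ap e" unfolding complex_def by blast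
  obtain u where u: "u \<in> lists {..n}" "c \<subseteq> (\<lambda>k. f e (ray u k)) ` {..n}" using simplex_in_chamber[OF e(2)] .
  have "(\<lambda>k. f e (ray u k)) ` {..n} \<in> complex"
    using chamber_face_in_Ap[OF u(1) subset_refl] e(1) unfolding complex_def by blast
  then have "(\<lambda>k. f e (ray u k)) ` {..n} = c" using c u(2) unfolding chambers_def by blast
  then show "bij_betw vtype c {..n}" using vtype_chamber[OF e(1) u(1)] by simp
qed

end

section \<open>Fixed lattices and integrality\<close>

text \<open>For a root of negative value the leading term of the monic equation would have smaller
  value than all the other terms together.\<close>

lemma root_in_valuation_ring:
  assumes F: "field_closed F" and v: "valuation F v"
    and p: "poly_over (val_level F v 0) p" "lead_coeff p = 1" and x: "x \<in> F" "poly p x = 0"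
  shows "x \<in> val_level F v 0"
proof (rule ccontr)
  assume *: "x \<notin> val_level F v 0"
  then have x0: "x \<noteq> 0" and vx: "v x < 0" using x(1) by (auto simp: val_level_def)
  define d where "d = Polynomial.degree p"
  have "d \<noteq> 0"
  proof
    assume "d = 0"
    then have "p = [:1:]" using p(2) unfolding d_def by (metis degree_0_id)
    then show False using x(2) by simp
  qed
  then obtain d' where d': "d = Suc d'" using not0_implies_Suc by blast
  have pw: "x ^ k \<in> val_level F v (int k * v x)" for k
    using ring_closed_power[OF field_closed_ring[OF F] x(1)] valuation_power[OF F v x(1) x0, of k]
    by (simp add: val_level_def)
  have "poly.coeff p i * x ^ i \<in> val_level F v (int d' * v x)" if i: "i \<in> {..d'}" for i
  proof -
    have c: "poly.coeff p i \<in> val_level F v 0" using p(1) by (simp add: poly_over_def)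
    have "int d' * v x \<le> int i * v x" using i vx by (intro mult_right_mono_neg) simp_all
    then show ?thesis using val_level_mult[OF F v c pw[of i]] val_level_mono by simp
  qed
  then have s: "(\<Sum>i\<le>d'. poly.coeff p i * x ^ i) \<in> val_level F v (int d' * v x)"
    by (rule val_level_sum[OF F v])
  have "poly p x = (\<Sum>i\<le>d'. poly.coeff p i * x ^ i) + x ^ d"
    using p(2) unfolding poly_altdef d_def[symmetric] d' by simp
  then have "x ^ d = - (\<Sum>i\<le>d'. poly.coeff p i * x ^ i)" using x(2) by (simp add: eq_neg_iff_add_eq_0 add.commute)
  then have "x ^ d \<in> val_level F v (int d' * v x)" using val_level_uminus[OF F v s] by simp
  then have "int d' * v x \<le> int d * v x"
    using x0 valuation_power[OF F v x(1) x0, of d] by (simp add: val_level_def)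
  then show False using vx unfolding d' by (simp add: algebra_simps)
qed

section \<open>The action on the lattice building\<close>

context lattice_building begin

lemma countable_GLF:
  assumes "countable F"
  shows "countable GLF"
proof (rule countable_subset)
  show "GLF \<subseteq> (\<lambda>L. mat dm dm (\<lambda>(i, j). L ! i ! j)) ` lists (lists F)"
  proof
    fix m assume m: "m \<in> GLF"
    have mF: "m $$ (i, j) \<in> F" if "i < dm" "j < dm" for i j using m that by (simp add: GLF_def entries_in_def)
    define L where "L = map (\<lambda>i. map (\<lambda>j. m $$ (i, j)) [0..<dm]) [0..<dm]"
    have "set L \<subseteq> lists F"
    proof
      fix l assume "l \<in> set L"
      then obtain i where i: "i < dm" "l = map (\<lambda>j. m $$ (i, j)) [0..<dm]" unfolding L_def set_map set_upt by auto
      show "l \<in> lists F" unfolding i(2) in_lists_conv_set using mF[OF i(1)] by simp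
    qed
    then have "L \<in> lists (lists F)" by (intro in_listsI) blast
    moreover have "m = mat dm dm (\<lambda>(i, j). L ! i ! j)"
      using GLF_carrier[OF m] by (intro eq_matI) (simp_all add: L_def del: upt_Suc)
    ultimately show "m \<in> (\<lambda>L. mat dm dm (\<lambda>(i, j). L ! i ! j)) ` lists (lists F)" by (rule rev_image_eqI)
  qed
  show "countable ((\<lambda>L. mat dm dm (\<lambda>(i, j). L ! i ! j)) ` lists (lists F))"
    by (intro countable_image countable_lists assms)
qed

definition Vx :: "'k vec set set" where
  "Vx = {vtx g S | g S. g \<in> H \<and> S \<in> vertices apartment}"

text \<open>Words can be absorbed into the matrix, so a vertex is given by an element of
  \<open>H\<close> and a type.\<close>

lemma countable_Vx:
  assumes "countable F"
  shows "countable Vx"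
proof (rule countable_subset)
  have "countable H" by (rule countable_subset[OF _ countable_GLF[OF assms]]) (auto simp: H_def)
  then show "countable ((\<lambda>(g, k). vtx g {int k..}) ` (H \<times> UNIV))" by (intro countable_image countable_SIGMA) simp_all
  show "Vx \<subseteq> (\<lambda>(g, k). vtx g {int k..}) ` (H \<times> UNIV)"
  proof
    fix x assume "x \<in> Vx"
    then obtain g u k where g: "g \<in> H" "x = vtx g (ray u k)" unfolding Vx_def vertices_apartment by blast
    obtain a where a: "a \<in> H" "\<And>S. vtx a S = vtx g (wperm u ` S)" using vtx_word[OF g(1)] by blast
    have "x = vtx a {int k..}" unfolding a(2) g(2) ray_def ..
    then show "x \<in> (\<lambda>(g, k). vtx g {int k..}) ` (H \<times> UNIV)" using a(1) by (intro image_eqI[of _ _ "(a, k)"]) simp_all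
  qed
qed

text \<open>
  If \<open>m\<close> fixes the lattice \<open>p L\<^sub>0\<close>, then \<open>p\<^sup>-\<^sup>1 m p\<close> is a matrix over the valuation ring.
\<close>

lemma char_poly_of_fixed_vertex:
  assumes m: "m \<in> H" and e: "e \<in> H" and k: "k \<le> n" and fix_vtx: "vtx (m * e) (ray u k) = vtx e (ray u k)"
  shows "poly_over Ov (char_poly m)"
proof -
  obtain a where a: "a \<in> H" "\<And>S. vtx a S = vtx e (wperm u ` S)" using vtx_word[OF e] by blast
  obtain b where b: "b \<in> GLF" "act b (lat {0..}) = lat {int k..}" using shift_mat[OF k] by blast
  define p where "p = a * b"
  have p: "p \<in> GLF" unfolding p_def by (rule GLF_mult[OF H_GLF[OF a(1)] b(1)])
  have pl: "act p (lat {0..}) = vtx e (ray u k)"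
    unfolding p_def act_mult[OF H_GLF[OF a(1)] b(1) lat_V] b(2) using a(2)[of "{int k..}"] by (simp add: vtx_def ray_def)
  have mp: "act m (act p (lat {0..})) = act p (lat {0..})"
    unfolding pl using fix_vtx unfolding vtx_mult[OF m e] .
  obtain p' where p': "p' \<in> GLF" "p * p' = 1\<^sub>m dm" "p' * p = 1\<^sub>m dm" using GLF_inverse[OF p] by metis
  note mG = H_GLF[OF m]
  have mpG: "m * p \<in> GLF" by (rule GLF_mult[OF mG p])
  define q where "q = p' * (m * p)"
  have q: "q \<in> GLF" unfolding q_def by (rule GLF_mult[OF p'(1) mpG])
  have "act q (lat {0..}) = lat {0..}"
    unfolding q_def act_mult[OF p'(1) mpG lat_V] act_mult[OF mG p lat_V] mp
    by (rule act_cancel[OF p p'(1) p'(3) lat_V])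
  then have "entries_in Ov dm q" using act_lat_0_iff[OF q] by simp
  then have "poly_over Ov (char_poly q)" by (rule char_poly_over_ring[OF O_ring])
  moreover have "similar_mat q m"
  proof (rule similar_matI)
    show "{q, m, p', p} \<subseteq> carrier_mat dm dm" using GLF_carrier q mG p'(1) p by blast
    show "p' * p = 1\<^sub>m dm" "p * p' = 1\<^sub>m dm" by (rule p'(3), rule p'(2))
    show "q = p' * m * p" unfolding q_def
      by (rule assoc_mult_mat[symmetric, OF GLF_carrier[OF p'(1)] GLF_carrier[OF mG] GLF_carrier[OF p]])
  qed
  ultimately show ?thesis using char_poly_similar by metis
qed

text \<open>The injection \<open>\<iota>\<close> renames vertices, so that the building can be
  placed in the type over which \<open>property_FB\<close> quantifies.\<close>

lemma building_charts:
  assumes \<iota>: "inj_on \<iota> Vx"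
  shows "charts n H (\<lambda>e S. \<iota> (vtx e S))"
proof (unfold_locales, goal_cases)
  case 1
  show ?case using H_one by blast
next
  case (2 e)
  show ?case
  proof (rule inj_onI)
    fix S T assume ST: "S \<in> vertices apartment" "T \<in> vertices apartment" "\<iota> (vtx e S) = \<iota> (vtx e T)"
    then have "vtx e S = vtx e T" using 2 by (intro inj_onD[OF \<iota>]) (auto simp: Vx_def)
    then show "S = T" by (rule vtx_inj[OF 2])
  qed
next
  case (3 e u)
  obtain a where "a \<in> H" "\<And>S. vtx a S = vtx e (wperm u ` S)" using vtx_word[OF 3(1)] by blast
  then show ?case by (intro bexI[of _ a]) simp_all
next
  case (4 e e' u u')
  obtain a x y where a: "a \<in> H" "x \<in> lists {..n}" "y \<in> lists {..n}"
    "\<And>k. vtx a (ray x k) = vtx e (ray u k) \<and> vtx a (ray y k) = vtx e' (ray u' k)"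
    using chambers_common_apartment[OF 4(1,2), of u u'] by blast
  show ?case using a(4) by (intro bexI[OF _ a(1)] bexI[OF _ a(2)] bexI[OF _ a(3)]) simp
next
  case (5 e e' u u' k l)
  have "vtx e (ray u k) \<in> Vx" "vtx e' (ray u' l) \<in> Vx" using 5(1-6) unfolding Vx_def vertices_apartment by blast+
  then have "vtx e (ray u k) = vtx e' (ray u' l)" using inj_onD[OF \<iota> 5(7)] by simp
  then show ?case by (rule vtx_type[OF 5(1,2) _ 5(5,6)])
next
  case (6 e e' S T)
  have r: "ray [] k \<in> vertices apartment" if "k \<le> n" for k
    unfolding vertices_apartment by (intro CollectI exI[of _ "[]"] exI[of _ k] conjI HOL.refl lists.Nil that)
  have "vtx e {int k..} = vtx e' {int k..}" if k: "k \<le> n" for k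
  proof -
    have "vtx e (ray [] k) \<in> Vx" "vtx e' (ray [] k) \<in> Vx" using r[OF k] 6(1,2) unfolding Vx_def by blast+
    then have "vtx e (ray [] k) = vtx e' (ray [] k)" using inj_onD[OF \<iota> 6(3)[OF k]] by simp
    then show ?thesis unfolding ray_Nil .
  qed
  moreover have "vtx e S = vtx e' T"
  proof -
    have "vtx e S \<in> Vx" "vtx e' T \<in> Vx" using 6(1,2,4,5) unfolding Vx_def by blast+
    then show ?thesis using inj_onD[OF \<iota> 6(6)] by simp
  qed
  ultimately show ?case by (rule common_chamber_retraction[OF 6(1,2)])
qed

text \<open>The fixed point supplied by \<open>property_FB\<close> yields a fixed vertex, that is, a
  lattice stable under the whole image of \<open>\<rho>\<close>.\<close>

lemma char_poly_over_valuation_ring: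
  fixes G :: "('g, 'b) monoid_scheme"
  assumes cF: "countable F" and G: "group G" and FB: "property_FB n G"
    and \<rho>: "\<And>g. g \<in> carrier G \<Longrightarrow> \<rho> g \<in> H"
      "\<And>g h. g \<in> carrier G \<Longrightarrow> h \<in> carrier G \<Longrightarrow> \<rho> (g \<otimes>\<^bsub>G\<^esub> h) = \<rho> g * \<rho> h"
    and g: "g \<in> carrier G"
  shows "poly_over Ov (char_poly (\<rho> g))"
proof -
  interpret group G by (rule G)
  \<comment> \<open>The first component carries no information; countability lets the second one
    number the vertices.\<close>
  define \<iota> :: "'k vec set \<Rightarrow> 'g \<times> nat" where "\<iota> L = (undefined, to_nat_on Vx L)" for L
  have \<iota>: "inj_on \<iota> Vx"
    using inj_on_to_nat_on[OF countable_Vx[OF cF]] unfolding \<iota>_def inj_on_def by simp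
  interpret C: charts n H "\<lambda>e S. \<iota> (vtx e S)" by (rule building_charts[OF \<iota>])
  have VxI: "vtx e S \<in> Vx" if "e \<in> H" "S \<in> vertices apartment" for e S using that unfolding Vx_def by blast
  have verts: "vertices C.complex = \<iota> ` Vx"
    unfolding C.vertices_complex Vx_def by blast
  define \<phi> where "\<phi> g z = \<iota> (act (\<rho> g) (inv_into Vx \<iota> z))" for g z
  have \<phi>: "\<phi> g (\<iota> (vtx e S)) = \<iota> (vtx (\<rho> g * e) S)" if "g \<in> carrier G" "e \<in> H" "S \<in> vertices apartment" for g e S
    unfolding \<phi>_def inv_into_f_f[OF \<iota> VxI[OF that(2,3)]] vtx_mult[OF \<rho>(1)[OF that(1)] that(2)] ..
  have vertE: "\<exists>e\<in>H. \<exists>S\<in>vertices apartment. z = \<iota> (vtx e S)" if "z \<in> vertices C.complex" for z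
    using that unfolding verts Vx_def by blast
  have one: "\<rho> \<one>\<^bsub>G\<^esub> = 1\<^sub>m dm"
  proof -
    have r: "\<rho> \<one>\<^bsub>G\<^esub> \<in> H" by (rule \<rho>(1)[OF one_closed])
    obtain r' where r': "r' \<in> H" "r' * \<rho> \<one>\<^bsub>G\<^esub> = 1\<^sub>m dm" using H_inverse[OF r] by metis
    note c = GLF_carrier[OF H_GLF[OF r]] GLF_carrier[OF H_GLF[OF r'(1)]]
    have "r' * (\<rho> \<one>\<^bsub>G\<^esub> * \<rho> \<one>\<^bsub>G\<^esub>) = r' * \<rho> \<one>\<^bsub>G\<^esub>" using \<rho>(2)[OF one_closed one_closed] by simp
    then have "r' * \<rho> \<one>\<^bsub>G\<^esub> * \<rho> \<one>\<^bsub>G\<^esub> = r' * \<rho> \<one>\<^bsub>G\<^esub>" unfolding assoc_mult_mat[OF c(2) c(1) c(1)] .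
    then show ?thesis unfolding r'(2) using left_mult_one_mat[OF c(1)] by simp
  qed
  define \<Phi> where "\<Phi> g = restrict (\<phi> g) (vertices C.complex)" for g
  have \<Phi>: "\<Phi> g (\<iota> (vtx e S)) = \<iota> (vtx (\<rho> g * e) S)" if "g \<in> carrier G" "e \<in> H" "S \<in> vertices apartment" for g e S
    unfolding \<Phi>_def using \<phi>[OF that] VxI[OF that(2,3)] by (simp add: verts)
  have "group_action G (vertices C.complex) \<Phi>"
    unfolding \<Phi>_def
  proof (rule group_actionI[OF G])
    fix g z assume g: "g \<in> carrier G" and z: "z \<in> vertices C.complex"
    obtain e S where e: "e \<in> H" "S \<in> vertices apartment" "z = \<iota> (vtx e S)" using vertE[OF z] by blast
    show "\<phi> g z \<in> vertices C.complex"
      unfolding e(3) \<phi>[OF g e(1,2)] verts by (rule imageI[OF VxI[OF H_mult[OF \<rho>(1)[OF g] e(1)] e(2)]])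
  next
    fix z assume z: "z \<in> vertices C.complex"
    obtain e S where e: "e \<in> H" "S \<in> vertices apartment" "z = \<iota> (vtx e S)" using vertE[OF z] by blast
    show "\<phi> \<one>\<^bsub>G\<^esub> z = z"
      unfolding e(3) \<phi>[OF one_closed e(1,2)] one using left_mult_one_mat[OF GLF_carrier[OF H_GLF[OF e(1)]]] by simp
  next
    fix g h z assume g: "g \<in> carrier G" and h: "h \<in> carrier G" and z: "z \<in> vertices C.complex"
    obtain e S where e: "e \<in> H" "S \<in> vertices apartment" "z = \<iota> (vtx e S)" using vertE[OF z] by blast
    have gh: "g \<otimes>\<^bsub>G\<^esub> h \<in> carrier G" using g h by simp
    show "\<phi> (g \<otimes>\<^bsub>G\<^esub> h) z = \<phi> g (\<phi> h z)"
      unfolding e(3) \<phi>[OF gh e(1,2)] \<phi>[OF h e(1,2)] \<phi>[OF g H_mult[OF \<rho>(1)[OF h] e(1)] e(2)] \<rho>(2)[OF g h]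
        assoc_mult_mat[OF GLF_carrier[OF H_GLF[OF \<rho>(1)[OF g]]] GLF_carrier[OF H_GLF[OF \<rho>(1)[OF h]]] GLF_carrier[OF H_GLF[OF e(1)]]] ..
  qed
  moreover have "\<Phi> g ` s \<in> C.complex" if g: "g \<in> carrier G" and s: "s \<in> C.complex" for g s
  proof -
    obtain e s0 where e: "e \<in> H" "s0 \<in> apartment" "s = (\<lambda>S. \<iota> (vtx e S)) ` s0"
      using s unfolding C.complex_def C.Ap_def by blast
    have sub: "S \<in> vertices apartment" if "S \<in> s0" for S using that e(2) unfolding vertices_def by blast
    have "\<Phi> g ` s = (\<lambda>S. \<iota> (vtx (\<rho> g * e) S)) ` s0"
      unfolding e(3) image_image by (intro image_cong HOL.refl \<Phi>[OF g e(1)] sub)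
    moreover have "\<rho> g * e \<in> H" by (rule H_mult[OF \<rho>(1)[OF g] e(1)])
    ultimately show ?thesis unfolding C.complex_def C.Ap_def using e(2) by blast
  qed
  ultimately have act: "simplicial_action G C.complex \<Phi>" unfolding simplicial_action_def by blast
  have tp: "type_preserving G C.complex C.vtype \<Phi>"
    unfolding type_preserving_def
  proof (intro ballI)
    fix g z assume g: "g \<in> carrier G" and z: "z \<in> vertices C.complex"
    obtain e S where e: "e \<in> H" "S \<in> vertices apartment" "z = \<iota> (vtx e S)" using vertE[OF z] by blast
    obtain u k where u: "u \<in> lists {..n}" "k \<le> n" "S = ray u k" using e(2) unfolding vertices_apartment by blast
    show "C.vtype (\<Phi> g z) = C.vtype z"
      unfolding e(3) \<Phi>[OF g e(1,2)] unfolding u(3) C.vtype_eq[OF e(1) u(1,2)] C.vtype_eq[OF H_mult[OF \<rho>(1)[OF g] e(1)] u(1,2)] ..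
  qed
  have "has_fixed_point G C.complex \<Phi>"
    using FB C.building_complex C.type_function_vtype act tp unfolding property_FB_def by blast
  then obtain z where z: "z \<in> vertices C.complex" "\<And>g. g \<in> carrier G \<Longrightarrow> \<Phi> g z = z"
    using fixed_vertex[OF _ C.simplicial_complex_complex tp C.inj_on_vtype] by blast
  obtain e S where e: "e \<in> H" "S \<in> vertices apartment" "z = \<iota> (vtx e S)" using vertE[OF z(1)] by blast
  obtain u k where u: "u \<in> lists {..n}" "k \<le> n" "S = ray u k" using e(2) unfolding vertices_apartment by blast
  have "\<iota> (vtx (\<rho> g * e) S) = \<iota> (vtx e S)" using z(2)[OF g] unfolding e(3) \<Phi>[OF g e(1,2)] .
  then have "vtx (\<rho> g * e) S = vtx e S"
    by (rule inj_onD[OF \<iota> _ VxI[OF H_mult[OF \<rho>(1)[OF g] e(1)] e(2)] VxI[OF e(1,2)]])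
  then show ?thesis unfolding u(3) by (rule char_poly_of_fixed_vertex[OF \<rho>(1)[OF g] e(1) u(2)])
qed

text \<open>
  The diagonal representation with entries \<open>\<pi>\<^bsup>\<chi> g\<^esup>\<close>, \<open>\<pi>\<^bsup>- \<chi> g\<^esup>\<close>, \<open>1\<close>, \dots, where \<open>\<chi>\<close> is the
  valuation of the determinant, has determinant \<open>1\<close> and so acts on the building preserving types.
\<close>

lemma v_det_trivial:
  fixes G :: "('g, 'b) monoid_scheme"
  assumes cF: "countable F" and G: "group G" and FB: "property_FB n G"
    and \<rho>: "\<And>g. g \<in> carrier G \<Longrightarrow> \<rho> g \<in> GLF"
      "\<And>g h. g \<in> carrier G \<Longrightarrow> h \<in> carrier G \<Longrightarrow> \<rho> (g \<otimes>\<^bsub>G\<^esub> h) = \<rho> g * \<rho> h"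
    and g: "g \<in> carrier G"
  shows "v (det (\<rho> g)) = 0"
proof -
  define d where "d c i = (if i = 0 then \<pi> powi c else if i = 1 then \<pi> powi (- c) else 1)" for c :: int and i :: nat
  define D where "D c = mat dm dm (\<lambda>(i, j). if i = j then d c i else 0)" for c
  have Dc: "D c \<in> carrier_mat dm dm" for c by (simp add: D_def)
  have dF: "d c i \<in> F" for c i
    using field_closed_powi[OF F \<pi>(1)] ring_closed_one[OF RF] by (simp add: d_def)
  have ent: "entries_in F dm (D c)" for c
    by (rule entries_inI[OF Dc]) (simp add: D_def dF ring_closed_zero[OF RF])
  have det: "det (D c) = 1" for c
  proof -
    have "det (D c) = prod_list (diag_mat (D c))"
      by (rule det_upper_triangular[OF _ Dc]) (auto simp: D_def upper_triangular_def)
    also have "\<dots> = (\<Prod>i = 0..<dm. D c $$ (i, i))" using Dc[of c] by (simp add: prod_list_diag_prod)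
    also have "\<dots> = (\<Prod>i = 0..<dm. d c i)" by (intro prod.cong) (simp_all add: D_def)
    also have "\<dots> = (\<Prod>i\<in>{0, 1}. d c i)"
      using n_pos by (intro prod.mono_neutral_right) (auto simp: d_def)
    also have "\<dots> = 1" using \<pi>(2) by (simp add: d_def power_int_minus)
    finally show ?thesis .
  qed
  have DH: "D c \<in> H" for c
    using ent[of c] det[of c] valuation_one[OF F v] by (simp add: H_def GLF_def)
  have d_add: "d (b + c) i = d b i * d c i" for b c i
    unfolding d_def using power_int_add[of \<pi> b c] power_int_add[of \<pi> "- b" "- c"] \<pi>(2) by simp
  have Dmult: "D (b + c) = D b * D c" for b c
  proof (rule eq_matI)
    fix i j assume "i < dim_row (D b * D c)" "j < dim_col (D b * D c)"
    then have ij: "i < dm" "j < dm" using Dc[of b] Dc[of c] by simp_all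
    have "(D b * D c) $$ (i, j) = (\<Sum>l = 0..<dm. D b $$ (i, l) * D c $$ (l, j))"
      using Dc[of b] Dc[of c] ij by (simp add: scalar_prod_def)
    also have "\<dots> = (\<Sum>l = 0..<dm. if l = i then d b i * D c $$ (i, j) else 0)"
      using ij by (intro sum.cong HOL.refl) (auto simp: D_def)
    also have "\<dots> = d b i * D c $$ (i, j)" using ij by simp
    also have "\<dots> = (if i = j then d b i * d c i else 0)" using ij by (simp add: D_def)
    also have "\<dots> = D (b + c) $$ (i, j)" using ij by (simp add: D_def d_add)
    finally show "D (b + c) $$ (i, j) = (D b * D c) $$ (i, j)" ..
  qed (use Dc[of "b + c"] Dc[of b] Dc[of c] in simp_all)
  define \<chi> where "\<chi> h = v (det (\<rho> h))" for h
  have \<chi>: "\<chi> (h \<otimes>\<^bsub>G\<^esub> k) = \<chi> h + \<chi> k" if "h \<in> carrier G" "k \<in> carrier G" for h k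
    unfolding \<chi>_def \<rho>(2)[OF that] by (rule v_det_mult[OF \<rho>(1)[OF that(1)] \<rho>(1)[OF that(2)]])
  have P: "poly_over Ov (char_poly (D (\<chi> g)))"
    by (rule char_poly_over_valuation_ring[where \<rho> = "\<lambda>g. D (\<chi> g)", OF cF G FB DH _ g]) (simp only: \<chi> Dmult)
  \<comment> \<open>The diagonal entries, among them \<open>\<pi> powi \<chi> g\<close> and
    \<open>\<pi> powi (- \<chi> g)\<close>, are roots of an integral characteristic polynomial;
    hence neither exponent is negative.\<close>
  have int: "0 \<le> v (d (\<chi> g) i)" if i: "i < dm" for i
  proof -
    have "eigenvector (D (\<chi> g)) (unit_vec dm i) (d (\<chi> g) i)"
      unfolding eigenvector_def
    proof (intro conjI eq_vecI)
      show "unit_vec dm i \<in> carrier_vec (dim_row (D (\<chi> g)))" using Dc[of "\<chi> g"] by simp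
      show "unit_vec dm i \<noteq> (0\<^sub>v (dim_row (D (\<chi> g))) :: 'k vec)"
        using i Dc[of "\<chi> g"] by (metis carrier_matD(1) index_unit_vec(1) index_zero_vec(1) zero_neq_one)
      show "dim_vec (D (\<chi> g) *\<^sub>v unit_vec dm i) = dim_vec (d (\<chi> g) i \<cdot>\<^sub>v unit_vec dm i)" using Dc[of "\<chi> g"] by simp
      fix j assume "j < dim_vec (d (\<chi> g) i \<cdot>\<^sub>v unit_vec dm i)"
      then have j: "j < dm" by simp
      have "(D (\<chi> g) *\<^sub>v unit_vec dm i) $ j = (\<Sum>l<dm. D (\<chi> g) $$ (j, l) * unit_vec dm i $ l)"
        by (rule index_mult_mat_vec_sum[OF Dc unit_vec_carrier j])
      also have "\<dots> = (\<Sum>l<dm. if l = i then D (\<chi> g) $$ (j, i) else 0)"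
        using i j by (intro sum.cong HOL.refl) simp
      also have "\<dots> = (d (\<chi> g) i \<cdot>\<^sub>v unit_vec dm i) $ j" using i j by (simp add: D_def)
      finally show "(D (\<chi> g) *\<^sub>v unit_vec dm i) $ j = (d (\<chi> g) i \<cdot>\<^sub>v unit_vec dm i) $ j" .
    qed
    then have "poly (char_poly (D (\<chi> g))) (d (\<chi> g) i) = 0"
      using eigenvalue_root_char_poly[OF Dc] unfolding eigenvalue_def by blast
    moreover have "lead_coeff (char_poly (D (\<chi> g))) = 1" using degree_monic_char_poly[OF Dc[of "\<chi> g"]] by simp
    ultimately have "d (\<chi> g) i \<in> Ov" using root_in_valuation_ring[OF F v P _ dF] by blast
    moreover have "d (\<chi> g) i \<noteq> 0" using \<pi>(2) by (simp add: d_def)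
    ultimately show ?thesis by (simp add: val_level_def)
  qed
  have "v (\<pi> powi c) = c" for c using valuation_powi[OF F v \<pi>(1,2)] \<pi>(3) by simp
  then have "0 \<le> \<chi> g" "0 \<le> - \<chi> g" using int[of 0] int[of 1] n_pos by (simp_all add: d_def)
  then show ?thesis by (simp add: \<chi>_def)
qed

end

lemma hom_general_linear_group:
  fixes G :: "('g, 'b) monoid_scheme" and \<rho> :: "'g \<Rightarrow> 'k :: field mat"
  assumes G: "group G" and \<rho>: "\<rho> \<in> hom G (general_linear_group k)"
  shows "g \<in> carrier G \<Longrightarrow> \<rho> g \<in> carrier_mat k k"
    and "g \<in> carrier G \<Longrightarrow> h \<in> carrier G \<Longrightarrow> \<rho> (g \<otimes>\<^bsub>G\<^esub> h) = \<rho> g * \<rho> h"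
    and "\<rho> \<one>\<^bsub>G\<^esub> = 1\<^sub>m k"
    and "g \<in> carrier G \<Longrightarrow> \<rho> (inv\<^bsub>G\<^esub> g) * \<rho> g = 1\<^sub>m k"
    and "g \<in> carrier G \<Longrightarrow> \<rho> g * \<rho> (inv\<^bsub>G\<^esub> g) = 1\<^sub>m k"
proof -
  interpret group G by (rule G)
  have c: "\<rho> g \<in> carrier_mat k k" "\<exists>b\<in>carrier_mat k k. b * \<rho> g = 1\<^sub>m k" if "g \<in> carrier G" for g
  proof -
    have "\<rho> g \<in> Units (ring_mat TYPE('k) k ())"
      using hom_in_carrier[OF \<rho> that] by (simp add: general_linear_group_def units_of_def)
    then show "\<rho> g \<in> carrier_mat k k" "\<exists>b\<in>carrier_mat k k. b * \<rho> g = 1\<^sub>m k"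
      unfolding Units_def ring_mat_def by auto
  qed
  show "g \<in> carrier G \<Longrightarrow> \<rho> g \<in> carrier_mat k k" for g by (rule c(1))
  show m: "\<rho> (g \<otimes>\<^bsub>G\<^esub> h) = \<rho> g * \<rho> h" if "g \<in> carrier G" "h \<in> carrier G" for g h
    using hom_mult[OF \<rho> that] by (simp add: general_linear_group_def units_of_def ring_mat_def)
  show one: "\<rho> \<one>\<^bsub>G\<^esub> = 1\<^sub>m k"
  proof -
    note r = c(1)[OF one_closed]
    obtain b where b: "b \<in> carrier_mat k k" "b * \<rho> \<one>\<^bsub>G\<^esub> = 1\<^sub>m k" using c(2)[OF one_closed] by blast
    have "b * (\<rho> \<one>\<^bsub>G\<^esub> * \<rho> \<one>\<^bsub>G\<^esub>) = b * \<rho> \<one>\<^bsub>G\<^esub>" using m[OF one_closed one_closed] by simp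
    then have "b * \<rho> \<one>\<^bsub>G\<^esub> * \<rho> \<one>\<^bsub>G\<^esub> = b * \<rho> \<one>\<^bsub>G\<^esub>" unfolding assoc_mult_mat[OF b(1) r r] .
    then show ?thesis unfolding b(2) using left_mult_one_mat[OF r] by simp
  qed
  show "\<rho> (inv\<^bsub>G\<^esub> g) * \<rho> g = 1\<^sub>m k" if "g \<in> carrier G"
    using m[OF inv_closed[OF that] that] one that by simp
  show "\<rho> g * \<rho> (inv\<^bsub>G\<^esub> g) = 1\<^sub>m k" if "g \<in> carrier G"
    using m[OF that inv_closed[OF that]] one that by simp
qed

text \<open>One field and one valuation with a pole at \<open>a\<close> serve all group elements;
  \<open>a\<close> may afterwards be a coefficient or a root.\<close>

lemma char_poly_integral:
  fixes G :: "('g, 'b) monoid_scheme" and \<rho> :: "'g \<Rightarrow> 'k :: field mat"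
  assumes n: "n \<ge> 1" and G: "group G" and fg: "finitely_generated G" and FB: "property_FB n G"
    and \<rho>: "\<rho> \<in> hom G (general_linear_group (n + 1))" and a: "\<not> algebraic_int a"
  obtains F v where "field_closed F" "valuation F v" "a \<in> F" "a \<notin> val_level F v 0"
    "\<And>g. g \<in> carrier G \<Longrightarrow> poly_over (val_level F v 0) (char_poly (\<rho> g))"
proof -
  interpret group G by (rule G)
  note hom = hom_general_linear_group[OF G \<rho>]
  obtain S where S: "finite S" "S \<subseteq> carrier G" "generate G S = carrier G"
    using fg unfolding finitely_generated_def by blast
  \<comment> \<open>Inverses of the generators are included because \<open>generate\<close> closes
    under them; then every matrix of the image has its entries in \<open>F\<close>.\<close>
  define T where "T = (\<lambda>(s, i, j). \<rho> s $$ (i, j)) ` ((S \<union> m_inv G ` S) \<times> {..n} \<times> {..n})"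
  have "finite T" unfolding T_def using S(1) by simp
  then obtain F v0 where Fx: "field_closed F" "countable F" "valuation F v0" "a \<in> F" "T \<subseteq> F" "v0 a < 0"
    using exists_valuation_finite[OF a] by blast
  have a0: "a \<noteq> 0" using a by auto
  obtain v \<pi> where vx: "valuation F v" "\<pi> \<in> F" "\<pi> \<noteq> 0" "v \<pi> = 1" "v a < 0"
    using valuation_normalize[OF Fx(1,3,4) a0 Fx(6)] .
  interpret lattice_building n F v \<pi> by unfold_locales (use n Fx(1) vx in simp_all)
  have TF: "entries_in F (n + 1) (\<rho> s)" if s: "s \<in> S \<union> m_inv G ` S" for s
  proof (rule entries_inI)
    have "s \<in> carrier G" using s S(2) by auto
    then show "\<rho> s \<in> carrier_mat (n + 1) (n + 1)" by (rule hom(1))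
    fix i j assume "i < n + 1" "j < n + 1"
    then have "\<rho> s $$ (i, j) \<in> T" unfolding T_def using s by (intro image_eqI[of _ _ "(s, i, j)"]) simp_all
    then show "\<rho> s $$ (i, j) \<in> F" using Fx(5) by blast
  qed
  have ent: "entries_in F (n + 1) (\<rho> g)" if "g \<in> generate G S" for g
    using that
  proof (induction rule: generate.induct)
    case one
    then show ?case unfolding hom(3) by (rule entries_in_one[OF RF])
  next
    case (incl h)
    then show ?case by (intro TF) simp
  next
    case (inv h)
    then show ?case by (intro TF) simp
  next
    case (eng h1 h2)
    then have "h1 \<in> carrier G" "h2 \<in> carrier G" using S(3) by blast+
    then show ?case unfolding hom(2)[OF \<open>h1 \<in> carrier G\<close> \<open>h2 \<in> carrier G\<close>]
      by (intro entries_in_mult[OF RF] eng.IH)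
  qed
  have GLFI: "\<rho> g \<in> GLF" if g: "g \<in> carrier G" for g
  proof -
    have "det (\<rho> (inv\<^bsub>G\<^esub> g)) * det (\<rho> g) = 1"
      using det_mult[OF hom(1)[OF inv_closed[OF g]] hom(1)[OF g]] hom(4)[OF g] by simp
    then have "det (\<rho> g) \<noteq> 0" by auto
    then show ?thesis using ent[of g] g S(3) by (simp add: GLF_def)
  qed
  have HI: "\<rho> g \<in> H" if g: "g \<in> carrier G" for g
    using GLFI[OF g] v_det_trivial[OF Fx(2) G FB GLFI hom(2) g] by (simp add: H_def)
  have "poly_over Ov (char_poly (\<rho> g))" if "g \<in> carrier G" for g
    by (rule char_poly_over_valuation_ring[OF Fx(2) G FB HI hom(2) that])
  moreover have "a \<notin> Ov" using vx(5) a0 by (simp add: val_level_def)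
  ultimately show ?thesis using that Fx(1,4) vx(1) by blast
qed

corollary algebraic_int_coeff_char_poly:
  fixes \<rho> :: "'g \<Rightarrow> 'k :: field mat"
  assumes "n \<ge> 1" "group G" "finitely_generated G" "property_FB n G"
    "\<rho> \<in> hom G (general_linear_group (n + 1))" "g \<in> carrier G"
  shows "algebraic_int (poly.coeff (char_poly (\<rho> g)) i)"
proof (rule ccontr)
  assume a: "\<not> algebraic_int (poly.coeff (char_poly (\<rho> g)) i)"
  obtain F v where "poly.coeff (char_poly (\<rho> g)) i \<notin> val_level F v 0" "poly_over (val_level F v 0) (char_poly (\<rho> g))"
    using char_poly_integral[OF assms(1-5) a] assms(6) by metis
  then show False unfolding poly_over_def by simp
qed

corollary algebraic_int_root_char_poly:
  fixes \<rho> :: "'g \<Rightarrow> 'k :: field mat"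
  assumes "n \<ge> 1" "group G" "finitely_generated G" "property_FB n G"
    "\<rho> \<in> hom G (general_linear_group (n + 1))" "g \<in> carrier G" and root: "poly (char_poly (\<rho> g)) a = 0"
  shows "algebraic_int a"
proof (rule ccontr)
  assume a: "\<not> algebraic_int a"
  obtain F v where *: "field_closed F" "valuation F v" "a \<in> F" "a \<notin> val_level F v 0"
    "poly_over (val_level F v 0) (char_poly (\<rho> g))"
    using char_poly_integral[OF assms(1-5) a] assms(6) by metis
  have "\<rho> g \<in> carrier_mat (n + 1) (n + 1)" by (rule hom_general_linear_group(1)[OF assms(2,5,6)])
  then have "lead_coeff (char_poly (\<rho> g)) = 1" using degree_monic_char_poly[of "\<rho> g" "n + 1"] by simp
  then show False using root_in_valuation_ring[OF *(1,2,5) _ *(3) root] *(4) by blast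
qed

section \<open>Roots of unity and passage to the algebraic closure\<close>

lemma finite_Ints_positive_char:
  assumes "CHAR('a :: ring_1) > 0"
  shows "finite (\<int> :: 'a set)"
proof (rule finite_subset)
  define p where "p = int CHAR('a)"
  have p0: "of_int p = (0 :: 'a)" "p > 0" using assms of_nat_CHAR[where 'a = 'a] by (simp_all add: p_def)
  show "(\<int> :: 'a set) \<subseteq> of_int ` {0..<p}"
  proof
    fix x :: 'a assume "x \<in> \<int>"
    then obtain z where z: "x = of_int z" by (auto elim: Ints_cases)
    have "x = of_int (p * (z div p) + z mod p)" unfolding z by simp
    also have "\<dots> = of_int (z mod p)" unfolding of_int_add of_int_mult p0(1) by simp
    finally show "x \<in> of_int ` {0..<p}" using p0(2) by (intro image_eqI[of _ _ "z mod p"]) simp_all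
  qed
qed simp

text \<open>All powers of \<open>a\<close> are combinations of \<open>1, ..., a ^ d'\<close> with
  coefficients in the finite ring of integers of the field, so two of them coincide.\<close>

lemma algebraic_int_root_of_unity:
  fixes a :: "'a :: field"
  assumes a: "algebraic_int a" "a \<noteq> 0" and char: "CHAR('a) > 0"
  shows "\<exists>m>0. a ^ m = 1"
proof -
  obtain p where p: "lead_coeff p = 1" "\<And>i. poly.coeff p i \<in> \<int>" "poly p a = 0"
    using a(1) by (auto elim: algebraic_int.cases)
  define d where "d = Polynomial.degree p"
  have "d \<noteq> 0"
  proof
    assume "d = 0"
    then have "p = [:1:]" using p(1) unfolding d_def by (metis degree_0_id)
    then show False using p(3) by simp
  qed
  then obtain d' where d': "d = Suc d'" using not0_implies_Suc by blast
  have rel: "a ^ d = - (\<Sum>i\<le>d'. poly.coeff p i * a ^ i)"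
  proof -
    have "poly p a = (\<Sum>i\<le>d'. poly.coeff p i * a ^ i) + a ^ d"
      using p(1) unfolding poly_altdef d_def[symmetric] d' by simp
    then show ?thesis using p(3) by (simp add: eq_neg_iff_add_eq_0 add.commute)
  qed
  define B where "B = (\<lambda>c. \<Sum>i\<le>d'. c i * a ^ i) ` ({..d'} \<rightarrow>\<^sub>E (\<int> :: 'a set))"
  have BI: "(\<Sum>i\<le>d'. c i * a ^ i) \<in> B" if "\<And>i. c i \<in> \<int>" for c
    unfolding B_def
  proof (rule image_eqI)
    show "restrict c {..d'} \<in> {..d'} \<rightarrow>\<^sub>E \<int>" using that by simp
    show "(\<Sum>i\<le>d'. c i * a ^ i) = (\<Sum>i\<le>d'. restrict c {..d'} i * a ^ i)" by (intro sum.cong) simp_all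
  qed
  have fin: "finite B"
    unfolding B_def by (intro finite_imageI finite_PiE finite_Ints_positive_char[OF char] finite_atMost)
  have pow: "\<exists>c. (\<forall>i. c i \<in> \<int>) \<and> a ^ k = (\<Sum>i\<le>d'. c i * a ^ i)" for k
  proof (induction k)
    case 0
    have "(\<Sum>i\<le>d'. (if i = 0 then 1 else 0) * a ^ i) = (\<Sum>i\<le>d'. if i = 0 then 1 else 0)"
      by (intro sum.cong) simp_all
    then show ?case by (intro exI[of _ "\<lambda>i. if i = 0 then 1 else 0"]) simp
  next
    case (Suc k)
    then obtain c where c: "\<And>i. c i \<in> \<int>" "a ^ k = (\<Sum>i\<le>d'. c i * a ^ i)" by blast
    \<comment> \<open>Multiplication by \<open>a\<close> shifts the coefficients, and the monic
      equation folds the top one back.\<close>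
    define b where "b i = (case i of 0 \<Rightarrow> 0 | Suc j \<Rightarrow> c j) - c d' * poly.coeff p i" for i
    have "b i \<in> \<int>" for i using c(1) p(2) by (auto simp: b_def intro: Ints_diff Ints_mult split: nat.split)
    moreover have "a ^ Suc k = (\<Sum>i\<le>d'. b i * a ^ i)"
    proof -
      have "a ^ Suc k = (\<Sum>i\<le>d'. c i * a ^ Suc i)" using c(2) by (simp add: sum_distrib_left mult_ac)
      also have "\<dots> = (\<Sum>i<d'. c i * a ^ Suc i) + c d' * a ^ d"
        unfolding d' by (simp add: lessThan_Suc_atMost[symmetric])
      also have "(\<Sum>i<d'. c i * a ^ Suc i) = (\<Sum>i\<le>d'. (case i of 0 \<Rightarrow> 0 | Suc j \<Rightarrow> c j) * a ^ i)"
        unfolding lessThan_Suc_atMost[symmetric] sum.lessThan_Suc_shift by simp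
      also have "c d' * a ^ d = - (\<Sum>i\<le>d'. c d' * poly.coeff p i * a ^ i)"
        unfolding rel by (simp add: sum_distrib_left mult.assoc)
      finally show ?thesis by (simp add: b_def left_diff_distrib sum_subtractf)
    qed
    ultimately show ?case by blast
  qed
  have "range (\<lambda>k. a ^ k) \<subseteq> B"
  proof (rule image_subsetI)
    fix k
    obtain c where "\<And>i. c i \<in> \<int>" "a ^ k = (\<Sum>i\<le>d'. c i * a ^ i)" using pow by blast
    then show "a ^ k \<in> B" using BI by metis
  qed
  then have "finite (range (\<lambda>k. a ^ k))" using fin by (rule finite_subset)
  then have "\<not> inj (\<lambda>k :: nat. a ^ k)" using finite_imageD[of "\<lambda>k. a ^ k" "UNIV :: nat set"] by auto
  then obtain j k :: nat where jk: "j < k" "a ^ j = a ^ k" unfolding inj_def by (metis nat_neq_iff)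
  have "a ^ k = a ^ j * a ^ (k - j)" using jk(1) by (simp flip: power_add)
  then have "a ^ (k - j) = 1" using jk(2) a(2) by simp
  then show ?thesis using jk(1) by (intro exI[of _ "k - j"]) simp
qed

text \<open>After base change, roots in the closure are roots in the coefficient field itself, which
  is where the preceding results find them. Invertibility excludes the eigenvalue \<open>0\<close>,
  the one algebraic integer in positive characteristic that is not a root of unity.\<close>

lemma hom_alg_closure:
  fixes \<rho> :: "'g \<Rightarrow> 'k :: field mat"
  assumes G: "group G" and \<rho>: "\<rho> \<in> hom G (general_linear_group k)"
  shows "(\<lambda>g. map_mat to_ac (\<rho> g)) \<in> hom G (general_linear_group k)"
    and "g \<in> carrier G \<Longrightarrow> char_poly (map_mat to_ac (\<rho> g)) = map_poly to_ac (char_poly (\<rho> g))"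
    and "g \<in> carrier G \<Longrightarrow> \<not> eigenvalue (map_mat to_ac (\<rho> g)) 0"
proof -
  interpret group G by (rule G)
  note hom = hom_general_linear_group[OF G \<rho>]
  interpret ac: comm_ring_hom "to_ac :: 'k \<Rightarrow> 'k alg_closure" by unfold_locales simp_all
  have c: "map_mat to_ac (\<rho> g) \<in> carrier_mat k k" if "g \<in> carrier G" for g using hom(1)[OF that] by simp
  have m: "map_mat to_ac (\<rho> g) * map_mat to_ac (\<rho> h) = map_mat to_ac (\<rho> g * \<rho> h)"
    if "g \<in> carrier G" "h \<in> carrier G" for g h using ac.mat_hom_mult[OF hom(1)[OF that(1)] hom(1)[OF that(2)]] by simp
  have inverse: "map_mat to_ac (\<rho> (inv\<^bsub>G\<^esub> g)) * map_mat to_ac (\<rho> g) = 1\<^sub>m k"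
    "map_mat to_ac (\<rho> g) * map_mat to_ac (\<rho> (inv\<^bsub>G\<^esub> g)) = 1\<^sub>m k" if "g \<in> carrier G" for g
    unfolding m[OF inv_closed[OF that] that] m[OF that inv_closed[OF that]] hom(4,5)[OF that] by (rule ac.mat_hom_one)+
  show "(\<lambda>g. map_mat to_ac (\<rho> g)) \<in> hom G (general_linear_group k)"
  proof (rule homI)
    fix g assume g: "g \<in> carrier G"
    have "map_mat to_ac (\<rho> g) \<in> Units (ring_mat TYPE('k alg_closure) k ())"
      unfolding Units_def ring_mat_def using c[OF g] c[OF inv_closed[OF g]] inverse[OF g] by auto
    then show "map_mat to_ac (\<rho> g) \<in> carrier (general_linear_group k)"
      by (simp add: general_linear_group_def units_of_def)
  next
    fix g h assume gh: "g \<in> carrier G" "h \<in> carrier G"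
    show "map_mat to_ac (\<rho> (g \<otimes>\<^bsub>G\<^esub> h)) = map_mat to_ac (\<rho> g) \<otimes>\<^bsub>general_linear_group k\<^esub> map_mat to_ac (\<rho> h)"
      using m[OF gh] hom(2)[OF gh] by (simp add: general_linear_group_def units_of_def ring_mat_def)
  qed
  show "char_poly (map_mat to_ac (\<rho> g)) = map_poly to_ac (char_poly (\<rho> g))" if "g \<in> carrier G"
    by (rule ac.char_poly_hom[OF hom(1)[OF that]])
  show "\<not> eigenvalue (map_mat to_ac (\<rho> g)) 0" if g: "g \<in> carrier G"
  proof
    assume "eigenvalue (map_mat to_ac (\<rho> g)) 0"
    then obtain x where x: "x \<in> carrier_vec k" "x \<noteq> 0\<^sub>v k" "map_mat to_ac (\<rho> g) *\<^sub>v x = 0 \<cdot>\<^sub>v x"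
      using c[OF g] unfolding eigenvalue_def eigenvector_def by auto
    have "x = map_mat to_ac (\<rho> (inv\<^bsub>G\<^esub> g)) *\<^sub>v (map_mat to_ac (\<rho> g) *\<^sub>v x)"
      using assoc_mult_mat_vec[OF c[OF inv_closed[OF g]] c[OF g] x(1)] inverse(1)[OF g] x(1) by simp
    also have "\<dots> = 0\<^sub>v k" unfolding x(3) using c[OF inv_closed[OF g]] x(1) by (intro eq_vecI) simp_all
    finally show False using x(2) by simp
  qed
qed

theorem propositionE:
  fixes n :: nat
    and G :: "('g, 'b) monoid_scheme"
    and \<rho> :: "'g \<Rightarrow> 'k :: field mat"
  assumes "n \<ge> 1"
    and "group G"
    and "finitely_generated G"
    and "property_FB n G"
    and "\<rho> \<in> hom G (general_linear_group (n + 1))"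
  shows "(CHAR('k) > 0 \<longrightarrow>
            (\<forall>g\<in>carrier G. \<forall>a :: 'k alg_closure.
               eigenvalue (map_mat to_ac (\<rho> g)) a \<longrightarrow> (\<exists>m>0. a ^ m = 1))) \<and>
         (CHAR('k) = 0 \<longrightarrow>
            (\<forall>g\<in>carrier G.
               (\<forall>i. algebraic_int (coeff (char_poly (\<rho> g)) i)) \<and>
               (\<forall>a :: 'k alg_closure.
                  poly (map_poly to_ac (char_poly (\<rho> g))) a = 0 \<longrightarrow> algebraic_int a)))"
proof (intro conjI impI ballI allI)
  note ac = hom_alg_closure[OF assms(2,5)]
  fix g assume g: "g \<in> carrier G"
  have root: "algebraic_int a" if "poly (map_poly to_ac (char_poly (\<rho> g))) a = 0" for a :: "'k alg_closure"
    using algebraic_int_root_char_poly[OF assms(1-4) ac(1) g, of a] that unfolding ac(2)[OF g] by blast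
  show "algebraic_int (coeff (char_poly (\<rho> g)) i)" for i
    by (rule algebraic_int_coeff_char_poly[OF assms g])
  show "algebraic_int a" if "poly (map_poly to_ac (char_poly (\<rho> g))) a = 0" for a :: "'k alg_closure"
    by (rule root[OF that])
  fix a :: "'k alg_closure"
  assume char: "CHAR('k) > 0" and e: "eigenvalue (map_mat to_ac (\<rho> g)) a"
  have "map_mat to_ac (\<rho> g) \<in> carrier_mat (n + 1) (n + 1)"
    by (rule hom_general_linear_group(1)[OF assms(2) ac(1) g])
  then have "poly (map_poly to_ac (char_poly (\<rho> g))) a = 0"
    using e eigenvalue_root_char_poly unfolding ac(2)[OF g, symmetric] by blast
  then have "algebraic_int a" by (rule root)
  moreover have "a \<noteq> 0" using e ac(3)[OF g] by blast
  ultimately show "\<exists>m>0. a ^ m = 1" using char by (intro algebraic_int_root_of_unity) simp_all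
qed

end
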